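(* Let $a\in\mathcal{G}_{S^m(\mathbb{R}^{2n})}$. Assume that there exist a representative $(a^\ast_\varepsilon)_\varepsilon$ of $a^\ast$, a moderate strictly nonzero net $(\lambda_\varepsilon)_\varepsilon$, a number $\delta>0$ and $0\le s\le m$ such that $$\Vert\varphi\Vert_s\le\lambda_\varepsilon\Vert a^\ast_\varepsilon(x,D)|_{\Omega_\delta}\varphi\Vert_0$$ for all $\varphi\in\mathcal{C}^\infty_c(\Omega_\delta)$, $\Omega_\delta:=\{x\in\mathbb{R}^n:|x|<\delta\}$, and for all $\varepsilon\in(0,1]$. Then for every $F\in\mathcal{L}_b(\mathcal{G}_c(\mathbb{R}^n),\widetilde{\mathbb{C}})$ generated by a net in $\mathcal{M}_{H^{-s}(\mathbb{R}^n)}$ there exists $T\in\mathcal{L}_b(\mathcal{G}_c(\Omega_\delta),\widetilde{\mathbb{C}})$ generated by a net in $\mathcal{M}_{L^2(\Omega_\delta)}$ such that $$a(x,D)|_{\Omega_\delta}T=F|_{\Omega_\delta}$$ in $\mathcal{L}(\mathcal{G}_c(\Omega_\delta),\widetilde{\mathbb{C}})$.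
   Context: All nets are indexed by $\varepsilon\in(0,1]$ and $O(\cdot)$ refers to $\varepsilon\to0$. For a locally convex space $E$ with seminorms $\{p_i\}$: $\mathcal{M}_E$ is the set of nets $(u_\varepsilon)_\varepsilon\in E^{(0,1]}$ such that for every $i$ there is $N\in\mathbb{N}$ with $p_i(u_\varepsilon)=O(\varepsilon^{-N})$; $\mathcal{N}_E$ is the set of nets with $p_i(u_\varepsilon)=O(\varepsilon^q)$ for all $i$ and all $q\in\mathbb{N}$; $\mathcal{G}_E=\mathcal{M}_E/\mathcal{N}_E$, with the topology given by the ultra-pseudo-seminorms $u\mapsto e^{-v_{p_i}(u)}$, $v_{p_i}(u)=\sup\{b\in\mathbb{R}:p_i(u_\varepsilon)=O(\varepsilon^b)\}$. $\widetilde{\mathbb{C}}=\mathcal{G}_{\mathbb{C}}$; a moderate net of numbers is an element of $\mathcal{M}_{\mathbb{C}}$; a net $(u_\varepsilon)_\varepsilon$ of numbers is strictly nonzero if there are $r>0$, $\eta\in(0,1]$ with $|u_\varepsilon|\ge\varepsilon^r$ for $\varepsilon\in(0,\eta]$. $\mathcal{G}(\Omega)=\mathcal{G}_{\mathcal{C}^\infty(\Omega)}$; $\mathcal{G}_c(\Omega)$ is the subalgebra of compactly supported elements, with the inductive limit topology (in the locally convex $\widetilde{\mathbb{C}}$-linear sense) of the submodules $\{u:\operatorname{supp}u\subseteq K\}$, $K\Subset\Omega$. $\mathcal{L}(\mathcal{G}_c(\Omega),\widetilde{\mathbb{C}})$ is the set of continuous $\widetilde{\mathbb{C}}$-linear functionals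 on $\mathcal{G}_c(\Omega)$, and $\mathcal{L}_b(\mathcal{G}_c(\Omega),\widetilde{\mathbb{C}})$ the subset of basic functionals, i.e. those of the form $T(u)=[(T_\varepsilon(u_\varepsilon))_\varepsilon]$ with a net $(T_\varepsilon)_\varepsilon$ in $\mathcal{D}'(\Omega)$ (said to generate $T$) such that for all $K\Subset\Omega$ there are $j,N\in\mathbb{N}$, $c>0$, $\eta\in(0,1]$ with $|T_\varepsilon(f)|\le c\,\varepsilon^{-N}\sup_{x\in K,|\alpha|\le j}|\partial^\alpha f(x)|$ for all $f\in\mathcal{C}^\infty_c(\Omega)$ supported in $K$ and $\varepsilon\in(0,\eta]$. $S^m(\mathbb{R}^{2n})$ is the space of $a\in\mathcal{C}^\infty(\mathbb{R}^{2n})$ with all seminorms $\sup_{(x,\xi)\in\mathbb{R}^{2n}}\langle\xi\rangle^{-m+|\alpha|}|\partial_\xi^\alpha\partial_x^\beta a(x,\xi)|$ finite, $\langle\xi\rangle=(1+|\xi|^2)^{1/2}$; $a(x,D)u=(2\pi)^{-n}\int e^{ix\xi}a(x,\xi)\widehat u(\xi)\,d\xi$. $a^\ast\in\mathcal{G}_{S^m(\mathbb{R}^{2n})}$ is the symbol of the formal $L^2$-adjoint of $a(x,D)$ (formed componentwise on representatives). $\Vert\cdot\Vert_s$ is the norm of $H^s(\mathbb{R}^n)$, $\Vert\cdot\Vert_0$ the $L^2$ norm; $a^\ast_\varepsilon(x,D)|_{\Omega_\delta}\varphi$ is the restriction of $a^\ast_\varepsilon(x,D)\varphi$ to $\Omega_\delta$,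 with norm taken in $L^2(\Omega_\delta)$. If $T$ is generated by $(t_\varepsilon)_\varepsilon\in\mathcal{M}_{L^2(\Omega_\delta)}$, then $a(x,D)|_{\Omega_\delta}T$ is the functional generated by the restrictions to $\Omega_\delta$ of $a_\varepsilon(x,D)t_\varepsilon$, with $t_\varepsilon$ extended by $0$ outside $\Omega_\delta$. *)

theory Defs
  imports "HOL-Analysis.Analysis" "HOL-Library.Landau_Symbols"
begin

section \<open>Smooth functions and their derivatives\<close>

text \<open>
  Derivatives \<open>\<partial>\<^sup>\<alpha>\<close> are indexed by lists of basis vectors. A list of length \<open>k\<close> stands for a
  multi-index with \<open>|\<alpha>| = k\<close>; on smooth functions the order of the list is irrelevant.
\<close>

fun partials :: "'a::euclidean_space list \<Rightarrow> ('a \<Rightarrow> complex) \<Rightarrow> 'a \<Rightarrow> complex" where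
  "partials [] f = f"
| "partials (b # \<alpha>) f = (\<lambda>x. frechet_derivative (partials \<alpha> f) (at x) b)"

definition smooth_on :: "'a::euclidean_space set \<Rightarrow> ('a \<Rightarrow> complex) set" where
  "smooth_on S = {f. \<forall>\<alpha>\<in>lists Basis. \<forall>x\<in>S. partials \<alpha> f differentiable (at x)}"

text \<open>The element 0 is inserted only to get the value 0 for empty \<open>K\<close>.\<close>

definition Ck_norm :: "'a::euclidean_space set \<Rightarrow> nat \<Rightarrow> ('a \<Rightarrow> complex) \<Rightarrow> real" where
  "Ck_norm K j f =
     Sup (insert 0 {cmod (partials \<alpha> f x) | x \<alpha>. x \<in> K \<and> \<alpha> \<in> lists Basis \<and> length \<alpha> \<le> j})"

definition smooth_seminorms :: "'a::euclidean_space set \<Rightarrow> (('a \<Rightarrow> complex) \<Rightarrow> real) set" where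
  "smooth_seminorms \<Omega> = {Ck_norm K j | K j. compact K \<and> K \<subseteq> \<Omega>}"

definition test_functions :: "'a::euclidean_space set \<Rightarrow> ('a \<Rightarrow> complex) set" where
  "test_functions \<Omega> = {f \<in> smooth_on UNIV. \<exists>K. compact K \<and> K \<subseteq> \<Omega> \<and> (\<forall>x. x \<notin> K \<longrightarrow> f x = 0)}"

definition japanese :: "'a::euclidean_space \<Rightarrow> real" where
  "japanese \<xi> = sqrt (1 + (norm \<xi>)\<^sup>2)"

definition schwartz_norm :: "nat \<Rightarrow> ('a::euclidean_space \<Rightarrow> complex) \<Rightarrow> real" where
  "schwartz_norm j f =
     Sup {japanese x ^ j * cmod (partials \<alpha> f x) | x \<alpha>. \<alpha> \<in> lists Basis \<and> length \<alpha> \<le> j}"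

definition schwartz :: "('a::euclidean_space \<Rightarrow> complex) set" where
  "schwartz = {f \<in> smooth_on UNIV.
     \<forall>j. bdd_above {japanese x ^ j * cmod (partials \<alpha> f x) | x \<alpha>. \<alpha> \<in> lists Basis \<and> length \<alpha> \<le> j}}"

section \<open>Distributions and Sobolev spaces\<close>

text \<open>
  A distribution is a functional on all functions \<open>'a \<Rightarrow> complex\<close> of which only the values on
  the relevant test functions matter. Hence the restriction of a distribution to a smaller open set
  is the same functional, viewed on fewer test functions.
\<close>

definition linear_functional_on :: "('a \<Rightarrow> complex) set \<Rightarrow> (('a \<Rightarrow> complex) \<Rightarrow> complex) \<Rightarrow> bool" where
  "linear_functional_on V T \<longleftrightarrow>
     (\<forall>f\<in>V. \<forall>g\<in>V. T (\<lambda>x. f x + g x) = T f + T g) \<and>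
     (\<forall>c. \<forall>f\<in>V. T (\<lambda>x. c * f x) = c * T f)"

definition distributions :: "'a::euclidean_space set \<Rightarrow> (('a \<Rightarrow> complex) \<Rightarrow> complex) set" where
  "distributions \<Omega> = {T. linear_functional_on (test_functions \<Omega>) T \<and>
     (\<forall>K. compact K \<and> K \<subseteq> \<Omega> \<longrightarrow>
        (\<exists>j c. \<forall>f\<in>test_functions K. cmod (T f) \<le> c * Ck_norm K j f))}"

definition tempered :: "(('a::euclidean_space \<Rightarrow> complex) \<Rightarrow> complex) set" where
  "tempered = {T. linear_functional_on schwartz T \<and>
     (\<exists>j c. \<forall>f\<in>schwartz. cmod (T f) \<le> c * schwartz_norm j f)}"

text \<open>The distribution defined by a function on \<open>\<Omega>\<close>, extended by 0 outside \<open>\<Omega>\<close>.\<close>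

definition fun_dist ::
    "'a::euclidean_space set \<Rightarrow> ('a \<Rightarrow> complex) \<Rightarrow> ('a \<Rightarrow> complex) \<Rightarrow> complex" where
  "fun_dist \<Omega> f = (\<lambda>\<phi>. LINT x:\<Omega>|lborel. f x * \<phi> x)"

definition L2_space :: "'a::euclidean_space set \<Rightarrow> ('a \<Rightarrow> complex) set" where
  "L2_space \<Omega> = {f. set_borel_measurable lborel \<Omega> f \<and> set_integrable lborel \<Omega> (\<lambda>x. (cmod (f x))\<^sup>2)}"

definition L2_norm :: "'a::euclidean_space set \<Rightarrow> ('a \<Rightarrow> complex) \<Rightarrow> real" where
  "L2_norm \<Omega> f = sqrt (LINT x:\<Omega>|lborel. (cmod (f x))\<^sup>2)"

definition fourier :: "('a::euclidean_space \<Rightarrow> complex) \<Rightarrow> 'a \<Rightarrow> complex" where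
  "fourier u \<xi> = (LINT x|lborel. cis (- (x \<bullet> \<xi>)) * u x)"

text \<open>
  \<open>fourier_density r u g\<close>: the Fourier transform of the tempered distribution \<open>u\<close> is the function
  \<open>g\<close>, and \<open>\<langle>\<xi>\<rangle>\<^sup>r g(\<xi>)\<close> is square integrable. Such \<open>g\<close> is unique almost everywhere.
\<close>

definition fourier_density ::
    "real \<Rightarrow> (('a::euclidean_space \<Rightarrow> complex) \<Rightarrow> complex) \<Rightarrow> ('a \<Rightarrow> complex) \<Rightarrow> bool" where
  "fourier_density r u g \<longleftrightarrow>
     g \<in> borel_measurable lborel \<and>
     integrable lborel (\<lambda>\<xi>. (japanese \<xi> powr r * cmod (g \<xi>))\<^sup>2) \<and>
     (\<forall>\<phi>\<in>schwartz. u (fourier \<phi>) = (LINT \<xi>|lborel. g \<xi> * \<phi> \<xi>))"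

definition sobolev :: "real \<Rightarrow> (('a::euclidean_space \<Rightarrow> complex) \<Rightarrow> complex) set" where
  "sobolev r = {u \<in> tempered. \<exists>g. fourier_density r u g}"

text \<open>
  The \<open>H\<^sup>r\<close> norm in terms of the Fourier transform \<open>g\<close>; the factor \<open>(2\<pi>)\<^sup>-\<^sup>n\<close> makes the case
  \<open>r = 0\<close> the \<open>L\<^sup>2\<close> norm. For a Schwartz function \<open>g\<close> is its Fourier integral.
\<close>

definition fourier_norm :: "real \<Rightarrow> ('a::euclidean_space \<Rightarrow> complex) \<Rightarrow> real" where
  "fourier_norm r g =
     sqrt (1 / (2 * pi) ^ DIM('a) * (LINT \<xi>|lborel. (japanese \<xi> powr r * cmod (g \<xi>))\<^sup>2))"

definition sobolev_norm :: "real \<Rightarrow> (('a::euclidean_space \<Rightarrow> complex) \<Rightarrow> complex) \<Rightarrow> real" where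
  "sobolev_norm r u = fourier_norm r (SOME g. fourier_density r u g)"

definition sobolev_norm_fun :: "real \<Rightarrow> ('a::euclidean_space \<Rightarrow> complex) \<Rightarrow> real" where
  "sobolev_norm_fun r \<phi> = fourier_norm r (fourier \<phi>)"

section \<open>Symbols and pseudodifferential operators\<close>

definition symbol_term ::
    "real \<Rightarrow> 'a::euclidean_space list \<Rightarrow> 'a list \<Rightarrow> ('a \<times> 'a \<Rightarrow> complex) \<Rightarrow> 'a \<times> 'a \<Rightarrow> real" where
  "symbol_term m \<alpha> \<beta> a = (\<lambda>(x, \<xi>). japanese \<xi> powr (- m + real (length \<alpha>)) *
     cmod (partials (map (\<lambda>b. (0, b)) \<alpha> @ map (\<lambda>b. (b, 0)) \<beta>) a (x, \<xi>)))"

definition symbols :: "real \<Rightarrow> ('a::euclidean_space \<times> 'a \<Rightarrow> complex) set" where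
  "symbols m = {a \<in> smooth_on UNIV.
     \<forall>\<alpha>\<in>lists Basis. \<forall>\<beta>\<in>lists Basis. bdd_above (range (symbol_term m \<alpha> \<beta> a))}"

definition symbol_seminorms :: "real \<Rightarrow> (('a::euclidean_space \<times> 'a \<Rightarrow> complex) \<Rightarrow> real) set" where
  "symbol_seminorms m =
     {\<lambda>a. Sup (range (symbol_term m \<alpha> \<beta> a)) | \<alpha> \<beta>. \<alpha> \<in> lists Basis \<and> \<beta> \<in> lists Basis}"

definition psido :: "('a::euclidean_space \<times> 'a \<Rightarrow> complex) \<Rightarrow> ('a \<Rightarrow> complex) \<Rightarrow> 'a \<Rightarrow> complex" where
  "psido a u x =
     1 / (2 * pi) ^ DIM('a) * (LINT \<xi>|lborel. cis (x \<bullet> \<xi>) * a (x, \<xi>) * fourier u \<xi>)"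

text \<open>
  The transpose of \<open>a(x,D)\<close> with respect to the bilinear pairing \<open>\<integral> u v\<close>, obtained from the
  formula for \<open>a(x,D)\<close> by interchanging integrals; the inner integral is rapidly decreasing
  in \<open>\<xi>\<close> for Schwartz functions \<open>\<phi>\<close>. It extends \<open>a(x,D)\<close> to tempered distributions.
\<close>

definition psido_transpose ::
    "('a::euclidean_space \<times> 'a \<Rightarrow> complex) \<Rightarrow> ('a \<Rightarrow> complex) \<Rightarrow> 'a \<Rightarrow> complex" where
  "psido_transpose a \<phi> y = 1 / (2 * pi) ^ DIM('a) *
     (LINT \<xi>|lborel. cis (- (y \<bullet> \<xi>)) * (LINT x|lborel. cis (x \<bullet> \<xi>) * a (x, \<xi>) * \<phi> x))"

definition psido_dist :: "('a::euclidean_space \<times> 'a \<Rightarrow> complex) \<Rightarrow>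
    (('a \<Rightarrow> complex) \<Rightarrow> complex) \<Rightarrow> ('a \<Rightarrow> complex) \<Rightarrow> complex" where
  "psido_dist a u = (\<lambda>\<phi>. u (psido_transpose a \<phi>))"

text \<open>\<open>b\<close> is the (unique) symbol of order \<open>m\<close> of the formal adjoint of \<open>a(x,D)\<close>.\<close>

definition adjoint_symbol ::
    "real \<Rightarrow> ('a::euclidean_space \<times> 'a \<Rightarrow> complex) \<Rightarrow> ('a \<times> 'a \<Rightarrow> complex) \<Rightarrow> bool" where
  "adjoint_symbol m a b \<longleftrightarrow> b \<in> symbols m \<and>
     (\<forall>u\<in>schwartz. \<forall>v\<in>schwartz.
        (LINT x|lborel. psido a u x * cnj (v x)) = (LINT x|lborel. u x * cnj (psido b v x)))"

section \<open>Colombeau spaces over a locally convex space\<close>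

text \<open>
  A locally convex space is given by its carrier \<open>E\<close> and its set \<open>P\<close> of seminorms.
  Nets are functions of a real parameter of which only the values on \<open>(0,1]\<close> matter.
\<close>

definition moderate :: "'e set \<Rightarrow> ('e \<Rightarrow> real) set \<Rightarrow> (real \<Rightarrow> 'e) set" where
  "moderate E P = {u. (\<forall>\<epsilon>\<in>{0<..1}. u \<epsilon> \<in> E) \<and>
     (\<forall>p\<in>P. \<exists>N::nat. (\<lambda>\<epsilon>. p (u \<epsilon>)) \<in> O[at_right 0](\<lambda>\<epsilon>. \<epsilon> powr (- real N)))}"

definition negligible_nets :: "'e set \<Rightarrow> ('e \<Rightarrow> real) set \<Rightarrow> (real \<Rightarrow> 'e) set" where
  "negligible_nets E P = {u. (\<forall>\<epsilon>\<in>{0<..1}. u \<epsilon> \<in> E) \<and>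
     (\<forall>p\<in>P. \<forall>q::nat. (\<lambda>\<epsilon>. p (u \<epsilon>)) \<in> O[at_right 0](\<lambda>\<epsilon>. \<epsilon> powr real q))}"

definition colombeau_rel ::
    "'e::minus set \<Rightarrow> ('e \<Rightarrow> real) set \<Rightarrow> ((real \<Rightarrow> 'e) \<times> (real \<Rightarrow> 'e)) set" where
  "colombeau_rel E P = {(u, v). u \<in> moderate E P \<and> v \<in> moderate E P \<and>
     (\<lambda>\<epsilon>. u \<epsilon> - v \<epsilon>) \<in> negligible_nets E P}"

definition colombeau :: "'e::minus set \<Rightarrow> ('e \<Rightarrow> real) set \<Rightarrow> (real \<Rightarrow> 'e) set set" where
  "colombeau E P = moderate E P // colombeau_rel E P"

definition colombeau_class ::
    "'e::minus set \<Rightarrow> ('e \<Rightarrow> real) set \<Rightarrow> (real \<Rightarrow> 'e) \<Rightarrow> (real \<Rightarrow> 'e) set" where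
  "colombeau_class E P u = colombeau_rel E P `` {u}"

definition lift2 :: "'e::minus set \<Rightarrow> ('e \<Rightarrow> real) set \<Rightarrow> ('c \<Rightarrow> 'd \<Rightarrow> 'e) \<Rightarrow>
    (real \<Rightarrow> 'c) set \<Rightarrow> (real \<Rightarrow> 'd) set \<Rightarrow> (real \<Rightarrow> 'e) set" where
  "lift2 E P h A B = (\<Union>u\<in>A. \<Union>v\<in>B. colombeau_class E P (\<lambda>\<epsilon>. h (u \<epsilon>) (v \<epsilon>)))"

definition valuation :: "('e \<Rightarrow> real) \<Rightarrow> (real \<Rightarrow> 'e) \<Rightarrow> ereal" where
  "valuation p u = Sup (ereal ` {b. (\<lambda>\<epsilon>. p (u \<epsilon>)) \<in> O[at_right 0](\<lambda>\<epsilon>. \<epsilon> powr b)})"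

text \<open>\<open>e\<^sup>-\<^sup>v\<close> on classes; the valuation does not depend on the representative.\<close>

definition ultra_seminorm :: "('e \<Rightarrow> real) \<Rightarrow> (real \<Rightarrow> 'e) set \<Rightarrow> real" where
  "ultra_seminorm p A = (let v = valuation p (SOME u. u \<in> A) in
     if v = \<infinity> then 0 else exp (- real_of_ereal v))"

definition colombeau_topology ::
    "'e::minus set \<Rightarrow> ('e \<Rightarrow> real) set \<Rightarrow> (real \<Rightarrow> 'e) set topology" where
  "colombeau_topology E P = topology_generated_by
     {{B \<in> colombeau E P. ultra_seminorm p (lift2 E P (-) B A) < r} | p A r.
        p \<in> P \<and> A \<in> colombeau E P \<and> 0 < r}"

section \<open>Generalized numbers and generalized functions\<close>

type_synonym gnum = "(real \<Rightarrow> complex) set"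
type_synonym 'a gfun = "(real \<Rightarrow> 'a \<Rightarrow> complex) set"

abbreviation moderate_numbers :: "(real \<Rightarrow> complex) set" where
  "moderate_numbers \<equiv> moderate UNIV {cmod}"

abbreviation num_class :: "(real \<Rightarrow> complex) \<Rightarrow> gnum" where
  "num_class \<equiv> colombeau_class UNIV {cmod}"

definition gnumbers :: "gnum set" where
  "gnumbers = colombeau UNIV {cmod}"

definition gnum_plus :: "gnum \<Rightarrow> gnum \<Rightarrow> gnum" where
  "gnum_plus = lift2 UNIV {cmod} (+)"

definition gnum_times :: "gnum \<Rightarrow> gnum \<Rightarrow> gnum" where
  "gnum_times = lift2 UNIV {cmod} (*)"

definition strictly_nonzero :: "(real \<Rightarrow> complex) \<Rightarrow> bool" where
  "strictly_nonzero u \<longleftrightarrow>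
     (\<exists>r>0. \<exists>\<eta>\<in>{0<..1}. \<forall>\<epsilon>\<in>{0<..\<eta>}. cmod (u \<epsilon>) \<ge> \<epsilon> powr r)"

abbreviation gfun_class :: "'a::euclidean_space set \<Rightarrow> (real \<Rightarrow> 'a \<Rightarrow> complex) \<Rightarrow> 'a gfun" where
  "gfun_class \<Omega> \<equiv> colombeau_class (smooth_on \<Omega>) (smooth_seminorms \<Omega>)"

definition gfunctions :: "'a::euclidean_space set \<Rightarrow> 'a gfun set" where
  "gfunctions \<Omega> = colombeau (smooth_on \<Omega>) (smooth_seminorms \<Omega>)"

definition gfun_plus :: "'a::euclidean_space set \<Rightarrow> 'a gfun \<Rightarrow> 'a gfun \<Rightarrow> 'a gfun" where
  "gfun_plus \<Omega> = lift2 (smooth_on \<Omega>) (smooth_seminorms \<Omega>) (\<lambda>f g x. f x + g x)"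

definition gfun_scale :: "'a::euclidean_space set \<Rightarrow> gnum \<Rightarrow> 'a gfun \<Rightarrow> 'a gfun" where
  "gfun_scale \<Omega> = lift2 (smooth_on \<Omega>) (smooth_seminorms \<Omega>) (\<lambda>c f x. c * f x)"

definition gfun_restrict :: "'a::euclidean_space set \<Rightarrow> 'a gfun \<Rightarrow> 'a gfun" where
  "gfun_restrict V U = (\<Union>u\<in>U. gfun_class V u)"

definition gsupport :: "'a::euclidean_space set \<Rightarrow> 'a gfun \<Rightarrow> 'a set" where
  "gsupport \<Omega> U = {x \<in> \<Omega>. \<not> (\<exists>V. open V \<and> x \<in> V \<and> V \<subseteq> \<Omega> \<and>
     gfun_restrict V U = gfun_class V (\<lambda>\<epsilon> x. 0))}"

definition gfun_compact :: "'a::euclidean_space set \<Rightarrow> 'a gfun set" where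
  "gfun_compact \<Omega> = {U \<in> gfunctions \<Omega>. compact (gsupport \<Omega> U)}"

definition gfun_supported :: "'a::euclidean_space set \<Rightarrow> 'a set \<Rightarrow> 'a gfun set" where
  "gfun_supported \<Omega> K = {U \<in> gfun_compact \<Omega>. gsupport \<Omega> U \<subseteq> K}"

text \<open>
  Absolutely convex subsets in the sense of locally convex modules over the generalized numbers:
  balanced means closed under scaling by \<open>|c|\<^sub>e \<le> 1\<close>, and convex means \<open>A + A \<subseteq> A\<close>.
\<close>

definition absolutely_convex :: "'a::euclidean_space set \<Rightarrow> 'a gfun set \<Rightarrow> bool" where
  "absolutely_convex \<Omega> A \<longleftrightarrow>
     (\<forall>c\<in>gnumbers. \<forall>U\<in>A. ultra_seminorm cmod c \<le> 1 \<longrightarrow> gfun_scale \<Omega> c U \<in> A) \<and>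
     (\<forall>U\<in>A. \<forall>V\<in>A. gfun_plus \<Omega> U V \<in> A)"

text \<open>
  The inductive limit topology: the neighbourhoods of 0 are generated by the absolutely convex sets
  whose trace on every submodule of elements supported in a compact set \<open>K\<close> is a neighbourhood of
  0 there. These sets are additive subgroups, so their translates are open and form a base.
\<close>

definition inductive_limit_topology :: "'a::euclidean_space set \<Rightarrow> 'a gfun topology" where
  "inductive_limit_topology \<Omega> = topology_generated_by
     {gfun_plus \<Omega> U ` A | U A. U \<in> gfun_compact \<Omega> \<and> A \<subseteq> gfun_compact \<Omega> \<and>
        absolutely_convex \<Omega> A \<and>
        (\<forall>K. compact K \<and> K \<subseteq> \<Omega> \<longrightarrow>
           (\<exists>W. openin (subtopology (colombeau_topology (smooth_on \<Omega>) (smooth_seminorms \<Omega>))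
                          (gfun_supported \<Omega> K)) W \<and>
                gfun_class \<Omega> (\<lambda>\<epsilon> x. 0) \<in> W \<and> W \<subseteq> A))}"

section \<open>Functionals on compactly supported generalized functions\<close>

text \<open>
  Functionals are functions on classes of which only the values on \<open>gfun_compact \<Omega>\<close> matter.
\<close>

definition gfunctionals :: "'a::euclidean_space set \<Rightarrow> ('a gfun \<Rightarrow> gnum) set" where
  "gfunctionals \<Omega> = {T.
     (\<forall>U\<in>gfun_compact \<Omega>. \<forall>V\<in>gfun_compact \<Omega>. T (gfun_plus \<Omega> U V) = gnum_plus (T U) (T V)) \<and>
     (\<forall>c\<in>gnumbers. \<forall>U\<in>gfun_compact \<Omega>. T (gfun_scale \<Omega> c U) = gnum_times c (T U)) \<and>
     continuous_map (inductive_limit_topology \<Omega>) (colombeau_topology UNIV {cmod}) T}"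

text \<open>
  Representatives by nets of test functions supported in a common compact subset of \<open>\<Omega>\<close> (and
  vanishing outside \<open>\<Omega>\<close>). Every compactly supported generalized function has some.
\<close>

definition compact_reps :: "'a::euclidean_space set \<Rightarrow> 'a gfun \<Rightarrow> (real \<Rightarrow> 'a \<Rightarrow> complex) set" where
  "compact_reps \<Omega> U = {u \<in> U. \<exists>K. compact K \<and> K \<subseteq> \<Omega> \<and> (\<forall>\<epsilon>\<in>{0<..1}. \<forall>x. x \<notin> K \<longrightarrow> u \<epsilon> x = 0)}"

definition basic_net ::
    "'a::euclidean_space set \<Rightarrow> (real \<Rightarrow> ('a \<Rightarrow> complex) \<Rightarrow> complex) \<Rightarrow> bool" where
  "basic_net \<Omega> T \<longleftrightarrow> (\<forall>\<epsilon>\<in>{0<..1}. T \<epsilon> \<in> distributions \<Omega>) \<and>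
     (\<forall>K. compact K \<and> K \<subseteq> \<Omega> \<longrightarrow>
        (\<exists>(j::nat) (N::nat). \<exists>c>0. \<exists>\<eta>\<in>{0<..1}. \<forall>f\<in>test_functions K. \<forall>\<epsilon>\<in>{0<..\<eta>}.
           cmod (T \<epsilon> f) \<le> c * \<epsilon> powr (- real N) * Ck_norm K j f))"

definition generates :: "'a::euclidean_space set \<Rightarrow>
    (real \<Rightarrow> ('a \<Rightarrow> complex) \<Rightarrow> complex) \<Rightarrow> ('a gfun \<Rightarrow> gnum) \<Rightarrow> bool" where
  "generates \<Omega> \<tau> T \<longleftrightarrow> basic_net \<Omega> \<tau> \<and>
     (\<forall>U\<in>gfun_compact \<Omega>. T U = (\<Union>u\<in>compact_reps \<Omega> U. num_class (\<lambda>\<epsilon>. \<tau> \<epsilon> (u \<epsilon>))))"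

definition basic_functionals :: "'a::euclidean_space set \<Rightarrow> ('a gfun \<Rightarrow> gnum) set" where
  "basic_functionals \<Omega> = {T \<in> gfunctionals \<Omega>. \<exists>\<tau>. generates \<Omega> \<tau> T}"

text \<open>Restriction to \<open>\<Omega>\<close> of a functional on the whole space, through extension by 0.\<close>

definition gfun_extend :: "'a::euclidean_space set \<Rightarrow> 'a gfun \<Rightarrow> 'a gfun" where
  "gfun_extend \<Omega> U = (\<Union>u\<in>compact_reps \<Omega> U. gfun_class UNIV u)"

definition restrict_functional ::
    "'a::euclidean_space set \<Rightarrow> ('a gfun \<Rightarrow> gnum) \<Rightarrow> 'a gfun \<Rightarrow> gnum" where
  "restrict_functional \<Omega> F = (\<lambda>U. F (gfun_extend \<Omega> U))"

section \<open>Generalized symbols\<close>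

type_synonym 'a gsymbol = "(real \<Rightarrow> 'a \<times> 'a \<Rightarrow> complex) set"

definition gsymbols :: "real \<Rightarrow> 'a::euclidean_space gsymbol set" where
  "gsymbols m = colombeau (symbols m) (symbol_seminorms m)"

definition gsymbol_adjoint :: "real \<Rightarrow> 'a::euclidean_space gsymbol \<Rightarrow> 'a gsymbol" where
  "gsymbol_adjoint m A = (\<Union>a\<in>A. \<Union>b\<in>{b. \<forall>\<epsilon>\<in>{0<..1}. adjoint_symbol m (a \<epsilon>) (b \<epsilon>)}.
     colombeau_class (symbols m) (symbol_seminorms m) b)"

text \<open>
  \<open>S\<close> is the functional \<open>a(x,D)|\<^sub>\<Omega> T\<close>, where \<open>T\<close> is generated by the net \<open>t\<close> in \<open>L\<^sup>2(\<Omega>)\<close>. It is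
  a function of the net \<open>t\<close>: as \<open>a(x,D)\<close> is not local, \<open>T\<close> alone does not determine it.
  It is required to be the same for all representatives of the symbol.
\<close>

definition psido_functional :: "'a::euclidean_space set \<Rightarrow> 'a gsymbol \<Rightarrow>
    (real \<Rightarrow> 'a \<Rightarrow> complex) \<Rightarrow> ('a gfun \<Rightarrow> gnum) \<Rightarrow> bool" where
  "psido_functional \<Omega> A t S \<longleftrightarrow> S \<in> gfunctionals \<Omega> \<and>
     (\<forall>a\<in>A. generates \<Omega> (\<lambda>\<epsilon>. psido_dist (a \<epsilon>) (fun_dist \<Omega> (t \<epsilon>))) S)"

end

theory Submission
  imports Defs "HOL-Probability.Probability" "HOL-Library.Function_Algebras"
begin

text \<open>
  Fix \<open>\<epsilon>\<close>. The a priori estimate says that the antilinear functional \<open>\<phi> \<mapsto> f\<^sub>\<epsilon>(cnj \<phi>)\<close> is bounded by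
  \<open>\<lambda>\<^sub>\<epsilon> \<parallel>f\<^sub>\<epsilon>\<parallel>\<^sub>-\<^sub>s\<close> times the \<open>L\<^sup>2(\<Omega>)\<close> norm of \<open>b\<^sub>\<epsilon>(x,D)\<phi>\<close>; this uses the duality of \<open>H\<^sup>s\<close> and \<open>H\<^sup>-\<^sup>s\<close>,
  hence Fourier inversion. The Riesz representation theorem yields \<open>t\<^sub>\<epsilon> \<in> L\<^sup>2(\<Omega>)\<close> of norm at most
  \<open>\<lambda>\<^sub>\<epsilon> \<parallel>f\<^sub>\<epsilon>\<parallel>\<^sub>-\<^sub>s\<close> with \<open>\<langle>t\<^sub>\<epsilon>, b\<^sub>\<epsilon>(x,D)\<phi>\<rangle> = f\<^sub>\<epsilon>(cnj \<phi>)\<close>, so the net \<open>t\<close> is moderate.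
  The transpose of \<open>a\<^sub>\<epsilon>(x,D)\<close> is the conjugated formal adjoint, and all representatives of a generalized symbol give operators
  whose difference is negligible on test functions, uniformly in \<open>C\<^sup>k\<close> norms. Hence \<open>a(x,D)T\<close> and \<open>F\<close>
  have the same values on nets of test functions with common compact support. Cut-off functions
  show that every compactly supported generalized function has such a representative, and that the
  functional generated by a basic net is continuous for the inductive limit topology.
\<close>

section \<open>Calculus of smooth functions\<close>

text \<open>The equation can hold only modulo negligible nets. The estimate is given for one
  representative of the adjoint class, while \<open>a(x,D)T\<close> must be formed from every
  representative of the symbol, and the exact adjoint of a representative differs from the given net
  by something negligible. Hence the equation solved at each \<epsilon> is the one dual to
  \<open>b \<epsilon>\<close>, and the defect is absorbed afterwards. For this, every operator bound
  has the shape: constant times symbol norm times \<open>C^k\<close> norm, with a constant that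
  depends only on the order and the compact support, not on \<epsilon>. A negligible symbol norm
  then beats all moderate factors.

  The nets carry no regularity in \<epsilon>, so the functions \<open>t \<epsilon>\<close> are
  chosen independently of each other. Adjoints are sesquilinear whereas distributions act
  bilinearly; therefore \<phi> enters the functional conjugated.

  All pairings are with compactly supported functions, so Fourier analysis is developed for test
  functions. Schwartz functions occur because Sobolev densities and adjoint symbols are defined
  through them.\<close>

lemma frechet_derivative_cong_open:
  assumes "open S" "x \<in> S" "\<And>y. y \<in> S \<Longrightarrow> f y = g y"
  shows "frechet_derivative f (at x) = frechet_derivative g (at x)"
proof -
  \<comment> \<open>\<open>frechet_derivative\<close> is a choice among all derivatives at the
    point. Equal sets of derivatives therefore give equal values, even where neither function is
    differentiable.\<close>
  have "(f has_derivative D) (at x) \<longleftrightarrow> (g has_derivative D) (at x)" for D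
    using has_derivative_transform_within_open[of f D x UNIV S g]
      has_derivative_transform_within_open[of g D x UNIV S f] assms by auto
  then show ?thesis by (simp add: frechet_derivative_def)
qed

lemma differentiable_cong_open:
  assumes "open S" "x \<in> S" "\<And>y. y \<in> S \<Longrightarrow> f y = g y" "f differentiable (at x)"
  shows "g differentiable (at x)"
  using assms has_derivative_transform_within_open[of f _ x UNIV S g]
  unfolding differentiable_def by metis

lemma partials_cong:
  assumes "open S" "\<And>y. y \<in> S \<Longrightarrow> f y = g y" "x \<in> S"
  shows "partials \<alpha> f x = partials \<alpha> g x"
  using assms(3)
proof (induction \<alpha> arbitrary: x)
  case Nil
  then show ?case using assms(2) by simp
next
  case (Cons b \<alpha>)
  then show ?case
    using frechet_derivative_cong_open[OF assms(1) Cons.prems, of "partials \<alpha> f" "partials \<alpha> g"]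
    by simp
qed

lemma partials_Cons_eq:
  assumes "open S" "x \<in> S" "\<And>y. y \<in> S \<Longrightarrow> partials \<alpha> f y = F y" "(F has_derivative D) (at x)"
  shows "partials (b # \<alpha>) f x = D b"
  using frechet_derivative_cong_open[OF assms(1,2), of "partials \<alpha> f" F] assms(3)
    frechet_derivative_at[OF assms(4)] by simp

text \<open>Lets a smoothness proof supply formulas \<open>F\<close> for the iterated partials. They
  have to agree with the partials on the open set only, because derivatives are local.\<close>

lemma smooth_onI:
  assumes "open S"
    and "\<And>\<alpha> x. \<alpha> \<in> lists Basis \<Longrightarrow> x \<in> S \<Longrightarrow> partials \<alpha> f x = F \<alpha> x"
    and "\<And>\<alpha> x. \<alpha> \<in> lists Basis \<Longrightarrow> x \<in> S \<Longrightarrow> F \<alpha> differentiable (at x)"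
  shows "f \<in> smooth_on S"
  unfolding smooth_on_def
proof (intro CollectI ballI)
  fix \<alpha> :: "'a list" and x assume "\<alpha> \<in> lists Basis" "x \<in> S"
  then show "partials \<alpha> f differentiable (at x)"
    by (intro differentiable_cong_open[OF assms(1) _ _ assms(3)]) (simp_all add: assms(2))
qed

lemma smooth_onD:
  assumes "f \<in> smooth_on S" "\<alpha> \<in> lists Basis" "x \<in> S"
  shows "partials \<alpha> f differentiable (at x)"
    and "(partials \<alpha> f has_derivative frechet_derivative (partials \<alpha> f) (at x)) (at x)"
  using assms frechet_derivative_works unfolding smooth_on_def by blast+

lemma smooth_on_mono: "f \<in> smooth_on S \<Longrightarrow> T \<subseteq> S \<Longrightarrow> f \<in> smooth_on T"
  unfolding smooth_on_def by blast

lemma smooth_on_cong: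
  assumes "open S" "\<And>y. y \<in> S \<Longrightarrow> f y = g y" "f \<in> smooth_on S"
  shows "g \<in> smooth_on S"
proof (rule smooth_onI[OF assms(1)])
  show "partials \<alpha> g x = partials \<alpha> f x" if "x \<in> S" for \<alpha> x
    by (rule partials_cong[OF assms(1) _ that, symmetric]) (rule assms(2))
qed (use smooth_onD[OF assms(3)] in auto)

lemma smooth_on_Un:
  assumes "f \<in> smooth_on S" "f \<in> smooth_on T"
  shows "f \<in> smooth_on (S \<union> T)"
  using assms unfolding smooth_on_def by blast

lemma continuous_partials:
  assumes "f \<in> smooth_on S" "\<alpha> \<in> lists Basis"
  shows "continuous_on S (partials \<alpha> f)"
  using smooth_onD[OF assms]
  by (meson continuous_at_imp_continuous_on differentiable_imp_continuous_within)

lemma smooth_on_continuous: "f \<in> smooth_on S \<Longrightarrow> continuous_on S f"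
  using continuous_partials[of f S "[]"] by simp

lemma partials_append: "partials (\<alpha> @ \<beta>) f = partials \<alpha> (partials \<beta> f)"
  by (induction \<alpha>) auto

lemma smooth_on_partials:
  assumes "f \<in> smooth_on S" "\<beta> \<in> lists Basis"
  shows "partials \<beta> f \<in> smooth_on S"
  using assms unfolding smooth_on_def by (auto simp flip: partials_append)

text \<open>Induction along the index list. It replaces explicit formulas for the partials of
  exponentials, bump functions and Fourier transforms: for each of these an invariant family is easy
  to name.\<close>

lemma partials_in_family:
  assumes "f \<in> \<F>"
    and "\<And>g. g \<in> \<F> \<Longrightarrow> \<exists>D. (\<forall>x. (g has_derivative D x) (at x)) \<and> (\<forall>b\<in>Basis. (\<lambda>x. D x b) \<in> \<F>)"
    and "\<alpha> \<in> lists Basis"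
  shows "partials \<alpha> f \<in> \<F>"
  using assms(3)
proof (induction \<alpha>)
  case Nil
  then show ?case using assms(1) by simp
next
  case (Cons b \<alpha>)
  then obtain D where D: "\<forall>x. (partials \<alpha> f has_derivative D x) (at x)" "(\<lambda>x. D x b) \<in> \<F>"
    using assms(2)[of "partials \<alpha> f"] by auto
  then have "partials (b # \<alpha>) f = (\<lambda>x. D x b)"
    by (metis frechet_derivative_at partials.simps(2))
  then show ?case using D by simp
qed

lemma smooth_on_family:
  assumes "f \<in> \<F>"
    and "\<And>g. g \<in> \<F> \<Longrightarrow> \<exists>D. (\<forall>x. (g has_derivative D x) (at x)) \<and> (\<forall>b\<in>Basis. (\<lambda>x. D x b) \<in> \<F>)"
  shows "f \<in> smooth_on S"
  using partials_in_family[OF assms] assms(2) unfolding smooth_on_def differentiable_def by blast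

section \<open>Linear operations and the Leibniz rule\<close>

lemma partials_bounded_linear:
  assumes L: "bounded_linear L" and "open S" "f \<in> smooth_on S"
  shows "\<alpha> \<in> lists Basis \<Longrightarrow> x \<in> S \<Longrightarrow> partials \<alpha> (\<lambda>x. L (f x)) x = L (partials \<alpha> f x)"
proof (induction \<alpha> arbitrary: x)
  case (Cons b \<alpha>)
  show ?case
    by (subst partials_Cons_eq[OF \<open>open S\<close> \<open>x \<in> S\<close> Cons.IH
          bounded_linear.has_derivative[OF L smooth_onD(2)[OF assms(3)]]])
       (use Cons.prems in auto)
qed simp

lemma smooth_on_bounded_linear:
  assumes L: "bounded_linear L" and "open S" "f \<in> smooth_on S"
  shows "(\<lambda>x. L (f x)) \<in> smooth_on S"
  by (rule smooth_onI[OF \<open>open S\<close> partials_bounded_linear[OF assms]])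
     (use bounded_linear.has_derivative[OF L smooth_onD(2)[OF assms(3)]] in \<open>auto simp: differentiable_def\<close>)

lemma partials_add:
  assumes "open S" "f \<in> smooth_on S" "g \<in> smooth_on S"
  shows "\<alpha> \<in> lists Basis \<Longrightarrow> x \<in> S \<Longrightarrow>
    partials \<alpha> (\<lambda>x. f x + g x) x = partials \<alpha> f x + partials \<alpha> g x"
proof (induction \<alpha> arbitrary: x)
  case (Cons b \<alpha>)
  show ?case
    by (subst partials_Cons_eq[OF \<open>open S\<close> \<open>x \<in> S\<close> Cons.IH
          has_derivative_add[OF smooth_onD(2)[OF assms(2)] smooth_onD(2)[OF assms(3)]]])
       (use Cons.prems in auto)
qed simp

lemma smooth_on_add:
  assumes "open S" "f \<in> smooth_on S" "g \<in> smooth_on S"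
  shows "(\<lambda>x. f x + g x) \<in> smooth_on S"
  by (rule smooth_onI[OF \<open>open S\<close> partials_add[OF assms]])
     (use smooth_onD assms in \<open>auto intro!: differentiable_add\<close>)

lemma partials_uminus:
  assumes "open S" "f \<in> smooth_on S" "\<alpha> \<in> lists Basis" "x \<in> S"
  shows "partials \<alpha> (\<lambda>x. - f x) x = - partials \<alpha> f x"
  by (rule partials_bounded_linear[OF _ assms(1,2)])
      (use assms bounded_linear_minus[OF bounded_linear_ident] in auto)

lemma smooth_on_uminus: "open S \<Longrightarrow> f \<in> smooth_on S \<Longrightarrow> (\<lambda>x. - f x) \<in> smooth_on S"
  by (rule smooth_on_bounded_linear[OF bounded_linear_minus[OF bounded_linear_ident]])

lemma smooth_on_cmult: "open S \<Longrightarrow> f \<in> smooth_on S \<Longrightarrow> (\<lambda>x. c * f x) \<in> smooth_on S"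
  by (rule smooth_on_bounded_linear[OF bounded_linear_mult_right])

lemma smooth_on_cnj: "open S \<Longrightarrow> f \<in> smooth_on S \<Longrightarrow> (\<lambda>x. cnj (f x)) \<in> smooth_on S"
  by (rule smooth_on_bounded_linear[OF bounded_linear_cnj])

lemma smooth_on_diff:
  assumes "open S" "f \<in> smooth_on S" "g \<in> smooth_on S"
  shows "(\<lambda>x. f x - g x) \<in> smooth_on S"
  using smooth_on_add[OF assms(1,2) smooth_on_uminus[OF assms(1,3)]] by simp

lemma partials_diff:
  assumes "open S" "f \<in> smooth_on S" "g \<in> smooth_on S" "\<alpha> \<in> lists Basis" "x \<in> S"
  shows "partials \<alpha> (\<lambda>x. f x - g x) x = partials \<alpha> f x - partials \<alpha> g x"
  using partials_add[OF assms(1,2) smooth_on_uminus[OF assms(1,3)] assms(4,5)]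
    partials_uminus[OF assms(1,3,4,5)] by simp

text \<open>Every position of the list goes to the left or to the right factor. The Leibniz rule
  becomes a plain sum over \<open>2 ^ length \<alpha>\<close> such splittings, with repetitions in
  place of binomial coefficients.\<close>

primrec splits :: "'b list \<Rightarrow> ('b list \<times> 'b list) list" where
  "splits [] = [([], [])]"
| "splits (b # \<alpha>) = map (\<lambda>(\<beta>, \<gamma>). (b # \<beta>, \<gamma>)) (splits \<alpha>) @ map (\<lambda>(\<beta>, \<gamma>). (\<beta>, b # \<gamma>)) (splits \<alpha>)"

lemma length_splits: "length (splits \<alpha>) = 2 ^ length \<alpha>"
  by (induction \<alpha>) auto

lemma in_splits:
  "(\<beta>, \<gamma>) \<in> set (splits \<alpha>) \<Longrightarrow> \<alpha> \<in> lists A \<Longrightarrow>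
     \<beta> \<in> lists A \<and> \<gamma> \<in> lists A \<and> length \<beta> \<le> length \<alpha> \<and> length \<gamma> \<le> length \<alpha>"
proof (induction \<alpha> arbitrary: \<beta> \<gamma>)
  case (Cons b \<alpha>)
  then have \<alpha>: "\<alpha> \<in> lists A" "b \<in> A" by auto
  from Cons.prems(1) consider \<beta>' where "\<beta> = b # \<beta>'" "(\<beta>', \<gamma>) \<in> set (splits \<alpha>)"
    | \<gamma>' where "\<gamma> = b # \<gamma>'" "(\<beta>, \<gamma>') \<in> set (splits \<alpha>)" by auto
  then show ?case
    using Cons.IH[OF _ \<alpha>(1)] \<alpha>(2) by cases fastforce+
qed auto

lemma has_derivative_sum_list:
  assumes "\<And>i. i \<in> set xs \<Longrightarrow> (F i has_derivative D i) (at x)"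
  shows "((\<lambda>y. \<Sum>i\<leftarrow>xs. F i y) has_derivative (\<lambda>h. \<Sum>i\<leftarrow>xs. D i h)) (at x)"
  using assms by (induction xs) (auto intro!: derivative_eq_intros)

lemma has_derivative_splits:
  assumes "f \<in> smooth_on S" "g \<in> smooth_on S" "\<alpha> \<in> lists Basis" "x \<in> S"
  shows "((\<lambda>x. \<Sum>(\<beta>, \<gamma>)\<leftarrow>splits \<alpha>. partials \<beta> f x * partials \<gamma> g x) has_derivative
    (\<lambda>h. \<Sum>(\<beta>, \<gamma>)\<leftarrow>splits \<alpha>. partials \<beta> f x * frechet_derivative (partials \<gamma> g) (at x) h
       + frechet_derivative (partials \<beta> f) (at x) h * partials \<gamma> g x)) (at x)"
  unfolding case_prod_beta
proof (rule has_derivative_sum_list)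
  fix i assume "i \<in> set (splits \<alpha>)"
  then have "fst i \<in> lists Basis" "snd i \<in> lists Basis"
    using in_splits[of "fst i" "snd i" \<alpha> Basis] assms(3) by simp_all
  then show "((\<lambda>x. partials (fst i) f x * partials (snd i) g x) has_derivative
      (\<lambda>h. partials (fst i) f x * frechet_derivative (partials (snd i) g) (at x) h
       + frechet_derivative (partials (fst i) f) (at x) h * partials (snd i) g x)) (at x)"
    by (intro has_derivative_mult smooth_onD(2)[OF assms(1) _ assms(4)] smooth_onD(2)[OF assms(2) _
        assms(4)])
qed

lemma partials_mult:
  assumes "open S" "f \<in> smooth_on S" "g \<in> smooth_on S"
  shows "\<alpha> \<in> lists Basis \<Longrightarrow> x \<in> S \<Longrightarrow>
    partials \<alpha> (\<lambda>x. f x * g x) x = (\<Sum>(\<beta>, \<gamma>)\<leftarrow>splits \<alpha>. partials \<beta> f x * partials \<gamma> g x)"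
proof (induction \<alpha> arbitrary: x)
  case (Cons b \<alpha>)
  \<comment> \<open>The product rule produces the two kinds of terms interleaved, while
    \<open>splits\<close> lists those with \<open>b\<close> on the left before those with
    \<open>b\<close> on the right.\<close>
  have *: "(\<Sum>(\<beta>, \<gamma>)\<leftarrow>xs. F \<beta> \<gamma> + G \<beta> \<gamma>) = (\<Sum>x\<leftarrow>xs. G (fst x) (snd x)) + (\<Sum>x\<leftarrow>xs. F (fst x) (snd x))"
    for xs and F G :: "'c \<Rightarrow> 'd \<Rightarrow> complex"
    by (induction xs) auto
  show ?case
    by (subst partials_Cons_eq[OF \<open>open S\<close> \<open>x \<in> S\<close> Cons.IH has_derivative_splits[OF assms(2,3)]])
       (use Cons.prems in \<open>auto simp: case_prod_beta o_def *\<close>)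
qed simp

lemma smooth_on_mult:
  assumes "open S" "f \<in> smooth_on S" "g \<in> smooth_on S"
  shows "(\<lambda>x. f x * g x) \<in> smooth_on S"
  by (rule smooth_onI[OF \<open>open S\<close> partials_mult[OF assms]])
     (use has_derivative_splits[OF assms(2,3)] in \<open>auto simp: differentiable_def\<close>)

lemma partials_vanish:
  assumes "open S" "\<And>y. y \<in> S \<Longrightarrow> f y = 0" "x \<in> S"
  shows "partials \<alpha> f x = 0"
proof -
  have "partials \<alpha> (\<lambda>_::'a. 0) = (\<lambda>_. 0)"
    by (induction \<alpha>) auto
  then show ?thesis
    using partials_cong[OF assms(1), of f "\<lambda>_. 0" x] assms by (metis (full_types))
qed

lemma smooth_on_const: "(\<lambda>x. c) \<in> smooth_on S"
  by (rule smooth_on_family[where \<F> = "range (\<lambda>c x. c)"]) (auto intro!: exI[of _ "\<lambda>_ _. 0"])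

section \<open>Seminorms of smooth functions\<close>

text \<open>Only finitely many index lists have length at most \<open>j\<close>, and each partial is
  continuous on the compact set. Without boundedness the \<open>Sup\<close> in
  \<open>Ck_norm\<close> would carry no information.\<close>

lemma Ck_norm_bdd:
  assumes "f \<in> smooth_on S" "compact K" "K \<subseteq> S"
  shows "bdd_above (insert 0 {cmod (partials \<alpha> f x) | x \<alpha>. x \<in> K
      \<and> \<alpha> \<in> lists (Basis::'a::euclidean_space set) \<and> length \<alpha> \<le> j})"
proof -
  have "finite {\<alpha>. set \<alpha> \<subseteq> (Basis::'a set) \<and> length \<alpha> \<le> j}"
    by (rule finite_lists_length_le) simp
  moreover have "bdd_above ((\<lambda>x. cmod (partials \<alpha> f x)) ` K)" if "\<alpha> \<in> lists Basis" for \<alpha>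
    using that assms continuous_partials[OF assms(1) that]
    by (intro bounded_imp_bdd_above compact_imp_bounded compact_continuous_image)
       (auto intro!: continuous_intros elim: continuous_on_subset)
  ultimately have "bdd_above (\<Union>\<alpha>\<in>{\<alpha>. set \<alpha> \<subseteq> (Basis::'a set) \<and> length \<alpha>
      \<le> j}. (\<lambda>x. cmod (partials \<alpha> f x)) ` K)"
    by (subst bdd_above_UN) (simp_all add: in_lists_conv_set subset_iff)
  then show ?thesis
    by (subst bdd_above_insert) (erule bdd_above_mono, auto)
qed

lemma Ck_norm_ge:
  assumes "f \<in> smooth_on S" "compact K" "K \<subseteq> S" "x \<in> K" "\<alpha> \<in> lists Basis" "length \<alpha> \<le> j"
  shows "cmod (partials \<alpha> f x) \<le> Ck_norm K j f"
  unfolding Ck_norm_def by (rule cSup_upper[OF _ Ck_norm_bdd[OF assms(1-3)]]) (use assms in auto)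

lemma Ck_norm_nonneg:
  assumes "f \<in> smooth_on S" "compact K" "K \<subseteq> S"
  shows "0 \<le> Ck_norm K j f"
  unfolding Ck_norm_def by (rule cSup_upper[OF _ Ck_norm_bdd[OF assms(1-3)]]) auto

lemma Ck_norm_le:
  assumes "0 \<le> c" "\<And>x \<alpha>. x \<in> K \<Longrightarrow> \<alpha> \<in> lists Basis \<Longrightarrow> length \<alpha> \<le> j \<Longrightarrow> cmod (partials \<alpha> f x) \<le> c"
  shows "Ck_norm K j f \<le> c"
  unfolding Ck_norm_def by (rule cSup_least) (use assms in auto)

lemma Ck_norm_diff:
  assumes "open S" "f \<in> smooth_on S" "g \<in> smooth_on S" "compact K" "K \<subseteq> S"
  shows "Ck_norm K j (\<lambda>x. f x - g x) \<le> Ck_norm K j f + Ck_norm K j g"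
proof (rule Ck_norm_le)
  fix x and \<alpha> :: "'a list" assume *: "x \<in> K" "\<alpha> \<in> lists Basis" "length \<alpha> \<le> j"
  have "cmod (partials \<alpha> (\<lambda>x. f x - g x) x) \<le> cmod (partials \<alpha> f x) + cmod (partials \<alpha> g x)"
    using * assms by (subst partials_diff[OF assms(1-3)]) (auto intro: norm_triangle_ineq4)
  also have "\<dots> \<le> Ck_norm K j f + Ck_norm K j g"
    using * assms by (intro add_mono Ck_norm_ge) auto
  finally show "cmod (partials \<alpha> (\<lambda>x. f x - g x) x) \<le> Ck_norm K j f + Ck_norm K j g" .
qed (use assms Ck_norm_nonneg in \<open>auto intro!: add_nonneg_nonneg\<close>)

lemma Ck_norm_cmult:
  assumes "open S" "f \<in> smooth_on S" "compact K" "K \<subseteq> S"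
  shows "Ck_norm K j (\<lambda>x. c * f x) \<le> cmod c * Ck_norm K j f"
  by (rule Ck_norm_le)
     (simp_all only: partials_bounded_linear[OF bounded_linear_mult_right assms(1,2)] subsetD[OF assms(4)]
        complex_mod_cnj norm_mult mult_left_mono Ck_norm_ge[OF assms(2-4)] norm_ge_zero
            mult_nonneg_nonneg[OF norm_ge_zero Ck_norm_nonneg[OF assms(2-4)]])

lemma Ck_norm_cnj:
  assumes "open S" "f \<in> smooth_on S" "compact K" "K \<subseteq> S"
  shows "Ck_norm K j (\<lambda>x. cnj (f x)) \<le> Ck_norm K j f"
  by (rule Ck_norm_le)
     (simp_all only: partials_bounded_linear[OF bounded_linear_cnj assms(1,2)] subsetD[OF assms(4)]
        complex_mod_cnj Ck_norm_ge[OF assms(2-4)] norm_ge_zero Ck_norm_nonneg[OF assms(2-4)])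

text \<open>Stated at a single point with free bounds \<open>A\<close> and \<open>B\<close>, so that
  it also applies to a symbol at fixed \<xi>, whose bound is a power of
  \<open>japanese \<xi>\<close> and not a \<open>Ck_norm\<close>. The factor \<open>2 ^ j\<close>
  counts the splittings.\<close>

lemma norm_partials_mult_le:
  assumes "open S" "f \<in> smooth_on S" "g \<in> smooth_on S" "x \<in> S" "\<alpha> \<in> lists Basis" "length \<alpha> \<le> j"
    and "\<And>\<beta>. \<beta> \<in> lists Basis \<Longrightarrow> length \<beta> \<le> j \<Longrightarrow> cmod (partials \<beta> f x) \<le> A"
    and "\<And>\<beta>. \<beta> \<in> lists Basis \<Longrightarrow> length \<beta> \<le> j \<Longrightarrow> cmod (partials \<beta> g x) \<le> B"
  shows "cmod (partials \<alpha> (\<lambda>x. f x * g x) x) \<le> 2 ^ j * A * B"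
proof -
  \<comment> \<open>The bounds are nonnegative because they dominate the undifferentiated functions,
    the case of the empty list.\<close>
  have AB: "0 \<le> A" "0 \<le> B"
    using order_trans[OF norm_ge_zero assms(7)[of "[]"]] order_trans[OF norm_ge_zero assms(8)[of "[]"]]
        by auto
  have *: "norm (\<Sum>i\<leftarrow>xs. F i) \<le> real (length xs) * C" if "\<forall>i\<in>set xs. norm (F i) \<le> C"
    for xs and F :: "'c \<Rightarrow> complex" and C
    using that by (induction xs) (auto simp: algebra_simps intro: order_trans[OF norm_triangle_ineq]
        add_mono)
  have "cmod (partials \<alpha> (\<lambda>x. f x * g x) x) \<le> real (length (splits \<alpha>)) * (A * B)"
    unfolding partials_mult[OF assms(1-3,5,4)]
  proof (rule *, clarify)
    fix \<beta> \<gamma> assume "(\<beta>, \<gamma>) \<in> set (splits \<alpha>)"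
    then have "cmod (partials \<beta> f x) \<le> A" "cmod (partials \<gamma> g x) \<le> B"
      using in_splits[of \<beta> \<gamma> \<alpha> Basis] assms(5-8) by force+
    then show "cmod (partials \<beta> f x * partials \<gamma> g x) \<le> A * B"
      using AB by (simp add: norm_mult mult_mono)
  qed
  also have "\<dots> \<le> 2 ^ j * (A * B)"
    using assms(6) AB by (auto simp: length_splits intro!: mult_right_mono power_increasing)
  finally show ?thesis by (simp add: mult.assoc)
qed

lemma Ck_norm_mult:
  assumes "open S" "f \<in> smooth_on S" "g \<in> smooth_on S" "compact K" "K \<subseteq> S"
  shows "Ck_norm K j (\<lambda>x. f x * g x) \<le> 2 ^ j * Ck_norm K j f * Ck_norm K j g"
  by (rule Ck_norm_le)
     (use assms in \<open>auto intro!: norm_partials_mult_le[OF assms(1-3)] Ck_norm_ge Ck_norm_nonneg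
         mult_nonneg_nonneg\<close>)

section \<open>Cut-off functions\<close>

text \<open>\<open>flat 0\<close> is the classical smooth function that vanishes to infinite order
  at 0. The extra powers of \<open>inverse t\<close> make the span of the family closed under
  differentiation.\<close>

definition flat :: "nat \<Rightarrow> real \<Rightarrow> real" where
  "flat k t = (if t > 0 then exp (- inverse t) * inverse t ^ k else 0)"

lemma flat_tendsto_0: "(flat k \<longlongrightarrow> 0) (at 0)"
proof -
  have "((\<lambda>t. inverse t ^ k / exp (inverse t)) \<longlongrightarrow> 0) (at_right (0::real))"
    using filterlim_compose[OF tendsto_power_div_exp_0 filterlim_inverse_at_top_right] by simp
  then have "(flat k \<longlongrightarrow> 0) (at_right 0)"
    by (rule Lim_transform_eventually)
       (auto simp: flat_def exp_minus field_simps eventually_at_right_field intro!: exI[of _ 1])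
  moreover have "(flat k \<longlongrightarrow> 0) (at_left 0)"
    by (rule Lim_transform_eventually[OF tendsto_const])
       (auto simp: flat_def eventually_at_left_field intro!: exI[of _ "-1"])
  ultimately show ?thesis by (simp add: filterlim_split_at)
qed

lemma flat_deriv: "(flat k has_real_derivative (flat (k + 2) t - real k * flat (k + 1) t)) (at t)"
proof -
  consider "t < 0" | "t = 0" | "t > 0" by linarith
  then show ?thesis
  proof cases
    case 1
    have "((\<lambda>_. 0) has_real_derivative 0) (at t)" by simp
    then have "(flat k has_real_derivative 0) (at t)"
      by (rule has_field_derivative_transform_within_open[of _ _ _ "{..<0}"])
          (use 1 in \<open>auto simp: flat_def\<close>)
    then show ?thesis using 1 by (simp add: flat_def)
  next
    case 2
    \<comment> \<open>For nonzero \<open>h\<close> the difference quotient of \<open>flat k\<close>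
      at 0 is \<open>flat (k + 1) h\<close>, which tends to 0.\<close>
    have "((\<lambda>h. flat k h / h) \<longlongrightarrow> 0) (at 0)"
      by (rule Lim_transform_eventually[OF flat_tendsto_0[of "Suc k"]])
         (auto simp: flat_def field_simps eventually_at_filter)
    then show ?thesis using 2 by (simp add: DERIV_def flat_def)
  next
    case 3
    have "((\<lambda>t. exp (- inverse t) * inverse t ^ k) has_real_derivative
         flat (k + 2) t - real k * flat (k + 1) t) (at t)"
      using 3 by (auto intro!: derivative_eq_intros simp: flat_def power2_eq_square)
         (cases k, auto simp: field_simps)
    then show ?thesis
      by (rule has_field_derivative_transform_within_open[of _ _ _ "{0<..}"])
          (use 3 in \<open>auto simp: flat_def\<close>)
  qed
qed

text \<open>A class closed under differentiation that contains radial bumps, coordinate functions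
  and quotients with nowhere vanishing denominator. Membership is then a proof of
  smoothness.\<close>

inductive_set elementary :: "('a::euclidean_space \<Rightarrow> complex) set" where
  const: "(\<lambda>x. c) \<in> elementary"
| coord: "(\<lambda>x. complex_of_real (x \<bullet> b)) \<in> elementary"
| flat: "(\<lambda>x. complex_of_real (flat k (\<mu> + \<nu> * ((x - z) \<bullet> (x - z))))) \<in> elementary"
| add: "f \<in> elementary \<Longrightarrow> g \<in> elementary \<Longrightarrow> (\<lambda>x. f x + g x) \<in> elementary"
| mult: "f \<in> elementary \<Longrightarrow> g \<in> elementary \<Longrightarrow> (\<lambda>x. f x * g x) \<in> elementary"
| inverse: "f \<in> elementary \<Longrightarrow> (\<And>x. f x \<noteq> 0) \<Longrightarrow> (\<lambda>x. inverse (f x)) \<in> elementary"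

lemma elementary_derivative:
  assumes "f \<in> elementary"
  shows "\<exists>D. (\<forall>x. (f has_derivative D x) (at x)) \<and> (\<forall>b. (\<lambda>x. D x b) \<in> elementary)"
  using assms
proof induction
  case (const c)
  show ?case by (rule exI[of _ "\<lambda>_ _. 0"]) (auto intro: elementary.const)
next
  case (coord b)
  show ?case
    by (rule exI[of _ "\<lambda>x h. of_real (h \<bullet> b)"]) (auto intro!: derivative_eq_intros elementary.const)
next
  case (flat k \<mu> \<nu> z)
  let ?q = "\<lambda>x. \<mu> + \<nu> * ((x - z) \<bullet> (x - z))"
  define D where "D x h = complex_of_real ((flat (k + 2) (?q x) - real k * flat (k + 1) (?q x)) *
    (\<nu> * (2 * ((x - z) \<bullet> h))))" for x h
  have "((\<lambda>x. flat k (?q x)) has_derivative (\<lambda>h. (flat (k + 2) (?q x) - real k * flat (k + 1) (?q x)) *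
    (\<nu> * (2 * ((x - z) \<bullet> h))))) (at x)" for x
    by (rule has_derivative_eq_rhs[OF DERIV_compose_FDERIV[OF flat_deriv]])
       (auto intro!: derivative_eq_intros simp: inner_commute algebra_simps)
  then have "\<forall>x. ((\<lambda>x. complex_of_real (flat k (?q x))) has_derivative D x) (at x)"
    unfolding D_def by (intro allI has_derivative_of_real)
  moreover have "(\<lambda>x. D x b) \<in> elementary" for b
  proof -
    have "(\<lambda>x. D x b) = (\<lambda>x. (of_real (flat (k + 2) (?q x)) + (- of_nat k) * of_real (flat (k + 1) (?q x)))
       * (of_real (2 * \<nu>) * (of_real (x \<bullet> b) + of_real (- (z \<bullet> b)))))"
      by (auto simp: D_def inner_diff_left algebra_simps)
    also have "\<dots> \<in> elementary" by (intro elementary.intros)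
    finally show ?thesis .
  qed
  ultimately show ?case by blast
next
  case (add f g)
  then obtain D E where "\<forall>x. (f has_derivative D x) (at x)" "\<forall>b. (\<lambda>x. D x b) \<in> elementary"
    "\<forall>x. (g has_derivative E x) (at x)" "\<forall>b. (\<lambda>x. E x b) \<in> elementary" by blast
  then show ?case
    by (intro exI[of _ "\<lambda>x h. D x h + E x h"]) (auto intro: has_derivative_add elementary.add)
next
  case (mult f g)
  then obtain D E where "\<forall>x. (f has_derivative D x) (at x)" "\<forall>b. (\<lambda>x. D x b) \<in> elementary"
    "\<forall>x. (g has_derivative E x) (at x)" "\<forall>b. (\<lambda>x. E x b) \<in> elementary" by blast
  then show ?case using mult.hyps
    by (intro exI[of _ "\<lambda>x h. f x * E x h + D x h * g x"]) (auto intro!: has_derivative_mult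
        elementary.intros(4,5))
next
  case (inverse f)
  then obtain D where D: "\<forall>x. (f has_derivative D x) (at x)" "\<forall>b. (\<lambda>x. D x b) \<in> elementary" by blast
  have "(\<lambda>x. - (inverse (f x) * D x b * inverse (f x))) \<in> elementary" for b
  proof -
    have "(\<lambda>x. (-1) * (inverse (f x) * D x b * inverse (f x))) \<in> elementary"
      using inverse D by (intro elementary.intros(1,5,6)) auto
    then show ?thesis by simp
  qed
  then show ?case using D inverse
    by (intro exI[of _ "\<lambda>x h. - (inverse (f x) * D x h * inverse (f x))"])
       (auto intro!: has_derivative_inverse)
qed

lemma elementary_smooth: "f \<in> elementary \<Longrightarrow> f \<in> smooth_on S"
  by (rule smooth_on_family[where \<F> = elementary]) (use elementary_derivative in blast)+

lemma bump_exists: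
  fixes z :: "'a::euclidean_space"
  assumes "0 < r"
  obtains \<psi> :: "'a \<Rightarrow> real" where "(\<lambda>x. complex_of_real (\<psi> x)) \<in> smooth_on UNIV"
    "\<And>x. 0 \<le> \<psi> x" "\<And>x. 0 < \<psi> x \<longleftrightarrow> norm (x - z) < r"
proof -
  define \<psi> where "\<psi> x = flat 0 (r\<^sup>2 + (- 1) * ((x - z) \<bullet> (x - z)))" for x
  have "(norm (x - z))\<^sup>2 < r\<^sup>2 \<longleftrightarrow> norm (x - z) < r" for x
    using power_mono_iff[of r "norm (x - z)" 2] assms by (simp flip: linorder_not_le)
  then have "0 < \<psi> x \<longleftrightarrow> norm (x - z) < r" for x
    by (simp add: \<psi>_def flat_def dot_square_norm)
  then show thesis
    using that[of \<psi>] elementary_smooth[OF elementary.flat, of 0 "r\<^sup>2" "-1" z UNIV]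
    by (simp add: \<psi>_def flat_def)
qed

text \<open>The quotient \<open>u / (u + v)\<close>, where \<open>u\<close> is positive exactly
  inside the ball of radius \<open>R\<close> and \<open>v\<close> exactly outside the closed ball of
  radius \<open>r\<close>. As \<open>r < R\<close>, at least one of them is positive at every
  point.\<close>

lemma cutoff_exists:
  assumes "0 < r" "r < R"
  obtains \<kappa> :: "'a::euclidean_space \<Rightarrow> complex" where "\<kappa> \<in> smooth_on UNIV"
    "\<And>x. norm x \<le> r \<Longrightarrow> \<kappa> x = 1" "\<And>x. R \<le> norm x \<Longrightarrow> \<kappa> x = 0"
proof -
  define u v :: "'a \<Rightarrow> complex" where
    "u x = flat 0 (R\<^sup>2 + (- 1) * ((x - 0) \<bullet> (x - 0)))" and
    "v x = flat 0 (- (r\<^sup>2) + 1 * ((x - 0) \<bullet> (x - 0)))" for x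
  have uv: "u \<in> elementary" "v \<in> elementary"
    unfolding u_def[abs_def] v_def[abs_def] by (rule elementary.flat)+
  have u0: "R \<le> norm x \<Longrightarrow> u x = 0" and v0: "norm x \<le> r \<Longrightarrow> v x = 0" for x
    using assms by (auto simp: u_def v_def flat_def dot_square_norm power_mono not_less)
  have nz: "u x + v x \<noteq> 0" for x
  proof -
    have "r\<^sup>2 < R\<^sup>2" using assms by (intro power_strict_mono) auto
    then have "(norm x)\<^sup>2 < R\<^sup>2 \<or> r\<^sup>2 < (norm x)\<^sup>2" by linarith
    then have "flat 0 (R\<^sup>2 - (norm x)\<^sup>2) + flat 0 ((norm x)\<^sup>2 - r\<^sup>2) > 0"
      by (auto simp: flat_def intro: add_pos_nonneg add_nonneg_pos)
    then show ?thesis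
      unfolding u_def v_def of_real_add[symmetric] of_real_eq_0_iff
      by (simp add: dot_square_norm)
  qed
  have "(\<lambda>x. u x * inverse (u x + v x)) \<in> smooth_on UNIV"
    using uv nz by (intro elementary_smooth elementary.intros(4-6)) auto
  then show thesis
  proof (rule that)
    fix x :: 'a assume "norm x \<le> r"
    then show "u x * inverse (u x + v x) = 1" using nz[of x] v0[of x] by simp
  qed (use u0 in auto)
qed

section \<open>Test functions\<close>

lemma test_functions_smooth: "f \<in> test_functions S \<Longrightarrow> f \<in> smooth_on UNIV"
  by (simp add: test_functions_def)

lemma test_functions_vanish: "f \<in> test_functions S \<Longrightarrow> x \<notin> S \<Longrightarrow> f x = 0"
  by (auto simp: test_functions_def)

lemma test_functions_mono: "S \<subseteq> T \<Longrightarrow> test_functions S \<subseteq> test_functions T"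
  unfolding test_functions_def by (blast intro: order_trans)

lemma test_functionsI:
  "f \<in> smooth_on UNIV \<Longrightarrow> compact K \<Longrightarrow> K \<subseteq> S \<Longrightarrow> (\<And>x. x \<notin> K \<Longrightarrow> f x = 0) \<Longrightarrow> f \<in> test_functions S"
  by (auto simp: test_functions_def)

lemma test_functionsE:
  assumes "f \<in> test_functions S"
  obtains K where "compact K" "K \<subseteq> S" "f \<in> test_functions K"
  using assms by (auto simp: test_functions_def)

lemma test_functions_mult:
  assumes "f \<in> test_functions S" "g \<in> smooth_on UNIV"
  shows "(\<lambda>x. g x * f x) \<in> test_functions S"
proof -
  obtain K where "compact K" "K \<subseteq> S" "f \<in> test_functions K" by (rule test_functionsE[OF assms(1)])
  then show ?thesis
    using smooth_on_mult[OF open_UNIV assms(2) test_functions_smooth[OF assms(1)]] test_functions_vanish[of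
        f K]
    by (intro test_functionsI[of _ K]) simp_all
qed

lemma test_functions_cmult: "f \<in> test_functions S \<Longrightarrow> (\<lambda>x. c * f x) \<in> test_functions S"
  by (rule test_functions_mult[OF _ smooth_on_const])

lemma test_functions_cnj:
  assumes "f \<in> test_functions S"
  shows "(\<lambda>x. cnj (f x)) \<in> test_functions S"
proof -
  obtain K where "compact K" "K \<subseteq> S" "f \<in> test_functions K" by (rule test_functionsE[OF assms(1)])
  then show ?thesis
    using smooth_on_cnj[OF open_UNIV test_functions_smooth[OF assms(1)]] test_functions_vanish[of f K]
    by (intro test_functionsI[of _ K]) simp_all
qed

lemma test_functions_add:
  assumes "f \<in> test_functions S" "g \<in> test_functions S"
  shows "(\<lambda>x. f x + g x) \<in> test_functions S"
proof -
  obtain K where "compact K" "K \<subseteq> S" "f \<in> test_functions K" by (rule test_functionsE[OF assms(1)])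
  moreover obtain L where "compact L" "L \<subseteq> S" "g \<in> test_functions L" by (rule test_functionsE[OF assms(2)])
  ultimately show ?thesis
    using smooth_on_add[OF open_UNIV assms[THEN test_functions_smooth]] test_functions_vanish[of f K]
      test_functions_vanish[of g L]
    by (intro test_functionsI[of _ "K \<union> L"]) auto
qed

lemma test_functions_partials:
  assumes "f \<in> test_functions S" "\<alpha> \<in> lists Basis"
  shows "partials \<alpha> f \<in> test_functions S"
proof -
  obtain K where K: "compact K" "K \<subseteq> S" "f \<in> test_functions K" by (rule test_functionsE[OF assms(1)])
  then have "partials \<alpha> f x = 0" if "x \<notin> K" for x
    using that by (intro partials_vanish[of "- K"]) (auto simp: compact_imp_closed test_functions_vanish)
  then show ?thesis
    using K smooth_on_partials[OF test_functions_smooth[OF assms(1)] assms(2)]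
    by (intro test_functionsI[of _ K]) auto
qed

text \<open>The bound holds at every point, not just on \<open>K\<close>: the complement of a
  compact support is open, so all partials vanish there. Thus the norm over \<open>K\<close> is a
  global norm.\<close>

lemma test_partials_le:
  assumes "f \<in> test_functions K" "compact K" "\<alpha> \<in> lists Basis" "length \<alpha> \<le> j"
  shows "cmod (partials \<alpha> f x) \<le> Ck_norm K j f"
proof (cases "x \<in> K")
  case True
  then show ?thesis using assms test_functions_smooth[OF assms(1)] by (intro Ck_norm_ge) auto
next
  case False
  then show ?thesis
    using assms test_functions_vanish[OF test_functions_partials] Ck_norm_nonneg[OF test_functions_smooth[OF
        assms(1)]]
    by (metis norm_zero subset_UNIV)
qed

lemma test_Ck_norm_nonneg: "f \<in> test_functions S \<Longrightarrow> compact K \<Longrightarrow> 0 \<le> Ck_norm K j f"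
  by (rule Ck_norm_nonneg[OF test_functions_smooth]) auto

lemma test_functions_bound: "f \<in> test_functions K \<Longrightarrow> compact K \<Longrightarrow> cmod (f x) \<le> Ck_norm K j f"
  using test_partials_le[of f K "[]" j x] by simp

lemma test_functions_continuous: "f \<in> test_functions S \<Longrightarrow> continuous_on UNIV f"
  by (rule smooth_on_continuous[OF test_functions_smooth])

lemma integrable_continuous_compact_support:
  fixes f :: "'a::euclidean_space \<Rightarrow> complex"
  assumes "continuous_on UNIV f" "compact K" "\<And>x. x \<notin> K \<Longrightarrow> f x = 0"
  shows "integrable lborel f"
proof -
  have "integrable lborel (\<lambda>x. indicator K x *\<^sub>R f x)"
    using assms by (intro borel_integrable_compact) (auto intro: continuous_on_subset)
  also have "(\<lambda>x. indicator K x *\<^sub>R f x) = f"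
    using assms(3) by (auto simp: indicator_def fun_eq_iff)
  finally show ?thesis .
qed

lemma integrable_test_mult:
  assumes "f \<in> test_functions S" "continuous_on UNIV g"
  shows "integrable lborel (\<lambda>x. g x * f x)"
proof -
  obtain K where "compact K" "f \<in> test_functions K" by (rule test_functionsE[OF assms(1)])
  then show ?thesis
    using assms test_functions_continuous[OF assms(1)] test_functions_vanish
    by (intro integrable_continuous_compact_support[of _ K]) (auto intro!: continuous_intros)
qed

lemma integrable_test: "f \<in> test_functions S \<Longrightarrow> integrable lborel f"
  using integrable_test_mult[of f S "\<lambda>_. 1"] by simp

lemma integral_test_le:
  assumes "f \<in> test_functions K" "compact K"
  shows "(LINT x|lborel. cmod (f x)) \<le> measure lborel K * Ck_norm K j f"
proof -
  have K: "integrable lborel (\<lambda>x. Ck_norm K j f * indicator K x)"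
    using assms emeasure_bounded_finite[OF compact_imp_bounded[OF assms(2)]]
    by (intro integrable_mult_right integrable_real_indicator) (auto simp: borel_compact)
  have "(LINT x|lborel. cmod (f x)) \<le> (LINT x|lborel. Ck_norm K j f * indicator K x)"
    using test_functions_bound[OF assms] test_functions_vanish[OF assms(1)]
    by (intro integral_mono integrable_norm integrable_test[OF assms(1)] K) (auto simp: indicator_def)
  also have "\<dots> = measure lborel K * Ck_norm K j f" using K by simp
  finally show ?thesis .
qed

section \<open>Integration on Euclidean space\<close>

lemma lborel_integral_affine:
  fixes f :: "'a::euclidean_space \<Rightarrow> complex"
  assumes "f \<in> borel_measurable borel" "c \<noteq> 0"
  shows "(LINT x|lborel. f x) = \<bar>c\<bar> ^ DIM('a) *\<^sub>R (LINT x|lborel. f (t + c *\<^sub>R x))"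
proof -
  have "(LINT x|lborel. f x) = (LINT x|density (distr lborel borel (\<lambda>x. t + c *\<^sub>R x)) (\<lambda>_. ennreal (\<bar>c\<bar> ^
      DIM('a))). f x)"
    using lborel_affine[OF assms(2), of t] by simp
  also have "\<dots> = (LINT x|distr lborel borel (\<lambda>x. t + c *\<^sub>R x). \<bar>c\<bar> ^ DIM('a) *\<^sub>R f x)"
    using assms by (intro integral_density) auto
  also have "\<dots> = (LINT x|lborel. \<bar>c\<bar> ^ DIM('a) *\<^sub>R f (t + c *\<^sub>R x))"
    using assms by (intro integral_distr) auto
  finally show ?thesis by simp
qed

lemma lborel_integral_reflect:
  fixes f :: "'a::euclidean_space \<Rightarrow> 'b::{banach, second_countable_topology}"
  shows "(LINT x|lborel. f (- x)) = (LINT x|lborel. f x)"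
    and "integrable lborel (\<lambda>x. f (- x)) \<longleftrightarrow> integrable lborel f"
proof -
  have *: "distr lborel borel uminus = (lborel :: 'a measure)"
    using lborel_affine[of "-1" "0::'a"] by (simp add: density_1)
  have meas: "(\<lambda>x. f (- x)) \<in> borel_measurable borel \<longleftrightarrow> f \<in> borel_measurable borel"
  proof
    assume "(\<lambda>x. f (- x)) \<in> borel_measurable borel"
    from measurable_compose[OF borel_measurable_uminus[OF measurable_ident_sets[OF refl]] this]
    show "f \<in> borel_measurable borel" by simp
  qed (rule measurable_compose[OF borel_measurable_uminus[OF measurable_ident_sets[OF refl]]])
  show 1: "integrable lborel (\<lambda>x. f (- x)) \<longleftrightarrow> integrable lborel f"
  proof (cases "f \<in> borel_measurable borel")
    case True
    have "integrable lborel f \<longleftrightarrow> integrable (distr lborel borel uminus) f" by (simp add: *)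
    also have "\<dots> \<longleftrightarrow> integrable lborel (\<lambda>x. f (- x))" using True by (intro integrable_distr_eq) auto
    finally show ?thesis by simp
  next
    case False
    then show ?thesis using meas by (auto dest!: borel_measurable_integrable)
  qed
  show "(LINT x|lborel. f (- x)) = (LINT x|lborel. f x)"
  proof (cases "f \<in> borel_measurable borel")
    case True
    have "(LINT x|lborel. f x) = (LINT x|distr lborel borel uminus. f x)" by (simp add: *)
    also have "\<dots> = (LINT x|lborel. f (- x))" using True by (intro integral_distr) auto
    finally show ?thesis by simp
  next
    case False
    \<comment> \<open>Neither side is integrable, and the integral of such a function is 0 by
      convention.\<close>
    then have "\<not> integrable lborel f" by (auto dest!: borel_measurable_integrable)
    then show ?thesis using 1 by (simp add: not_integrable_integral_eq)
  qed
qed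

lemma
  fixes g :: "'a::euclidean_space \<Rightarrow> real \<Rightarrow> 'b::{real_normed_field, banach, second_countable_topology}"
  assumes g: "\<And>b. b \<in> Basis \<Longrightarrow> integrable lborel (g b)"
  shows integrable_lborel_prod: "integrable lborel (\<lambda>x::'a. \<Prod>b\<in>Basis. g b (x \<bullet> b))"
    and integral_lborel_prod:
      "(LINT x|lborel. (\<Prod>b\<in>Basis. g b (x \<bullet> b))) = (\<Prod>b\<in>Basis. (LINT t|lborel. g b t))"
proof -
  interpret product_sigma_finite "\<lambda>_::'a. lborel :: real measure" by standard
  have meas: "(\<lambda>x::'a. \<Prod>b\<in>Basis. g b (x \<bullet> b)) \<in> borel_measurable borel"
    using g by (intro borel_measurable_prod) (auto dest!: borel_measurable_integrable intro:
        measurable_compose)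
  have meas': "(\<lambda>f. \<Sum>b\<in>Basis. f b *\<^sub>R b) \<in> borel_measurable (Pi\<^sub>M (Basis::'a set) (\<lambda>_. lborel))"
    by measurable
  have eq: "(\<lambda>f. \<Prod>b\<in>Basis. g b ((\<Sum>b\<in>Basis. f b *\<^sub>R b) \<bullet> b)) = (\<lambda>f. \<Prod>b\<in>Basis. g b (f b))"
    by (auto simp: inner_sum_left_Basis)
  show "integrable lborel (\<lambda>x::'a. \<Prod>b\<in>Basis. g b (x \<bullet> b))"
    unfolding lborel_eq[where 'a='a] integrable_distr_eq[OF meas' meas] eq
    by (rule product_integrable_prod) (use g in auto)
  show "(LINT x|lborel. (\<Prod>b\<in>Basis. g b (x \<bullet> b))) = (\<Prod>b\<in>Basis. (LINT t|lborel. g b t))"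
    unfolding lborel_eq[where 'a='a] integral_distr[OF meas' meas] eq
    by (rule product_integral_prod) (use g in auto)
qed

text \<open>The form of Fubini used throughout: oscillating factors and normalized symbols go into
  the bounded kernel, and a product of two integrable functions of separate variables is the
  majorant.\<close>

lemma fubini_bounded_kernel:
  fixes f :: "'a::euclidean_space \<Rightarrow> complex" and g :: "'b::euclidean_space \<Rightarrow> complex"
  assumes f: "integrable lborel f" and g: "integrable lborel g"
    and K: "(\<lambda>(x, y). K x y) \<in> borel_measurable borel" "\<And>x y. cmod (K x y) \<le> B"
  shows "(LINT y|lborel. (LINT x|lborel. K x y * f x * g y))
      = (LINT x|lborel. (LINT y|lborel. K x y * f x * g y))"
proof -
  have [measurable]: "f \<in> borel_measurable borel" "g \<in> borel_measurable borel"
    using f g by (auto dest!: borel_measurable_integrable)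
  have [measurable]: "(\<lambda>(x, y). K x y) \<in> borel_measurable (lborel \<Otimes>\<^sub>M lborel)"
    using K(1) by (simp add: lborel_prod)
  have fg: "integrable (lborel \<Otimes>\<^sub>M lborel) (\<lambda>(x, y). f x * g y)"
  proof (rule lborel_pair.Fubini_integrable)
    show "integrable lborel (\<lambda>x. LINT y|lborel. cmod (case (x, y) of (x, y) \<Rightarrow> f x * g y))"
      using f by (auto simp: norm_mult)
    show "AE x in lborel. integrable lborel (\<lambda>y. case (x, y) of (x, y) \<Rightarrow> f x * g y)"
      using g by auto
  qed measurable
  have "integrable (lborel \<Otimes>\<^sub>M lborel) (\<lambda>(x, y). K x y * f x * g y)"
  proof (rule Bochner_Integration.integrable_bound)
    show "integrable (lborel \<Otimes>\<^sub>M lborel) (\<lambda>p. B *\<^sub>R (case p of (x, y) \<Rightarrow> f x * g y))"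
      using fg by simp
    have "cmod (K x y * f x * g y) \<le> cmod (B *\<^sub>R (f x * g y))" for x y
    proof -
      have "cmod (K x y) * cmod (f x * g y) \<le> \<bar>B\<bar> * cmod (f x * g y)"
        using K(2)[of x y] by (intro mult_right_mono) auto
      then show ?thesis by (simp add: norm_mult mult.assoc)
    qed
    then show "AE x in lborel \<Otimes>\<^sub>M lborel. cmod (case x of (x, y) \<Rightarrow> K x y * f x * g y)
         \<le> cmod (B *\<^sub>R (case x of (x, y) \<Rightarrow> f x * g y))" by auto
  qed measurable
  from lborel_pair.Fubini_integral[OF this] show ?thesis .
qed

lemma integrable_norm_bound:
  fixes f :: "'a \<Rightarrow> 'b::{banach, second_countable_topology}"
  assumes "integrable M g" "f \<in> borel_measurable M" "\<And>x. norm (f x) \<le> g x"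
  shows "integrable M f"
  by (rule Bochner_Integration.integrable_bound[OF assms(1,2)])
      (use assms(3) in \<open>auto intro: order_trans abs_ge_self\<close>)

text \<open>By translation invariance the difference quotients have integral zero.\<close>

lemma integral_partial_eq_0:
  fixes f :: "'a::euclidean_space \<Rightarrow> complex"
  assumes f: "f \<in> test_functions K" "compact K" and b: "b \<in> Basis"
  shows "(LINT x|lborel. partials [b] f x) = 0"
proof -
  define h where "h k = inverse (real (Suc k))" for k
  have h: "0 < h k" "h k \<le> 1" for k by (auto simp: h_def field_simps)
  define D where "D k x = (f (x + h k *\<^sub>R b) - f x) /\<^sub>R h k" for k x
  define C where "C = Ck_norm K 1 f"
  \<comment> \<open>Difference quotients with steps at most 1 all vanish off \<open>L\<close>, so a
    multiple of its indicator is a common majorant.\<close>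
  define L where "L = {x - y | x y. x \<in> K \<and> y \<in> cball 0 1}"
  have L: "compact L" unfolding L_def using f by (intro compact_differences) auto
  have C0: "0 \<le> C" unfolding C_def by (rule test_Ck_norm_nonneg[OF f])
  have vd: "((\<lambda>t. f (x + t *\<^sub>R b)) has_vector_derivative partials [b] f (x + t *\<^sub>R b)) (at t)" for x t
  proof -
    have D: "(f has_derivative frechet_derivative f (at (x + t *\<^sub>R b))) (at (x + t *\<^sub>R b))"
      using smooth_onD(2)[OF test_functions_smooth[OF f(1)], of "[]"] by simp
    have "((\<lambda>t. f (x + t *\<^sub>R b)) has_derivative (\<lambda>s. frechet_derivative f (at (x + t *\<^sub>R b)) (s *\<^sub>R b))) (at
        t)"
      by (rule has_derivative_compose[where f = "\<lambda>t. x + t *\<^sub>R b" and g = f and x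
          = t, OF _ D]) (auto intro!: derivative_eq_intros)
    then show ?thesis
      unfolding has_vector_derivative_def by (simp add: linear_scale[OF has_derivative_linear[OF D]])
  qed
  have DC: "cmod (D k x) \<le> C * indicator L x" for k x
  proof (cases "x \<in> L")
    case True
    have "cmod (f (x + h k *\<^sub>R b) - f (x + 0 *\<^sub>R b)) \<le> C * norm (h k - 0)"
    proof (rule differentiable_bound[of UNIV "\<lambda>t. f (x + t *\<^sub>R b)"
        "\<lambda>t s. s *\<^sub>R partials [b] f (x + t *\<^sub>R b)"])
      show "onorm (\<lambda>s. s *\<^sub>R partials [b] f (x + t *\<^sub>R b)) \<le> C" for t
      proof (rule onorm_bound[OF C0])
        have "cmod (partials [b] f (x + t *\<^sub>R b)) \<le> C"
          unfolding C_def using f b by (intro test_partials_le) auto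
        then show "norm (s *\<^sub>R partials [b] f (x + t *\<^sub>R b)) \<le> C * norm s" for s
          by (simp add: mult.commute[of C] mult_left_mono)
      qed
    qed (use vd in \<open>auto simp: has_vector_derivative_def\<close>)
    then show ?thesis using h[of k] True by (simp add: D_def divide_simps mult.commute)
  next
    case False
    have "x + h k *\<^sub>R b \<notin> K"
    proof
      assume "x + h k *\<^sub>R b \<in> K"
      moreover have "h k *\<^sub>R b \<in> cball 0 1" using h[of k] b by auto
      moreover have "x = (x + h k *\<^sub>R b) - h k *\<^sub>R b" by simp
      ultimately show False using False unfolding L_def by blast
    qed
    moreover have "x \<notin> K"
      using False unfolding L_def by (metis (mono_tags, lifting) centre_in_cball diff_zero mem_Collect_eq
          zero_le_one)
    ultimately show ?thesis using f by (simp add: D_def test_functions_vanish False)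
  qed
  have "(\<lambda>k. LINT x|lborel. D k x) \<longlonglongrightarrow> (LINT x|lborel. partials [b] f x)"
  proof (rule integral_dominated_convergence)
    show "integrable lborel (\<lambda>x. C * indicator L x)"
      using L emeasure_bounded_finite[OF compact_imp_bounded[OF L]]
      by (intro integrable_mult_right integrable_real_indicator) (auto simp: borel_compact)
    show "AE x in lborel. (\<lambda>k. D k x) \<longlonglongrightarrow> partials [b] f x"
    proof (rule AE_I2)
      fix x
      have "((\<lambda>s. (f (x + s *\<^sub>R b) - f x) /\<^sub>R s) \<longlongrightarrow> partials [b] f x) (at 0)"
      proof -
        let ?p = "partials [b] f x"
        have "((\<lambda>s. cmod (f (x + s *\<^sub>R b) - f x - s *\<^sub>R ?p) / norm s) \<longlongrightarrow> 0) (at 0)"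
          using vd[of x 0] by (simp add: has_vector_derivative_def has_derivative_at)
        moreover have "\<forall>\<^sub>F s in at 0. cmod (f (x + s *\<^sub>R b) - f x - s *\<^sub>R ?p) / norm s
            = cmod ((f (x + s *\<^sub>R b) - f x) /\<^sub>R s - ?p)"
          unfolding eventually_at_filter
        proof (intro always_eventually allI impI)
          fix s :: real assume "s \<noteq> 0"
          then have "(f (x + s *\<^sub>R b) - f x) /\<^sub>R s - ?p = (f (x + s *\<^sub>R b) - f x - s *\<^sub>R ?p) /\<^sub>R s"
            by (simp add: scaleR_diff_right)
          then show "cmod (f (x + s *\<^sub>R b) - f x - s *\<^sub>R ?p) / norm s
            = cmod ((f (x + s *\<^sub>R b) - f x) /\<^sub>R s - ?p)"
            by (simp add: divide_inverse mult.commute)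
        qed
        ultimately have "((\<lambda>s. cmod ((f (x + s *\<^sub>R b) - f x) /\<^sub>R s - ?p)) \<longlongrightarrow> 0) (at 0)"
          by (rule Lim_transform_eventually)
        then show ?thesis by (subst LIM_zero_iff[symmetric]) (rule tendsto_norm_zero_cancel)
      qed
      moreover have "filterlim h (at 0) sequentially"
        unfolding filterlim_at h_def using LIMSEQ_inverse_real_of_nat by auto
      ultimately show "(\<lambda>k. D k x) \<longlonglongrightarrow> partials [b] f x"
        unfolding D_def by (rule filterlim_compose)
    qed
    show "AE x in lborel. cmod (D k x) \<le> C * indicator L x" for k using DC by simp
  qed (use test_functions_continuous[OF f(1)] test_functions_continuous[OF test_functions_partials[OF f(1),
      of "[b]"]] b
        in \<open>auto simp: D_def intro!: borel_measurable_continuous_onI continuous_intros intro: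
            continuous_on_compose2\<close>)
  moreover have "(LINT x|lborel. D k x) = 0" for k
  proof -
    have m: "f \<in> borel_measurable borel"
      using test_functions_continuous[OF f(1)] by (rule borel_measurable_continuous_onI)
    have "(LINT x|lborel. f x) = (LINT x|lborel. f (h k *\<^sub>R b + x))"
      using lborel_integral_affine[OF m, of 1 "h k *\<^sub>R b"] by simp
    moreover have "integrable lborel (\<lambda>x. f (h k *\<^sub>R b + x))"
      using lborel_distr_plus[of "h k *\<^sub>R b"] integrable_distr_eq[of
          "(+) (h k *\<^sub>R b)" lborel borel f] m integrable_test[OF f(1)]
      by simp
    ultimately show ?thesis using integrable_test[OF f(1)] by (simp add: D_def add.commute)
  qed
  ultimately show ?thesis using LIMSEQ_unique[OF _ tendsto_const] by simp
qed

section \<open>The Fourier transform of test functions\<close>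

lemma continuous_cis_inner [continuous_intros]:
  "continuous_on S f \<Longrightarrow> continuous_on S g \<Longrightarrow> continuous_on S (\<lambda>x. cis (f x \<bullet> g x))"
  by (rule continuous_on_compose2[OF continuous_on_cis[OF continuous_on_id, of UNIV]]) (auto intro:
      continuous_intros)

lemma has_derivative_cis_inner:
  "((\<lambda>x. cis (- (x \<bullet> \<xi>))) has_derivative (\<lambda>h. - (\<i> * (h \<bullet> \<xi>)) * cis (- (x \<bullet> \<xi>)))) (at x)"
proof -
  have "((\<lambda>x. - (\<i> * complex_of_real (x \<bullet> \<xi>))) has_derivative (\<lambda>h. - (\<i> * complex_of_real (h \<bullet> \<xi>)))) (at x)"
    by (auto intro!: derivative_eq_intros)
  from has_derivative_compose[OF this DERIV_exp[unfolded has_field_derivative_def]]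
  show ?thesis by (simp add: cis_conv_exp mult.commute)
qed

lemma smooth_cis: "(\<lambda>x. cis (- (x \<bullet> \<xi>))) \<in> smooth_on S"
proof (rule smooth_on_family[where \<F> = "range (\<lambda>c x. c * cis (- (x \<bullet> \<xi>)))"])
  fix g assume "g \<in> range (\<lambda>c x. c * cis (- (x \<bullet> \<xi>)))"
  then obtain c where g: "g = (\<lambda>x. c * cis (- (x \<bullet> \<xi>)))" by auto
  have "(g has_derivative (\<lambda>h. (- (\<i> * complex_of_real (h \<bullet> \<xi>)) * c) * cis (- (x \<bullet> \<xi>)))) (at x)" for x
    unfolding g using has_derivative_mult_right[OF has_derivative_cis_inner, of c \<xi> x]
        by (simp add: mult_ac)
  then show "\<exists>D. (\<forall>x. (g has_derivative D x) (at x)) \<and>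
      (\<forall>b\<in>Basis. (\<lambda>x. D x b) \<in> range (\<lambda>c x. c * cis (- (x \<bullet> \<xi>))))"
    by (intro exI[of _ "\<lambda>x h. (- (\<i> * complex_of_real (h \<bullet> \<xi>)) * c) * cis (- (x \<bullet> \<xi>))"] conjI allI ballI
        rangeI)
qed (auto intro!: image_eqI[of _ _ 1])

lemma partial_cis: "frechet_derivative (\<lambda>x. cis (- (x \<bullet> \<xi>))) (at x) b = - (\<i> * (b \<bullet> \<xi>)) * cis (- (x \<bullet> \<xi>))"
  using frechet_derivative_at[OF has_derivative_cis_inner, of \<xi> x] by metis

lemma integrable_fourier: "f \<in> test_functions S \<Longrightarrow> integrable lborel (\<lambda>x. cis (- (x \<bullet> \<xi>)) * f x)"
  by (intro integrable_test_mult smooth_on_continuous[OF smooth_cis])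

text \<open>Integration by parts. The product of \<open>f\<close> with the character is again a test
  function, so its partial derivative has integral 0.\<close>

lemma fourier_partial:
  assumes f: "f \<in> test_functions S" and b: "b \<in> Basis"
  shows "fourier (partials [b] f) \<xi> = \<i> * (\<xi> \<bullet> b) * fourier f \<xi>"
proof -
  obtain K where K: "compact K" "f \<in> test_functions K" by (rule test_functionsE[OF f])
  let ?g = "\<lambda>x. cis (- (x \<bullet> \<xi>)) * f x"
  have g: "?g \<in> test_functions K" by (rule test_functions_mult[OF K(2) smooth_cis])
  have "partials [b] ?g x = cis (- (x \<bullet> \<xi>)) * partials [b] f x + - (\<i> * (\<xi> \<bullet> b)) * ?g x" for x
    using partials_mult[OF open_UNIV smooth_cis test_functions_smooth[OF f], of "[b]" x] b
    by (simp add: partial_cis inner_commute[of \<xi> b])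
  then have "0 = (LINT x|lborel. cis (- (x \<bullet> \<xi>)) * partials [b] f x + - (\<i> * (\<xi> \<bullet> b)) * ?g x)"
    using integral_partial_eq_0[OF g K(1) b] by simp
  also have "\<dots> = fourier (partials [b] f) \<xi> + - (\<i> * (\<xi> \<bullet> b)) * fourier f \<xi>"
    unfolding fourier_def
    by (subst Bochner_Integration.integral_add)
       (use integrable_fourier[OF f] integrable_fourier[OF test_functions_partials[OF f, of
           "[b]"]] b in auto)
  finally show ?thesis by (simp add: algebra_simps)
qed

lemma fourier_partials_replicate:
  assumes f: "f \<in> test_functions S" and b: "b \<in> Basis"
  shows "fourier (partials (replicate k b) f) \<xi> = (\<i> * (\<xi> \<bullet> b)) ^ k * fourier f \<xi>"
proof (induction k)
  case (Suc k)
  have "partials (replicate (Suc k) b) f = partials [b] (partials (replicate k b) f)" by simp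
  then show ?case
    using fourier_partial[OF test_functions_partials[OF f] b, of "replicate k b" \<xi>] Suc b
      in_lists_conv_set[of "replicate k b" Basis] by (simp add: mult.assoc)
qed simp

lemma fourier_le:
  assumes "f \<in> test_functions K" "compact K"
  shows "cmod (fourier f \<xi>) \<le> measure lborel K * Ck_norm K j f"
proof -
  have "cmod (fourier f \<xi>) \<le> (LINT x|lborel. cmod (cis (- (x \<bullet> \<xi>)) * f x))"
    unfolding fourier_def by (rule integral_norm_bound)
  also have "\<dots> = (LINT x|lborel. cmod (f x))" by (simp add: norm_mult)
  also have "\<dots> \<le> measure lborel K * Ck_norm K j f" by (rule integral_test_le[OF assms])
  finally show ?thesis .
qed

section \<open>The weight \<open>japanese\<close> and rapid decay\<close>

lemma japanese_ge_1: "1 \<le> japanese \<xi>" by (simp add: japanese_def)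
lemma japanese_pos: "0 < japanese \<xi>" using japanese_ge_1[of \<xi>] by linarith
lemma japanese_nonneg [simp]: "0 \<le> japanese \<xi>" using japanese_ge_1[of \<xi>] by linarith
lemma japanese_minus [simp]: "japanese (- \<xi>) = japanese \<xi>" by (simp add: japanese_def)
lemma continuous_japanese: "continuous_on S japanese"
  unfolding japanese_def[abs_def] by (intro continuous_intros)
lemma measurable_japanese [measurable]: "japanese \<in> borel_measurable borel"
  by (rule borel_measurable_continuous_onI[OF continuous_japanese])

lemma japanese_powr_le: "r \<le> real k \<Longrightarrow> japanese \<xi> powr r \<le> japanese \<xi> ^ k"
  using powr_mono[OF _ japanese_ge_1, of r "real k" \<xi>] japanese_pos[of \<xi>] by (simp add: powr_realpow)

text \<open>Pure powers of the coordinates dominate the weight, so decay needs only repeated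
  derivatives in one direction at a time and no mixed ones.\<close>

lemma japanese_power_le:
  "japanese (\<xi>::'a::euclidean_space) ^ k \<le> (real DIM('a) + 1) ^ k * (1 + (\<Sum>b\<in>Basis. \<bar>\<xi> \<bullet> b\<bar> ^ k))"
proof -
  \<comment> \<open>The sum \<open>1 + (\<Sum>b\<in>Basis. \<bar>\<xi> \<bullet> b\<bar>)\<close>
    has \<open>DIM('a) + 1\<close> terms, all in \<open>A\<close>; this is the origin of the
    constant.\<close>
  define A where "A = insert 1 ((\<lambda>b. \<bar>\<xi> \<bullet> b\<bar>) ` Basis)"
  define M where "M = Max A"
  have A: "finite A" "A \<noteq> {}" by (auto simp: A_def)
  have M: "a \<le> M" if "a \<in> A" for a using that A by (simp add: M_def)
  have "japanese \<xi> \<le> 1 + norm \<xi>"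
    unfolding japanese_def by (rule real_le_lsqrt) (auto simp: power2_sum)
  also have "\<dots> \<le> 1 + (\<Sum>b\<in>Basis. \<bar>\<xi> \<bullet> b\<bar>)" using norm_le_l1[of \<xi>] by simp
  also have "\<dots> \<le> M + (\<Sum>b\<in>(Basis::'a set). M)"
    by (intro add_mono sum_mono M) (auto simp: A_def)
  also have "\<dots> = (real DIM('a) + 1) * M" by (simp add: algebra_simps)
  finally have "japanese \<xi> ^ k \<le> (real DIM('a) + 1) ^ k * M ^ k"
    by (metis japanese_nonneg power_mono power_mult_distrib)
  also have "M ^ k \<le> 1 + (\<Sum>b\<in>Basis. \<bar>\<xi> \<bullet> b\<bar> ^ k)"
  proof -
    have "M \<in> A" using A by (simp add: M_def)
    then consider "M = 1" | b where "b \<in> Basis" "M = \<bar>\<xi> \<bullet> b\<bar>" by (auto simp: A_def)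
    then show ?thesis
    proof cases
      case 2
      then have "M ^ k \<le> (\<Sum>b\<in>Basis. \<bar>\<xi> \<bullet> b\<bar> ^ k)" by (auto intro: member_le_sum)
      then show ?thesis by simp
    qed (simp add: sum_nonneg)
  qed
  finally show ?thesis by (simp add: mult_left_mono)
qed

text \<open>The constant depends on \<open>K\<close> and \<open>k\<close> only. This uniformity in
  \<open>f\<close> is what allows the estimate to be applied along nets.\<close>

lemma fourier_decay:
  fixes K :: "'a::euclidean_space set"
  assumes "compact K"
  shows "\<exists>C\<ge>0. \<forall>f\<in>test_functions K. \<forall>\<xi>. japanese \<xi> ^ k * cmod (fourier f \<xi>) \<le> C * Ck_norm K k f"
proof (intro exI conjI ballI allI)
  let ?N = "real DIM('a) + 1" and ?V = "measure lborel K"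
  fix f :: "'a \<Rightarrow> complex" and \<xi> assume f: "f \<in> test_functions K"
  have *: "\<bar>\<xi> \<bullet> b\<bar> ^ k * cmod (fourier f \<xi>) \<le> ?V * Ck_norm K k f" if "b \<in> Basis" for b
  proof -
    have r: "replicate k b \<in> lists Basis" using that by auto
    have "\<bar>\<xi> \<bullet> b\<bar> ^ k * cmod (fourier f \<xi>) = cmod (fourier (partials (replicate k b) f) \<xi>)"
      using that by (simp add: fourier_partials_replicate[OF f] norm_mult norm_power)
    also have "\<dots> \<le> (LINT x|lborel. cmod (cis (- (x \<bullet> \<xi>)) * partials (replicate k b) f x))"
      unfolding fourier_def by (rule integral_norm_bound)
    also have "\<dots> = (LINT x|lborel. cmod (partials (replicate k b) f x))" by (simp add: norm_mult)
    also have "\<dots> \<le> ?V * Ck_norm K 0 (partials (replicate k b) f)"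
      by (rule integral_test_le[OF test_functions_partials[OF f r] assms])
    also have "\<dots> \<le> ?V * Ck_norm K k f"
      using test_partials_le[OF f assms r, of k]
      by (intro mult_left_mono Ck_norm_le) (auto simp: test_Ck_norm_nonneg[OF f assms])
    finally show ?thesis .
  qed
  have "japanese \<xi> ^ k * cmod (fourier f \<xi>) \<le> ?N ^ k * (1 + (\<Sum>b\<in>Basis. \<bar>\<xi> \<bullet> b\<bar> ^ k)) * cmod (fourier f \<xi>)"
    by (intro mult_right_mono japanese_power_le) auto
  also have "\<dots> = ?N ^ k * (cmod (fourier f \<xi>) + (\<Sum>b\<in>Basis. \<bar>\<xi> \<bullet> b\<bar> ^ k * cmod (fourier f \<xi>)))"
    by (simp add: algebra_simps sum_distrib_left)
  also have "\<dots> \<le> ?N ^ k * (?V * Ck_norm K k f + (\<Sum>b\<in>(Basis::'a set). ?V * Ck_norm K k f))"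
    by (intro mult_left_mono add_mono sum_mono * fourier_le[OF f assms]) auto
  also have "\<dots> = ?N ^ k * ?N * ?V * Ck_norm K k f" by (simp add: algebra_simps)
  finally show "japanese \<xi> ^ k * cmod (fourier f \<xi>) \<le> ?N ^ k * ?N * ?V * Ck_norm K k f" .
qed auto

text \<open>The exponent \<open>2 * DIM('a)\<close> comes from comparison with a product: each
  factor \<open>1 + (\<xi> \<bullet> b)\<^sup>2\<close> is at most the square of the weight, and the
  product of the reciprocals is integrable coordinate by coordinate.\<close>

lemma integrable_japanese: "integrable lborel (\<lambda>\<xi>::'a::euclidean_space. 1 / japanese \<xi> ^ (2 * DIM('a)))"
proof -
  let ?g = "\<lambda>t::real. 1 / (1 + t\<^sup>2)"
  have "set_integrable lborel {0<..} ?g"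
    using integrable_I0i_1_div_plus_square unfolding interval_lebesgue_integrable_def
    by (simp add: zero_ereal_def)
  then have i: "integrable lborel (\<lambda>t. indicator {0<..} t *\<^sub>R ?g t)" by (simp add: set_integrable_def)
  \<comment> \<open>The half line and its reflection cover everything except the null set
    \<open>{0}\<close>.\<close>
  then have "integrable lborel (\<lambda>t. indicator {0<..} (- t) *\<^sub>R ?g (- t))"
    by (subst lborel_integral_reflect(2)[of "\<lambda>t. indicator {0<..} t *\<^sub>R ?g t"])
  with i have "integrable lborel (\<lambda>t. indicator {0<..} t *\<^sub>R ?g t + indicator {0<..} (- t) *\<^sub>R ?g (- t))"
    by (rule Bochner_Integration.integrable_add)
  then have g: "integrable lborel ?g"
  proof (rule integrable_cong_AE_imp)
    show "AE t in lborel. indicator {0<..} t *\<^sub>R ?g t + indicator {0<..} (- t) *\<^sub>R ?g (- t) = ?g t"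
      using AE_lborel_singleton[of "0::real"] by eventually_elim (auto simp: indicator_def)
  qed measurable
  have "1 / japanese \<xi> ^ (2 * DIM('a)) \<le> (\<Prod>b\<in>Basis. ?g (\<xi> \<bullet> b))" for \<xi> :: 'a
  proof -
    have "(\<Prod>b\<in>(Basis::'a set). 1 + (\<xi> \<bullet> b)\<^sup>2) \<le> (\<Prod>b\<in>(Basis::'a set). (japanese \<xi>)\<^sup>2)"
    proof (rule prod_mono)
      fix b :: 'a assume "b \<in> Basis"
      then have "\<bar>\<xi> \<bullet> b\<bar> ^ 2 \<le> (norm \<xi>)\<^sup>2" by (intro power_mono Basis_le_norm) auto
      then show "0 \<le> 1 + (\<xi> \<bullet> b)\<^sup>2 \<and> 1 + (\<xi> \<bullet> b)\<^sup>2 \<le> (japanese \<xi>)\<^sup>2" by (auto simp: japanese_def)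
    qed
    also have "\<dots> = japanese \<xi> ^ (2 * DIM('a))" by (simp add: power_mult)
    finally have "1 / japanese \<xi> ^ (2 * DIM('a)) \<le> 1 / (\<Prod>b\<in>Basis. 1 + (\<xi> \<bullet> b)\<^sup>2)"
      by (intro divide_left_mono mult_pos_pos prod_pos) (auto intro!: add_pos_nonneg zero_less_power
          japanese_pos)
    then show ?thesis by (simp add: prod_dividef)
  qed
  then have "norm (1 / japanese \<xi> ^ (2 * DIM('a))) \<le> (\<Prod>b\<in>Basis. ?g (\<xi> \<bullet> b))" for \<xi> :: 'a
    by (simp only: real_norm_def abs_of_nonneg zero_le_divide_1_iff zero_le_power japanese_nonneg)
  moreover have "(\<lambda>\<xi>::'a. 1 / japanese \<xi> ^ (2 * DIM('a))) \<in> borel_measurable lborel" by measurable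
  ultimately show ?thesis
    by (intro integrable_norm_bound[OF integrable_lborel_prod[of "\<lambda>_. ?g", OF g]])
qed

lemma integrable_rapid_decay:
  fixes f :: "'a::euclidean_space \<Rightarrow> complex"
  assumes f: "f \<in> borel_measurable borel"
    and k: "k \<ge> 2 * DIM('a)" "\<And>\<xi>. japanese \<xi> ^ k * cmod (f \<xi>) \<le> C"
  shows "integrable lborel f" "cmod (LINT \<xi>|lborel. f \<xi>)
      \<le> C * (LINT \<xi>|lborel. 1 / japanese (\<xi>::'a) ^ (2 * DIM('a)))"
proof -
  have le: "cmod (f \<xi>) \<le> C * (1 / japanese \<xi> ^ (2 * DIM('a)))" for \<xi>
  proof -
    have "japanese \<xi> ^ (2 * DIM('a)) * cmod (f \<xi>) \<le> japanese \<xi> ^ k * cmod (f \<xi>)"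
      using k(1) japanese_ge_1 by (intro mult_right_mono power_increasing) auto
    also have "\<dots> \<le> C" by (rule k)
    finally show ?thesis using japanese_pos[of \<xi>] by (simp add: field_simps)
  qed
  have C: "integrable lborel (\<lambda>\<xi>::'a. C * (1 / japanese \<xi> ^ (2 * DIM('a))))"
    by (intro integrable_mult_right integrable_japanese)
  show i: "integrable lborel f" by (rule integrable_norm_bound[OF C]) (use f le in auto)
  have "cmod (LINT \<xi>|lborel. f \<xi>) \<le> (LINT \<xi>|lborel. cmod (f \<xi>))" by (rule integral_norm_bound)
  also have "\<dots> \<le> (LINT \<xi>|lborel. C * (1 / japanese (\<xi>::'a) ^ (2 * DIM('a))))"
    by (intro integral_mono integrable_norm i C le)
  finally show "cmod (LINT \<xi>|lborel. f \<xi>) \<le> C * (LINT \<xi>|lborel. 1 / japanese (\<xi>::'a) ^ (2 * DIM('a)))"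
    by (simp only: integral_mult_right_zero)
qed

text \<open>Differentiation under the integral with the remainder bound \<open>t\<^sup>2 / 2\<close>
  for \<open>cis t - 1 - \<i> * t\<close>; the second moment of \<open>f\<close> is finite by
  compact support. The derivative is written through transforms of test functions again, which makes
  the transforms a family closed under differentiation.\<close>

lemma has_derivative_fourier:
  fixes f :: "'a::euclidean_space \<Rightarrow> complex"
  assumes f: "f \<in> test_functions S"
  shows "(fourier f has_derivative
    (\<lambda>h. \<Sum>b\<in>Basis. (h \<bullet> b) *\<^sub>R fourier (\<lambda>x. (- (\<i> * (x \<bullet> b))) * f x) \<xi>)) (at \<xi>)"
proof (rule has_derivativeI_sandwich[OF zero_less_one])
  define C where "C = (LINT x|lborel. (norm x)\<^sup>2 / 2 * cmod (f x))"
  have "continuous_on UNIV (\<lambda>x. cis (- (x \<bullet> \<xi>)) * (- (\<i> * (x \<bullet> b))))" for b \<xi> :: 'a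
    by (intro continuous_intros smooth_on_continuous[OF smooth_cis])
  then have int: "integrable lborel (\<lambda>x. cis (- (x \<bullet> \<xi>)) * ((- (\<i> * (x \<bullet> b))) * f x))" for b \<xi>
    using integrable_test_mult[OF f, of "\<lambda>x. cis (- (x \<bullet> \<xi>)) * (- (\<i> * (x \<bullet> b)))"]
    by (simp only: mult.assoc)
  have intC: "integrable lborel (\<lambda>x. (norm x)\<^sup>2 / 2 * cmod (f x))"
  proof -
    have "integrable lborel (\<lambda>x. complex_of_real ((norm x)\<^sup>2 / 2) * f x)"
      by (intro integrable_test_mult[OF f] continuous_intros) auto
    then have "integrable lborel (\<lambda>x. cmod (complex_of_real ((norm x)\<^sup>2 / 2) * f x))"
      by (rule integrable_norm)
    then show ?thesis by (simp add: norm_mult norm_divide norm_power)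
  qed
  fix \<eta> assume "\<eta> \<noteq> \<xi>"
  let ?h = "\<eta> - \<xi>"
  have E: "(\<Sum>b\<in>Basis. (?h \<bullet> b) *\<^sub>R fourier (\<lambda>x. (- (\<i> * (x \<bullet> b))) * f x) \<xi>)
     = (LINT x|lborel. cis (- (x \<bullet> \<xi>)) * ((- (\<i> * (x \<bullet> ?h))) * f x))" (is "?L = _")
  proof -
    have "?L = (LINT x|lborel. (\<Sum>b\<in>Basis. (?h \<bullet> b) *\<^sub>R (cis (- (x \<bullet> \<xi>)) * ((- (\<i> * (x \<bullet> b))) * f x))))"
      unfolding fourier_def using int by (subst Bochner_Integration.integral_sum) auto
    also have "(\<lambda>x. (\<Sum>b\<in>Basis. (?h \<bullet> b) *\<^sub>R (cis (- (x \<bullet> \<xi>)) * ((- (\<i> * (x \<bullet> b))) * f x))))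
        = (\<lambda>x. cis (- (x \<bullet> \<xi>)) * ((- (\<i> * (x \<bullet> ?h))) * f x))"
    proof
      fix x
      have "complex_of_real (x \<bullet> ?h) = (\<Sum>b\<in>Basis. of_real ((?h \<bullet> b) * (x \<bullet> b)))"
        by (subst euclidean_inner[of x ?h]) (simp add: mult.commute)
      then show "(\<Sum>b\<in>Basis. (?h \<bullet> b) *\<^sub>R (cis (- (x \<bullet> \<xi>)) * ((- (\<i> * (x \<bullet> b))) * f x)))
          = cis (- (x \<bullet> \<xi>)) * ((- (\<i> * (x \<bullet> ?h))) * f x)"
        by (simp add: sum_distrib_left sum_distrib_right scaleR_conv_of_real sum_negf[symmetric] mult_ac)
    qed
    finally show ?thesis .
  qed
  have "cmod (fourier f \<eta> - fourier f \<xi> - ?L) = cmod (LINT x|lborel.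
      cis (- (x \<bullet> \<eta>)) * f x - cis (- (x \<bullet> \<xi>)) * f x - cis (- (x \<bullet> \<xi>)) * ((- (\<i> * (x \<bullet> ?h))) * f x))"
  proof -
    have "integrable lborel (\<lambda>x. cis (- (x \<bullet> \<xi>)) * ((- (\<i> * (x \<bullet> ?h))) * f x))"
      using int[of \<xi> ?h] .
    then show ?thesis
      unfolding E unfolding fourier_def using integrable_fourier[OF f] by simp
  qed
  also have "\<dots> \<le> (LINT x|lborel. (norm ?h)\<^sup>2 * ((norm x)\<^sup>2 / 2 * cmod (f x)))"
  proof (rule order_trans[OF integral_norm_bound], rule integral_mono)
    show "cmod (cis (- (x \<bullet> \<eta>)) * f x - cis (- (x \<bullet> \<xi>)) * f x - cis (- (x \<bullet> \<xi>)) * ((- (\<i> * (x \<bullet> ?h))) * f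
        x))
      \<le> (norm ?h)\<^sup>2 * ((norm x)\<^sup>2 / 2 * cmod (f x))" for x
    proof -
      let ?t = "- (x \<bullet> ?h)"
      have "cis (- (x \<bullet> \<eta>)) = cis (- (x \<bullet> \<xi>)) * cis ?t"
        by (simp add: cis_mult inner_diff_right)
      then have eq: "cis (- (x \<bullet> \<eta>)) * f x - cis (- (x \<bullet> \<xi>)) * f x - cis (- (x \<bullet> \<xi>)) * ((- (\<i> * (x \<bullet> ?h))) *
          f x)
        = cis (- (x \<bullet> \<xi>)) * ((cis ?t - 1 - \<i> * ?t) * f x)"
        by (simp add: algebra_simps)
      have "cmod (cis ?t - 1 - \<i> * ?t) \<le> ?t\<^sup>2 / 2"
        using iexp_approx1[of ?t 1] by (simp add: cis_conv_exp power2_eq_square algebra_simps)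
      also have "\<dots> \<le> (norm x * norm ?h)\<^sup>2 / 2"
        using Cauchy_Schwarz_ineq2[of x ?h] by (auto simp: abs_le_square_iff[symmetric])
      finally have "cmod (cis ?t - 1 - \<i> * ?t) \<le> (norm ?h)\<^sup>2 * ((norm x)\<^sup>2 / 2)"
        by (simp add: power_mult_distrib mult.commute)
      then have "cmod (cis ?t - 1 - \<i> * ?t) * cmod (f x) \<le> (norm ?h)\<^sup>2 * ((norm x)\<^sup>2 / 2) * cmod (f x)"
        by (rule mult_right_mono) simp
      then show ?thesis unfolding eq by (simp add: norm_mult mult.assoc)
    qed
  qed (use integrable_mult_right[OF intC, of "(norm ?h)\<^sup>2"] int[of \<xi> ?h] integrable_fourier[OF f] in \<open>auto
      intro!: integrable_norm Bochner_Integration.integrable_diff\<close>)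
  also have "\<dots> = (norm ?h)\<^sup>2 * C" unfolding C_def by (rule integral_mult_right_zero)
  finally show "cmod (fourier f \<eta> - fourier f \<xi> - ?L) / norm ?h \<le> C * norm ?h"
    using \<open>\<eta> \<noteq> \<xi>\<close> by (simp add: field_simps power2_eq_square)
next
  show "bounded_linear (\<lambda>h. \<Sum>b\<in>Basis. (h \<bullet> b) *\<^sub>R fourier (\<lambda>x. (- (\<i> * (x \<bullet> b))) * f x) \<xi>)"
    by (intro bounded_linear_sum bounded_linear_compose[OF bounded_linear_scaleR_left]
        bounded_linear_inner_left)
next
  have "((\<lambda>\<eta>. C * norm (\<eta> - \<xi>)) \<longlongrightarrow> C * norm (\<xi> - \<xi>)) (at \<xi>)" for C by (intro tendsto_intros)
  from this[of "LINT x|lborel. (norm x)\<^sup>2 / 2 * cmod (f x)"] show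
      "((\<lambda>\<eta>. (LINT x|lborel. (norm x)\<^sup>2 / 2 * cmod (f x)) * norm (\<eta> - \<xi>)) \<longlongrightarrow> 0) (at \<xi>)" by simp
qed

lemma continuous_fourier: "f \<in> test_functions S \<Longrightarrow> continuous_on UNIV (fourier f)"
  using has_derivative_fourier by (blast intro: has_derivative_continuous continuous_at_imp_continuous_on)

lemma measurable_fourier: "f \<in> test_functions S \<Longrightarrow> fourier f \<in> borel_measurable borel"
  by (rule borel_measurable_continuous_onI[OF continuous_fourier])

section \<open>Transforms of test functions as Schwartz functions\<close>

lemma schwartzI:
  assumes "f \<in> smooth_on UNIV"
    and "\<And>\<alpha> j. \<alpha> \<in> lists Basis \<Longrightarrow> \<exists>C. \<forall>x. japanese x ^ j * cmod (partials \<alpha> f x) \<le> C"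
  shows "(f :: 'a::euclidean_space \<Rightarrow> complex) \<in> schwartz"
  unfolding schwartz_def
proof (intro CollectI conjI allI assms(1))
  fix j
  have "finite {\<alpha>. set \<alpha> \<subseteq> (Basis::'a set) \<and> length \<alpha> \<le> j}"
    by (rule finite_lists_length_le) simp
  moreover have "bdd_above (range (\<lambda>x. japanese x ^ j * cmod (partials \<alpha> f x)))" if "\<alpha> \<in> lists Basis" for \<alpha>
    using assms(2)[OF that, of j] by (auto intro: bdd_aboveI)
  ultimately have "bdd_above (\<Union>\<alpha>\<in>{\<alpha>. set \<alpha> \<subseteq> (Basis::'a set) \<and> length \<alpha> \<le> j}.
      range (\<lambda>x. japanese x ^ j * cmod (partials \<alpha> f x)))"
    by (subst bdd_above_UN) (simp_all add: in_lists_conv_set subset_iff)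
  then show "bdd_above {japanese x ^ j * cmod (partials \<alpha> f x) | x \<alpha>. \<alpha> \<in> lists Basis \<and> length \<alpha> \<le> j}"
    by (rule bdd_above_mono) auto
qed

lemma test_functions_schwartz:
  assumes f: "f \<in> test_functions S"
  shows "f \<in> schwartz"
proof (rule schwartzI[OF test_functions_smooth[OF f]])
  fix \<alpha> :: "'a list" and j assume \<alpha>: "\<alpha> \<in> lists Basis"
  obtain K where K: "compact K" "f \<in> test_functions K" by (rule test_functionsE[OF f])
  have "continuous_on K (\<lambda>x. japanese x ^ j * cmod (partials \<alpha> f x))"
    using continuous_partials[OF test_functions_smooth[OF f] \<alpha>]
    by (intro continuous_intros continuous_japanese) (auto elim: continuous_on_subset)
  then have "bounded ((\<lambda>x. japanese x ^ j * cmod (partials \<alpha> f x)) ` K)"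
    using K by (intro compact_imp_bounded compact_continuous_image)
  then obtain C where C: "\<And>x. x \<in> K \<Longrightarrow> \<bar>japanese x ^ j * cmod (partials \<alpha> f x)\<bar> \<le> C"
    by (auto simp: bounded_iff)
  have "japanese x ^ j * cmod (partials \<alpha> f x) \<le> \<bar>C\<bar>" for x
  proof (cases "x \<in> K")
    case True
    then show ?thesis using C[of x] by linarith
  next
    case False
    then show ?thesis using test_functions_vanish[OF test_functions_partials[OF K(2) \<alpha>] False] by simp
  qed
  then show "\<exists>C. \<forall>x. japanese x ^ j * cmod (partials \<alpha> f x) \<le> C" by blast
qed

text \<open>Derivatives of reflected transforms are reflected transforms of test functions
  \<open>\<i> * (x \<bullet> b) * w x\<close>, and all of these decay rapidly. The reflection is the
  one in the inversion formula.\<close>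

lemma fourier_reflected_schwartz:
  fixes f :: "'a::euclidean_space \<Rightarrow> complex"
  assumes f: "f \<in> test_functions S"
  shows "(\<lambda>\<xi>. fourier f (- \<xi>)) \<in> schwartz"
proof -
  obtain K where K: "compact K" "f \<in> test_functions K" by (rule test_functionsE[OF f])
  define \<F> where "\<F> = (\<lambda>w \<xi>. fourier w (- \<xi>)) ` test_functions K"
  have D: "\<exists>D. (\<forall>x. (g has_derivative D x) (at x)) \<and> (\<forall>b\<in>Basis. (\<lambda>x. D x b) \<in> \<F>)" if g: "g \<in> \<F>" for g
  proof -
    obtain w where w: "w \<in> test_functions K" "g = (\<lambda>\<xi>. fourier w (- \<xi>))" using g unfolding \<F>_def by blast
    define D where "D \<xi> h = (\<Sum>b\<in>Basis. ((- h) \<bullet> b) *\<^sub>R fourier (\<lambda>x. (- (\<i> * (x \<bullet> b))) * w x) (- \<xi>))"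
        for \<xi> h :: 'a
    have "(g has_derivative D \<xi>) (at \<xi>)" for \<xi>
      unfolding w(2) D_def
      by (rule has_derivative_compose[where f = uminus and g =
          "fourier w", OF _ has_derivative_fourier[OF w(1)]])
         (auto intro!: derivative_eq_intros)
    moreover have "(\<lambda>\<xi>. D \<xi> b) \<in> \<F>" if b: "b \<in> Basis" for b
    proof -
      have "D \<xi> b = fourier (\<lambda>x. (- 1) * ((- (\<i> * (x \<bullet> b))) * w x)) (- \<xi>)" for \<xi>
      proof -
        have "D \<xi> b = (\<Sum>c\<in>Basis. if b = c then - fourier (\<lambda>x. (- (\<i> * (x \<bullet> c))) * w x) (- \<xi>) else 0)"
          unfolding D_def using b by (intro sum.cong) (auto simp: inner_Basis)
        also have "\<dots> = - fourier (\<lambda>x. (- (\<i> * (x \<bullet> b))) * w x) (- \<xi>)" using b by simp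
        also have "\<dots> = fourier (\<lambda>x. (- 1) * ((- (\<i> * (x \<bullet> b))) * w x)) (- \<xi>)"
          by (simp add: fourier_def)
        finally show ?thesis .
      qed
      moreover have "(\<lambda>x. (- \<i>) * (of_real (x \<bullet> b))) \<in> smooth_on UNIV"
        by (intro elementary_smooth elementary.intros)
      then have "(\<lambda>x. (- 1) * ((- (\<i> * (x \<bullet> b))) * w x)) \<in> test_functions K"
        using test_functions_cmult[OF test_functions_mult[OF w(1)], of "\<lambda>x. (- \<i>) * (of_real (x \<bullet> b))" "-1"]
            by simp
      ultimately show ?thesis unfolding \<F>_def by (intro image_eqI) auto
    qed
    ultimately show ?thesis by blast
  qed
  have f\<F>: "(\<lambda>\<xi>. fourier f (- \<xi>)) \<in> \<F>" using K by (auto simp: \<F>_def)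
  show ?thesis
  proof (rule schwartzI)
    show "(\<lambda>\<xi>. fourier f (- \<xi>)) \<in> smooth_on UNIV" by (rule smooth_on_family[OF f\<F> D])
    fix \<alpha> :: "'a list" and j assume "\<alpha> \<in> lists Basis"
    from partials_in_family[OF f\<F> D this] obtain w where
      w: "w \<in> test_functions K" "partials \<alpha> (\<lambda>\<xi>. fourier f (- \<xi>)) = (\<lambda>\<xi>. fourier w (- \<xi>))"
      by (auto simp: \<F>_def)
    obtain C where "\<forall>\<xi>. japanese \<xi> ^ j * cmod (fourier w \<xi>) \<le> C * Ck_norm K j w"
      using fourier_decay[OF K(1), of j] w(1) by blast
    then have "\<forall>x. japanese x ^ j * cmod (partials \<alpha> (\<lambda>\<xi>. fourier f (- \<xi>)) x) \<le> C * Ck_norm K j w"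
      unfolding w(2) by (metis japanese_minus)
    then show "\<exists>C. \<forall>x. japanese x ^ j * cmod (partials \<alpha> (\<lambda>\<xi>. fourier f (- \<xi>)) x) \<le> C" by blast
  qed
qed

lemma integrable_fourier_test:
  assumes "f \<in> test_functions S"
  shows "integrable lborel (fourier (f :: 'a::euclidean_space \<Rightarrow> complex))"
proof -
  obtain K where K: "compact K" "f \<in> test_functions K" by (rule test_functionsE[OF assms])
  then obtain C where "\<forall>\<xi>. japanese \<xi> ^ (2 * DIM('a)) * cmod (fourier f \<xi>) \<le> C * Ck_norm K (2 * DIM('a)) f"
    using fourier_decay[OF K(1), of "2 * DIM('a)"] by blast
  then show ?thesis by (intro integrable_rapid_decay(1)[OF measurable_fourier[OF assms]]) auto
qed

section \<open>Fourier inversion\<close>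

definition gauss :: "'a::euclidean_space \<Rightarrow> real" where
  "gauss x = exp (- (norm x)\<^sup>2 / 2)"

lemma gauss_prod: "gauss x = (\<Prod>b\<in>Basis. exp (- (x \<bullet> b)\<^sup>2 / 2))"
proof -
  have "(norm x)\<^sup>2 = (\<Sum>b\<in>Basis. (x \<bullet> b)\<^sup>2)"
    unfolding power2_norm_eq_inner by (subst euclidean_inner) (simp add: power2_eq_square)
  then show ?thesis by (simp add: gauss_def exp_sum[symmetric] sum_negf sum_divide_distrib)
qed

lemma measurable_gauss [measurable]: "gauss \<in> borel_measurable borel"
  unfolding gauss_def[abs_def] by measurable

text \<open>Up to normalization this is the characteristic function of the standard normal
  distribution.\<close>

lemma gauss_1:
  shows "integrable lborel (\<lambda>t. cis (t * y) * exp (- t\<^sup>2 / 2))"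
    and "(LINT t|lborel. cis (t * y) * exp (- t\<^sup>2 / 2)) = sqrt (2 * pi) * exp (- y\<^sup>2 / 2)"
proof -
  have e: "exp (- t\<^sup>2 / 2) = sqrt (2 * pi) * std_normal_density t" for t
    by (simp add: std_normal_density_def)
  have "(LINT t|lborel. std_normal_density t *\<^sub>R cis (t * y))
      = (LINT t|std_normal_distribution. cis (t * y))"
    by (subst integral_density) (auto simp: cis_conv_exp)
  also have "\<dots> = exp (- y\<^sup>2 / 2)"
    using fun_cong[OF char_std_normal_distribution, of y] by (simp add: char_def cis_conv_exp mult_ac)
  finally have "(LINT t|lborel. std_normal_density t *\<^sub>R cis (t * y)) = exp (- y\<^sup>2 / 2)" .
  moreover have "(\<lambda>t. cis (t * y) * exp (- t\<^sup>2 / 2))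
      = (\<lambda>t. complex_of_real (sqrt (2 * pi)) * (std_normal_density t *\<^sub>R cis (t * y)))"
    by (rule ext) (simp only: e of_real_mult scaleR_conv_of_real mult_ac)
  ultimately show "(LINT t|lborel. cis (t * y) * exp (- t\<^sup>2 / 2)) = sqrt (2 * pi) * exp (- y\<^sup>2 / 2)"
    by (simp only: integral_mult_right_zero of_real_mult)
  have "integrable lborel (\<lambda>t. sqrt (2 * pi) * std_normal_density t)"
    by (intro integrable_mult_right integrable_normal_density) simp
  then show "integrable lborel (\<lambda>t. cis (t * y) * exp (- t\<^sup>2 / 2))"
    proof (rule integrable_norm_bound)
    show "cmod (cis (t * y) * exp (- t\<^sup>2 / 2)) \<le> sqrt (2 * pi) * std_normal_density t" for t
      unfolding e[symmetric] by (simp add: norm_mult)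
  qed (auto simp: cis_conv_exp)
qed

lemma
  fixes \<xi> :: "'a::euclidean_space"
  shows integrable_gauss: "integrable lborel (\<lambda>x. cis (x \<bullet> \<xi>) * gauss x)"
    and fourier_gauss: "(LINT x|lborel. cis (x \<bullet> \<xi>) * gauss x) = sqrt (2 * pi) ^ DIM('a) * gauss \<xi>"
proof -
  let ?g = "\<lambda>b t. cis (t * (\<xi> \<bullet> b)) * exp (- t\<^sup>2 / 2)"
  have eq: "(\<lambda>x. cis (x \<bullet> \<xi>) * gauss x) = (\<lambda>x. \<Prod>b\<in>Basis. ?g b (x \<bullet> b))"
  proof
    fix x
    have "cis (x \<bullet> \<xi>) = (\<Prod>b\<in>Basis. cis ((x \<bullet> b) * (\<xi> \<bullet> b)))"
      by (subst euclidean_inner[of x \<xi>]) (simp add: cis_conv_exp exp_sum[symmetric] sum_distrib_left)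
    then show "cis (x \<bullet> \<xi>) * gauss x = (\<Prod>b\<in>Basis. ?g b (x \<bullet> b))"
      by (simp add: gauss_prod prod.distrib)
  qed
  show "integrable lborel (\<lambda>x. cis (x \<bullet> \<xi>) * gauss x)"
    unfolding eq by (rule integrable_lborel_prod) (rule gauss_1)
  have "(LINT x|lborel. cis (x \<bullet> \<xi>) * gauss x) = (\<Prod>b\<in>(Basis::'a set). complex_of_real (sqrt (2 * pi) * exp
      (- (\<xi> \<bullet> b)\<^sup>2 / 2)))"
    unfolding eq by (subst integral_lborel_prod[OF gauss_1(1)]) (simp only: gauss_1(2) of_real_mult)
  also have "\<dots> = sqrt (2 * pi) ^ DIM('a) * gauss \<xi>"
    by (simp add: prod.distrib gauss_prod)
  finally show "(LINT x|lborel. cis (x \<bullet> \<xi>) * gauss x) = sqrt (2 * pi) ^ DIM('a) * gauss \<xi>" .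
qed

lemma integrable_gauss_real: "integrable lborel (gauss :: 'a::euclidean_space \<Rightarrow> real)"
  using integrable_norm[OF integrable_gauss[of "0::'a"]]
      by (simp add: gauss_def[abs_def] norm_mult abs_of_nonneg)

lemma integrable_gauss_scaled:
  assumes "h \<noteq> 0"
  shows "integrable lborel (\<lambda>x::'a::euclidean_space. complex_of_real (gauss (h *\<^sub>R x)))"
proof -
  have "integrable lborel (\<lambda>x::'a. complex_of_real (gauss x))"
    using integrable_gauss_real by (rule integrable_of_real)
  then have "integrable (density (distr lborel borel (\<lambda>x. 0 + h *\<^sub>R x)) (\<lambda>_. ennreal (\<bar>h\<bar> ^ DIM('a))))
      (\<lambda>x::'a. complex_of_real (gauss x))"
    using lborel_affine[OF assms, of "0::'a"] by simp
  then have "integrable (distr lborel borel (\<lambda>x. 0 + h *\<^sub>R x)) (\<lambda>x::'a. \<bar>h\<bar> ^ DIM('a) *\<^sub>R complex_of_real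
      (gauss x))"
    by (subst (asm) integrable_density) auto
  then have "integrable lborel (\<lambda>x::'a. \<bar>h\<bar> ^ DIM('a) *\<^sub>R complex_of_real (gauss (0 + h *\<^sub>R x)))"
    by (subst (asm) integrable_distr_eq) auto
  from integrable_scaleR_right[OF this, of "1 / \<bar>h\<bar> ^ DIM('a)"] show ?thesis using assms by simp
qed

text \<open>The scaling exchanges a wide Gaussian in \<xi> for a narrow one in \<open>z\<close>; the
  factor \<open>h ^ DIM('a)\<close> is the Jacobian.\<close>

lemma fourier_gauss_scaled:
  fixes z :: "'a::euclidean_space"
  assumes "h > 0"
  shows "h ^ DIM('a) * (LINT \<xi>|lborel. cis (z \<bullet> \<xi>) * gauss (h *\<^sub>R \<xi>))
      = sqrt (2 * pi) ^ DIM('a) * gauss (z /\<^sub>R h)"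
proof -
  have "(LINT \<xi>|lborel. cis (\<xi> \<bullet> (z /\<^sub>R h)) * gauss \<xi>)
    = \<bar>h\<bar> ^ DIM('a) *\<^sub>R (LINT \<xi>|lborel. cis ((0 + h *\<^sub>R \<xi>) \<bullet> (z /\<^sub>R h)) * gauss (0 + h *\<^sub>R \<xi>))"
    using assms by (intro lborel_integral_affine borel_measurable_times)
      (auto intro!: borel_measurable_continuous_onI continuous_intros)
  moreover have "(0 + h *\<^sub>R \<xi>) \<bullet> (z /\<^sub>R h) = z \<bullet> \<xi>" for \<xi>
    using assms by (simp add: inner_commute field_simps)
  ultimately show ?thesis using assms fourier_gauss[of "z /\<^sub>R h"]
    by (simp add: scaleR_conv_of_real)
qed

text \<open>The Gaussian factor makes the double integral absolutely convergent, so that the order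
  of integration can be exchanged; without it the integrand has constant modulus in \<xi>.
  Integrating in \<xi> first then leaves an average of \<open>f\<close> near
  \<open>x\<close>.\<close>

lemma fourier_inversion_gauss:
  fixes f :: "'a::euclidean_space \<Rightarrow> complex"
  assumes f: "f \<in> test_functions S" and h: "h > 0"
  shows "(LINT \<xi>|lborel. cis (x \<bullet> \<xi>) * fourier f \<xi> * gauss (h *\<^sub>R \<xi>))
    = sqrt (2 * pi) ^ DIM('a) * (LINT y|lborel. f (x + h *\<^sub>R y) * gauss y)"
proof -
  have "(LINT \<xi>|lborel. cis (x \<bullet> \<xi>) * fourier f \<xi> * gauss (h *\<^sub>R \<xi>))
    = (LINT \<xi>|lborel. (LINT y|lborel. cis ((x - y) \<bullet> \<xi>) * f y * gauss (h *\<^sub>R \<xi>)))"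
  proof (rule Bochner_Integration.integral_cong[OF refl])
    fix \<xi>
    have e: "cis ((x - y) \<bullet> \<xi>) = cis (x \<bullet> \<xi>) * cis (- (y \<bullet> \<xi>))" for y
      by (simp add: cis_mult inner_diff_left)
    have "cis (x \<bullet> \<xi>) * fourier f \<xi> * gauss (h *\<^sub>R \<xi>)
        = (LINT y|lborel. (cis (x \<bullet> \<xi>) * gauss (h *\<^sub>R \<xi>)) * (cis (- (y \<bullet> \<xi>)) * f y))"
      unfolding fourier_def integral_mult_right_zero by (simp only: mult_ac)
    also have "\<dots> = (LINT y|lborel. cis ((x - y) \<bullet> \<xi>) * f y * gauss (h *\<^sub>R \<xi>))"
      by (intro Bochner_Integration.integral_cong refl)
         (use e in \<open>simp add: mult_ac\<close>)
    finally show "cis (x \<bullet> \<xi>) * fourier f \<xi> * gauss (h *\<^sub>R \<xi>)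
        = (LINT y|lborel. cis ((x - y) \<bullet> \<xi>) * f y * gauss (h *\<^sub>R \<xi>))" .
  qed
  also have "\<dots> = (LINT y|lborel. (LINT \<xi>|lborel. cis ((x - y) \<bullet> \<xi>) * f y * gauss (h *\<^sub>R \<xi>)))"
    by (rule fubini_bounded_kernel[OF integrable_test[OF f] integrable_gauss_scaled, where B = 1])
       (use h in \<open>auto simp: case_prod_beta intro!: borel_measurable_continuous_onI continuous_intros\<close>)
  also have "\<dots> = (LINT y|lborel. f y * (LINT \<xi>|lborel. cis ((x - y) \<bullet> \<xi>) * gauss (h *\<^sub>R \<xi>)))"
    by (simp flip: integral_mult_right_zero add: mult_ac)
  \<comment> \<open>Substituting \<open>x + h *\<^sub>R y\<close> for \<open>y\<close> moves the
    scale into the argument of \<open>f\<close>; the Jacobian is the factor expected by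
    \<open>fourier_gauss_scaled\<close>.\<close>
  also have "\<dots> = \<bar>h\<bar> ^ DIM('a) *\<^sub>R (LINT y|lborel. f (x + h *\<^sub>R y) *
      (LINT \<xi>|lborel. cis ((x - (x + h *\<^sub>R y)) \<bullet> \<xi>) * gauss (h *\<^sub>R \<xi>)))"
  proof (rule lborel_integral_affine)
    have "(\<lambda>y. LINT \<xi>|lborel. cis ((x - y) \<bullet> \<xi>) * gauss (h *\<^sub>R \<xi>)) \<in> borel_measurable borel"
    proof -
      have "(\<lambda>p. cis ((x - fst p) \<bullet> snd p)) \<in> borel_measurable (borel \<Otimes>\<^sub>M (borel :: 'a measure))"
        unfolding borel_prod by (intro borel_measurable_continuous_onI continuous_intros)
      then have "(\<lambda>p. cis ((x - fst p) \<bullet> snd p) * gauss (h *\<^sub>R snd p)) \<in> borel_measurable (borel \<Otimes>\<^sub>M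
          lborel)"
        by (intro borel_measurable_times) auto
      from lborel.borel_measurable_lebesgue_integral[of
          "\<lambda>y \<xi>. cis ((x - y) \<bullet> \<xi>) * gauss (h *\<^sub>R \<xi>)" borel] this
      show ?thesis by (simp add: case_prod_beta)
    qed
    then show "(\<lambda>y. f y * (LINT \<xi>|lborel. cis ((x - y) \<bullet> \<xi>) * gauss (h *\<^sub>R \<xi>))) \<in> borel_measurable borel"
      using borel_measurable_integrable[OF integrable_test[OF f]] by auto
  qed (use h in simp)
  also have "\<dots> = (LINT y|lborel. f (x + h *\<^sub>R y) *
      (h ^ DIM('a) * (LINT \<xi>|lborel. cis ((- h *\<^sub>R y) \<bullet> \<xi>) * gauss (h *\<^sub>R \<xi>))))"
    using h by (simp add: scaleR_conv_of_real mult_ac flip: integral_mult_right_zero)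
  also have "\<dots> = (LINT y|lborel. f (x + h *\<^sub>R y) * (sqrt (2 * pi) ^ DIM('a) * gauss y))"
  proof -
    have "complex_of_real h ^ DIM('a) * (LINT \<xi>|lborel. cis ((- h *\<^sub>R y) \<bullet> \<xi>) * gauss (h *\<^sub>R \<xi>))
        = complex_of_real (sqrt (2 * pi)) ^ DIM('a) * gauss y" for y :: 'a
      using fourier_gauss_scaled[OF h, of "- h *\<^sub>R y"] h by (simp add: gauss_def)
    then show ?thesis by (simp only: of_real_power of_real_mult)
  qed
  finally show ?thesis by (simp add: mult_ac flip: integral_mult_right_zero)
qed

text \<open>The regularization parameter tends to 0 on both sides of
  \<open>fourier_inversion_gauss\<close>. The dominating functions are the integrable transform on
  the left and a Gaussian times the supremum bound of \<open>f\<close> on the right.\<close>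

theorem fourier_inversion:
  fixes f :: "'a::euclidean_space \<Rightarrow> complex"
  assumes f: "f \<in> test_functions S"
  shows "(LINT \<xi>|lborel. cis (x \<bullet> \<xi>) * fourier f \<xi>) = (2 * pi) ^ DIM('a) * f x"
proof -
  define h where "h k = inverse (real (Suc k))" for k
  have [measurable]: "fourier f \<in> borel_measurable borel" "(\<lambda>\<xi>. cis (x \<bullet> \<xi>)) \<in> borel_measurable borel"
    by (auto intro!: measurable_fourier[OF f] borel_measurable_continuous_onI continuous_intros)
  have h: "0 < h k" for k by (simp add: h_def)
  have h0: "h \<longlonglongrightarrow> 0" unfolding h_def by (rule LIMSEQ_inverse_real_of_nat)
  obtain K where K: "compact K" "f \<in> test_functions K" by (rule test_functionsE[OF f])
  have "(\<lambda>k. LINT \<xi>|lborel. cis (x \<bullet> \<xi>) * fourier f \<xi> * gauss (h k *\<^sub>R \<xi>))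
      \<longlonglongrightarrow> (LINT \<xi>|lborel. cis (x \<bullet> \<xi>) * fourier f \<xi>)"
  proof (rule integral_dominated_convergence)
    show "integrable lborel (\<lambda>\<xi>. cmod (fourier f \<xi>))"
        by (rule integrable_norm[OF integrable_fourier_test[OF f]])
    have "(\<lambda>k. cis (x \<bullet> \<xi>) * fourier f \<xi> * gauss (h k *\<^sub>R \<xi>))
        \<longlonglongrightarrow> cis (x \<bullet> \<xi>) * fourier f \<xi> * complex_of_real (exp (- (norm (0 *\<^sub>R \<xi>))\<^sup>2 / 2))" for \<xi>
      unfolding gauss_def by (intro tendsto_intros h0) auto
    then show "AE \<xi> in lborel. (\<lambda>k. cis (x \<bullet> \<xi>) * fourier f \<xi> * gauss (h k *\<^sub>R \<xi>))
        \<longlonglongrightarrow> cis (x \<bullet> \<xi>) * fourier f \<xi>"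
      by simp
    show "AE \<xi> in lborel. cmod (cis (x \<bullet> \<xi>) * fourier f \<xi> * gauss (h k *\<^sub>R \<xi>)) \<le> cmod (fourier f \<xi>)" for k
      by (auto simp: norm_mult gauss_def intro!: mult_right_le_one_le)
  qed measurable
  moreover have "(\<lambda>k. sqrt (2 * pi) ^ DIM('a) * (LINT y|lborel. f (x + h k *\<^sub>R y) * gauss y))
      \<longlonglongrightarrow> sqrt (2 * pi) ^ DIM('a) * (LINT y|lborel. f x * complex_of_real (gauss (y::'a)))"
  proof (intro tendsto_mult tendsto_const integral_dominated_convergence)
    show "integrable lborel (\<lambda>y::'a. Ck_norm K 0 f * gauss y)"
        by (intro integrable_mult_right integrable_gauss_real)
    have c: "isCont f x" using test_functions_continuous[OF f] by (simp add: continuous_on_eq_continuous_at)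
    have "(\<lambda>k. x + h k *\<^sub>R y) \<longlonglongrightarrow> x + 0 *\<^sub>R y" for y by (intro tendsto_intros h0)
    then have "(\<lambda>k. x + h k *\<^sub>R y) \<longlonglongrightarrow> x" for y by simp
    then show "AE y in lborel. (\<lambda>k. f (x + h k *\<^sub>R y) * complex_of_real (gauss y)) \<longlonglongrightarrow> f x * gauss y"
      by (intro AE_I2 tendsto_mult tendsto_const isCont_tendsto_compose[OF c])
    show "AE y in lborel. cmod (f (x + h k *\<^sub>R y) * complex_of_real (gauss y)) \<le> Ck_norm K 0 f * gauss y"
        for k
      using test_functions_bound[OF K(2,1)] by (auto simp: norm_mult gauss_def intro!: mult_right_mono)
    have "continuous_on UNIV (\<lambda>y. f (x + h k *\<^sub>R y))" for k
      by (rule continuous_on_compose2[OF test_functions_continuous[OF f]]) (auto intro!: continuous_intros)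
    then show "(\<lambda>y. f (x + h k *\<^sub>R y) * complex_of_real (gauss y)) \<in> borel_measurable lborel" for k
      by (intro borel_measurable_times) (auto intro: borel_measurable_continuous_onI)
  qed auto
  ultimately have "(LINT \<xi>|lborel. cis (x \<bullet> \<xi>) * fourier f \<xi>)
      = sqrt (2 * pi) ^ DIM('a) * (LINT y|lborel. f x * complex_of_real (gauss (y::'a)))"
    unfolding fourier_inversion_gauss[OF f h] by (rule LIMSEQ_unique)
  \<comment> \<open>The Gaussian integral contributes the second factor
    \<open>sqrt (2 * pi) ^ DIM('a)\<close>.\<close>
  also have "(LINT y|lborel. f x * complex_of_real (gauss (y::'a))) = f x * sqrt (2 * pi) ^ DIM('a)"
    using fourier_gauss[of "0::'a"] by (simp add: gauss_def)
  also have "complex_of_real (sqrt (2 * pi) ^ DIM('a)) * (f x * complex_of_real (sqrt (2 * pi) ^ DIM('a)))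
      = complex_of_real ((sqrt (2 * pi) * sqrt (2 * pi)) ^ DIM('a)) * f x"
    by (simp only: power_mult_distrib of_real_mult mult_ac)
  finally show ?thesis by simp
qed

lemma fourier_cmult: "fourier (\<lambda>x. c * f x) \<xi> = c * fourier f \<xi>"
  by (simp add: fourier_def mult.left_commute[of _ c])

lemma fourier_cnj: "fourier (\<lambda>x. cnj (f x)) \<xi> = cnj (fourier f (- \<xi>))"
  unfolding fourier_def by (subst Bochner_Integration.integral_cnj[symmetric]) (simp add: cis_cnj)

text \<open>\<open>fourier_density\<close> describes a distribution on transforms of Schwartz
  functions. This exhibits every test function as such a transform.\<close>

lemma fourier_of_schwartz:
  fixes f :: "'a::euclidean_space \<Rightarrow> complex"
  assumes f: "f \<in> test_functions S"
  defines "\<phi> \<equiv> \<lambda>\<xi>. 1 / (2 * pi) ^ DIM('a) * fourier f (- \<xi>)"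
  shows "\<phi> \<in> schwartz" "fourier \<phi> = f"
proof -
  have "\<phi> = (\<lambda>\<xi>. fourier (\<lambda>x. 1 / (2 * pi) ^ DIM('a) * f x) (- \<xi>))"
    by (simp only: \<phi>_def fourier_cmult)
  then show "\<phi> \<in> schwartz" using fourier_reflected_schwartz[OF test_functions_cmult[OF f]] by metis
  show "fourier \<phi> = f"
  proof
    fix x
    have "fourier \<phi> x = 1 / (2 * pi) ^ DIM('a) * (LINT \<xi>|lborel. cis (x \<bullet> - \<xi>) * fourier f (- \<xi>))"
    proof -
      have "cis (- (\<xi> \<bullet> x)) * (c * F) = c * (cis (x \<bullet> - \<xi>) * F)" for \<xi> c F
        by (simp add: inner_commute)
      then show ?thesis unfolding fourier_def[of \<phi>] unfolding \<phi>_def by (simp only: integral_mult_right_zero)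
    qed
    also have "\<dots> = 1 / (2 * pi) ^ DIM('a) * (LINT \<xi>|lborel. cis (x \<bullet> \<xi>) * fourier f \<xi>)"
      by (subst lborel_integral_reflect(1)[where f = "\<lambda>\<xi>. cis (x \<bullet> \<xi>) * fourier f \<xi>"]) simp
    finally show "fourier \<phi> x = f x" by (simp add: fourier_inversion[OF f])
  qed
qed

section \<open>Riesz representation in \<open>L\<^sup>2\<close>\<close>

text \<open>Functions rather than classes, over a whole measure space;
  \<open>L2_space \<Omega>\<close> reduces to this by multiplying with the indicator of \<Omega>.
  The companion \<open>sq_norm\<close> is the squared norm, which keeps roots out of the
  parallelogram law.\<close>

definition sq_integrable :: "'a measure \<Rightarrow> ('a \<Rightarrow> complex) \<Rightarrow> bool" where
  "sq_integrable M f \<longleftrightarrow> f \<in> borel_measurable M \<and> integrable M (\<lambda>x. (cmod (f x))\<^sup>2)"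

definition sq_norm :: "'a measure \<Rightarrow> ('a \<Rightarrow> complex) \<Rightarrow> real" where
  "sq_norm M f = (LINT x|M. (cmod (f x))\<^sup>2)"

lemma sq_norm_nonneg: "0 \<le> sq_norm M f"
  by (simp add: sq_norm_def)

lemma sq_integrable_mult:
  assumes "sq_integrable M f" "sq_integrable M g"
  shows "integrable M (\<lambda>x. f x * g x)" "integrable M (\<lambda>x. f x * cnj (g x))"
    "integrable M (\<lambda>x. cmod (f x) * cmod (g x))"
proof -
  have i: "integrable M (\<lambda>x. (cmod (f x))\<^sup>2 + (cmod (g x))\<^sup>2)"
    using assms by (auto simp: sq_integrable_def)
  have le: "cmod (f x) * cmod (g x) \<le> (cmod (f x))\<^sup>2 + (cmod (g x))\<^sup>2" for x
    using sum_squares_bound[of "cmod (f x)" "cmod (g x)"] mult_nonneg_nonneg[of "cmod (f x)" "cmod (g x)"]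
    by (simp del: mult_nonneg_nonneg)
  have m: "f \<in> borel_measurable M" "g \<in> borel_measurable M"
    using assms by (auto simp: sq_integrable_def)
  then have "(\<lambda>x. cnj (g x)) \<in> borel_measurable M"
    using measurable_compose[OF _ borel_measurable_continuous_onI[OF continuous_on_cnj[OF
        continuous_on_id]]] by blast
  note m = m this
  show "integrable M (\<lambda>x. f x * g x)" "integrable M (\<lambda>x. f x * cnj (g x))"
    "integrable M (\<lambda>x. cmod (f x) * cmod (g x))"
    by (rule integrable_norm_bound[OF i]; use le m in \<open>auto simp: norm_mult intro!:
        borel_measurable_times\<close>)+
qed

lemma cauchy_schwarz_integral:
  assumes f: "sq_integrable M f" and g: "sq_integrable M g"
  shows "(LINT x|M. cmod (f x) * cmod (g x)) \<le> sqrt (sq_norm M f) * sqrt (sq_norm M g)"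
proof -
  define A B C where "A = sq_norm M f" and "B = sq_norm M g" and "C = (LINT x|M. cmod (f x) * cmod (g x))"
  \<comment> \<open>Expands the nonnegative integral of
    \<open>(cmod (f x) - t * cmod (g x))\<^sup>2\<close>.\<close>
  have q: "2 * t * C \<le> A + t\<^sup>2 * B" for t
  proof -
    have "(LINT x|M. 2 * t * (cmod (f x) * cmod (g x))) \<le> (LINT x|M. (cmod (f x))\<^sup>2 + t\<^sup>2 * (cmod (g x))\<^sup>2)"
    proof (rule integral_mono)
      show "2 * t * (cmod (f x) * cmod (g x)) \<le> (cmod (f x))\<^sup>2 + t\<^sup>2 * (cmod (g x))\<^sup>2" for x
        using sum_squares_bound[of "cmod (f x)" "t * cmod (g x)"] by (simp add: power_mult_distrib mult_ac)
    qed (use f g sq_integrable_mult(3)[OF f g] in \<open>auto simp: sq_integrable_def\<close>)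
    also have "\<dots> = A + t\<^sup>2 * B"
      using f g by (simp add: sq_integrable_def A_def B_def sq_norm_def)
    finally show ?thesis by (simp add: C_def)
  qed
  have AB: "0 \<le> A" "0 \<le> B" by (auto simp: A_def B_def sq_norm_nonneg)
  have C: "0 \<le> C" unfolding C_def by (rule integral_nonneg_AE) auto
  have "C\<^sup>2 \<le> A * B"
  \<comment> \<open>For \<open>B = 0\<close> the bound on \<open>2 * t * C\<close> is independent of
    \<open>t\<close>, and a large \<open>t\<close> forces \<open>C = 0\<close>; otherwise
    \<open>C / B\<close> is the optimal \<open>t\<close>.\<close>
  proof (cases "B = 0")
    case True
    have "C = 0"
    proof (rule ccontr)
      assume "C \<noteq> 0"
      then have "2 * ((A + 1) / (2 * C)) * C = A + 1" by simp
      then show False using q[of "(A + 1) / (2 * C)"] True by simp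
    qed
    then show ?thesis using True by simp
  next
    case False
    then have B: "B > 0" using AB by simp
    have "2 * (C / B) * C \<le> A + (C / B)\<^sup>2 * B" by (rule q)
    then show ?thesis using B by (simp add: field_simps power2_eq_square)
  qed
  then have "C \<le> sqrt (A * B)" by (rule real_le_rsqrt)
  then show ?thesis by (simp add: A_def B_def C_def real_sqrt_mult)
qed

lemma cauchy_schwarz_complex:
  assumes "sq_integrable M f" "sq_integrable M g"
  shows "cmod (LINT x|M. f x * g x) \<le> sqrt (sq_norm M f) * sqrt (sq_norm M g)"
    and "cmod (LINT x|M. f x * cnj (g x)) \<le> sqrt (sq_norm M f) * sqrt (sq_norm M g)"
  using integral_norm_bound[of M "\<lambda>x. f x * g x"] integral_norm_bound[of M "\<lambda>x. f x * cnj (g x)"]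
    cauchy_schwarz_integral[OF assms]
  by (auto simp: norm_mult)

lemma sq_integrable_cmult: "sq_integrable M f \<Longrightarrow> sq_integrable M (\<lambda>x. c * f x)"
  by (auto simp: sq_integrable_def norm_mult power_mult_distrib)

lemma sq_integrable_add:
  assumes "sq_integrable M f" "sq_integrable M g"
  shows "sq_integrable M (\<lambda>x. f x + g x)"
proof -
  have i: "integrable M (\<lambda>x. (cmod (f x))\<^sup>2 + (cmod (g x))\<^sup>2 + 2 * (cmod (f x) * cmod (g x)))"
    using assms sq_integrable_mult(3)[OF assms] by (auto simp: sq_integrable_def)
  have "integrable M (\<lambda>x. (cmod (f x + g x))\<^sup>2)"
  proof (rule integrable_norm_bound[OF i])
    show "norm ((cmod (f x + g x))\<^sup>2) \<le> (cmod (f x))\<^sup>2 + (cmod (g x))\<^sup>2 + 2 * (cmod (f x) * cmod (g x))"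
        for x
      using power_mono[OF norm_triangle_ineq[of "f x" "g x"] norm_ge_zero, of 2] by (simp add: power2_sum)
    show "(\<lambda>x. (cmod (f x + g x))\<^sup>2) \<in> borel_measurable M"
    proof -
      have [measurable]: "f \<in> borel_measurable M" "g \<in> borel_measurable M"
        using assms by (auto simp: sq_integrable_def)
      show ?thesis by measurable
    qed
  qed
  then show ?thesis using assms by (auto simp: sq_integrable_def)
qed

lemma sq_integrable_diff:
  assumes "sq_integrable M f" "sq_integrable M g"
  shows "sq_integrable M (\<lambda>x. f x - g x)"
  using sq_integrable_add[OF assms(1) sq_integrable_cmult[OF assms(2), of "-1"]] by simp

lemma sq_norm_add:
  assumes "sq_integrable M f" "sq_integrable M g"
  shows "sq_norm M (\<lambda>x. f x + g x) = sq_norm M f + sq_norm M g + 2 * Re (LINT x|M. f x * cnj (g x))"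
proof -
  have "(cmod (f x + g x))\<^sup>2 = (cmod (f x))\<^sup>2 + (cmod (g x))\<^sup>2 + 2 * Re (f x * cnj (g x))" for x
    by (simp only: cmod_power2) (simp add: power2_eq_square algebra_simps)
  moreover define R where "R x = Re (f x * cnj (g x))" for x
  ultimately have "sq_norm M (\<lambda>x. f x + g x) = (LINT x|M. (cmod (f x))\<^sup>2 + (cmod (g x))\<^sup>2 + 2 * R x)"
    by (simp add: sq_norm_def)
  moreover have "integrable M R" "(LINT x|M. R x) = Re (LINT x|M. f x * cnj (g x))"
    using sq_integrable_mult(2)[OF assms] integrable_Re integral_Re unfolding R_def[abs_def] by blast+
  ultimately show ?thesis using assms by (simp add: sq_norm_def sq_integrable_def)
qed

lemma sq_norm_cmult: "sq_norm M (\<lambda>x. c * f x) = (cmod c)\<^sup>2 * sq_norm M f"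
  by (simp add: sq_norm_def norm_mult power_mult_distrib)

lemma sq_norm_triangle:
  assumes "sq_integrable M f" "sq_integrable M g"
  shows "sqrt (sq_norm M (\<lambda>x. f x + g x)) \<le> sqrt (sq_norm M f) + sqrt (sq_norm M g)"
proof -
  have "Re (LINT x|M. f x * cnj (g x)) \<le> sqrt (sq_norm M f) * sqrt (sq_norm M g)"
    using cauchy_schwarz_complex(2)[OF assms] complex_Re_le_cmod order_trans by blast
  then show ?thesis
    by (intro real_le_lsqrt) (auto simp: sq_norm_add[OF assms] power2_sum sq_norm_nonneg)
qed

lemma parallelogram_law:
  assumes "sq_integrable M f" "sq_integrable M g"
  shows "sq_norm M (\<lambda>x. f x - g x) + sq_norm M (\<lambda>x. f x + g x) = 2 * sq_norm M f + 2 * sq_norm M g"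
proof -
  have "sq_norm M (\<lambda>x. f x - g x) = sq_norm M f + sq_norm M g - 2 * Re (LINT x|M. f x * cnj (g x))"
    using sq_norm_add[OF assms(1) sq_integrable_cmult[OF assms(2), of "-1"]] sq_norm_cmult[of M "-1" g]
    by simp
  then show ?thesis using sq_norm_add[OF assms] by simp
qed

text \<open>The core of the Riesz-Fischer theorem. By monotone convergence the sum of the absolute
  increments is square integrable, hence finite almost everywhere, so the sequence converges
  pointwise; Fatou's lemma carries the rate over to the limit.\<close>

lemma fast_cauchy_limit:
  assumes v: "\<And>k. sq_integrable M (v k)"
    and fast: "\<And>k. sqrt (sq_norm M (\<lambda>x. v (Suc k) x - v k x)) \<le> (1 / 2) ^ k"
  obtains t where "sq_integrable M t" "\<And>k. sqrt (sq_norm M (\<lambda>x. t x - v k x)) \<le> 2 * (1 / 2) ^ k"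
proof -
  have [measurable]: "v k \<in> borel_measurable M" for k using v by (simp add: sq_integrable_def)
  have diff: "sq_integrable M (\<lambda>x. v n x - v k x)" for n k by (intro sq_integrable_diff v)
  define d where "d k x = cmod (v (Suc k) x - v k x)" for k x
  define s where "s n x = (\<Sum>k<n. d k x)" for n x
  have s0: "0 \<le> s n x" for n x by (auto simp: s_def d_def intro: sum_nonneg)
  \<comment> \<open>The bound is the partial sum of the geometric series that dominates the
    increments.\<close>
  have sq: "sq_integrable M (\<lambda>x. complex_of_real (s n x)) \<and>
      sqrt (sq_norm M (\<lambda>x. complex_of_real (s n x))) \<le> 2 - 2 * (1 / 2) ^ n" for n
  proof (induction n)
    case 0
    show ?case by (simp add: s_def sq_integrable_def sq_norm_def)
  next
    case (Suc n)
    have d: "sq_integrable M (\<lambda>x. complex_of_real (d n x))"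
      using diff[of "Suc n" n] by (simp add: d_def sq_integrable_def)
    have "sq_norm M (\<lambda>x. complex_of_real (d n x)) = sq_norm M (\<lambda>x. v (Suc n) x - v n x)"
      by (simp add: d_def sq_norm_def)
    then have "sqrt (sq_norm M (\<lambda>x. complex_of_real (d n x))) \<le> (1 / 2) ^ n"
      using fast by simp
    then show ?case
      using sq_integrable_add[OF _ d, of "\<lambda>x. complex_of_real (s n x)"]
        sq_norm_triangle[OF _ d, of "\<lambda>x. complex_of_real (s n x)"] Suc
      by (simp add: s_def)
  qed
  have int: "(\<integral>\<^sup>+x. ennreal ((s n x)\<^sup>2) \<partial>M) \<le> ennreal 4" for n
  proof -
    have "sq_norm M (\<lambda>x. complex_of_real (s n x)) \<le> 2\<^sup>2"
      using sq[of n] by (intro sqrt_le_D) (auto intro: order_trans)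
    then show ?thesis
      using sq[of n] s0 by (subst nn_integral_eq_integral) (auto simp: sq_integrable_def sq_norm_def simp
          del: ennreal_numeral intro!: ennreal_leI)
  qed
  have "(\<integral>\<^sup>+x. (SUP n. ennreal ((s n x)\<^sup>2)) \<partial>M) = (SUP n. (\<integral>\<^sup>+x. ennreal ((s n x)\<^sup>2) \<partial>M))"
  proof (rule nn_integral_monotone_convergence_SUP)
    show "incseq (\<lambda>n x. ennreal ((s n x)\<^sup>2))"
      using s0 by (auto simp: incseq_def le_fun_def s_def d_def intro!: ennreal_leI power_mono sum_mono2)
    show "(\<lambda>x. ennreal ((s n x)\<^sup>2)) \<in> borel_measurable M" for n
      unfolding s_def d_def by measurable
  qed
  also have "\<dots> \<le> ennreal 4" by (rule SUP_least) (rule int)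
  finally have "(\<integral>\<^sup>+x. (SUP n. ennreal ((s n x)\<^sup>2)) \<partial>M) \<noteq> \<infinity>"
    by (auto simp: top_unique)
  then have "AE x in M. (SUP n. ennreal ((s n x)\<^sup>2)) \<noteq> \<infinity>"
    by (rule nn_integral_noteq_infinite[rotated]) (unfold s_def d_def, measurable)
  then have conv: "AE x in M. convergent (\<lambda>k. v k x)"
  proof eventually_elim
    case (elim x)
    then obtain B where B: "0 \<le> B" "(SUP n. ennreal ((s n x)\<^sup>2)) = ennreal B"
      by (metis ennreal_cases infinity_ennreal_def)
    have "s n x \<le> 1 + B" for n
    proof -
      have "ennreal ((s n x)\<^sup>2) \<le> ennreal B" unfolding B(2)[symmetric] by (rule SUP_upper) simp
      then have "(s n x)\<^sup>2 \<le> B" using B(1) by simp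
      moreover have "s n x \<le> 1 + (s n x)\<^sup>2" using sum_squares_bound[of 1 "s n x"] s0[of n x] by simp
      ultimately show ?thesis by linarith
    qed
    then have "summable (\<lambda>k. d k x)"
      by (intro summableI_nonneg_bounded[of _ "1 + B"]) (auto simp: s_def d_def)
    then have "summable (\<lambda>k. v (Suc k) x - v k x)" unfolding d_def by (rule summable_norm_cancel)
    then have "convergent (\<lambda>n. v n x - v 0 x)"
      unfolding summable_iff_convergent sum_lessThan_telescope[of "\<lambda>k. v k x"] .
    then show "convergent (\<lambda>k. v k x)" by (simp add: convergent_diff_const_right_iff)
  qed
  \<comment> \<open>On the exceptional null set \<open>lim\<close> has an unspecified value, but
    \<open>t\<close> is measurable all the same.\<close>
  define t where "t x = lim (\<lambda>k. v k x)" for x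
  have [measurable]: "t \<in> borel_measurable M" unfolding t_def[abs_def] by measurable
  have vk: "n \<ge> k \<Longrightarrow> sqrt (sq_norm M (\<lambda>x. v n x - v k x)) \<le> 2 * (1 / 2) ^ k - 2 * (1 / 2) ^ n" for n k
  proof (induction n rule: dec_induct)
    case base
    show ?case by (simp add: sq_norm_def)
  next
    case (step n)
    then show ?case
      using sq_norm_triangle[OF diff[of "Suc n" n] diff[of n k]] fast[of n] by simp
  qed
  have lim: "(\<integral>\<^sup>+x. ennreal ((cmod (t x - v k x))\<^sup>2) \<partial>M) \<le> ennreal ((2 * (1 / 2) ^ k)\<^sup>2)" for k
  proof -
    have "(\<integral>\<^sup>+x. ennreal ((cmod (t x - v k x))\<^sup>2) \<partial>M)
        = (\<integral>\<^sup>+x. liminf (\<lambda>n. ennreal ((cmod (v n x - v k x))\<^sup>2)) \<partial>M)"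
    proof (rule nn_integral_cong_AE)
      show "AE x in M. ennreal ((cmod (t x - v k x))\<^sup>2) = liminf (\<lambda>n. ennreal ((cmod (v n x - v k x))\<^sup>2))"
        using conv
      proof eventually_elim
        case (elim x)
        then have "(\<lambda>n. v n x) \<longlonglongrightarrow> t x" unfolding t_def by (simp add: convergent_LIMSEQ_iff)
        then have "(\<lambda>n. ennreal ((cmod (v n x - v k x))\<^sup>2)) \<longlonglongrightarrow> ennreal ((cmod (t x - v k x))\<^sup>2)"
          by (intro tendsto_ennrealI tendsto_intros)
        then show ?case by (intro lim_imp_Liminf[symmetric]) auto
      qed
    qed
    also have "\<dots> \<le> liminf (\<lambda>n. (\<integral>\<^sup>+x. ennreal ((cmod (v n x - v k x))\<^sup>2) \<partial>M))"
      by (rule nn_integral_liminf) measurable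
    also have "\<dots> \<le> liminf (\<lambda>n. ennreal ((2 * (1 / 2) ^ k)\<^sup>2))"
    proof (rule Liminf_mono, rule eventually_sequentiallyI[of k])
      fix n assume "k \<le> n"
      then have "sqrt (sq_norm M (\<lambda>x. v n x - v k x)) \<le> 2 * (1 / 2) ^ k"
        using vk[of k n] by (smt (verit) zero_le_power divide_nonneg_nonneg)
      then have "sq_norm M (\<lambda>x. v n x - v k x) \<le> (2 * (1 / 2) ^ k)\<^sup>2" by (rule sqrt_le_D)
      then show "(\<integral>\<^sup>+x. ennreal ((cmod (v n x - v k x))\<^sup>2) \<partial>M) \<le> ennreal ((2 * (1 / 2) ^ k)\<^sup>2)"
        using diff[of n k] by (subst nn_integral_eq_integral) (auto simp: sq_integrable_def sq_norm_def
            ennreal_leI)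
    qed
    also have "\<dots> = ennreal ((2 * (1 / 2) ^ k)\<^sup>2)" by (simp add: Liminf_const)
    finally show ?thesis .
  qed
  have i: "integrable M (\<lambda>x. (cmod (t x - v k x))\<^sup>2)" for k
    using lim[of k] by (intro integrableI_bounded) (auto simp: top_unique less_top[symmetric])
  have tv: "sq_integrable M (\<lambda>x. t x - v k x)" for k
    using i[of k] by (simp add: sq_integrable_def)
  show thesis
  proof (rule that)
    show "sq_integrable M t" using sq_integrable_add[OF tv[of 0] v[of 0]] by simp
    show "sqrt (sq_norm M (\<lambda>x. t x - v k x)) \<le> 2 * (1 / 2) ^ k" for k
    proof (rule real_le_lsqrt)
      have "ennreal (sq_norm M (\<lambda>x. t x - v k x)) \<le> ennreal ((2 * (1 / 2) ^ k)\<^sup>2)"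
        using lim[of k] i[of k] by (subst (asm) nn_integral_eq_integral) (auto simp: sq_norm_def)
      then show "sq_norm M (\<lambda>x. t x - v k x) \<le> (2 * (1 / 2) ^ k)\<^sup>2" by simp
    qed auto
  qed
qed

text \<open>The representing function is the limit of a minimising sequence of
  \<open>\<parallel>B \<phi>\<parallel>\<^sup>2 - 2 Re (\<l> \<phi>)\<close>. Parametrising by \<open>\<phi>\<close> instead of the range of \<open>B\<close> makes it unnecessary
  to check that \<open>\<l>\<close> is well-defined on that range.\<close>

theorem riesz_representation_L2:
  fixes B :: "('b \<Rightarrow> complex) \<Rightarrow> 'a \<Rightarrow> complex" and \<l> :: "('b \<Rightarrow> complex) \<Rightarrow> complex"
  assumes ne: "X \<noteq> {}"
    and X_add: "\<And>\<phi> \<psi>. \<phi> \<in> X \<Longrightarrow> \<psi> \<in> X \<Longrightarrow> (\<lambda>x. \<phi> x + \<psi> x) \<in> X"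
    and X_mult: "\<And>c \<phi>. \<phi> \<in> X \<Longrightarrow> (\<lambda>x. c * \<phi> x) \<in> X"
    and B: "\<And>\<phi>. \<phi> \<in> X \<Longrightarrow> sq_integrable M (B \<phi>)"
    and B_add: "\<And>\<phi> \<psi>. \<phi> \<in> X \<Longrightarrow> \<psi> \<in> X \<Longrightarrow> B (\<lambda>x. \<phi> x + \<psi> x) = (\<lambda>x. B \<phi> x + B \<psi> x)"
    and B_mult: "\<And>c \<phi>. \<phi> \<in> X \<Longrightarrow> B (\<lambda>x. c * \<phi> x) = (\<lambda>x. c * B \<phi> x)"
    and l_add: "\<And>\<phi> \<psi>. \<phi> \<in> X \<Longrightarrow> \<psi> \<in> X \<Longrightarrow> \<l> (\<lambda>x. \<phi> x + \<psi> x) = \<l> \<phi> + \<l> \<psi>"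
    and l_mult: "\<And>c \<phi>. \<phi> \<in> X \<Longrightarrow> \<l> (\<lambda>x. c * \<phi> x) = cnj c * \<l> \<phi>"
    and C: "0 \<le> C" "\<And>\<phi>. \<phi> \<in> X \<Longrightarrow> cmod (\<l> \<phi>) \<le> C * sqrt (sq_norm M (B \<phi>))"
  shows "\<exists>t. sq_integrable M t \<and> sqrt (sq_norm M t) \<le> C \<and>
    (\<forall>\<phi>\<in>X. (LINT x|M. t x * cnj (B \<phi> x)) = \<l> \<phi>)"
proof -
  define J where "J \<phi> = sq_norm M (B \<phi>) - 2 * Re (\<l> \<phi>)" for \<phi>
  \<comment> \<open>Completing the square: \<open>J \<phi>\<close> is at least
    \<open>n\<^sup>2 - 2 * C * n\<close>, where \<open>n\<close> is the norm of
    \<open>B \<phi>\<close>.\<close>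
  have J_ge: "- C\<^sup>2 \<le> J \<phi>" if "\<phi> \<in> X" for \<phi>
  proof -
    let ?n = "sqrt (sq_norm M (B \<phi>))"
    have "Re (\<l> \<phi>) \<le> C * ?n" using C(2)[OF that] complex_Re_le_cmod order_trans by blast
    moreover have "2 * (C * ?n) \<le> C\<^sup>2 + ?n\<^sup>2" using sum_squares_bound[of C ?n] by simp
    moreover have "?n\<^sup>2 = sq_norm M (B \<phi>)" by (simp add: sq_norm_nonneg)
    ultimately show ?thesis by (simp add: J_def)
  qed
  define m where "m = Inf (J ` X)"
  have bdd: "bdd_below (J ` X)" using J_ge by (intro bdd_belowI2[of X "- C\<^sup>2"])
  have m: "m \<le> J \<phi>" if "\<phi> \<in> X" for \<phi>
    unfolding m_def using that by (intro cINF_lower bdd)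
  have "\<exists>\<phi>\<in>X. J \<phi> < m + e" if "e > 0" for e
    using cInf_lessD[of "J ` X" "m + e"] ne that unfolding m_def by auto
  \<comment> \<open>The tolerance is chosen so that the parallelogram law gives squared increments
    of at most \<open>(1 / 4) ^ k\<close>, the rate required by
    \<open>fast_cauchy_limit\<close>.\<close>
  then have "\<forall>k. \<exists>\<phi>. \<phi> \<in> X \<and> J \<phi> < m + (1 / 4) ^ k / 4"
      by (metis divide_pos_pos zero_less_numeral zero_less_one zero_less_power)
  then obtain \<phi> where \<phi>: "\<And>k. \<phi> k \<in> X" "\<And>k. J (\<phi> k) < m + (1 / 4) ^ k / 4" by metis
  define v where "v k = B (\<phi> k)" for k
  have v: "sq_integrable M (v k)" for k using B[OF \<phi>(1)] by (simp add: v_def)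
  have "sqrt (sq_norm M (\<lambda>x. v (Suc k) x - v k x)) \<le> (1 / 2) ^ k" for k
  proof (rule real_le_lsqrt)
    \<comment> \<open>The midpoint lies in \<open>X\<close>, so \<open>J\<close> is at least
      \<open>m\<close> there; together with near-minimality at both ends this forces the images
      under \<open>B\<close> to be close.\<close>
    define \<mu> where "\<mu> = (\<lambda>x. (1 / 2) * (\<phi> (Suc k) x + \<phi> k x))"
    have sum: "(\<lambda>x. \<phi> (Suc k) x + \<phi> k x) \<in> X" by (intro X_add \<phi>)
    then have \<mu>: "\<mu> \<in> X" unfolding \<mu>_def by (rule X_mult)
    have "B \<mu> = (\<lambda>x. (1 / 2) * (v (Suc k) x + v k x))"
      unfolding \<mu>_def v_def B_mult[OF sum] B_add[OF \<phi>(1) \<phi>(1)] by simp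
    then have "4 * sq_norm M (B \<mu>) = sq_norm M (\<lambda>x. v (Suc k) x + v k x)"
      using sq_norm_cmult[of M "1 / 2" "\<lambda>x. v (Suc k) x + v k x"]
          by (simp add: power2_eq_square norm_divide)
    moreover have "2 * Re (\<l> \<mu>) = Re (\<l> (\<phi> (Suc k))) + Re (\<l> (\<phi> k))"
    proof -
      have "\<l> \<mu> = cnj (1 / 2) * (\<l> (\<phi> (Suc k)) + \<l> (\<phi> k))"
        by (simp only: \<mu>_def l_mult[OF sum] l_add[OF \<phi>(1) \<phi>(1)])
      then have "Re (\<l> \<mu>) = Re (cnj (1 / 2) * (\<l> (\<phi> (Suc k)) + \<l> (\<phi> k)))" by (rule arg_cong)
      also have "\<dots> = (Re (\<l> (\<phi> (Suc k))) + Re (\<l> (\<phi> k))) / 2" by simp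
      finally show ?thesis by simp
    qed
    moreover have "m \<le> J \<mu>" by (rule m[OF \<mu>])
    moreover have "sq_norm M (\<lambda>x. v (Suc k) x - v k x) + sq_norm M (\<lambda>x. v (Suc k) x + v k x)
        = 2 * sq_norm M (v (Suc k)) + 2 * sq_norm M (v k)"
      by (rule parallelogram_law[OF v v])
    ultimately have "sq_norm M (\<lambda>x. v (Suc k) x - v k x) \<le> 2 * J (\<phi> (Suc k)) + 2 * J (\<phi> k) - 4 * m"
      unfolding J_def v_def by argo
    also have "\<dots> \<le> (1 / 4) ^ k"
    proof -
      define e :: real where "e = (1 / 4) ^ k"
      have "0 \<le> e" "J (\<phi> k) < m + e / 4" "J (\<phi> (Suc k)) < m + e / 16"
        using \<phi>(2)[of k] \<phi>(2)[of "Suc k"] by (simp_all add: e_def)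
      then show ?thesis unfolding e_def[symmetric] by argo
    qed
    also have "\<dots> = ((1 / 2) ^ k)\<^sup>2"
    proof -
      have "((1 / 2 :: real) ^ k)\<^sup>2 = ((1 / 2)\<^sup>2) ^ k" by (simp only: power_mult[symmetric] mult.commute)
      then show ?thesis by (simp add: power2_eq_square)
    qed
    finally show "sq_norm M (\<lambda>x. v (Suc k) x - v k x) \<le> ((1 / 2) ^ k)\<^sup>2" .
  qed auto
  then obtain t where t: "sq_integrable M t" "\<And>k. sqrt (sq_norm M (\<lambda>x. t x - v k x)) \<le> 2 * (1 / 2) ^ k"
    using fast_cauchy_limit[of M v, OF v] by metis
  have tv: "sq_integrable M (\<lambda>x. t x - v k x)" for k by (intro sq_integrable_diff t v)
  have e0: "(\<lambda>k. c * (2 * (1 / 2 :: real) ^ k)) \<longlonglongrightarrow> 0" for c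
    by (intro tendsto_mult_right_zero LIMSEQ_power_zero) auto
  have riesz: "(LINT x|M. t x * cnj (B \<psi> x)) = \<l> \<psi>" if \<psi>: "\<psi> \<in> X" for \<psi>
  proof -
    define D where "D = (LINT x|M. t x * cnj (B \<psi> x)) - \<l> \<psi>"
    define N where "N = sq_norm M (B \<psi>)"
    \<comment> \<open>First variation. Passing from \<open>\<phi> k\<close> to
      \<open>\<phi> k + c * \<psi>\<close> cannot bring \<open>J\<close> below \<open>m\<close>, and
      \<open>J (\<phi> k)\<close> exceeds \<open>m\<close> by a vanishing amount. In the limit an
      expression quadratic in \<open>c\<close>, with linear part governed by \<open>D\<close>, is
      nonnegative.\<close>
    have var: "0 \<le> 2 * Re (cnj c * D) + (cmod c)\<^sup>2 * N" for c
    proof (rule LIMSEQ_le_const)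
      have "(\<lambda>k. LINT x|M. v k x * cnj (B \<psi> x)) \<longlonglongrightarrow> (LINT x|M. t x * cnj (B \<psi> x))"
      proof (subst tendsto_dist_iff, rule tendsto_sandwich[OF _ _ tendsto_const e0[of "sqrt N"]])
        show "\<forall>\<^sub>F k in sequentially. dist (LINT x|M. v k x * cnj (B \<psi> x)) (LINT x|M. t x * cnj (B \<psi> x))
            \<le> sqrt N * (2 * (1 / 2) ^ k)"
        proof (rule always_eventually, rule allI)
          fix k
          have "(LINT x|M. t x * cnj (B \<psi> x)) - (LINT x|M. v k x * cnj (B \<psi> x))
              = (LINT x|M. (t x - v k x) * cnj (B \<psi> x))"
            using sq_integrable_mult(2)[OF t(1) B[OF \<psi>]] sq_integrable_mult(2)[OF v B[OF \<psi>]]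
            by (simp add: left_diff_distrib)
          also have "cmod \<dots> \<le> sqrt (sq_norm M (\<lambda>x. t x - v k x)) * sqrt N"
            unfolding N_def by (rule cauchy_schwarz_complex(2)[OF tv B[OF \<psi>]])
          also have "\<dots> \<le> 2 * (1 / 2) ^ k * sqrt N"
            using t(2) by (intro mult_right_mono) (auto simp: N_def sq_norm_nonneg)
          finally show "dist (LINT x|M. v k x * cnj (B \<psi> x)) (LINT x|M. t x * cnj (B \<psi> x))
              \<le> sqrt N * (2 * (1 / 2) ^ k)"
            by (simp add: dist_norm norm_minus_commute mult.commute)
        qed
      qed auto
      then have "(\<lambda>k. 2 * Re (cnj c * ((LINT x|M. v k x * cnj (B \<psi> x)) - \<l> \<psi>)) + (cmod c)\<^sup>2 * N + (1 / 4) *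
          (1 / 4) ^ k)
          \<longlonglongrightarrow> 2 * Re (cnj c * D) + (cmod c)\<^sup>2 * N + (1 / 4) * 0"
        unfolding D_def by (intro tendsto_intros LIMSEQ_power_zero) auto
      then show "(\<lambda>k. 2 * Re (cnj c * ((LINT x|M. v k x * cnj (B \<psi> x)) - \<l> \<psi>)) + (cmod c)\<^sup>2 * N + (1 / 4) *
          (1 / 4) ^ k)
          \<longlonglongrightarrow> 2 * Re (cnj c * D) + (cmod c)\<^sup>2 * N" by simp
      have "0 \<le> 2 * Re (cnj c * ((LINT x|M. v k x * cnj (B \<psi> x)) - \<l> \<psi>)) + (cmod c)\<^sup>2 * N + (1 / 4) * (1 /
          4) ^ k" for k
      proof -
        have c\<psi>: "(\<lambda>x. c * \<psi> x) \<in> X" by (rule X_mult[OF \<psi>])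
        have "sq_norm M (B (\<lambda>x. \<phi> k x + c * \<psi> x))
            = sq_norm M (v k) + (cmod c)\<^sup>2 * N + 2 * Re (cnj c * (LINT x|M. v k x * cnj (B \<psi> x)))"
          unfolding B_add[OF \<phi>(1) c\<psi>] B_mult[OF \<psi>] v_def[symmetric]
          by (subst sq_norm_add[OF v sq_integrable_cmult[OF B[OF \<psi>]]])
             (simp add: sq_norm_cmult N_def mult.left_commute[of _ "cnj c"])
        moreover have "m \<le> J (\<lambda>x. \<phi> k x + c * \<psi> x)" by (rule m[OF X_add[OF \<phi>(1) c\<psi>]])
        moreover have "\<l> (\<lambda>x. \<phi> k x + c * \<psi> x) = \<l> (\<phi> k) + cnj c * \<l> \<psi>"
          by (simp add: l_add[OF \<phi>(1) c\<psi>] l_mult[OF \<psi>])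
        ultimately show ?thesis
          using \<phi>(2)[of k] unfolding J_def v_def right_diff_distrib by (simp del: times_complex.sel)
      qed
      then show "\<exists>K. \<forall>k\<ge>K. 0 \<le> 2 * Re (cnj c * ((LINT x|M. v k x * cnj (B \<psi> x)) - \<l> \<psi>)) + (cmod c)\<^sup>2 * N +
          (1 / 4) * (1 / 4) ^ k"
        by blast
    qed
    have N0: "0 \<le> N" by (simp add: N_def sq_norm_nonneg)
    \<comment> \<open>With \<open>c = - r * D\<close> the expression becomes
      \<open>r * (cmod D)\<^sup>2 * (r * N - 2)\<close>, which is negative unless
      \<open>D = 0\<close>. The 1 in the denominator covers \<open>N = 0\<close>.\<close>
    define r where "r = 1 / (N + 1)"
    have r: "r > 0" "r * N < 1" using N0 by (auto simp: r_def field_simps)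
    have "cnj (- r * D) * D = complex_of_real (- r * (cmod D)\<^sup>2)"
      unfolding of_real_mult complex_norm_square by simp
    then have "0 \<le> 2 * (- r * (cmod D)\<^sup>2) + (r * cmod D)\<^sup>2 * N"
      using var[of "- r * D"] r by (simp only: Re_complex_of_real) (simp add: norm_mult)
    also have "\<dots> = r * (cmod D)\<^sup>2 * (r * N - 2)" by (simp add: power2_eq_square algebra_simps)
    finally have "D = 0" using r by (simp add: zero_le_mult_iff mult_le_0_iff)
    then show ?thesis by (simp add: D_def)
  qed
  define n where "n = sqrt (sq_norm M t)"
  have n0: "0 \<le> n" by (simp add: n_def sq_norm_nonneg)
  \<comment> \<open>Pairs \<open>t\<close> with itself: \<open>t\<close> is approximated by
    \<open>v k = B (\<phi> k)\<close>, for which the pairing is a value of \<open>\<l>\<close> and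
    hence bounded by \<open>C\<close> times the norm of \<open>v k\<close>.\<close>
  have "n\<^sup>2 \<le> C * n"
  proof (rule LIMSEQ_le_const)
    have "(\<lambda>k. C * n + (C + n) * (2 * (1 / 2) ^ k)) \<longlonglongrightarrow> C * n + 0" by (intro tendsto_add tendsto_const e0)
    then show "(\<lambda>k. C * n + (C + n) * (2 * (1 / 2) ^ k)) \<longlonglongrightarrow> C * n" by simp
    have "n\<^sup>2 \<le> C * n + (C + n) * (2 * (1 / 2) ^ k)" for k
    proof -
      let ?e = "2 * (1 / 2) ^ k :: real"
      have "sqrt (sq_norm M (v k)) \<le> n + ?e"
      proof -
        have "sqrt (sq_norm M (\<lambda>x. t x + (- 1) * (t x - v k x)))
            \<le> n + sqrt (sq_norm M (\<lambda>x. (- 1) * (t x - v k x)))"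
          unfolding n_def by (rule sq_norm_triangle[OF t(1) sq_integrable_cmult[OF tv]])
        then show ?thesis using t(2)[of k] unfolding sq_norm_cmult by simp
      qed
      then have 1: "cmod (LINT x|M. t x * cnj (v k x)) \<le> C * (n + ?e)"
        using C(2)[OF \<phi>(1)[of k]] mult_left_mono[OF _ C(1)] order_trans
            unfolding riesz[OF \<phi>(1), symmetric] v_def by blast
      have 2: "cmod (LINT x|M. t x * cnj (t x - v k x)) \<le> n * ?e"
        using cauchy_schwarz_complex(2)[OF t(1) tv[of k]] mult_left_mono[OF t(2)[of k] n0]
        unfolding n_def by linarith
      have "complex_of_real (n\<^sup>2) = (LINT x|M. t x * cnj (t x))"
      proof -
        have "complex_of_real (n\<^sup>2) = complex_of_real (LINT x|M. (cmod (t x))\<^sup>2)"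
          by (simp add: n_def sq_norm_nonneg sq_norm_def)
        also have "\<dots> = (LINT x|M. t x * cnj (t x))"
          unfolding integral_complex_of_real[symmetric] complex_norm_square ..
        finally show ?thesis .
      qed
      also have "\<dots> = (LINT x|M. t x * cnj (v k x)) + (LINT x|M. t x * cnj (t x - v k x))"
        using sq_integrable_mult(2)[OF t(1) v[of k]] sq_integrable_mult(2)[OF t(1) t(1)]
        by (simp add: right_diff_distrib)
      finally have "complex_of_real (n\<^sup>2) = (LINT x|M. t x * cnj (v k x)) + (LINT x|M. t x * cnj (t x - v k
          x))" .
      then have "cmod (complex_of_real (n\<^sup>2)) \<le> C * (n + ?e) + n * ?e"
        using order_trans[OF norm_triangle_ineq add_mono[OF 1 2]] by simp
      then show ?thesis unfolding norm_of_real by (simp add: algebra_simps)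
    qed
    then show "\<exists>K. \<forall>k\<ge>K. n\<^sup>2 \<le> C * n + (C + n) * (2 * (1 / 2) ^ k)" by blast
  qed
  then have "n \<le> C" using n0 C(1) by (cases "n = 0") (auto simp: power2_eq_square)
  then show ?thesis using t(1) riesz unfolding n_def by blast
qed

section \<open>Pseudodifferential operators on test functions\<close>

lemma continuous_on_parametric_integral:
  fixes F :: "'a::euclidean_space \<Rightarrow> 'b \<Rightarrow> complex"
  assumes c: "\<And>\<xi>. continuous_on UNIV (\<lambda>x. F x \<xi>)"
    and m: "\<And>x. F x \<in> borel_measurable M"
    and g: "integrable M g" "\<And>x \<xi>. cmod (F x \<xi>) \<le> g \<xi>"
  shows "continuous_on UNIV (\<lambda>x. LINT \<xi>|M. F x \<xi>)"
  unfolding continuous_on_eq_continuous_at[OF open_UNIV]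
proof
  fix z
  show "isCont (\<lambda>x. LINT \<xi>|M. F x \<xi>) z"
    unfolding continuous_at_sequentially o_def
  proof (intro allI impI)
    fix X assume X: "X \<longlonglongrightarrow> z"
    show "(\<lambda>k. LINT \<xi>|M. F (X k) \<xi>) \<longlonglongrightarrow> (LINT \<xi>|M. F z \<xi>)"
    proof (rule integral_dominated_convergence[OF m m g(1)])
      have "isCont (\<lambda>x. F x \<xi>) z" for \<xi> using c[of \<xi>] by (simp add: continuous_on_eq_continuous_at)
      then show "AE \<xi> in M. (\<lambda>k. F (X k) \<xi>) \<longlonglongrightarrow> F z \<xi>"
        by (intro AE_I2 isCont_tendsto_compose[where g = "\<lambda>x. F x \<xi>" for \<xi>] X)
    qed (use g(2) in auto)
  qed
qed

text \<open>The fundamental lemma of the calculus of variations. Near a point with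
  \<open>D z \<noteq> 0\<close>, testing with \<open>cnj (D z)\<close> times a bump gives an
  integrand whose real part is at least half of \<open>(cmod (D z))\<^sup>2\<close> times the
  bump.\<close>

lemma continuous_eq_0_if_orthogonal:
  fixes D :: "'a::euclidean_space \<Rightarrow> complex"
  assumes D: "continuous_on UNIV D"
    and orth: "\<And>u. u \<in> test_functions UNIV \<Longrightarrow> (LINT x|lborel. u x * D x) = 0"
  shows "D z = 0"
proof (rule ccontr)
  assume nz: "D z \<noteq> 0"
  have "isCont D z" using D by (simp add: continuous_on_eq_continuous_at)
  then obtain r where r: "0 < r" "\<And>x. norm (x - z) < r \<Longrightarrow> cmod (D x - D z) < cmod (D z) / 2"
    unfolding continuous_at_eps_delta using nz by (metis dist_norm half_gt_zero_iff zero_less_norm_iff)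
  obtain \<psi> where \<psi>: "(\<lambda>x. complex_of_real (\<psi> x)) \<in> smooth_on UNIV" "\<And>x. 0 \<le> \<psi> x" "\<And>x. 0 < \<psi> x
      \<longleftrightarrow> norm (x - z) < r"
    using bump_exists[OF r(1), of z] by metis
  have \<psi>t: "(\<lambda>x. complex_of_real (\<psi> x)) \<in> test_functions UNIV"
  proof (rule test_functionsI[OF \<psi>(1) compact_cball[of z r]])
    fix x assume "x \<notin> cball z r"
    then have "\<not> 0 < \<psi> x" unfolding \<psi>(3) by (auto simp: dist_norm norm_minus_commute)
    then show "complex_of_real (\<psi> x) = 0" using \<psi>(2)[of x] by simp
  qed auto
  have i\<psi>: "integrable lborel \<psi>" using integrable_Re[OF integrable_test[OF \<psi>t]] by simp
  have u: "(\<lambda>x. cnj (D z) * complex_of_real (\<psi> x)) \<in> test_functions UNIV"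
    by (rule test_functions_cmult[OF \<psi>t])
  have i: "integrable lborel (\<lambda>x. D x * (cnj (D z) * complex_of_real (\<psi> x)))"
    by (rule integrable_test_mult[OF u D])
  have le: "(cmod (D z))\<^sup>2 / 2 * \<psi> x \<le> Re (D x * (cnj (D z) * complex_of_real (\<psi> x)))" for x
  proof (cases "norm (x - z) < r")
    case True
    have "cmod ((D x - D z) * cnj (D z)) \<le> cmod (D z) / 2 * cmod (D z)"
      using mult_right_mono[OF less_imp_le[OF r(2)[OF True]], of "cmod (D z)"] by (simp add: norm_mult)
    then have "- Re ((D x - D z) * cnj (D z)) \<le> (cmod (D z))\<^sup>2 / 2"
      using abs_Re_le_cmod[of "(D x - D z) * cnj (D z)"] by (simp add: power2_eq_square)
    moreover have "D x * cnj (D z) = complex_of_real ((cmod (D z))\<^sup>2) + (D x - D z) * cnj (D z)"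
      unfolding complex_norm_square by (simp add: algebra_simps)
    ultimately have "(cmod (D z))\<^sup>2 / 2 \<le> Re (D x * cnj (D z))" by simp
    from mult_right_mono[OF this \<psi>(2)[of x]] show ?thesis by (simp add: mult.assoc[symmetric])
  next
    case False
    then have "\<psi> x = 0" using \<psi>(2,3)[of x] by force
    then show ?thesis by simp
  qed
  have "(LINT x|lborel. (cmod (D z))\<^sup>2 / 2 * \<psi> x)
      \<le> (LINT x|lborel. Re (D x * (cnj (D z) * complex_of_real (\<psi> x))))"
    by (intro integral_mono integrable_mult_right i\<psi> integrable_Re i le)
  also have "\<dots> = 0" unfolding integral_Re[OF i] using orth[OF u] by (simp add: mult.commute)
  finally have "(LINT x|lborel. \<psi> x) \<le> 0" using nz by (simp add: mult_le_0_iff)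
  moreover have "0 \<le> (LINT x|lborel. \<psi> x)" by (rule integral_nonneg_AE) (simp add: \<psi>(2))
  ultimately have "(LINT x|lborel. \<psi> x) = 0" by simp
  then have "AE x in lborel. \<psi> x = 0" using integral_nonneg_eq_0_iff_AE[OF i\<psi>] \<psi>(2) by simp
  then have "AE x in lborel. x \<notin> ball z r"
    by eventually_elim (use \<psi>(3) in \<open>force simp: dist_norm norm_minus_commute\<close>)
  then have "emeasure lborel (ball z r) = 0"
    by (subst (asm) AE_iff_measurable[of "ball z r"]) auto
  then have "measure lborel (ball z r) = 0" by (simp add: measure_def)
  then show False using content_ball_pos[OF r(1), of z] by simp
qed

text \<open>Replaces the real order by a natural power, which integration by parts can compensate.
  For negative \<open>m\<close> the power is 0.\<close>

lemma japanese_powr_ceiling: "japanese \<xi> powr m \<le> japanese \<xi> ^ nat \<lceil>m\<rceil>"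
  by (rule japanese_powr_le) linarith

section \<open>Symbols and their slices at fixed frequency\<close>

lemma Basis_prod_fst: "b \<in> Basis \<Longrightarrow> (b, 0) \<in> Basis"
  by (auto simp: Basis_prod_def)

lemma partials_slice:
  fixes a :: "'a::euclidean_space \<times> 'a \<Rightarrow> complex"
  assumes a: "a \<in> smooth_on UNIV"
  shows "\<beta> \<in> lists Basis \<Longrightarrow> partials \<beta> (\<lambda>x. a (x, \<xi>)) x = partials (map (\<lambda>b. (b, 0)) \<beta>) a (x, \<xi>)"
    and "(\<lambda>x. a (x, \<xi>)) \<in> smooth_on UNIV"
proof -
  have lists: "map (\<lambda>b. (b, 0)) \<beta> \<in> lists (Basis :: ('a \<times> 'a) set)" if "\<beta> \<in> lists Basis" for \<beta> :: "'a list"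
    using that by (simp add: in_lists_conv_set Basis_prod_fst)
  have D: "((\<lambda>x. partials (map (\<lambda>b. (b, 0)) \<beta>) a (x, \<xi>)) has_derivative
      (\<lambda>h. frechet_derivative (partials (map (\<lambda>b. (b, 0)) \<beta>) a) (at (x, \<xi>)) (h, 0))) (at x)"
    if "\<beta> \<in> lists Basis" for \<beta> x
    by (rule has_derivative_compose[where f = "\<lambda>x. (x, \<xi>)", OF _ smooth_onD(2)[OF a lists[OF that] UNIV_I]])
       (auto intro!: derivative_eq_intros)
  show 1: "partials \<beta> (\<lambda>x. a (x, \<xi>)) x = partials (map (\<lambda>b. (b, 0)) \<beta>) a (x, \<xi>)"
    if "\<beta> \<in> lists Basis" for \<beta> x
    using that
  proof (induction \<beta> arbitrary: x)
    case (Cons b \<beta>)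
    then have "\<beta> \<in> lists Basis" by simp
    from partials_Cons_eq[OF open_UNIV UNIV_I Cons.IH D[OF this]] show ?case by simp
  qed simp
  show "(\<lambda>x. a (x, \<xi>)) \<in> smooth_on UNIV"
    by (rule smooth_onI[OF open_UNIV 1]) (use D in \<open>auto simp: differentiable_def\<close>)
qed

text \<open>Contains no derivatives in \<xi>, since every estimate works with the slice of the
  symbol in \<open>x\<close> at fixed \<xi>.\<close>

definition symbol_norm :: "real \<Rightarrow> nat \<Rightarrow> ('a::euclidean_space \<times> 'a \<Rightarrow> complex) \<Rightarrow> real" where
  "symbol_norm m j a = (\<Sum>\<beta> | set \<beta> \<subseteq> Basis \<and> length \<beta> \<le> j. Sup (range (symbol_term m [] \<beta> a)))"

lemma finite_multi_indices: "finite {\<beta>. set \<beta> \<subseteq> (Basis :: 'a::euclidean_space set) \<and> length \<beta> \<le> j}"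
  by (rule finite_lists_length_le) simp

lemma symbol_smooth: "a \<in> symbols m \<Longrightarrow> a \<in> smooth_on UNIV"
  by (simp add: symbols_def)

lemma continuous_symbol: "a \<in> symbols m \<Longrightarrow> continuous_on UNIV a"
  by (rule smooth_on_continuous[OF symbol_smooth])

lemma Sup_symbol_term_nonneg:
  assumes "a \<in> symbols m" "\<alpha> \<in> lists Basis" "\<beta> \<in> lists Basis"
  shows "0 \<le> Sup (range (symbol_term m \<alpha> \<beta> a))"
proof -
  have "symbol_term m \<alpha> \<beta> a (0, 0) \<le> Sup (range (symbol_term m \<alpha> \<beta> a))"
    using assms by (intro cSup_upper) (auto simp: symbols_def)
  moreover have "0 \<le> symbol_term m \<alpha> \<beta> a (0, 0)" by (simp add: symbol_term_def)
  ultimately show ?thesis by linarith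
qed

lemma symbol_norm_nonneg: "a \<in> symbols m \<Longrightarrow> 0 \<le> symbol_norm m j a"
  unfolding symbol_norm_def by (intro sum_nonneg Sup_symbol_term_nonneg) auto

lemma symbol_bound:
  assumes a: "a \<in> symbols m" and \<beta>: "\<beta> \<in> lists Basis" "length \<beta> \<le> j"
  shows "cmod (partials \<beta> (\<lambda>x. a (x, \<xi>)) x) \<le> japanese \<xi> powr m * symbol_norm m j a"
proof -
  have "japanese \<xi> powr (- m) * cmod (partials \<beta> (\<lambda>x. a (x, \<xi>)) x) = symbol_term m [] \<beta> a (x, \<xi>)"
    by (simp add: symbol_term_def partials_slice(1)[OF symbol_smooth[OF a] \<beta>(1)])
  also have "\<dots> \<le> Sup (range (symbol_term m [] \<beta> a))"
    using a \<beta> by (intro cSup_upper) (auto simp: symbols_def)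
  also have "\<dots> \<le> symbol_norm m j a"
    unfolding symbol_norm_def using \<beta> Sup_symbol_term_nonneg[OF a, of "[]"]
    by (intro member_le_sum finite_multi_indices) (auto simp: in_lists_conv_set)
  finally show ?thesis
    using japanese_pos[of \<xi>] by (simp add: powr_minus field_simps)
qed

lemma symbol_bound_0: "a \<in> symbols m \<Longrightarrow> cmod (a (x, \<xi>)) \<le> japanese \<xi> powr m * symbol_norm m 0 a"
  using symbol_bound[of a m "[]" 0 \<xi> x] by simp

lemma symbol_slice_test:
  assumes "a \<in> symbols m" "\<phi> \<in> test_functions S"
  shows "(\<lambda>x. a (x, \<xi>) * \<phi> x) \<in> test_functions S"
  by (rule test_functions_mult[OF assms(2) partials_slice(2)[OF symbol_smooth[OF assms(1)]]])

lemma Ck_norm_symbol_slice: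
  assumes a: "a \<in> symbols m" and \<phi>: "\<phi> \<in> test_functions K" "compact K"
  shows "Ck_norm K j (\<lambda>x. a (x, \<xi>) * \<phi> x) \<le> 2 ^ j * (japanese \<xi> powr m * symbol_norm m j a) * Ck_norm K j \<phi>"
proof (rule Ck_norm_le)
  fix x and \<alpha> :: "'a list" assume "x \<in> K" "\<alpha> \<in> lists Basis" "length \<alpha> \<le> j"
  then show "cmod (partials \<alpha> (\<lambda>x. a (x, \<xi>) * \<phi> x) x)
      \<le> 2 ^ j * (japanese \<xi> powr m * symbol_norm m j a) * Ck_norm K j \<phi>"
    by (intro norm_partials_mult_le[OF open_UNIV partials_slice(2)[OF symbol_smooth[OF a]]
        test_functions_smooth[OF \<phi>(1)]]
        symbol_bound[OF a] test_partials_le[OF \<phi>]) auto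
qed (auto intro!: mult_nonneg_nonneg symbol_norm_nonneg[OF a] test_Ck_norm_nonneg[OF \<phi>])

text \<open>The inner integral of \<open>psido_transpose\<close>. It is the Fourier transform of the
  test function \<open>a (x, \<xi>) * \<phi> x\<close> at \<open>- \<xi>\<close>, where \<xi> is
  both parameter and argument.\<close>

definition symbol_fourier ::
    "('a::euclidean_space \<times> 'a \<Rightarrow> complex) \<Rightarrow> ('a \<Rightarrow> complex) \<Rightarrow> 'a \<Rightarrow> complex" where
  "symbol_fourier a \<phi> \<xi> = (LINT x|lborel. cis (x \<bullet> \<xi>) * a (x, \<xi>) * \<phi> x)"

lemma symbol_fourier_eq: "symbol_fourier a \<phi> \<xi> = fourier (\<lambda>x. a (x, \<xi>) * \<phi> x) (- \<xi>)"
  by (simp add: symbol_fourier_def fourier_def mult.assoc)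

lemma psido_transpose_eq: "psido_transpose a \<phi> y =
    1 / (2 * pi) ^ DIM('a) * (LINT \<xi>|lborel. cis (- (y \<bullet> \<xi>)) * symbol_fourier a \<phi> (\<xi>::'a::euclidean_space))"
  by (simp add: psido_transpose_def symbol_fourier_def)

lemma measurable_symbol_kernel:
  fixes a :: "'a::euclidean_space \<times> 'a \<Rightarrow> complex"
  assumes "a \<in> symbols m"
  shows "(\<lambda>(\<xi>, x). cis (x \<bullet> \<xi>) * a (x, \<xi>)) \<in> borel_measurable (borel \<Otimes>\<^sub>M borel)"
  unfolding borel_prod case_prod_beta
  by (intro borel_measurable_continuous_onI continuous_intros
      continuous_on_compose2[OF continuous_symbol[OF assms]]) auto

lemma measurable_symbol_fourier:
  fixes \<phi> :: "'a::euclidean_space \<Rightarrow> complex"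
  assumes a: "a \<in> symbols m" and \<phi>: "\<phi> \<in> test_functions S"
  shows "symbol_fourier a \<phi> \<in> borel_measurable borel"
proof -
  have "\<phi> \<in> borel_measurable borel"
    by (rule borel_measurable_continuous_onI[OF test_functions_continuous[OF \<phi>]])
  then have "(\<lambda>p. \<phi> (snd p)) \<in> borel_measurable (borel \<Otimes>\<^sub>M (borel :: 'a measure))" by measurable
  from borel_measurable_times[OF measurable_symbol_kernel[OF a] this]
  have "(\<lambda>(\<xi>, x). cis (x \<bullet> \<xi>) * a (x, \<xi>) * \<phi> x) \<in> borel_measurable (borel \<Otimes>\<^sub>M lborel)"
    by (simp add: case_prod_beta measurable_cong_sets[OF sets_pair_measure_cong[OF refl sets_lborel] refl])
  then show ?thesis
    unfolding symbol_fourier_def[abs_def] by (rule lborel.borel_measurable_lebesgue_integral)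
qed

text \<open>Decay of order \<open>p\<close> costs \<open>p + q\<close> derivatives: \<open>q\<close>
  of them pay for the growth of the symbol, which is at most of the size
  \<open>japanese \<xi> ^ q\<close>. The constant is uniform in the symbol as well as in
  \<phi>.\<close>

lemma symbol_fourier_decay:
  fixes K :: "'a::euclidean_space set"
  assumes K: "compact K"
  shows "\<exists>k. \<exists>C\<ge>0. \<forall>a\<in>symbols m. \<forall>\<phi>\<in>test_functions K. \<forall>\<xi>.
    japanese \<xi> ^ p * cmod (symbol_fourier a \<phi> \<xi>) \<le> C * (symbol_norm m k a * Ck_norm K k \<phi>)"
proof -
  define q k where "q = nat \<lceil>m\<rceil>" and "k = p + q"
  obtain C where C: "0 \<le> C" "\<And>f \<xi>. f \<in> test_functions K \<Longrightarrow> japanese \<xi> ^ k * cmod (fourier f \<xi>)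
      \<le> C * Ck_norm K k f"
    using fourier_decay[OF K, of k] by blast
  have "japanese \<xi> ^ p * cmod (symbol_fourier a \<phi> \<xi>) \<le> C * 2 ^ k * (symbol_norm m k a * Ck_norm K k \<phi>)"
    if a: "a \<in> symbols m" and \<phi>: "\<phi> \<in> test_functions K" for a \<phi> \<xi>
  proof -
    \<comment> \<open>The factor \<open>japanese \<xi> ^ q\<close> is carried along on both sides
      and cancelled at the end.\<close>
    have "japanese \<xi> ^ q * (japanese \<xi> ^ p * cmod (symbol_fourier a \<phi> \<xi>))
        = japanese (- \<xi>) ^ k * cmod (fourier (\<lambda>x. a (x, \<xi>) * \<phi> x) (- \<xi>))"
      by (simp add: symbol_fourier_eq k_def power_add mult_ac)
    also have "\<dots> \<le> C * Ck_norm K k (\<lambda>x. a (x, \<xi>) * \<phi> x)"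
      by (rule C(2)[OF symbol_slice_test[OF a \<phi>]])
    also have "\<dots> \<le> C * (2 ^ k * (japanese \<xi> powr m * symbol_norm m k a) * Ck_norm K k \<phi>)"
      by (intro mult_left_mono Ck_norm_symbol_slice[OF a \<phi> K] C)
    also have "\<dots> = japanese \<xi> powr m * (C * 2 ^ k * (symbol_norm m k a * Ck_norm K k \<phi>))"
        by (simp add: mult_ac)
    also have "\<dots> \<le> japanese \<xi> ^ q * (C * 2 ^ k * (symbol_norm m k a * Ck_norm K k \<phi>))"
      unfolding q_def
      by (intro mult_right_mono japanese_powr_ceiling mult_nonneg_nonneg C symbol_norm_nonneg[OF a]
          test_Ck_norm_nonneg[OF \<phi> K]) auto
    finally show ?thesis using japanese_pos[of \<xi>] by simp
  qed
  then show ?thesis using C(1) by (intro exI[of _ k] exI[of _ "C * 2 ^ k"]) auto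
qed

lemma integrable_symbol_fourier:
  fixes \<phi> :: "'a::euclidean_space \<Rightarrow> complex"
  assumes a: "a \<in> symbols m" and \<phi>: "\<phi> \<in> test_functions S"
  shows "integrable lborel (symbol_fourier a \<phi>)"
proof -
  obtain K where K: "compact K" "\<phi> \<in> test_functions K" by (rule test_functionsE[OF \<phi>])
  then obtain k C where "\<forall>a\<in>symbols m. \<forall>\<phi>\<in>test_functions K. \<forall>\<xi>.
    japanese \<xi> ^ (2 * DIM('a)) * cmod (symbol_fourier a \<phi> \<xi>) \<le> C * (symbol_norm m k a * Ck_norm K k \<phi>)"
    using symbol_fourier_decay[OF K(1), of m "2 * DIM('a)"] by blast
  then show ?thesis using K a
    by (intro integrable_rapid_decay(1)[OF measurable_symbol_fourier[OF a \<phi>] order_refl]) blast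
qed

lemma integrable_cis_mult:
  assumes "integrable lborel f"
  shows "integrable lborel (\<lambda>\<xi>. cis (y \<bullet> \<xi>) * f \<xi>)" "integrable lborel (\<lambda>\<xi>. cis (- (y \<bullet> \<xi>)) * f \<xi>)"
proof -
  have "(\<lambda>\<xi>. cis (y \<bullet> \<xi>)) \<in> borel_measurable borel" "(\<lambda>\<xi>. cis (- (y \<bullet> \<xi>))) \<in> borel_measurable borel"
    using smooth_on_continuous[OF smooth_cis, of UNIV y]
    by (auto intro!: borel_measurable_continuous_onI continuous_intros simp: inner_commute)
  then show "integrable lborel (\<lambda>\<xi>. cis (y \<bullet> \<xi>) * f \<xi>)" "integrable lborel (\<lambda>\<xi>. cis (- (y \<bullet> \<xi>)) * f \<xi>)"
    using assms by (auto intro!: integrable_norm_bound[OF integrable_norm[OF assms]] simp: norm_mult)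
qed

text \<open>A bound in the supremum norm is the right one for pairing with square integrable
  functions on a domain of finite measure.\<close>

lemma psido_transpose_bound:
  fixes K :: "'a::euclidean_space set"
  assumes K: "compact K"
  shows "\<exists>k. \<exists>C\<ge>0. \<forall>a\<in>symbols m. \<forall>\<phi>\<in>test_functions K. \<forall>y.
    cmod (psido_transpose a \<phi> y) \<le> C * (symbol_norm m k a * Ck_norm K k \<phi>)"
proof -
  let ?p = "2 * DIM('a)"
  define I where "I = (LINT \<xi>|lborel. 1 / japanese (\<xi>::'a) ^ (2 * DIM('a)))"
  have I: "0 \<le> I" unfolding I_def by (rule integral_nonneg_AE) auto
  obtain k C where C: "0 \<le> C" "\<And>a \<phi> \<xi>. a \<in> symbols m \<Longrightarrow> \<phi> \<in> test_functions K \<Longrightarrow>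
    japanese \<xi> ^ ?p * cmod (symbol_fourier a \<phi> \<xi>) \<le> C * (symbol_norm m k a * Ck_norm K k \<phi>)"
    using symbol_fourier_decay[OF K, of m ?p] by blast
  let ?c = "1 / (2 * pi) ^ DIM('a)"
  have "cmod (psido_transpose a \<phi> y) \<le> ?c * C * I * (symbol_norm m k a * Ck_norm K k \<phi>)"
    if a: "a \<in> symbols m" and \<phi>: "\<phi> \<in> test_functions K" for a \<phi> y
  proof -
    have "cmod (LINT \<xi>|lborel. cis (- (y \<bullet> \<xi>)) * symbol_fourier a \<phi> \<xi>)
        \<le> C * (symbol_norm m k a * Ck_norm K k \<phi>) * I"
      unfolding I_def
      by (rule integrable_rapid_decay(2)[of _ ?p])
         (use C(2)[OF a \<phi>] borel_measurable_integrable[OF integrable_cis_mult(2)[OF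
             integrable_symbol_fourier[OF a \<phi>]]]
           in \<open>auto simp: norm_mult\<close>)
    from mult_left_mono[OF this, of ?c] show ?thesis
      unfolding psido_transpose_eq by (simp add: norm_mult norm_divide norm_power mult_ac)
  qed
  then show ?thesis using C(1) I by (intro exI[of _ k] exI[of _ "?c * C * I"]) auto
qed

lemma continuous_psido_transpose:
  fixes \<phi> :: "'a::euclidean_space \<Rightarrow> complex"
  assumes a: "a \<in> symbols m" and \<phi>: "\<phi> \<in> test_functions S"
  shows "continuous_on UNIV (psido_transpose a \<phi>)"
  unfolding psido_transpose_eq[abs_def]
  by (intro continuous_on_mult continuous_on_const continuous_on_parametric_integral[OF _ _
        integrable_norm[OF integrable_symbol_fourier[OF a \<phi>]]]
      borel_measurable_integrable[OF integrable_cis_mult(2)[OF integrable_symbol_fourier[OF a \<phi>]]])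
     (auto intro!: continuous_intros smooth_on_continuous[OF smooth_cis] simp: norm_mult)

lemma integrable_symbol_slice:
  assumes a: "a \<in> symbols m" and \<phi>: "\<phi> \<in> test_functions S"
  shows "integrable lborel (\<lambda>x. cis (x \<bullet> \<xi>) * a (x, \<xi>) * \<phi> x)"
  using integrable_fourier[OF symbol_slice_test[OF a \<phi>], of "- \<xi>"] by (simp add: mult.assoc)

lemma psido_transpose_add:
  assumes a: "a \<in> symbols m" and \<phi>: "\<phi> \<in> test_functions S" "\<psi> \<in> test_functions S"
  shows "psido_transpose a (\<lambda>x. \<phi> x + \<psi> x) y = psido_transpose a \<phi> y + psido_transpose a \<psi> y"
proof -
  have "symbol_fourier a (\<lambda>x. \<phi> x + \<psi> x) = (\<lambda>\<xi>. symbol_fourier a \<phi> \<xi> + symbol_fourier a \<psi> \<xi>)"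
    using integrable_symbol_slice[OF a \<phi>(1)] integrable_symbol_slice[OF a \<phi>(2)]
    unfolding symbol_fourier_def by (simp add: distrib_left)
  then show ?thesis
    using integrable_cis_mult(2)[OF integrable_symbol_fourier[OF a \<phi>(1)], of y]
      integrable_cis_mult(2)[OF integrable_symbol_fourier[OF a \<phi>(2)], of y]
    unfolding psido_transpose_eq by (simp add: distrib_left add_divide_distrib)
qed

lemma psido_transpose_cmult:
  "psido_transpose a (\<lambda>x. c * \<phi> x) y = c * psido_transpose a \<phi> y"
proof -
  have "symbol_fourier a (\<lambda>x. c * \<phi> x) = (\<lambda>\<xi>. c * symbol_fourier a \<phi> \<xi>)"
    unfolding symbol_fourier_def by (simp add: mult.left_commute[of _ c])
  then show ?thesis unfolding psido_transpose_eq by (simp add: mult.left_commute[of _ c])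
qed

lemma psido_transpose_diff_symbol:
  assumes a: "a \<in> symbols m" "b \<in> symbols m" and \<phi>: "\<phi> \<in> test_functions S"
  shows "psido_transpose (\<lambda>p. a p - b p) \<phi> y = psido_transpose a \<phi> y - psido_transpose b \<phi> y"
proof -
  have "symbol_fourier (\<lambda>p. a p - b p) \<phi> = (\<lambda>\<xi>. symbol_fourier a \<phi> \<xi> - symbol_fourier b \<phi> \<xi>)"
    using integrable_symbol_slice[OF a(1) \<phi>] integrable_symbol_slice[OF a(2) \<phi>]
    unfolding symbol_fourier_def by (simp add: left_diff_distrib right_diff_distrib)
  then show ?thesis
    using integrable_cis_mult(2)[OF integrable_symbol_fourier[OF a(1) \<phi>], of y]
      integrable_cis_mult(2)[OF integrable_symbol_fourier[OF a(2) \<phi>], of y]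
    unfolding psido_transpose_eq by (simp add: right_diff_distrib diff_divide_distrib)
qed

text \<open>The weighted transform in the second part gives a majorant for the first that is
  independent of \<open>x\<close>; it is also the integrable factor in the exchange of integrals for
  the transpose.\<close>

lemma integrable_symbol_fourier_density:
  fixes \<phi> :: "'a::euclidean_space \<Rightarrow> complex"
  assumes a: "a \<in> symbols m" and \<phi>: "\<phi> \<in> test_functions S"
  shows "integrable lborel (\<lambda>\<xi>. cis (x \<bullet> \<xi>) * a (x, \<xi>) * fourier \<phi> \<xi>)"
    and "integrable lborel (\<lambda>\<xi>. complex_of_real (japanese \<xi> ^ nat \<lceil>m\<rceil>) * fourier \<phi> \<xi>)"
proof -
  let ?q = "nat \<lceil>m\<rceil>" and ?p = "2 * DIM('a)"
  obtain K where K: "compact K" "\<phi> \<in> test_functions K" by (rule test_functionsE[OF \<phi>])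
  obtain C where C: "\<forall>\<xi>. japanese \<xi> ^ (?p + ?q) * cmod (fourier \<phi> \<xi>) \<le> C * Ck_norm K (?p + ?q) \<phi>"
    using fourier_decay[OF K(1), of "?p + ?q"] K(2) by blast
  have [measurable]: "fourier \<phi> \<in> borel_measurable borel" by (rule measurable_fourier[OF \<phi>])
  show i: "integrable lborel (\<lambda>\<xi>. complex_of_real (japanese \<xi> ^ ?q) * fourier \<phi> \<xi>)"
  proof (rule integrable_rapid_decay(1)[OF _ order_refl])
    show "japanese \<xi> ^ ?p * cmod (complex_of_real (japanese \<xi> ^ ?q) * fourier \<phi> \<xi>)
        \<le> C * Ck_norm K (?p + ?q) \<phi>" for \<xi>
      using C[rule_format, of \<xi>] by (simp add: norm_mult norm_power power_add mult_ac)
  qed measurable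
  show "integrable lborel (\<lambda>\<xi>. cis (x \<bullet> \<xi>) * a (x, \<xi>) * fourier \<phi> \<xi>)"
  proof (rule integrable_norm_bound)
    show "integrable lborel (\<lambda>\<xi>. symbol_norm m 0 a * cmod (complex_of_real (japanese \<xi> ^ ?q) * fourier \<phi>
        \<xi>))"
      by (intro integrable_mult_right integrable_norm i)
    have "continuous_on UNIV (\<lambda>\<xi>. cis (x \<bullet> \<xi>) * a (x, \<xi>))"
      by (intro continuous_intros continuous_on_compose2[OF continuous_symbol[OF a]]) auto
    from borel_measurable_continuous_onI[OF this]
    show "(\<lambda>\<xi>. cis (x \<bullet> \<xi>) * a (x, \<xi>) * fourier \<phi> \<xi>) \<in> borel_measurable lborel"
      by (intro borel_measurable_times[of "\<lambda>\<xi>. cis (x \<bullet> \<xi>) * a (x, \<xi>)"]) auto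
    fix \<xi>
    have "cmod (a (x, \<xi>)) \<le> japanese \<xi> ^ ?q * symbol_norm m 0 a"
      by (rule order_trans[OF symbol_bound_0[OF a] mult_right_mono[OF japanese_powr_ceiling
          symbol_norm_nonneg[OF a]]])
    from mult_right_mono[OF this, of "cmod (fourier \<phi> \<xi>)"]
    show "cmod (cis (x \<bullet> \<xi>) * a (x, \<xi>) * fourier \<phi> \<xi>)
        \<le> symbol_norm m 0 a * cmod (complex_of_real (japanese \<xi> ^ ?q) * fourier \<phi> \<xi>)"
      by (simp add: norm_mult norm_power mult_ac)
  qed
qed

text \<open>All derivatives fall on \<phi> here, so \<open>symbol_norm m 0\<close> suffices. For the
  transpose the symbol and \<phi> are transformed together, and derivatives of the symbol
  enter.\<close>

lemma psido_bound:
  fixes K :: "'a::euclidean_space set"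
  assumes K: "compact K"
  shows "\<exists>k. \<exists>C\<ge>0. \<forall>a\<in>symbols m. \<forall>\<phi>\<in>test_functions K. \<forall>x.
    cmod (psido a \<phi> x) \<le> C * (symbol_norm m 0 a * Ck_norm K k \<phi>)"
proof -
  define q p k where "q = nat \<lceil>m\<rceil>" and "p = 2 * DIM('a)" and "k = p + q"
  define I where "I = (LINT \<xi>|lborel. 1 / japanese (\<xi>::'a) ^ (2 * DIM('a)))"
  have I: "0 \<le> I" unfolding I_def by (rule integral_nonneg_AE) auto
  obtain C where C: "0 \<le> C" "\<And>f \<xi>. f \<in> test_functions K \<Longrightarrow> japanese \<xi> ^ k * cmod (fourier f \<xi>)
      \<le> C * Ck_norm K k f"
    using fourier_decay[OF K, of k] by blast
  let ?c = "1 / (2 * pi) ^ DIM('a)"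
  have "cmod (psido a \<phi> x) \<le> ?c * C * I * (symbol_norm m 0 a * Ck_norm K k \<phi>)"
    if a: "a \<in> symbols m" and \<phi>: "\<phi> \<in> test_functions K" for a \<phi> x
  proof -
    have le: "japanese \<xi> ^ p * cmod (cis (x \<bullet> \<xi>) * a (x, \<xi>) * fourier \<phi> \<xi>)
        \<le> C * (symbol_norm m 0 a * Ck_norm K k \<phi>)" for \<xi>
    proof -
      have "cmod (a (x, \<xi>)) \<le> japanese \<xi> ^ q * symbol_norm m 0 a"
        unfolding q_def
        by (rule order_trans[OF symbol_bound_0[OF a] mult_right_mono[OF japanese_powr_ceiling
            symbol_norm_nonneg[OF a]]])
      then have "japanese \<xi> ^ p * (cmod (a (x, \<xi>)) * cmod (fourier \<phi> \<xi>))
          \<le> japanese \<xi> ^ p * (japanese \<xi> ^ q * symbol_norm m 0 a * cmod (fourier \<phi> \<xi>))"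
        by (intro mult_left_mono mult_right_mono) auto
      also have "\<dots> = symbol_norm m 0 a * (japanese \<xi> ^ k * cmod (fourier \<phi> \<xi>))"
        by (simp add: k_def power_add mult_ac)
      also have "\<dots> \<le> symbol_norm m 0 a * (C * Ck_norm K k \<phi>)"
        by (intro mult_left_mono C \<phi> symbol_norm_nonneg[OF a])
      finally show ?thesis by (simp add: norm_mult mult_ac)
    qed
    have "cmod (LINT \<xi>|lborel. cis (x \<bullet> \<xi>) * a (x, \<xi>) * fourier \<phi> \<xi>)
        \<le> C * (symbol_norm m 0 a * Ck_norm K k \<phi>) * I"
      unfolding I_def
      by (rule integrable_rapid_decay(2)[OF _ _ le])
         (use borel_measurable_integrable[OF integrable_symbol_fourier_density(1)[OF a \<phi>]] in \<open>auto simp: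
             p_def\<close>)
    from mult_left_mono[OF this, of ?c] show ?thesis
      unfolding psido_def by (simp add: norm_mult norm_divide norm_power mult_ac)
  qed
  then show ?thesis using C(1) I by (intro exI[of _ k] exI[of _ "?c * C * I"]) auto
qed

lemma continuous_psido:
  fixes \<phi> :: "'a::euclidean_space \<Rightarrow> complex"
  assumes a: "a \<in> symbols m" and \<phi>: "\<phi> \<in> test_functions S"
  shows "continuous_on UNIV (psido a \<phi>)"
  unfolding psido_def[abs_def]
proof (intro continuous_on_mult continuous_on_const continuous_on_parametric_integral
    borel_measurable_integrable[OF integrable_symbol_fourier_density(1)[OF a \<phi>]])
  show "integrable lborel (\<lambda>\<xi>. symbol_norm m 0 a * cmod (complex_of_real (japanese \<xi> ^ nat \<lceil>m\<rceil>) * fourier \<phi>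
      \<xi>))"
    by (intro integrable_mult_right integrable_norm integrable_symbol_fourier_density(2)[OF a \<phi>])
  show "continuous_on UNIV (\<lambda>x. a (x, \<xi>))" for \<xi>
    by (rule continuous_on_compose2[OF continuous_symbol[OF a]]) (auto intro!: continuous_intros)
  show "continuous_on UNIV (\<lambda>x. cis (x \<bullet> \<xi>))" for \<xi> :: 'a by (intro continuous_intros)
  fix x \<xi>
  have "cmod (a (x, \<xi>)) \<le> japanese \<xi> ^ nat \<lceil>m\<rceil> * symbol_norm m 0 a"
    by (rule order_trans[OF symbol_bound_0[OF a] mult_right_mono[OF japanese_powr_ceiling
        symbol_norm_nonneg[OF a]]])
  from mult_right_mono[OF this, of "cmod (fourier \<phi> \<xi>)"]
  show "cmod (cis (x \<bullet> \<xi>) * a (x, \<xi>) * fourier \<phi> \<xi>)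
      \<le> symbol_norm m 0 a * cmod (complex_of_real (japanese \<xi> ^ nat \<lceil>m\<rceil>) * fourier \<phi> \<xi>)"
    by (simp add: norm_mult norm_power mult_ac)
qed

lemma fourier_add:
  "f \<in> test_functions S \<Longrightarrow> g \<in> test_functions S \<Longrightarrow> fourier (\<lambda>x. f x + g x) \<xi> = fourier f \<xi> + fourier g \<xi>"
  using integrable_fourier[of f S \<xi>] integrable_fourier[of g S \<xi>] by (simp add: fourier_def distrib_left)

lemma psido_add:
  assumes a: "a \<in> symbols m" and \<phi>: "\<phi> \<in> test_functions S" "\<psi> \<in> test_functions S"
  shows "psido a (\<lambda>x. \<phi> x + \<psi> x) x = psido a \<phi> x + psido a \<psi> x"
  using integrable_symbol_fourier_density(1)[OF a \<phi>(1), of x] integrable_symbol_fourier_density(1)[OF a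
      \<phi>(2), of x]
  unfolding psido_def fourier_add[OF \<phi>] by (simp add: distrib_left add_divide_distrib)

lemma psido_cmult: "psido a (\<lambda>x. c * \<phi> x) x = c * psido a \<phi> x"
  unfolding psido_def fourier_cmult by (simp add: mult.left_commute[of _ c])

lemma psido_diff_symbol:
  assumes a: "a \<in> symbols m" "b \<in> symbols m" and \<phi>: "\<phi> \<in> test_functions S"
  shows "psido (\<lambda>p. a p - b p) \<phi> x = psido a \<phi> x - psido b \<phi> x"
  using integrable_symbol_fourier_density(1)[OF a(1) \<phi>, of x] integrable_symbol_fourier_density(1)[OF a(2)
      \<phi>, of x]
  unfolding psido_def by (simp add: left_diff_distrib right_diff_distrib diff_divide_distrib)

lemma psido_transpose_pairing:
  fixes u :: "'a::euclidean_space \<Rightarrow> complex"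
  assumes a: "a \<in> symbols m" and u: "u \<in> test_functions S" and \<phi>: "\<phi> \<in> test_functions T"
  shows "(LINT x|lborel. psido a u x * \<phi> x) = (LINT y|lborel. u y * psido_transpose a \<phi> y)"
proof -
  let ?q = "nat \<lceil>m\<rceil>" and ?c = "complex_of_real (1 / (2 * pi) ^ DIM('a))"
  \<comment> \<open>The symbol may be unbounded in \<xi>. Dividing it by \<open>?J\<close> yields a
    bounded kernel, and the transform of \<open>u\<close> multiplied by \<open>?J\<close> is still
    integrable.\<close>
  let ?J = "\<lambda>\<xi>::'a. complex_of_real (japanese \<xi> ^ ?q)"
  have J: "?J \<xi> \<noteq> 0" for \<xi> using japanese_pos[of \<xi>] by simp
  have cancel: "z / j * (j * f) * p = f * (z * p)" if "j \<noteq> 0" for z j f p :: complex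
    using that by simp
  have "(LINT x|lborel. psido a u x * \<phi> x) = ?c * (LINT x|lborel. (LINT \<xi>|lborel. cis (x \<bullet> \<xi>) * a (x, \<xi>) /
      ?J \<xi> * (?J \<xi> * fourier u \<xi>) * \<phi> x))"
  proof -
    have "psido a u x * \<phi> x = ?c * (LINT \<xi>|lborel. cis (x \<bullet> \<xi>) * a (x, \<xi>) / ?J \<xi> * (?J \<xi> * fourier u \<xi>) * \<phi>
        x)" for x
    proof -
      have "cis (x \<bullet> \<xi>) * a (x, \<xi>) / ?J \<xi> * (?J \<xi> * fourier u \<xi>) * \<phi> x
          = cis (x \<bullet> \<xi>) * a (x, \<xi>) * fourier u \<xi> * \<phi> x" for \<xi>
        unfolding cancel[OF J] by simp
      then show ?thesis unfolding psido_def by (simp only: integral_mult_left_zero) simp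
    qed
    then show ?thesis by (simp only: integral_mult_right_zero)
  qed
  also have "(LINT x|lborel. (LINT \<xi>|lborel. cis (x \<bullet> \<xi>) * a (x, \<xi>) / ?J \<xi> * (?J \<xi> * fourier u \<xi>) * \<phi> x))
      = (LINT \<xi>|lborel. (LINT x|lborel. cis (x \<bullet> \<xi>) * a (x, \<xi>) / ?J \<xi> * (?J \<xi> * fourier u \<xi>) * \<phi> x))"
  proof (rule fubini_bounded_kernel[OF integrable_symbol_fourier_density(2)[OF a u] integrable_test[OF \<phi>]])
    show "(\<lambda>(\<xi>, x). cis (x \<bullet> \<xi>) * a (x, \<xi>) / ?J \<xi>) \<in> borel_measurable borel"
      unfolding case_prod_beta
      by (intro borel_measurable_continuous_onI continuous_intros continuous_on_compose2[OF
          continuous_symbol[OF a]]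
          continuous_on_compose2[OF continuous_japanese, of UNIV]) (use J in auto)
    show "cmod (cis (x \<bullet> \<xi>) * a (x, \<xi>) / ?J \<xi>) \<le> symbol_norm m 0 a" for x \<xi>
    proof -
      have "cmod (a (x, \<xi>)) \<le> japanese \<xi> ^ ?q * symbol_norm m 0 a"
        by (rule order_trans[OF symbol_bound_0[OF a] mult_right_mono[OF japanese_powr_ceiling
            symbol_norm_nonneg[OF a]]])
      then show ?thesis
        using japanese_pos[of \<xi>] by (simp add: norm_mult norm_divide norm_power pos_divide_le_eq
            mult.commute)
    qed
  qed
  also have "\<dots> = (LINT \<xi>|lborel. (LINT y|lborel. cis (- (y \<bullet> \<xi>)) * u y * symbol_fourier a \<phi> \<xi>))"
  proof (rule Bochner_Integration.integral_cong[OF refl])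
    fix \<xi>
    have "(LINT x|lborel. cis (x \<bullet> \<xi>) * a (x, \<xi>) / ?J \<xi> * (?J \<xi> * fourier u \<xi>) * \<phi> x)
        = (LINT x|lborel. fourier u \<xi> * (cis (x \<bullet> \<xi>) * a (x, \<xi>) * \<phi> x))"
      unfolding cancel[OF J] ..
    also have "\<dots> = fourier u \<xi> * symbol_fourier a \<phi> \<xi>"
      unfolding symbol_fourier_def by (rule integral_mult_right_zero)
    also have "\<dots> = (LINT y|lborel. cis (- (y \<bullet> \<xi>)) * u y * symbol_fourier a \<phi> \<xi>)"
      unfolding fourier_def by (rule integral_mult_left_zero[symmetric])
    finally show "(LINT x|lborel. cis (x \<bullet> \<xi>) * a (x, \<xi>) / ?J \<xi> * (?J \<xi> * fourier u \<xi>) * \<phi> x)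
        = (LINT y|lborel. cis (- (y \<bullet> \<xi>)) * u y * symbol_fourier a \<phi> \<xi>)" .
  qed
  also have "\<dots> = (LINT y|lborel. (LINT \<xi>|lborel. cis (- (y \<bullet> \<xi>)) * u y * symbol_fourier a \<phi> \<xi>))"
    by (rule fubini_bounded_kernel[OF integrable_test[OF u] integrable_symbol_fourier[OF a \<phi>], where B = 1])
       (auto simp: case_prod_beta simp flip: inner_minus_left intro!: borel_measurable_continuous_onI
           continuous_intros)
  also have "?c * \<dots> = (LINT y|lborel. u y * psido_transpose a \<phi> y)"
  proof -
    have "u y * psido_transpose a \<phi> y = ?c * (LINT \<xi>|lborel. cis (- (y \<bullet> \<xi>)) * u y * symbol_fourier a \<phi> \<xi>)"
        for y
    proof -
      have "cis (- (y \<bullet> \<xi>)) * u y * symbol_fourier a \<phi> \<xi> = u y * (cis (- (y \<bullet> \<xi>)) * symbol_fourier a \<phi> \<xi>)"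
          for \<xi>
        by simp
      then show ?thesis unfolding psido_transpose_eq by (simp only: integral_mult_right_zero) simp
    qed
    then show ?thesis by (simp only: integral_mult_right_zero)
  qed
  finally show ?thesis .
qed

text \<open>The adjoint identity with \<open>v = cnj \<phi>\<close> says that both sides have the
  same integral against every test function \<open>u\<close>; being continuous, they agree
  everywhere.\<close>

lemma psido_transpose_adjoint:
  fixes \<phi> :: "'a::euclidean_space \<Rightarrow> complex"
  assumes ab: "adjoint_symbol m a b" and a: "a \<in> symbols m" and \<phi>: "\<phi> \<in> test_functions S"
  shows "psido_transpose a \<phi> y = cnj (psido b (\<lambda>x. cnj (\<phi> x)) y)"
proof -
  have b: "b \<in> symbols m" using ab by (simp add: adjoint_symbol_def)
  have \<phi>': "(\<lambda>x. cnj (\<phi> x)) \<in> test_functions S" by (rule test_functions_cnj[OF \<phi>])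
  have cont: "continuous_on UNIV (\<lambda>y. cnj (psido b (\<lambda>x. cnj (\<phi> x)) y))"
    by (intro continuous_intros continuous_psido[OF b \<phi>'])
  have "psido_transpose a \<phi> y - cnj (psido b (\<lambda>x. cnj (\<phi> x)) y) = 0"
  proof (rule continuous_eq_0_if_orthogonal[where D =
      "\<lambda>y. psido_transpose a \<phi> y - cnj (psido b (\<lambda>x. cnj (\<phi> x)) y)"])
    show "continuous_on UNIV (\<lambda>y. psido_transpose a \<phi> y - cnj (psido b (\<lambda>x. cnj (\<phi> x)) y))"
      by (intro continuous_on_diff continuous_psido_transpose[OF a \<phi>] cont)
    fix u :: "'a \<Rightarrow> complex" assume u: "u \<in> test_functions UNIV"
    have "(LINT x|lborel. psido a u x * cnj (cnj (\<phi> x)))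
        = (LINT x|lborel. u x * cnj (psido b (\<lambda>x. cnj (\<phi> x)) x))"
      using bspec[OF bspec[OF conjunct2[OF ab[unfolded adjoint_symbol_def]] test_functions_schwartz[OF u]]
          test_functions_schwartz[OF \<phi>']] .
    then have "(LINT x|lborel. u x * psido_transpose a \<phi> x)
        = (LINT x|lborel. u x * cnj (psido b (\<lambda>x. cnj (\<phi> x)) x))"
      using psido_transpose_pairing[OF a u \<phi>] by simp
    then show "(LINT y|lborel. u y * (psido_transpose a \<phi> y - cnj (psido b (\<lambda>x. cnj (\<phi> x)) y))) = 0"
      using integrable_test_mult[OF u continuous_psido_transpose[OF a \<phi>]] integrable_test_mult[OF u cont]
      by (simp add: right_diff_distrib mult.commute)
  qed
  then show ?thesis by simp
qed

text \<open>The duality of Sobolev spaces: the weights \<open>japanese \<xi> powr (- s)\<close> and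
  \<open>japanese \<xi> powr s\<close> cancel, and the Cauchy-Schwarz inequality applies to the
  weighted densities.\<close>

lemma sobolev_pairing:
  fixes \<phi> :: "'a::euclidean_space \<Rightarrow> complex"
  assumes g: "fourier_density (- s) u g" and \<phi>: "\<phi> \<in> test_functions S"
  shows "cmod (u \<phi>) \<le> fourier_norm (- s) g * sobolev_norm_fun s \<phi>"
proof -
  let ?c = "1 / (2 * pi) ^ DIM('a)"
  define \<gamma> where "\<gamma> \<xi> = complex_of_real (japanese \<xi> powr (- s)) * g \<xi>" for \<xi> :: 'a
  define w where "w \<xi> = complex_of_real (japanese \<xi> powr s) * fourier \<phi> (- \<xi>)" for \<xi> :: 'a
  have [measurable]: "fourier \<phi> \<in> borel_measurable borel" "g \<in> borel_measurable borel"
    using measurable_fourier[OF \<phi>] g by (auto simp: fourier_density_def)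
  have \<gamma>: "sq_integrable lborel \<gamma>"
    using g by (simp add: sq_integrable_def \<gamma>_def[abs_def] fourier_density_def norm_mult)
  obtain K where K: "compact K" "\<phi> \<in> test_functions K" by (rule test_functionsE[OF \<phi>])
  \<comment> \<open>A bounded integrable function is square integrable; both properties follow from
    rapid decay.\<close>
  have w: "sq_integrable lborel w"
  proof -
    let ?q = "nat \<lceil>s\<rceil>" and ?p = "2 * DIM('a)"
    obtain C where C: "0 \<le> C" "\<And>\<xi>. japanese \<xi> ^ (?p + ?q) * cmod (fourier \<phi> \<xi>) \<le> C * Ck_norm K (?p + ?q) \<phi>"
      using fourier_decay[OF K(1), of "?p + ?q"] K(2) by blast
    define c where "c = C * Ck_norm K (?p + ?q) \<phi>"
    have wc: "japanese \<xi> ^ ?p * cmod (w \<xi>) \<le> c" for \<xi>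
    proof -
      have "japanese \<xi> ^ ?p * cmod (w \<xi>) \<le> japanese \<xi> ^ ?p * (japanese \<xi> ^ ?q * cmod (fourier \<phi> (- \<xi>)))"
        unfolding w_def using japanese_powr_ceiling[of \<xi> s]
            by (auto simp: norm_mult intro!: mult_left_mono mult_right_mono)
      also have "\<dots> \<le> c" using C(2)[of "- \<xi>"] by (simp add: c_def power_add mult_ac)
      finally show ?thesis .
    qed
    have w1: "cmod (w \<xi>) \<le> c" for \<xi>
    proof -
      have "1 * cmod (w \<xi>) \<le> japanese \<xi> ^ ?p * cmod (w \<xi>)"
        by (intro mult_right_mono one_le_power japanese_ge_1) auto
      then show ?thesis using wc[of \<xi>] by simp
    qed
    have "integrable lborel w"
      by (rule integrable_rapid_decay(1)[OF _ order_refl wc]) (simp add: w_def[abs_def])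
    then have "integrable lborel (\<lambda>\<xi>. c * cmod (w \<xi>))" by simp
    then have "integrable lborel (\<lambda>\<xi>. (cmod (w \<xi>))\<^sup>2)"
      by (rule integrable_norm_bound) (use w1 in \<open>auto simp: w_def[abs_def] power2_eq_square intro!:
          mult_right_mono\<close>)
    then show ?thesis by (simp add: sq_integrable_def w_def[abs_def])
  qed
  have "u \<phi> = (LINT \<xi>|lborel. g \<xi> * (?c * fourier \<phi> (- \<xi>)))"
  proof -
    define \<theta> where "\<theta> = (\<lambda>\<xi>. 1 / (2 * pi) ^ DIM('a) * fourier \<phi> (- \<xi>))"
    have "\<theta> \<in> schwartz" "fourier \<theta> = \<phi>" unfolding \<theta>_def using fourier_of_schwartz[OF \<phi>] by auto
    then have "u \<phi> = (LINT \<xi>|lborel. g \<xi> * \<theta> \<xi>)" using g unfolding fourier_density_def by metis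
    then show ?thesis by (simp add: \<theta>_def)
  qed
  also have "\<dots> = (LINT \<xi>|lborel. ?c * (\<gamma> \<xi> * w \<xi>))"
  proof (intro Bochner_Integration.integral_cong refl)
    fix \<xi> :: 'a
    have "complex_of_real (japanese \<xi> powr (- s)) * complex_of_real (japanese \<xi> powr s) = 1"
      using japanese_pos[of \<xi>] unfolding of_real_mult[symmetric] powr_add[symmetric] by simp
    then have "\<gamma> \<xi> * w \<xi> = g \<xi> * fourier \<phi> (- \<xi>)" unfolding \<gamma>_def w_def
        by (metis mult.assoc mult.left_commute mult_1)
    then show "g \<xi> * (?c * fourier \<phi> (- \<xi>)) = ?c * (\<gamma> \<xi> * w \<xi>)" by simp
  qed
  finally have "cmod (u \<phi>) = ?c * cmod (LINT \<xi>|lborel. \<gamma> \<xi> * w \<xi>)"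
    by (simp add: norm_mult norm_divide norm_power)
  also have "\<dots> \<le> ?c * (sqrt (sq_norm lborel \<gamma>) * sqrt (sq_norm lborel w))"
    by (intro mult_left_mono cauchy_schwarz_complex(1) \<gamma> w) auto
  \<comment> \<open>Fourier inversion leaves one factor \<open>?c\<close>, which is shared evenly by
    the two norms.\<close>
  also have "\<dots> = (sqrt ?c * sqrt (sq_norm lborel \<gamma>)) * (sqrt ?c * sqrt (sq_norm lborel w))"
  proof -
    have "?c = sqrt ?c * sqrt ?c" by simp
    then show ?thesis by (metis mult.assoc mult.left_commute)
  qed
  also have "sqrt ?c * sqrt (sq_norm lborel \<gamma>) = fourier_norm (- s) g"
    unfolding fourier_norm_def sq_norm_def \<gamma>_def real_sqrt_mult by (simp add: norm_mult)
  also have "sqrt ?c * sqrt (sq_norm lborel w) = sobolev_norm_fun s \<phi>"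
    using lborel_integral_reflect(1)[of "\<lambda>\<xi>. (japanese \<xi> powr s * cmod (fourier \<phi> \<xi>))\<^sup>2"]
    unfolding sobolev_norm_fun_def fourier_norm_def sq_norm_def w_def real_sqrt_mult
        by (simp add: norm_mult)
  finally show ?thesis .
qed

text \<open>Conjugation reflects the modulus of the transform, and the weight is even.\<close>

lemma sobolev_norm_fun_cnj: "sobolev_norm_fun s (\<lambda>x. cnj (\<phi> x))
    = sobolev_norm_fun s (\<phi> :: 'a::euclidean_space \<Rightarrow> complex)"
  using lborel_integral_reflect(1)[of "\<lambda>\<xi>. (japanese \<xi> powr s * cmod (fourier \<phi> \<xi>))\<^sup>2"]
  unfolding sobolev_norm_fun_def fourier_norm_def fourier_cnj by simp

section \<open>Orders of nets\<close>

abbreviation has_order :: "(real \<Rightarrow> real) \<Rightarrow> real \<Rightarrow> bool" where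
  "has_order f b \<equiv> f \<in> O[at_right 0](\<lambda>\<epsilon>. \<epsilon> powr b)"

lemma has_orderD:
  assumes "has_order f b"
  obtains c \<eta> where "0 < c" "0 < \<eta>" "\<eta> \<le> 1" "\<And>\<epsilon>. 0 < \<epsilon> \<Longrightarrow> \<epsilon> \<le> \<eta> \<Longrightarrow> \<bar>f \<epsilon>\<bar> \<le> c * \<epsilon> powr b"
proof -
  obtain c where c: "c > 0" "\<forall>\<^sub>F \<epsilon> in at_right 0. norm (f \<epsilon>) \<le> c * norm (\<epsilon> powr b)"
    using landau_o.bigE[OF assms] by blast
  then obtain d where d: "d > 0" "\<And>\<epsilon>. 0 < \<epsilon> \<Longrightarrow> \<epsilon> < d \<Longrightarrow> \<bar>f \<epsilon>\<bar> \<le> c * \<epsilon> powr b"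
    unfolding eventually_at_right_field by auto
  \<comment> \<open>The filter gives an open interval of validity; halving \<open>d\<close> makes it
    closed at the right end, and the minimum keeps it inside \<open>{0<..1}\<close>.\<close>
  show thesis
    by (rule that[OF c(1), of "min (d / 2) 1"]) (use d in auto)
qed

lemma has_orderI:
  assumes "0 < \<eta>" "\<And>\<epsilon>. 0 < \<epsilon> \<Longrightarrow> \<epsilon> \<le> \<eta> \<Longrightarrow> \<bar>f \<epsilon>\<bar> \<le> c * \<epsilon> powr b"
  shows "has_order f b"
proof (rule bigoI[of _ c])
  show "\<forall>\<^sub>F \<epsilon> in at_right 0. norm (f \<epsilon>) \<le> c * norm (\<epsilon> powr b)"
    unfolding eventually_at_right_field using assms by (intro exI[of _ \<eta>]) auto
qed

text \<open>Transfers an order through a bound that itself loses a power of \<epsilon>, the form in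
  which the estimate of a basic net is applied.\<close>

lemma has_order_powr_bound:
  assumes "has_order g b" "0 < \<eta>" "0 \<le> c"
    and "\<And>\<epsilon>. 0 < \<epsilon> \<Longrightarrow> \<epsilon> \<le> \<eta> \<Longrightarrow> \<epsilon> \<le> 1 \<Longrightarrow> \<bar>f \<epsilon>\<bar> \<le> c * \<epsilon> powr a * \<bar>g \<epsilon>\<bar>"
  shows "has_order f (a + b)"
proof -
  obtain c' \<eta>' where g: "0 < c'" "0 < \<eta>'" "\<eta>' \<le> 1" "\<And>\<epsilon>. 0 < \<epsilon> \<Longrightarrow> \<epsilon> \<le> \<eta>' \<Longrightarrow> \<bar>g \<epsilon>\<bar> \<le> c' * \<epsilon> powr b"
    by (rule has_orderD[OF assms(1)]) blast
  show ?thesis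
  proof (rule has_orderI[of "min \<eta> \<eta>'" _ "c * c'"])
    fix \<epsilon> :: real assume \<epsilon>: "0 < \<epsilon>" "\<epsilon> \<le> min \<eta> \<eta>'"
    then have "\<bar>f \<epsilon>\<bar> \<le> c * \<epsilon> powr a * \<bar>g \<epsilon>\<bar>" using assms(4)[of \<epsilon>] g(3) by simp
    also have "\<dots> \<le> c * \<epsilon> powr a * (c' * \<epsilon> powr b)"
      using \<epsilon> g assms(3) by (intro mult_left_mono) auto
    finally show "\<bar>f \<epsilon>\<bar> \<le> c * c' * \<epsilon> powr (a + b)" by (simp add: powr_add mult_ac)
  qed (use assms g in auto)
qed

lemma has_order_bound:
  assumes "has_order g b" "\<And>\<epsilon>. \<epsilon> \<in> {0<..1} \<Longrightarrow> \<bar>f \<epsilon>\<bar> \<le> c * \<bar>g \<epsilon>\<bar>"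
  shows "has_order f b"
proof -
  have "has_order f (0 + b)"
  proof (rule has_order_powr_bound[OF assms(1), of 1 "\<bar>c\<bar>"])
    fix \<epsilon> :: real assume "0 < \<epsilon>" "\<epsilon> \<le> 1"
    then have "\<bar>f \<epsilon>\<bar> \<le> c * \<bar>g \<epsilon>\<bar>" "\<epsilon> powr 0 = 1" using assms(2) by auto
    moreover have "c * \<bar>g \<epsilon>\<bar> \<le> \<bar>c\<bar> * \<bar>g \<epsilon>\<bar>" by (intro mult_right_mono) auto
    ultimately show "\<bar>f \<epsilon>\<bar> \<le> \<bar>c\<bar> * \<epsilon> powr 0 * \<bar>g \<epsilon>\<bar>" by simp
  qed auto
  then show ?thesis by simp
qed

lemma has_order_mono: "has_order f b \<Longrightarrow> a \<le> b \<Longrightarrow> has_order f a"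
proof -
  assume f: "has_order f b" and ab: "a \<le> b"
  obtain c \<eta> where c: "0 < c" "0 < \<eta>" "\<eta> \<le> 1" "\<And>\<epsilon>. 0 < \<epsilon> \<Longrightarrow> \<epsilon> \<le> \<eta> \<Longrightarrow> \<bar>f \<epsilon>\<bar> \<le> c * \<epsilon> powr b"
    by (rule has_orderD[OF f]) blast
  show "has_order f a"
  proof (rule has_orderI[OF c(2), of _ c])
    fix \<epsilon> :: real assume \<epsilon>: "0 < \<epsilon>" "\<epsilon> \<le> \<eta>"
    then have "\<epsilon> powr b \<le> \<epsilon> powr a" using ab c(3) by (intro powr_mono') auto
    then have "c * \<epsilon> powr b \<le> c * \<epsilon> powr a" using c(1) by simp
    then show "\<bar>f \<epsilon>\<bar> \<le> c * \<epsilon> powr a" using c(4)[OF \<epsilon>] by linarith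
  qed
qed

lemma has_order_add: "has_order f b \<Longrightarrow> has_order g b \<Longrightarrow> has_order (\<lambda>\<epsilon>. f \<epsilon> + g \<epsilon>) b"
  by (rule sum_in_bigo)

lemma has_order_mult: "has_order f a \<Longrightarrow> has_order g b \<Longrightarrow> has_order (\<lambda>\<epsilon>. f \<epsilon> * g \<epsilon>) (a + b)"
  unfolding powr_add by (rule landau_o.big.mult)

lemma has_order_sum:
  "finite I \<Longrightarrow> (\<And>i. i \<in> I \<Longrightarrow> has_order (f i) b) \<Longrightarrow> has_order (\<lambda>\<epsilon>. \<Sum>i\<in>I. f i \<epsilon>) b"
  by (rule big_sum_in_bigo)

section \<open>Colombeau spaces\<close>

text \<open>The axioms speak of differences, the operation in which Colombeau equivalence is
  expressed; sums and negatives are derived. The carrier \<open>E\<close> is a set because the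
  smooth functions on an open set and the symbols are subsets of function types.\<close>

locale seminormed_space =
  fixes E :: "'e::ab_group_add set" and P :: "('e \<Rightarrow> real) set"
  assumes zero_in: "0 \<in> E"
    and diff_in: "x \<in> E \<Longrightarrow> y \<in> E \<Longrightarrow> x - y \<in> E"
    and seminorm_0: "p \<in> P \<Longrightarrow> p 0 = 0"
    and seminorm_nonneg: "p \<in> P \<Longrightarrow> x \<in> E \<Longrightarrow> 0 \<le> p x"
    and seminorm_diff: "p \<in> P \<Longrightarrow> x \<in> E \<Longrightarrow> y \<in> E \<Longrightarrow> p (x - y) \<le> p x + p y"
begin

abbreviation "nets \<equiv> moderate E P"
abbreviation "rel \<equiv> colombeau_rel E P"
abbreviation "cls \<equiv> colombeau_class E P"

lemma uminus_in: "x \<in> E \<Longrightarrow> - x \<in> E"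
  using diff_in[OF zero_in, of x] by simp

lemma seminorm_uminus: "p \<in> P \<Longrightarrow> x \<in> E \<Longrightarrow> p (- x) \<le> p x"
  using seminorm_diff[OF _ zero_in, of p x] seminorm_0[of p] by simp

lemma seminorm_add: "p \<in> P \<Longrightarrow> x \<in> E \<Longrightarrow> y \<in> E \<Longrightarrow> p (x + y) \<le> p x + p y"
  using seminorm_diff[OF _ _ uminus_in, of p x y] seminorm_uminus[of p y] by simp

lemma moderate_in: "u \<in> nets \<Longrightarrow> \<epsilon> \<in> {0<..1} \<Longrightarrow> u \<epsilon> \<in> E"
  by (simp add: moderate_def)

lemma moderate_order: "u \<in> nets \<Longrightarrow> p \<in> P \<Longrightarrow> \<exists>N::nat. has_order (\<lambda>\<epsilon>. p (u \<epsilon>)) (- real N)"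
  by (simp add: moderate_def)

lemma moderateI:
  assumes "\<And>\<epsilon>. \<epsilon> \<in> {0<..1} \<Longrightarrow> u \<epsilon> \<in> E" "\<And>p. p \<in> P \<Longrightarrow> \<exists>b. has_order (\<lambda>\<epsilon>. p (u \<epsilon>)) b"
  shows "u \<in> nets"
  unfolding moderate_def
proof (intro CollectI conjI ballI)
  fix p assume "p \<in> P"
  then obtain b where b: "has_order (\<lambda>\<epsilon>. p (u \<epsilon>)) b" using assms(2) by blast
  have "- real (nat \<lceil>- b\<rceil>) \<le> b" by linarith
  then show "\<exists>N::nat. has_order (\<lambda>\<epsilon>. p (u \<epsilon>)) (- real N)" using has_order_mono[OF b] by blast
qed (use assms in auto)

lemma moderate_zero: "(\<lambda>\<epsilon>. 0) \<in> nets"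
  by (rule moderateI) (auto simp: zero_in seminorm_0 intro: exI[of _ 0])

lemma order_diff:
  assumes u: "\<And>\<epsilon>. \<epsilon> \<in> {0<..1} \<Longrightarrow> u \<epsilon> \<in> E" and v: "\<And>\<epsilon>. \<epsilon> \<in> {0<..1} \<Longrightarrow> v \<epsilon> \<in> E" and p: "p \<in> P"
    and b: "has_order (\<lambda>\<epsilon>. p (u \<epsilon>)) b" "has_order (\<lambda>\<epsilon>. p (v \<epsilon>)) b"
  shows "has_order (\<lambda>\<epsilon>. p (u \<epsilon> - v \<epsilon>)) b"
proof (rule has_order_bound[OF has_order_add[OF b], of _ 1])
  fix \<epsilon> :: real assume \<epsilon>: "\<epsilon> \<in> {0<..1}"
  show "\<bar>p (u \<epsilon> - v \<epsilon>)\<bar> \<le> 1 * \<bar>p (u \<epsilon>) + p (v \<epsilon>)\<bar>"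
    using seminorm_diff[OF p u[OF \<epsilon>] v[OF \<epsilon>]] seminorm_nonneg[OF p diff_in[OF u[OF \<epsilon>] v[OF \<epsilon>]]]
      seminorm_nonneg[OF p u[OF \<epsilon>]] seminorm_nonneg[OF p v[OF \<epsilon>]] by simp
qed

lemma moderate_diff:
  assumes "u \<in> nets" "v \<in> nets"
  shows "(\<lambda>\<epsilon>. u \<epsilon> - v \<epsilon>) \<in> nets"
proof (rule moderateI)
  fix p assume p: "p \<in> P"
  obtain N M :: nat where "has_order (\<lambda>\<epsilon>. p (u \<epsilon>)) (- real N)" "has_order (\<lambda>\<epsilon>. p (v \<epsilon>)) (- real M)"
    using moderate_order[OF assms(1) p] moderate_order[OF assms(2) p] by blast
  then have "has_order (\<lambda>\<epsilon>. p (u \<epsilon>)) (- real N - real M)" "has_order (\<lambda>\<epsilon>. p (v \<epsilon>)) (- real N - real M)"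
    by (auto elim: has_order_mono)
  then have "has_order (\<lambda>\<epsilon>. p (u \<epsilon> - v \<epsilon>)) (- real N - real M)"
    using assms moderate_in by (intro order_diff[of u v] p)
  then show "\<exists>b. has_order (\<lambda>\<epsilon>. p (u \<epsilon> - v \<epsilon>)) b" ..
qed (rule diff_in[OF moderate_in[OF assms(1)] moderate_in[OF assms(2)]])

lemma moderate_add:
  assumes "u \<in> nets" "v \<in> nets"
  shows "(\<lambda>\<epsilon>. u \<epsilon> + v \<epsilon>) \<in> nets"
  using moderate_diff[OF assms(1) moderate_diff[OF moderate_zero assms(2)]] by simp

text \<open>Arbitrary real orders replace natural ones, by monotonicity; a negligible factor can
  then absorb any prescribed loss.\<close>

lemma rel_iff: "(u, v) \<in> rel \<longleftrightarrow> u \<in> nets \<and> v \<in> nets \<and>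
    (\<forall>p\<in>P. \<forall>b. has_order (\<lambda>\<epsilon>. p (u \<epsilon> - v \<epsilon>)) b)"
proof -
  have "(\<forall>q::nat. has_order f (real q)) \<longleftrightarrow> (\<forall>b. has_order f b)" for f
    by (metis has_order_mono real_arch_simple)
  then show ?thesis
    unfolding colombeau_rel_def negligible_nets_def using diff_in moderate_in by auto
qed

lemma rel_trans: "(u, v) \<in> rel \<Longrightarrow> (v, w) \<in> rel \<Longrightarrow> (u, w) \<in> rel"
proof -
  assume uv: "(u, v) \<in> rel" and vw: "(v, w) \<in> rel"
  have m: "u \<in> nets" "v \<in> nets" "w \<in> nets" using uv vw by (auto simp: rel_iff)
  have "has_order (\<lambda>\<epsilon>. p (u \<epsilon> - w \<epsilon>)) b" if p: "p \<in> P" for p b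
  proof (rule has_order_bound[of "\<lambda>\<epsilon>. p (u \<epsilon> - v \<epsilon>) + p (v \<epsilon> - w \<epsilon>)" _ _ 1])
    show "has_order (\<lambda>\<epsilon>. p (u \<epsilon> - v \<epsilon>) + p (v \<epsilon> - w \<epsilon>)) b"
      using uv vw p by (intro has_order_add) (auto simp: rel_iff)
    fix \<epsilon> :: real assume "\<epsilon> \<in> {0<..1}"
    then have E: "u \<epsilon> \<in> E" "v \<epsilon> \<in> E" "w \<epsilon> \<in> E" using m moderate_in by auto
    then have "p ((u \<epsilon> - v \<epsilon>) + (v \<epsilon> - w \<epsilon>)) \<le> p (u \<epsilon> - v \<epsilon>) + p (v \<epsilon> - w \<epsilon>)"
      by (intro seminorm_add p diff_in)
    moreover have "0 \<le> p (u \<epsilon> - w \<epsilon>)" using E by (intro seminorm_nonneg p diff_in)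
    ultimately show "\<bar>p (u \<epsilon> - w \<epsilon>)\<bar> \<le> 1 * \<bar>p (u \<epsilon> - v \<epsilon>) + p (v \<epsilon> - w \<epsilon>)\<bar>" by simp
  qed
  then show "(u, w) \<in> rel" using m by (simp add: rel_iff)
qed

lemma rel_refl: "u \<in> nets \<Longrightarrow> (u, u) \<in> rel"
  by (simp add: rel_iff seminorm_0)

lemma rel_sym: "(u, v) \<in> rel \<Longrightarrow> (v, u) \<in> rel"
proof -
  assume uv: "(u, v) \<in> rel"
  have m: "u \<in> nets" "v \<in> nets" using uv by (auto simp: rel_iff)
  have "has_order (\<lambda>\<epsilon>. p (v \<epsilon> - u \<epsilon>)) b" if p: "p \<in> P" for p b
  proof (rule has_order_bound[of "\<lambda>\<epsilon>. p (u \<epsilon> - v \<epsilon>)" _ _ 1])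
    show "has_order (\<lambda>\<epsilon>. p (u \<epsilon> - v \<epsilon>)) b" using uv p by (auto simp: rel_iff)
    fix \<epsilon> :: real assume "\<epsilon> \<in> {0<..1}"
    then have E: "u \<epsilon> - v \<epsilon> \<in> E" "v \<epsilon> - u \<epsilon> \<in> E" using m moderate_in diff_in by auto
    show "\<bar>p (v \<epsilon> - u \<epsilon>)\<bar> \<le> 1 * \<bar>p (u \<epsilon> - v \<epsilon>)\<bar>"
      using seminorm_uminus[OF p E(1)] seminorm_nonneg[OF p E(1)] seminorm_nonneg[OF p E(2)] by simp
  qed
  then show "(v, u) \<in> rel" using m by (simp add: rel_iff)
qed

lemma in_cls_iff: "v \<in> cls u \<longleftrightarrow> (u, v) \<in> rel"
  by (simp add: colombeau_class_def)

lemma cls_eq: "(u, v) \<in> rel \<Longrightarrow> cls u = cls v"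
  unfolding set_eq_iff in_cls_iff using rel_trans rel_sym by blast

lemma self_in_cls: "u \<in> nets \<Longrightarrow> u \<in> cls u"
  by (simp add: in_cls_iff rel_refl)

lemma cls_in: "u \<in> nets \<Longrightarrow> cls u \<in> colombeau E P"
  unfolding colombeau_def colombeau_class_def by (rule quotientI)

lemma colombeauE:
  assumes "U \<in> colombeau E P"
  obtains u where "u \<in> nets" "U = cls u" "u \<in> U"
proof -
  obtain u where u: "u \<in> nets" "U = cls u"
    using assms unfolding colombeau_def colombeau_class_def by (rule quotientE)
  then show thesis using that self_in_cls by blast
qed

lemma member:
  assumes "U \<in> colombeau E P" "u \<in> U"
  shows "u \<in> nets" "U = cls u"
proof -
  obtain v where v: "v \<in> nets" "U = cls v" by (rule colombeauE[OF assms(1)])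
  then have "(v, u) \<in> rel" using assms(2) by (simp add: in_cls_iff)
  then show "u \<in> nets" "U = cls u" using cls_eq v by (auto simp: rel_iff)
qed

lemma member_rel: "U \<in> colombeau E P \<Longrightarrow> u \<in> U \<Longrightarrow> v \<in> U \<Longrightarrow> (u, v) \<in> rel"
  using member in_cls_iff by blast

text \<open>\<open>lift2\<close> is a union over all pairs of representatives. If the result does
  not depend on them, all members of the union are the same class.\<close>

lemma lift2_eq:
  assumes "u \<in> A" "v \<in> B"
    and "\<And>u' v'. u' \<in> A \<Longrightarrow> v' \<in> B \<Longrightarrow> ((\<lambda>\<epsilon>. h (u \<epsilon>) (v \<epsilon>)), (\<lambda>\<epsilon>. h (u' \<epsilon>) (v' \<epsilon>))) \<in> rel"
  shows "lift2 E P h A B = cls (\<lambda>\<epsilon>. h (u \<epsilon>) (v \<epsilon>))"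
proof -
  have "cls (\<lambda>\<epsilon>. h (u' \<epsilon>) (v' \<epsilon>)) = cls (\<lambda>\<epsilon>. h (u \<epsilon>) (v \<epsilon>))" if "u' \<in> A" "v' \<in> B" for u' v'
    by (rule cls_eq[symmetric, OF assms(3)[OF that]])
  then show ?thesis unfolding lift2_def using assms(1,2) by blast
qed

lemma rel_diff:
  assumes "(u, u') \<in> rel" "(v, v') \<in> rel"
  shows "((\<lambda>\<epsilon>. u \<epsilon> - v \<epsilon>), (\<lambda>\<epsilon>. u' \<epsilon> - v' \<epsilon>)) \<in> rel"
proof -
  have m: "u \<in> nets" "v \<in> nets" "u' \<in> nets" "v' \<in> nets"
    using assms by (auto simp: rel_iff)
  have "has_order (\<lambda>\<epsilon>. p ((u \<epsilon> - u' \<epsilon>) - (v \<epsilon> - v' \<epsilon>))) b" if p: "p \<in> P" for p b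
  proof (rule order_diff[of "\<lambda>\<epsilon>. u \<epsilon> - u' \<epsilon>" "\<lambda>\<epsilon>. v \<epsilon> - v' \<epsilon>", OF _ _ p])
    fix \<epsilon> :: real assume \<epsilon>: "\<epsilon> \<in> {0<..1}"
    show "u \<epsilon> - u' \<epsilon> \<in> E" "v \<epsilon> - v' \<epsilon> \<in> E" by (intro diff_in m[THEN moderate_in, OF \<epsilon>])+
  qed (use assms p in \<open>auto simp: rel_iff\<close>)
  moreover have "(u \<epsilon> - u' \<epsilon>) - (v \<epsilon> - v' \<epsilon>) = (u \<epsilon> - v \<epsilon>) - (u' \<epsilon> - v' \<epsilon>)" for \<epsilon> by simp
  ultimately show ?thesis using m moderate_diff by (simp add: rel_iff)
qed

lemma lift2_diff:
  assumes "u \<in> nets" "v \<in> nets"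
  shows "lift2 E P (-) (cls u) (cls v) = cls (\<lambda>\<epsilon>. u \<epsilon> - v \<epsilon>)"
  by (rule lift2_eq) (auto simp: rel_refl assms in_cls_iff intro: rel_diff)

lemma rel_add:
  assumes "(u, u') \<in> rel" "(v, v') \<in> rel"
  shows "((\<lambda>\<epsilon>. u \<epsilon> + v \<epsilon>), (\<lambda>\<epsilon>. u' \<epsilon> + v' \<epsilon>)) \<in> rel"
  using rel_diff[OF assms(1) rel_diff[OF rel_refl[OF moderate_zero] assms(2)]] by simp

lemma lift2_add:
  assumes "u \<in> nets" "v \<in> nets"
  shows "lift2 E P (+) (cls u) (cls v) = cls (\<lambda>\<epsilon>. u \<epsilon> + v \<epsilon>)"
  by (rule lift2_eq) (auto simp: rel_refl assms in_cls_iff intro: rel_add)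

lemma order_rel:
  assumes "(u, v) \<in> rel" "p \<in> P" "has_order (\<lambda>\<epsilon>. p (u \<epsilon>)) b"
  shows "has_order (\<lambda>\<epsilon>. p (v \<epsilon>)) b"
proof -
  have m: "u \<in> nets" "v \<in> nets" using assms by (auto simp: rel_iff)
  have "has_order (\<lambda>\<epsilon>. p (u \<epsilon> - (u \<epsilon> - v \<epsilon>))) b"
  proof (rule order_diff[of u "\<lambda>\<epsilon>. u \<epsilon> - v \<epsilon>", OF _ _ assms(2)])
    fix \<epsilon> :: real assume \<epsilon>: "\<epsilon> \<in> {0<..1}"
    show "u \<epsilon> \<in> E" "u \<epsilon> - v \<epsilon> \<in> E" by (intro diff_in m[THEN moderate_in, OF \<epsilon>])+
  qed (use assms in \<open>auto simp: rel_iff\<close>)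
  then show ?thesis by simp
qed

text \<open>Translates the topology into orders of nets. A strict inequality is witnessed by some
  order above \<open>- ln r\<close>; from a value of at most 1 only negative orders follow, since
  the supremum in the valuation may not be attained.\<close>

lemma
  assumes U: "U \<in> colombeau E P" "u \<in> U" and p: "p \<in> P"
  shows ultra_seminorm_less_iff:
      "0 < r \<Longrightarrow> ultra_seminorm p U < r \<longleftrightarrow> (\<exists>b. - ln r < b \<and> has_order (\<lambda>\<epsilon>. p (u \<epsilon>)) b)"
    and ultra_seminorm_le_1: "ultra_seminorm p U \<le> 1 \<Longrightarrow> b < 0 \<Longrightarrow> has_order (\<lambda>\<epsilon>. p (u \<epsilon>)) b"
proof -
  define S where "S = {b. has_order (\<lambda>\<epsilon>. p (u \<epsilon>)) b}"
  define v where "v = Sup (ereal ` S)"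
  have "(SOME u. u \<in> U) \<in> U" by (rule someI[of "\<lambda>u. u \<in> U", OF U(2)])
  from member_rel[OF U(1) this U(2)] have "valuation p (SOME u. u \<in> U) = v"
    unfolding valuation_def v_def S_def using order_rel[OF _ p] rel_sym by metis
  then have us: "ultra_seminorm p U = (if v = \<infinity> then 0 else exp (- real_of_ereal v))"
    by (simp add: ultra_seminorm_def Let_def)
  have less: "ereal x < v \<longleftrightarrow> (\<exists>b. x < b \<and> has_order (\<lambda>\<epsilon>. p (u \<epsilon>)) b)" for x
    unfolding v_def S_def by (auto simp: less_Sup_iff)
  obtain N :: nat where "has_order (\<lambda>\<epsilon>. p (u \<epsilon>)) (- real N)"
    using moderate_order[OF member(1)[OF U] p] by blast
  \<comment> \<open>Moderateness excludes the valuation \<open>- \<infinity>\<close>, for which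
    \<open>real_of_ereal\<close> would return a default value.\<close>
  then have "ereal (- real N - 1) < v" unfolding less by (intro exI[of _ "- real N"]) auto
  then have cases: "v = \<infinity> \<or> (\<exists>x. v = ereal x)" by (cases v) auto
  show "ultra_seminorm p U < r \<longleftrightarrow> (\<exists>b. - ln r < b \<and> has_order (\<lambda>\<epsilon>. p (u \<epsilon>)) b)" if "0 < r"
    unfolding less[symmetric] using cases
  proof
    assume "\<exists>x. v = ereal x"
    then obtain x where x: "v = ereal x" by blast
    have "exp (- x) < r \<longleftrightarrow> - x < ln r" using that by (metis exp_less_cancel_iff exp_ln)
    then show "ultra_seminorm p U < r \<longleftrightarrow> ereal (- ln r) < v" unfolding us x by auto
  qed (use that in \<open>auto simp: us\<close>)
  show "has_order (\<lambda>\<epsilon>. p (u \<epsilon>)) b" if "ultra_seminorm p U \<le> 1" "b < 0"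
  proof -
    have "ereal b < v" using cases that by (auto simp: us)
    then obtain b' where "b < b'" "has_order (\<lambda>\<epsilon>. p (u \<epsilon>)) b'" unfolding less by blast
    from has_order_mono[OF this(2) less_imp_le[OF this(1)]] show ?thesis .
  qed
qed

lemma openin_ultra_ball:
  assumes "p \<in> P" "A \<in> colombeau E P" "0 < r"
  shows "openin (colombeau_topology E P) {B \<in> colombeau E P. ultra_seminorm p (lift2 E P (-) B A) < r}"
  unfolding colombeau_topology_def by (rule topology_generated_by_Basis) (use assms in blast)

end

section \<open>Generalized numbers and smooth generalized functions\<close>

interpretation num: seminormed_space "UNIV :: complex set" "{cmod}"
  by standard (auto intro: norm_triangle_ineq4)

lemma rel_mult_numbers:
  assumes "(c, c') \<in> num.rel" "(d, d') \<in> num.rel"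
  shows "((\<lambda>\<epsilon>. c \<epsilon> * d \<epsilon>), (\<lambda>\<epsilon>. c' \<epsilon> * d' \<epsilon>)) \<in> num.rel"
proof -
  have m: "c \<in> moderate_numbers" "d \<in> moderate_numbers" "c' \<in> moderate_numbers" "d' \<in> moderate_numbers"
    using assms by (auto simp: num.rel_iff)
  have mult: "(\<lambda>\<epsilon>. x \<epsilon> * y \<epsilon>) \<in> moderate_numbers" if xy: "x \<in> moderate_numbers" "y \<in> moderate_numbers"
      for x y
  proof (rule num.moderateI)
    fix p :: "complex \<Rightarrow> real" assume "p \<in> {cmod}"
    moreover obtain N M :: nat where "has_order (\<lambda>\<epsilon>. cmod (x \<epsilon>)) (- real N)"
        "has_order (\<lambda>\<epsilon>. cmod (y \<epsilon>)) (- real M)"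
      using num.moderate_order[OF xy(1)] num.moderate_order[OF xy(2)] by blast
    ultimately show "\<exists>b. has_order (\<lambda>\<epsilon>. p (x \<epsilon> * y \<epsilon>)) b"
      using has_order_mult by (fastforce simp: norm_mult)
  qed simp
  have "has_order (\<lambda>\<epsilon>. cmod (c \<epsilon> * d \<epsilon> - c' \<epsilon> * d' \<epsilon>)) b" for b
  proof -
    obtain N M :: nat where N: "has_order (\<lambda>\<epsilon>. cmod (c \<epsilon>)) (- real N)" and M:
        "has_order (\<lambda>\<epsilon>. cmod (d' \<epsilon>)) (- real M)"
      using num.moderate_order[OF m(1)] num.moderate_order[OF m(4)] by blast
    \<comment> \<open>The orders are raised by \<open>N\<close> and \<open>M\<close> to make up for
      the growth of the other factors.\<close>
    have d: "has_order (\<lambda>\<epsilon>. cmod (d \<epsilon> - d' \<epsilon>)) (b + real N)" and c: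
        "has_order (\<lambda>\<epsilon>. cmod (c \<epsilon> - c' \<epsilon>)) (b + real M)"
      using assms by (auto simp: num.rel_iff)
    have "has_order (\<lambda>\<epsilon>. cmod (c \<epsilon>) * cmod (d \<epsilon> - d' \<epsilon>) + cmod (c \<epsilon> - c' \<epsilon>) * cmod (d' \<epsilon>)) b"
      using has_order_mult[OF N d] has_order_mult[OF c M] by (intro has_order_add) auto
    then show ?thesis
    proof (rule has_order_bound[where c = 1])
      fix \<epsilon>
      have "c \<epsilon> * d \<epsilon> - c' \<epsilon> * d' \<epsilon> = c \<epsilon> * (d \<epsilon> - d' \<epsilon>) + (c \<epsilon> - c' \<epsilon>) * d' \<epsilon>" by (simp add: algebra_simps)
      then have "cmod (c \<epsilon> * d \<epsilon> - c' \<epsilon> * d' \<epsilon>) \<le> cmod (c \<epsilon>) * cmod (d \<epsilon> - d' \<epsilon>) + cmod (c \<epsilon> - c' \<epsilon>) * cmod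
          (d' \<epsilon>)"
        using norm_triangle_ineq[of "c \<epsilon> * (d \<epsilon> - d' \<epsilon>)" "(c \<epsilon> - c' \<epsilon>) * d' \<epsilon>"] by (simp only: norm_mult)
      then show "\<bar>cmod (c \<epsilon> * d \<epsilon> - c' \<epsilon> * d' \<epsilon>)\<bar>
          \<le> 1 * \<bar>cmod (c \<epsilon>) * cmod (d \<epsilon> - d' \<epsilon>) + cmod (c \<epsilon> - c' \<epsilon>) * cmod (d' \<epsilon>)\<bar>"
        by simp
    qed
  qed
  then show ?thesis using mult[OF m(1,2)] mult[OF m(3,4)] by (simp add: num.rel_iff)
qed

lemma gnum_plus_class:
  "c \<in> moderate_numbers \<Longrightarrow> d \<in> moderate_numbers \<Longrightarrow>
    gnum_plus (num_class c) (num_class d) = num_class (\<lambda>\<epsilon>. c \<epsilon> + d \<epsilon>)"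
  unfolding gnum_plus_def by (rule num.lift2_add)

lemma gnum_times_class:
  "c \<in> moderate_numbers \<Longrightarrow> d \<in> moderate_numbers \<Longrightarrow>
    gnum_times (num_class c) (num_class d) = num_class (\<lambda>\<epsilon>. c \<epsilon> * d \<epsilon>)"
  unfolding gnum_times_def
  by (rule num.lift2_eq) (auto simp: num.rel_refl num.in_cls_iff intro: rel_mult_numbers)

lemma seminormed_space_smooth:
  assumes "open \<Omega>"
  shows "seminormed_space (smooth_on \<Omega>) (smooth_seminorms \<Omega>)"
proof
  show "0 \<in> smooth_on \<Omega>" using smooth_on_const[of 0 \<Omega>] by (simp add: zero_fun_def)
  show "f - g \<in> smooth_on \<Omega>" if "f \<in> smooth_on \<Omega>" "g \<in> smooth_on \<Omega>" for f g
    using smooth_on_diff[OF assms that] by (simp add: fun_diff_def)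
  fix p :: "('a \<Rightarrow> complex) \<Rightarrow> real" assume "p \<in> smooth_seminorms \<Omega>"
  then obtain K j where K: "p = Ck_norm K j" "compact K" "K \<subseteq> \<Omega>" by (auto simp: smooth_seminorms_def)
  show nonneg: "0 \<le> p f" if "f \<in> smooth_on \<Omega>" for f
    unfolding K(1) by (rule Ck_norm_nonneg[OF that K(2,3)])
  show "p 0 = 0"
  proof (rule antisym)
    show "p 0 \<le> 0"
      unfolding K(1) using partials_vanish[OF open_UNIV, of "0 :: 'a \<Rightarrow> complex"] by (intro Ck_norm_le) auto
    show "0 \<le> p 0" by (rule nonneg) (use smooth_on_const[of 0 \<Omega>] in \<open>simp add: zero_fun_def\<close>)
  qed
  show "p (f - g) \<le> p f + p g" if "f \<in> smooth_on \<Omega>" "g \<in> smooth_on \<Omega>" for f g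
    using Ck_norm_diff[OF assms that K(2,3)] by (simp add: K(1) fun_diff_def)
qed

lemma restrict_rel:
  assumes "open V" "V \<subseteq> \<Omega>" "open \<Omega>" "(u, v) \<in> colombeau_rel (smooth_on \<Omega>) (smooth_seminorms \<Omega>)"
  shows "(u, v) \<in> colombeau_rel (smooth_on V) (smooth_seminorms V)"
proof -
  interpret D: seminormed_space "smooth_on \<Omega>" "smooth_seminorms \<Omega>"
      by (rule seminormed_space_smooth[OF assms(3)])
  interpret V: seminormed_space "smooth_on V" "smooth_seminorms V"
      by (rule seminormed_space_smooth[OF assms(1)])
  have sub: "smooth_seminorms V \<subseteq> smooth_seminorms \<Omega>"
    using assms(2) unfolding smooth_seminorms_def by blast
  have mod: "w \<in> moderate (smooth_on V) (smooth_seminorms V)" if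
      "w \<in> moderate (smooth_on \<Omega>) (smooth_seminorms \<Omega>)" for w
    using that sub smooth_on_mono[OF _ assms(2)] unfolding moderate_def by blast
  show ?thesis using assms(4) sub mod unfolding D.rel_iff V.rel_iff by blast
qed

section \<open>Functionals generated by basic nets\<close>

text \<open>Copies the right-hand side of \<open>generates\<close>, so that the equation required
  there holds by definition. What needs proof is that the union is a single class.\<close>

definition functional_of :: "'a::euclidean_space set \<Rightarrow> (real \<Rightarrow> ('a \<Rightarrow> complex) \<Rightarrow> complex) \<Rightarrow> 'a gfun \<Rightarrow> gnum"
    where
  "functional_of \<Omega> \<tau> U = (\<Union>u\<in>compact_reps \<Omega> U. num_class (\<lambda>\<epsilon>. \<tau> \<epsilon> (u \<epsilon>)))"

locale open_domain =
  fixes \<Omega> :: "'a::euclidean_space set"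
  assumes open_domain: "open \<Omega>"
begin

sublocale seminormed_space "smooth_on \<Omega>" "smooth_seminorms \<Omega>"
  by (rule seminormed_space_smooth[OF open_domain])

lemma seminorm_in: "compact K \<Longrightarrow> K \<subseteq> \<Omega> \<Longrightarrow> Ck_norm K j \<in> smooth_seminorms \<Omega>"
  unfolding smooth_seminorms_def by blast

lemma gfun_plus_class:
  "u \<in> nets \<Longrightarrow> v \<in> nets \<Longrightarrow>
    gfun_plus \<Omega> (cls u) (cls v) = cls (\<lambda>\<epsilon> x. u \<epsilon> x + v \<epsilon> x)"
proof -
  have "(\<lambda>f g x. f x + g x) = ((+) :: ('a \<Rightarrow> complex) \<Rightarrow> _)" by (intro ext) simp
  then show "u \<in> nets \<Longrightarrow> v \<in> nets \<Longrightarrow>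
      gfun_plus \<Omega> (cls u) (cls v) = cls (\<lambda>\<epsilon> x. u \<epsilon> x + v \<epsilon> x)"
    using lift2_add[of u v] by (simp add: gfun_plus_def plus_fun_def)
qed

lemma scale_rel:
  assumes cd: "(c, d) \<in> num.rel" and uv: "(u, v) \<in> rel"
  shows "((\<lambda>\<epsilon> x. c \<epsilon> * u \<epsilon> x), (\<lambda>\<epsilon> x. d \<epsilon> * v \<epsilon> x)) \<in> rel"
proof -
  have mod: "(\<lambda>\<epsilon> x. c \<epsilon> * u \<epsilon> x) \<in> nets"
    if c: "c \<in> moderate_numbers" and u: "u \<in> nets" for c u
  proof (rule moderateI)
    show "(\<lambda>x. c \<epsilon> * u \<epsilon> x) \<in> smooth_on \<Omega>" if "\<epsilon> \<in> {0<..1}" for \<epsilon>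
      by (rule smooth_on_cmult[OF open_domain moderate_in[OF u that]])
    fix p :: "('a \<Rightarrow> complex) \<Rightarrow> real" assume p: "p \<in> smooth_seminorms \<Omega>"
    then obtain K j where K: "p = Ck_norm K j" "compact K" "K \<subseteq> \<Omega>" by (auto simp: smooth_seminorms_def)
    obtain N M :: nat where "has_order (\<lambda>\<epsilon>. cmod (c \<epsilon>)) (- real N)" "has_order (\<lambda>\<epsilon>. p (u \<epsilon>)) (- real M)"
      using num.moderate_order[OF c] moderate_order[OF u p] by blast
    from has_order_mult[OF this] have "has_order (\<lambda>\<epsilon>. p (\<lambda>x. c \<epsilon> * u \<epsilon> x)) (- real N + - real M)"
    proof (rule has_order_bound[where c = 1])
      fix \<epsilon> :: real assume \<epsilon>: "\<epsilon> \<in> {0<..1}"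
      have "0 \<le> p (\<lambda>x. c \<epsilon> * u \<epsilon> x)"
        by (rule seminorm_nonneg[OF p smooth_on_cmult[OF open_domain moderate_in[OF u \<epsilon>]]])
      moreover have "0 \<le> p (u \<epsilon>)" by (rule seminorm_nonneg[OF p moderate_in[OF u \<epsilon>]])
      ultimately show "\<bar>p (\<lambda>x. c \<epsilon> * u \<epsilon> x)\<bar> \<le> 1 * \<bar>cmod (c \<epsilon>) * p (u \<epsilon>)\<bar>"
        using Ck_norm_cmult[OF open_domain moderate_in[OF u \<epsilon>] K(2,3), of j "c \<epsilon>"] by (simp add: K(1))
    qed
    then show "\<exists>b. has_order (\<lambda>\<epsilon>. p (\<lambda>x. c \<epsilon> * u \<epsilon> x)) b" ..
  qed
  have m: "c \<in> moderate_numbers" "d \<in> moderate_numbers" "u \<in> nets"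
      "v \<in> nets"
    using cd uv by (auto simp: rel_iff num.rel_iff)
  have "has_order (\<lambda>\<epsilon>. p ((\<lambda>x. c \<epsilon> * u \<epsilon> x) - (\<lambda>x. d \<epsilon> * v \<epsilon> x))) b" if p: "p \<in> smooth_seminorms \<Omega>" for p b
  proof -
    obtain K j where K: "p = Ck_norm K j" "compact K" "K \<subseteq> \<Omega>" using p by (auto simp: smooth_seminorms_def)
    obtain N M :: nat where N: "has_order (\<lambda>\<epsilon>. cmod (c \<epsilon>)) (- real N)" and M:
        "has_order (\<lambda>\<epsilon>. p (v \<epsilon>)) (- real M)"
      using num.moderate_order[OF m(1)] moderate_order[OF m(4) p] by blast
    have uv': "has_order (\<lambda>\<epsilon>. p (u \<epsilon> - v \<epsilon>)) (b + real N)" and cd':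
        "has_order (\<lambda>\<epsilon>. cmod (c \<epsilon> - d \<epsilon>)) (b + real M)"
      using cd uv p by (auto simp: rel_iff num.rel_iff)
    have "has_order (\<lambda>\<epsilon>. cmod (c \<epsilon>) * p (u \<epsilon> - v \<epsilon>) + cmod (c \<epsilon> - d \<epsilon>) * p (v \<epsilon>)) b"
      using has_order_mult[OF N uv'] has_order_mult[OF cd' M] by (intro has_order_add) auto
    then show ?thesis
    proof (rule has_order_bound[where c = 1])
      fix \<epsilon> :: real assume \<epsilon>: "\<epsilon> \<in> {0<..1}"
      have E: "u \<epsilon> \<in> smooth_on \<Omega>" "v \<epsilon> \<in> smooth_on \<Omega>" using m moderate_in \<epsilon> by auto
      have E1: "(\<lambda>x. c \<epsilon> * (u \<epsilon> - v \<epsilon>) x) \<in> smooth_on \<Omega>" "(\<lambda>x. (c \<epsilon> - d \<epsilon>) * v \<epsilon> x) \<in> smooth_on \<Omega>"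
        by (intro smooth_on_cmult open_domain diff_in E)+
      have "(\<lambda>x. c \<epsilon> * u \<epsilon> x) - (\<lambda>x. d \<epsilon> * v \<epsilon> x) = (\<lambda>x. c \<epsilon> * (u \<epsilon> - v \<epsilon>) x) + (\<lambda>x. (c \<epsilon> - d \<epsilon>) * v \<epsilon> x)"
        by (simp add: fun_eq_iff algebra_simps)
      then have "p ((\<lambda>x. c \<epsilon> * u \<epsilon> x) - (\<lambda>x. d \<epsilon> * v \<epsilon> x))
          \<le> p (\<lambda>x. c \<epsilon> * (u \<epsilon> - v \<epsilon>) x) + p (\<lambda>x. (c \<epsilon> - d \<epsilon>) * v \<epsilon> x)"
        using seminorm_add[OF p E1] by simp
      also have "\<dots> \<le> cmod (c \<epsilon>) * p (u \<epsilon> - v \<epsilon>) + cmod (c \<epsilon> - d \<epsilon>) * p (v \<epsilon>)"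
        unfolding K(1) by (intro add_mono Ck_norm_cmult[OF open_domain _ K(2,3)] diff_in E)
      finally show "\<bar>p ((\<lambda>x. c \<epsilon> * u \<epsilon> x) - (\<lambda>x. d \<epsilon> * v \<epsilon> x))\<bar>
          \<le> 1 * \<bar>cmod (c \<epsilon>) * p (u \<epsilon> - v \<epsilon>) + cmod (c \<epsilon> - d \<epsilon>) * p (v \<epsilon>)\<bar>"
        using seminorm_nonneg[OF p diff_in[OF smooth_on_cmult[OF open_domain E(1)] smooth_on_cmult[OF
            open_domain E(2)]], of "c \<epsilon>" "d \<epsilon>"]
        by simp
    qed
  qed
  then show ?thesis using mod[OF m(1,3)] mod[OF m(2,4)] unfolding rel_iff by blast
qed

lemma gfun_scale_class:
  assumes "c \<in> moderate_numbers" "u \<in> nets"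
  shows "gfun_scale \<Omega> (num_class c) (cls u) = cls (\<lambda>\<epsilon> x. c \<epsilon> * u \<epsilon> x)"
  unfolding gfun_scale_def
  by (rule lift2_eq) (auto simp: assms num.rel_refl rel_refl num.in_cls_iff in_cls_iff intro: scale_rel)

lemma moderate_scale:
  assumes "c \<in> moderate_numbers" "u \<in> nets"
  shows "(\<lambda>\<epsilon> x. c \<epsilon> * u \<epsilon> x) \<in> nets"
  using scale_rel[OF num.rel_refl[OF assms(1)] rel_refl[OF assms(2)]] by (simp add: rel_iff)

lemma moderate_plus:
  assumes "u \<in> nets" "v \<in> nets"
  shows "(\<lambda>\<epsilon> x. u \<epsilon> x + v \<epsilon> x) \<in> nets"
  using moderate_add[OF assms] by (simp add: plus_fun_def)

text \<open>On the open set \<open>\<Omega> - K\<close> the representative vanishes, so the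
  restriction of its class is zero near each of the points there.\<close>

lemma gsupport_cls:
  assumes u: "u \<in> nets" and K: "compact K"
    and vanish: "\<And>\<epsilon> x. \<epsilon> \<in> {0<..1} \<Longrightarrow> x \<notin> K \<Longrightarrow> u \<epsilon> x = 0"
  shows "gsupport \<Omega> (cls u) \<subseteq> K"
proof
  fix x assume x: "x \<in> gsupport \<Omega> (cls u)"
  show "x \<in> K"
  proof (rule ccontr)
    assume "x \<notin> K"
    define V where "V = \<Omega> - K"
    have V: "open V" "V \<subseteq> \<Omega>" "x \<in> V"
      using x \<open>x \<notin> K\<close> open_domain compact_imp_closed[OF K] by (auto simp: V_def gsupport_def)
    interpret V: seminormed_space "smooth_on V" "smooth_seminorms V"
        by (rule seminormed_space_smooth[OF V(1)])
    have uV: "u \<in> V.nets"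
      using restrict_rel[OF V(1,2) open_domain rel_refl[OF u]] by (simp add: V.rel_iff)
    have u0: "(u, \<lambda>\<epsilon>. 0) \<in> V.rel"
      unfolding V.rel_iff
    proof (intro conjI uV V.moderate_zero ballI allI)
      fix p :: "('a \<Rightarrow> complex) \<Rightarrow> real" and b assume p: "p \<in> smooth_seminorms V"
      then obtain L j where L: "p = Ck_norm L j" "compact L" "L \<subseteq> V" by (auto simp: smooth_seminorms_def)
      show "has_order (\<lambda>\<epsilon>. p (u \<epsilon> - 0)) b"
      proof (rule has_orderI[of 1 _ 0])
        fix \<epsilon> :: real assume \<epsilon>: "0 < \<epsilon>" "\<epsilon> \<le> 1"
        then have "0 \<le> p (u \<epsilon>)" using V.seminorm_nonneg[OF p V.moderate_in[OF uV]] by simp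
        moreover have "p (u \<epsilon>) \<le> 0"
          unfolding L(1)
        proof (rule Ck_norm_le)
          fix y \<alpha> assume "y \<in> L"
          then have "partials \<alpha> (u \<epsilon>) y = 0"
            using L(3) \<epsilon> vanish by (intro partials_vanish[OF V(1)]) (auto simp: V_def)
          then show "cmod (partials \<alpha> (u \<epsilon>) y) \<le> 0" by simp
        qed simp
        ultimately show "\<bar>p (u \<epsilon> - 0)\<bar> \<le> 0 * \<epsilon> powr b" by simp
      qed simp
    qed
    have "gfun_class V v = gfun_class V (\<lambda>\<epsilon> x. 0)" if "v \<in> cls u" for v
    proof -
      have "(u, v) \<in> V.rel" using that restrict_rel[OF V(1,2) open_domain] by (simp add: in_cls_iff)
      then have "gfun_class V v = gfun_class V (\<lambda>\<epsilon>. 0)" using u0 V.cls_eq by metis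
      then show ?thesis by (simp add: zero_fun_def)
    qed
    then have "gfun_restrict V (cls u) = gfun_class V (\<lambda>\<epsilon> x. 0)"
      unfolding gfun_restrict_def using self_in_cls[OF u] by blast
    then show False using x V unfolding gsupport_def by blast
  qed
qed

text \<open>The support is \<open>K\<close> without the union of all open sets on which the class
  vanishes, hence closed in \<open>K\<close>.\<close>

lemma compact_gsupport:
  assumes "gsupport \<Omega> U \<subseteq> K" "compact K" "K \<subseteq> \<Omega>"
  shows "compact (gsupport \<Omega> U)"
proof -
  define W where "W = \<Union>{V. open V \<and> V \<subseteq> \<Omega> \<and> gfun_restrict V U = gfun_class V (\<lambda>\<epsilon> x. 0)}"
  have "gsupport \<Omega> U = K \<inter> - W" using assms(1,3) unfolding gsupport_def W_def by blast
  moreover have "open W" unfolding W_def by (rule open_Union) simp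
  ultimately show ?thesis using assms(2) by (simp add: compact_Int_closed closed_Compl)
qed

text \<open>Compactness makes a local property uniform: finitely many balls on which
  \<open>u\<close> is negligible cover \<open>L\<close>, and the norm over \<open>L\<close> is at
  most the sum of theirs.\<close>

lemma negligible_off_gsupport:
  assumes U: "U \<in> gfunctions \<Omega>" "u \<in> U" and L: "compact L" "L \<subseteq> \<Omega>" "L \<inter> gsupport \<Omega> U = {}"
  shows "has_order (\<lambda>\<epsilon>. Ck_norm L j (u \<epsilon>)) b"
proof -
  have um: "u \<in> nets"
    using member(1)[of U u] U by (simp add: gfunctions_def)
  have "\<exists>r>0. cball x r \<subseteq> \<Omega> \<and> has_order (\<lambda>\<epsilon>. Ck_norm (cball x r) j (u \<epsilon>)) b" if "x \<in> L" for x
  proof -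
    have "x \<in> \<Omega>" "x \<notin> gsupport \<Omega> U" using that L by auto
    then obtain V where V: "open V" "x \<in> V" "V \<subseteq> \<Omega>" "gfun_restrict V U = gfun_class V (\<lambda>\<epsilon> x. 0)"
      unfolding gsupport_def by blast
    interpret V: seminormed_space "smooth_on V" "smooth_seminorms V"
        by (rule seminormed_space_smooth[OF V(1)])
    have "u \<in> V.nets"
      using restrict_rel[OF V(1,3) open_domain rel_refl[OF um]] by (simp add: V.rel_iff)
    then have "u \<in> gfun_class V (\<lambda>\<epsilon>. 0)"
      using V(4) U(2) V.self_in_cls[of u] unfolding gfun_restrict_def zero_fun_def by blast
    then have u0: "(u, \<lambda>\<epsilon>. 0) \<in> V.rel" using V.rel_sym by (simp add: V.in_cls_iff)
    obtain r where r: "r > 0" "cball x r \<subseteq> V" using V(1,2) open_contains_cball by blast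
    then have "Ck_norm (cball x r) j \<in> smooth_seminorms V" unfolding smooth_seminorms_def
        using compact_cball by blast
    then have "has_order (\<lambda>\<epsilon>. Ck_norm (cball x r) j (u \<epsilon>)) b" using u0 by (simp add: V.rel_iff)
    then show ?thesis using r V(3) by blast
  qed
  then obtain r where r: "\<And>x. x \<in> L \<Longrightarrow> r x > 0 \<and> cball x (r x) \<subseteq> \<Omega>
      \<and> has_order (\<lambda>\<epsilon>. Ck_norm (cball x (r x)) j (u \<epsilon>)) b"
    by metis
  then have "L \<subseteq> (\<Union>x\<in>L. ball x (r x))" by auto
  then obtain D where D: "D \<subseteq> L" "finite D" "L \<subseteq> (\<Union>x\<in>D. ball x (r x))"
    by (rule compactE_image[OF L(1), rotated]) auto
  have "has_order (\<lambda>\<epsilon>. \<Sum>x\<in>D. Ck_norm (cball x (r x)) j (u \<epsilon>)) b"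
    using D r by (intro has_order_sum) auto
  then show ?thesis
  proof (rule has_order_bound[where c = 1])
    fix \<epsilon> :: real assume \<epsilon>: "\<epsilon> \<in> {0<..1}"
    have u: "u \<epsilon> \<in> smooth_on \<Omega>" by (rule moderate_in[OF um \<epsilon>])
    have nn: "0 \<le> Ck_norm (cball x (r x)) j (u \<epsilon>)" if "x \<in> D" for x
      using r[of x] that D by (intro Ck_norm_nonneg[OF u]) auto
    have "Ck_norm L j (u \<epsilon>) \<le> (\<Sum>x\<in>D. Ck_norm (cball x (r x)) j (u \<epsilon>))"
    proof (rule Ck_norm_le)
      fix y and \<alpha> :: "'a list" assume y: "y \<in> L" "\<alpha> \<in> lists Basis" "length \<alpha> \<le> j"
      obtain x where x: "x \<in> D" "y \<in> ball x (r x)" using D(3) y(1) by auto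
      have "cmod (partials \<alpha> (u \<epsilon>) y) \<le> Ck_norm (cball x (r x)) j (u \<epsilon>)"
        using r[of x] x D y by (intro Ck_norm_ge[OF u]) auto
      also have "\<dots> \<le> (\<Sum>x\<in>D. Ck_norm (cball x (r x)) j (u \<epsilon>))"
        using x(1) D(2) nn by (intro member_le_sum) auto
      finally show "cmod (partials \<alpha> (u \<epsilon>) y) \<le> (\<Sum>x\<in>D. Ck_norm (cball x (r x)) j (u \<epsilon>))" .
    qed (intro sum_nonneg nn)
    then show "\<bar>Ck_norm L j (u \<epsilon>)\<bar> \<le> 1 * \<bar>\<Sum>x\<in>D. Ck_norm (cball x (r x)) j (u \<epsilon>)\<bar>"
      using Ck_norm_nonneg[OF u L(1,2), of j] by simp
  qed
qed

text \<open>Representatives are known to be smooth on \<Omega> only, whereas basic nets act on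
  functions smooth everywhere. Vanishing on the open set \<open>- K\<close> closes the gap, because
  \<Omega> and \<open>- K\<close> cover the space.\<close>

lemma compact_repsE:
  assumes U: "U \<in> gfunctions \<Omega>" and u: "u \<in> compact_reps \<Omega> U"
  obtains K where "compact K" "K \<subseteq> \<Omega>" "\<And>\<epsilon>. \<epsilon> \<in> {0<..1} \<Longrightarrow> u \<epsilon> \<in> test_functions K"
    "u \<in> nets" "U = cls u" "gsupport \<Omega> U \<subseteq> K"
proof -
  obtain K where K: "compact K" "K \<subseteq> \<Omega>" "\<And>\<epsilon> x. \<epsilon> \<in> {0<..1} \<Longrightarrow> x \<notin> K \<Longrightarrow> u \<epsilon> x = 0" and uU: "u \<in> U"
    using u by (auto simp: compact_reps_def)
  have um: "u \<in> nets" "U = cls u"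
    using member[of U u] U uU by (auto simp: gfunctions_def)
  show thesis
  proof (rule that[OF K(1,2) _ um])
    show "gsupport \<Omega> U \<subseteq> K" unfolding um(2) by (rule gsupport_cls[OF um(1) K(1,3)])
    fix \<epsilon> :: real assume \<epsilon>: "\<epsilon> \<in> {0<..1}"
    have "u \<epsilon> \<in> smooth_on (- K)"
      using K \<epsilon> by (intro smooth_on_cong[OF _ _ smooth_on_const[of 0]]) (auto simp: compact_imp_closed)
    then have "u \<epsilon> \<in> smooth_on (\<Omega> \<union> - K)" using moderate_in[OF um(1) \<epsilon>] by (intro smooth_on_Un)
    moreover have "\<Omega> \<union> - K = UNIV" using K(2) by blast
    ultimately show "u \<epsilon> \<in> test_functions K" using K \<epsilon> by (intro test_functionsI[of _ K]) auto
  qed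
qed

lemma compact_reps_test:
  assumes "U \<in> gfunctions \<Omega>" "u \<in> compact_reps \<Omega> U" "\<epsilon> \<in> {0<..1}"
  shows "u \<epsilon> \<in> test_functions \<Omega>"
proof -
  obtain K where "K \<subseteq> \<Omega>" "\<And>\<epsilon>. \<epsilon> \<in> {0<..1} \<Longrightarrow> u \<epsilon> \<in> test_functions K"
    by (rule compact_repsE[OF assms(1,2)]) blast
  then show ?thesis using test_functions_mono assms(3) by blast
qed

lemma compact_repsI:
  assumes "u \<in> nets" "compact K" "K \<subseteq> \<Omega>"
    "\<And>\<epsilon> x. \<epsilon> \<in> {0<..1} \<Longrightarrow> x \<notin> K \<Longrightarrow> u \<epsilon> x = 0"
  shows "u \<in> compact_reps \<Omega> (cls u)" "cls u \<in> gfun_compact \<Omega>"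
  using assms self_in_cls[OF assms(1)] cls_in[OF assms(1)] compact_gsupport[OF gsupport_cls[OF assms(1,2,4)]
      assms(2,3)]
  by (auto simp: compact_reps_def gfun_compact_def gfunctions_def)

lemma basic_net_linear:
  assumes "basic_net \<Omega> \<tau>" "\<epsilon> \<in> {0<..1}" "f \<in> test_functions \<Omega>"
  shows "g \<in> test_functions \<Omega> \<Longrightarrow> \<tau> \<epsilon> (\<lambda>x. f x + g x) = \<tau> \<epsilon> f + \<tau> \<epsilon> g"
    and "\<tau> \<epsilon> (\<lambda>x. c * f x) = c * \<tau> \<epsilon> f"
    and "g \<in> test_functions \<Omega> \<Longrightarrow> \<tau> \<epsilon> (\<lambda>x. f x - g x) = \<tau> \<epsilon> f - \<tau> \<epsilon> g"
proof -
  have lin: "linear_functional_on (test_functions \<Omega>) (\<tau> \<epsilon>)"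
    using assms by (auto simp: basic_net_def distributions_def)
  have c: "\<tau> \<epsilon> (\<lambda>x. c * f x) = c * \<tau> \<epsilon> f" if "f \<in> test_functions \<Omega>" for c f
    using lin that by (simp add: linear_functional_on_def)
  have a: "\<tau> \<epsilon> (\<lambda>x. f x + g x) = \<tau> \<epsilon> f + \<tau> \<epsilon> g" if "g \<in> test_functions \<Omega>" for g
    using lin assms that by (simp add: linear_functional_on_def)
  show "g \<in> test_functions \<Omega> \<Longrightarrow> \<tau> \<epsilon> (\<lambda>x. f x + g x) = \<tau> \<epsilon> f + \<tau> \<epsilon> g" by (rule a)
  show "\<tau> \<epsilon> (\<lambda>x. c * f x) = c * \<tau> \<epsilon> f" by (rule c[OF assms(3)])
  show "\<tau> \<epsilon> (\<lambda>x. f x - g x) = \<tau> \<epsilon> f - \<tau> \<epsilon> g" if g: "g \<in> test_functions \<Omega>"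
    using a[OF test_functions_cmult[OF g, of "-1"]] c[OF g, of "-1"] by simp
qed

text \<open>\<open>j\<close> and \<open>N\<close> are fixed before the net \<open>w\<close>, so that
  one loss exponent serves all nets supported in \<open>K\<close>.\<close>

lemma basic_net_order:
  assumes \<tau>: "basic_net \<Omega> \<tau>" and K: "compact K" "K \<subseteq> \<Omega>"
  obtains j N :: nat where "\<And>w b. (\<And>\<epsilon>. \<epsilon> \<in> {0<..1} \<Longrightarrow> w \<epsilon> \<in> test_functions K) \<Longrightarrow>
    has_order (\<lambda>\<epsilon>. Ck_norm K j (w \<epsilon>)) b \<Longrightarrow> has_order (\<lambda>\<epsilon>. cmod (\<tau> \<epsilon> (w \<epsilon>))) (- real N + b)"
proof -
  obtain j N :: nat and c \<eta> where *: "c > 0" "\<eta> \<in> {0<..1}" "\<And>f \<epsilon>. f \<in> test_functions K \<Longrightarrow> \<epsilon> \<in> {0<..\<eta>} \<Longrightarrow>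
      cmod (\<tau> \<epsilon> f) \<le> c * \<epsilon> powr (- real N) * Ck_norm K j f"
    using \<tau> K unfolding basic_net_def by meson
  show thesis
  proof (rule that)
    fix w b assume w: "\<And>\<epsilon>. \<epsilon> \<in> {0<..1} \<Longrightarrow> w \<epsilon> \<in> test_functions K" and b:
        "has_order (\<lambda>\<epsilon>. Ck_norm K j (w \<epsilon>)) b"
    show "has_order (\<lambda>\<epsilon>. cmod (\<tau> \<epsilon> (w \<epsilon>))) (- real N + b)"
    proof (rule has_order_powr_bound[OF b, of \<eta> c])
      fix \<epsilon> :: real assume \<epsilon>: "0 < \<epsilon>" "\<epsilon> \<le> \<eta>" "\<epsilon> \<le> 1"
      then have "w \<epsilon> \<in> test_functions K" by (intro w) auto
      then show "\<bar>cmod (\<tau> \<epsilon> (w \<epsilon>))\<bar> \<le> c * \<epsilon> powr - real N * \<bar>Ck_norm K j (w \<epsilon>)\<bar>"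
        using *(3)[of "w \<epsilon>" \<epsilon>] \<epsilon> test_Ck_norm_nonneg[OF _ K(1), of "w \<epsilon>" K j] by simp
    qed (use * in auto)
  qed
qed

lemma basic_net_moderate:
  assumes \<tau>: "basic_net \<Omega> \<tau>" and U: "U \<in> gfunctions \<Omega>" "u \<in> compact_reps \<Omega> U"
  shows "(\<lambda>\<epsilon>. \<tau> \<epsilon> (u \<epsilon>)) \<in> moderate_numbers"
proof -
  obtain K where K: "compact K" "K \<subseteq> \<Omega>" "\<And>\<epsilon>. \<epsilon> \<in> {0<..1} \<Longrightarrow> u \<epsilon> \<in> test_functions K"
    "u \<in> nets"
    by (rule compact_repsE[OF U]) blast
  obtain j N :: nat where N: "\<And>b. has_order (\<lambda>\<epsilon>. Ck_norm K j (u \<epsilon>)) b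
      \<Longrightarrow> has_order (\<lambda>\<epsilon>. cmod (\<tau> \<epsilon> (u \<epsilon>))) (- real N + b)"
  proof -
    obtain j N :: nat where N: "\<And>w b. (\<And>\<epsilon>. \<epsilon> \<in> {0<..1} \<Longrightarrow> w \<epsilon> \<in> test_functions K) \<Longrightarrow>
        has_order (\<lambda>\<epsilon>. Ck_norm K j (w \<epsilon>)) b \<Longrightarrow> has_order (\<lambda>\<epsilon>. cmod (\<tau> \<epsilon> (w \<epsilon>))) (- real N + b)"
      by (rule basic_net_order[OF \<tau> K(1,2)]) blast
    show thesis by (rule that[OF N[OF K(3)]])
  qed
  obtain M :: nat where "has_order (\<lambda>\<epsilon>. Ck_norm K j (u \<epsilon>)) (- real M)"
    using moderate_order[OF K(4) seminorm_in[OF K(1,2)]] by blast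
  from N[OF this] show ?thesis by (intro num.moderateI) auto
qed

text \<open>Two representatives may have different supports. On the union their difference is a
  negligible net of test functions, and a basic net maps it to a negligible number.\<close>

lemma functional_of_eq:
  assumes \<tau>: "basic_net \<Omega> \<tau>" and U: "U \<in> gfunctions \<Omega>" and u: "u \<in> compact_reps \<Omega> U"
  shows "functional_of \<Omega> \<tau> U = num_class (\<lambda>\<epsilon>. \<tau> \<epsilon> (u \<epsilon>))"
proof -
  have "num_class (\<lambda>\<epsilon>. \<tau> \<epsilon> (v \<epsilon>)) = num_class (\<lambda>\<epsilon>. \<tau> \<epsilon> (u \<epsilon>))" if v: "v \<in> compact_reps \<Omega> U" for v
  proof (rule num.cls_eq, unfold num.rel_iff, intro conjI basic_net_moderate[OF \<tau> U] u v ballI allI)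
    fix p :: "complex \<Rightarrow> real" and b assume p: "p \<in> {cmod}"
    obtain K where K: "compact K" "K \<subseteq> \<Omega>" "\<And>\<epsilon>. \<epsilon> \<in> {0<..1} \<Longrightarrow> u \<epsilon> \<in> test_functions K"
      by (rule compact_repsE[OF U u]) blast
    obtain L where L: "compact L" "L \<subseteq> \<Omega>" "\<And>\<epsilon>. \<epsilon> \<in> {0<..1} \<Longrightarrow> v \<epsilon> \<in> test_functions L"
      by (rule compact_repsE[OF U v]) blast
    define M where "M = K \<union> L"
    have M: "compact M" "M \<subseteq> \<Omega>" using K L by (auto simp: M_def)
    have w: "u \<epsilon> \<in> test_functions M" "v \<epsilon> \<in> test_functions M" "(\<lambda>x. v \<epsilon> x - u \<epsilon> x) \<in> test_functions M" if
        "\<epsilon> \<in> {0<..1}" for \<epsilon>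
    proof -
      show 1: "u \<epsilon> \<in> test_functions M" "v \<epsilon> \<in> test_functions M"
        using K(3)[OF that] L(3)[OF that] test_functions_mono[of K M] test_functions_mono[of L M]
            by (auto simp: M_def)
      show "(\<lambda>x. v \<epsilon> x - u \<epsilon> x) \<in> test_functions M"
        using test_functions_add[OF 1(2) test_functions_cmult[OF 1(1), of "-1"]] by simp
    qed
    obtain j N :: nat where N: "\<And>w b. (\<And>\<epsilon>. \<epsilon> \<in> {0<..1} \<Longrightarrow> w \<epsilon> \<in> test_functions M) \<Longrightarrow>
        has_order (\<lambda>\<epsilon>. Ck_norm M j (w \<epsilon>)) b \<Longrightarrow> has_order (\<lambda>\<epsilon>. cmod (\<tau> \<epsilon> (w \<epsilon>))) (- real N + b)"
      by (rule basic_net_order[OF \<tau> M]) blast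
    have "(v, u) \<in> rel"
      using member_rel[of U v u] U u v by (auto simp: gfunctions_def compact_reps_def)
    then have "has_order (\<lambda>\<epsilon>. Ck_norm M j (\<lambda>x. v \<epsilon> x - u \<epsilon> x)) (real N + b)"
      using seminorm_in[OF M] by (simp add: rel_iff fun_diff_def)
    from N[OF w(3) this] have "has_order (\<lambda>\<epsilon>. cmod (\<tau> \<epsilon> (\<lambda>x. v \<epsilon> x - u \<epsilon> x))) b" by simp
    then show "has_order (\<lambda>\<epsilon>. p (\<tau> \<epsilon> (v \<epsilon>) - \<tau> \<epsilon> (u \<epsilon>))) b"
    proof (rule has_order_bound[where c = 1])
      fix \<epsilon> :: real assume \<epsilon>: "\<epsilon> \<in> {0<..1}"
      then have "u \<epsilon> \<in> test_functions \<Omega>" "v \<epsilon> \<in> test_functions \<Omega>"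
        using w[OF \<epsilon>] test_functions_mono[OF M(2)] by auto
      then show "\<bar>p (\<tau> \<epsilon> (v \<epsilon>) - \<tau> \<epsilon> (u \<epsilon>))\<bar> \<le> 1 * \<bar>cmod (\<tau> \<epsilon> (\<lambda>x. v \<epsilon> x - u \<epsilon> x))\<bar>"
        using p basic_net_linear(3)[OF \<tau> \<epsilon>] by simp
    qed
  qed
  then show ?thesis unfolding functional_of_def using u by blast
qed

end

text \<open>The existence of cut-off functions is assumed here and established for balls by
  \<open>cutoff_domain_ball\<close>. That \<kappa> is 1 on a neighbourhood, and not just on
  \<open>K\<close>, makes all derivatives of \<open>1 - \<kappa>\<close> vanish there.\<close>

locale cutoff_domain = open_domain \<Omega> for \<Omega> :: "'a::euclidean_space set" +
  assumes cutoff: "compact K \<Longrightarrow> K \<subseteq> \<Omega> \<Longrightarrow>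
    \<exists>\<kappa>\<in>test_functions \<Omega>. \<exists>V. open V \<and> K \<subseteq> V \<and> (\<forall>x\<in>V. \<kappa> x = 1)"
begin

text \<open>\<kappa> and \<open>L\<close> depend on \<open>K\<close> alone. A common support for all
  elements of \<open>gfun_supported \<Omega> K\<close> is what the neighbourhoods in the inductive
  limit topology require.\<close>

lemma cutoff_compact_rep:
  assumes K: "compact K" "K \<subseteq> \<Omega>"
  obtains \<kappa> L where "compact L" "L \<subseteq> \<Omega>" "\<kappa> \<in> test_functions L"
    "\<And>U u. U \<in> gfun_supported \<Omega> K \<Longrightarrow> u \<in> U \<Longrightarrow> (\<lambda>\<epsilon> x. \<kappa> x * u \<epsilon> x) \<in> compact_reps \<Omega> U"
proof -
  obtain \<kappa> V where \<kappa>: "\<kappa> \<in> test_functions \<Omega>" "open V" "K \<subseteq> V" "\<And>x. x \<in> V \<Longrightarrow> \<kappa> x = 1"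
    using cutoff[OF K] by blast
  obtain L where L: "compact L" "L \<subseteq> \<Omega>" "\<kappa> \<in> test_functions L" by (rule test_functionsE[OF \<kappa>(1)])
  have \<kappa>s: "\<kappa> \<in> smooth_on \<Omega>" using smooth_on_mono[OF test_functions_smooth[OF \<kappa>(1)]] by simp
  have \<kappa>s': "(\<lambda>x. 1 - \<kappa> x) \<in> smooth_on \<Omega>" by (rule smooth_on_diff[OF open_domain smooth_on_const \<kappa>s])
  show thesis
  proof (rule that[OF L])
    fix U u assume U: "U \<in> gfun_supported \<Omega> K" and u: "u \<in> U"
    have UG: "U \<in> gfunctions \<Omega>" and supp: "gsupport \<Omega> U \<subseteq> K"
      using U by (auto simp: gfun_supported_def gfun_compact_def)
    have um: "u \<in> nets" "U = cls u"
      using member[of U u] UG u by (auto simp: gfunctions_def)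
    have mod: "(\<lambda>\<epsilon> x. \<kappa> x * u \<epsilon> x) \<in> nets"
    proof (rule moderateI)
      show "(\<lambda>x. \<kappa> x * u \<epsilon> x) \<in> smooth_on \<Omega>" if "\<epsilon> \<in> {0<..1}" for \<epsilon>
        by (rule smooth_on_mult[OF open_domain \<kappa>s moderate_in[OF um(1) that]])
      fix p :: "('a \<Rightarrow> complex) \<Rightarrow> real" assume p: "p \<in> smooth_seminorms \<Omega>"
      then obtain M j where M: "p = Ck_norm M j" "compact M" "M \<subseteq> \<Omega>" by (auto simp: smooth_seminorms_def)
      obtain N :: nat where "has_order (\<lambda>\<epsilon>. p (u \<epsilon>)) (- real N)" using moderate_order[OF um(1) p] by blast
      then have "has_order (\<lambda>\<epsilon>. p (\<lambda>x. \<kappa> x * u \<epsilon> x)) (- real N)"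
      proof (rule has_order_bound[where c = "2 ^ j * p \<kappa>"])
        fix \<epsilon> :: real assume "\<epsilon> \<in> {0<..1}"
        then have uE: "u \<epsilon> \<in> smooth_on \<Omega>" by (rule moderate_in[OF um(1)])
        show "\<bar>p (\<lambda>x. \<kappa> x * u \<epsilon> x)\<bar> \<le> 2 ^ j * p \<kappa> * \<bar>p (u \<epsilon>)\<bar>"
          using Ck_norm_mult[OF open_domain \<kappa>s uE M(2,3), of j] seminorm_nonneg[OF p uE]
            seminorm_nonneg[OF p smooth_on_mult[OF open_domain \<kappa>s uE]] by (simp add: M(1))
      qed
      then show "\<exists>b. has_order (\<lambda>\<epsilon>. p (\<lambda>x. \<kappa> x * u \<epsilon> x)) b" ..
    qed
    have "(u, \<lambda>\<epsilon> x. \<kappa> x * u \<epsilon> x) \<in> rel"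
      unfolding rel_iff
    proof (intro conjI um(1) mod ballI allI)
      fix p :: "('a \<Rightarrow> complex) \<Rightarrow> real" and b assume p: "p \<in> smooth_seminorms \<Omega>"
      then obtain M j where M: "p = Ck_norm M j" "compact M" "M \<subseteq> \<Omega>" by (auto simp: smooth_seminorms_def)
      \<comment> \<open>On \<open>V\<close> the difference
        \<open>(1 - \<kappa>) * u \<epsilon>\<close> is zero, and the rest \<open>M - V\<close> of
        the compact set is disjoint from the support of \<open>U\<close>, so that \<open>u\<close>
        is negligible on it.\<close>
      define M' where "M' = M - V"
      have M': "compact M'" "M' \<subseteq> \<Omega>" "M' \<inter> gsupport \<Omega> U = {}"
        using M \<kappa>(2,3) supp by (auto simp: M'_def compact_diff)
      have "has_order (\<lambda>\<epsilon>. Ck_norm M' j (u \<epsilon>)) b" by (rule negligible_off_gsupport[OF UG u M'])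
      then show "has_order (\<lambda>\<epsilon>. p (u \<epsilon> - (\<lambda>x. \<kappa> x * u \<epsilon> x))) b"
      proof (rule has_order_bound[where c = "2 ^ j * Ck_norm M' j (\<lambda>x. 1 - \<kappa> x)"])
        fix \<epsilon> :: real assume \<epsilon>: "\<epsilon> \<in> {0<..1}"
        have uE: "u \<epsilon> \<in> smooth_on \<Omega>" by (rule moderate_in[OF um(1) \<epsilon>])
        define w where "w = (\<lambda>x. (1 - \<kappa> x) * u \<epsilon> x)"
        have eq: "u \<epsilon> - (\<lambda>x. \<kappa> x * u \<epsilon> x) = w" by (simp add: w_def fun_eq_iff left_diff_distrib)
        have w: "w \<in> smooth_on \<Omega>" unfolding w_def by (rule smooth_on_mult[OF open_domain \<kappa>s' uE])
        have "p w \<le> Ck_norm M' j w"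
          unfolding M(1)
        proof (rule Ck_norm_le)
          fix x and \<alpha> :: "'a list" assume x: "x \<in> M" "\<alpha> \<in> lists Basis" "length \<alpha> \<le> j"
          show "cmod (partials \<alpha> w x) \<le> Ck_norm M' j w"
          proof (cases "x \<in> V")
            case True
            have "partials \<alpha> w x = 0"
              by (rule partials_vanish[OF \<kappa>(2) _ True]) (simp add: w_def \<kappa>(4))
            then show ?thesis using Ck_norm_nonneg[OF w M'(1,2), of j] by simp
          qed (use x M' in \<open>auto simp: M'_def intro!: Ck_norm_ge[OF w]\<close>)
        qed (rule Ck_norm_nonneg[OF w M'(1,2)])
        also have "\<dots> \<le> 2 ^ j * Ck_norm M' j (\<lambda>x. 1 - \<kappa> x) * Ck_norm M' j (u \<epsilon>)"
          unfolding w_def by (rule Ck_norm_mult[OF open_domain \<kappa>s' uE M'(1,2)])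
        finally show "\<bar>p (u \<epsilon> - (\<lambda>x. \<kappa> x * u \<epsilon> x))\<bar>
            \<le> 2 ^ j * Ck_norm M' j (\<lambda>x. 1 - \<kappa> x) * \<bar>Ck_norm M' j (u \<epsilon>)\<bar>"
          unfolding eq using seminorm_nonneg[OF p w] Ck_norm_nonneg[OF uE M'(1,2), of j] by simp
      qed
    qed
    then have "(\<lambda>\<epsilon> x. \<kappa> x * u \<epsilon> x) \<in> U" by (simp add: um(2) in_cls_iff)
    then show "(\<lambda>\<epsilon> x. \<kappa> x * u \<epsilon> x) \<in> compact_reps \<Omega> U"
      using L test_functions_vanish[OF L(3)] by (auto simp: compact_reps_def)
  qed
qed

lemma compact_rep_exists:
  assumes "U \<in> gfun_compact \<Omega>"
  obtains u where "u \<in> compact_reps \<Omega> U"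
proof -
  have U: "U \<in> gfun_supported \<Omega> (gsupport \<Omega> U)" using assms by (simp add: gfun_supported_def)
  have K: "compact (gsupport \<Omega> U)" "gsupport \<Omega> U \<subseteq> \<Omega>"
    using assms by (auto simp: gfun_compact_def gsupport_def)
  obtain u where u: "u \<in> U" using assms colombeauE unfolding gfun_compact_def gfunctions_def by blast
  show thesis
    by (rule cutoff_compact_rep[OF K]) (use that U u in blast)
qed

lemma gfun_compact_plus:
  assumes "u \<in> compact_reps \<Omega> U" "v \<in> compact_reps \<Omega> V" "U \<in> gfunctions \<Omega>" "V \<in> gfunctions \<Omega>"
  shows "gfun_plus \<Omega> U V \<in> gfun_compact \<Omega>" "(\<lambda>\<epsilon> x. u \<epsilon> x + v \<epsilon> x) \<in> compact_reps \<Omega> (gfun_plus \<Omega> U V)"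
proof -
  obtain K where K: "compact K" "K \<subseteq> \<Omega>" "\<And>\<epsilon>. \<epsilon> \<in> {0<..1} \<Longrightarrow> u \<epsilon> \<in> test_functions K"
    "u \<in> nets" "U = cls u"
    by (rule compact_repsE[OF assms(3,1)]) blast
  obtain L where L: "compact L" "L \<subseteq> \<Omega>" "\<And>\<epsilon>. \<epsilon> \<in> {0<..1} \<Longrightarrow> v \<epsilon> \<in> test_functions L"
    "v \<in> nets" "V = cls v"
    by (rule compact_repsE[OF assms(4,2)]) blast
  have "gfun_plus \<Omega> U V = cls (\<lambda>\<epsilon> x. u \<epsilon> x + v \<epsilon> x)"
    unfolding K(5) L(5) by (rule gfun_plus_class[OF K(4) L(4)])
  moreover have "u \<epsilon> x + v \<epsilon> x = 0" if "\<epsilon> \<in> {0<..1}" "x \<notin> K \<union> L" for \<epsilon> x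
    using that test_functions_vanish[OF K(3)] test_functions_vanish[OF L(3)] by auto
  ultimately show "gfun_plus \<Omega> U V \<in> gfun_compact \<Omega>"
      "(\<lambda>\<epsilon> x. u \<epsilon> x + v \<epsilon> x) \<in> compact_reps \<Omega> (gfun_plus \<Omega> U V)"
    using compact_repsI[OF moderate_plus[OF K(4) L(4)], of "K \<union> L"] K L by auto
qed

lemma gfun_compact_scale:
  assumes "c \<in> moderate_numbers" "u \<in> compact_reps \<Omega> U" "U \<in> gfunctions \<Omega>"
  shows "gfun_scale \<Omega> (num_class c) U \<in> gfun_compact \<Omega>"
    "(\<lambda>\<epsilon> x. c \<epsilon> * u \<epsilon> x) \<in> compact_reps \<Omega> (gfun_scale \<Omega> (num_class c) U)"
proof -
  obtain K where K: "compact K" "K \<subseteq> \<Omega>" "\<And>\<epsilon>. \<epsilon> \<in> {0<..1} \<Longrightarrow> u \<epsilon> \<in> test_functions K"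
    "u \<in> nets" "U = cls u"
    by (rule compact_repsE[OF assms(3,2)]) blast
  have "gfun_scale \<Omega> (num_class c) U = cls (\<lambda>\<epsilon> x. c \<epsilon> * u \<epsilon> x)"
    unfolding K(5) by (rule gfun_scale_class[OF assms(1) K(4)])
  moreover have "c \<epsilon> * u \<epsilon> x = 0" if "\<epsilon> \<in> {0<..1}" "x \<notin> K" for \<epsilon> x
    using that test_functions_vanish[OF K(3)] by auto
  ultimately show "gfun_scale \<Omega> (num_class c) U \<in> gfun_compact \<Omega>"
    "(\<lambda>\<epsilon> x. c \<epsilon> * u \<epsilon> x) \<in> compact_reps \<Omega> (gfun_scale \<Omega> (num_class c) U)"
    using compact_repsI[OF moderate_scale[OF assms(1) K(4)], of K] K by auto
qed

lemma zero_compact: "(\<lambda>\<epsilon> x. 0) \<in> compact_reps \<Omega> (cls (\<lambda>\<epsilon> x. 0))" "cls (\<lambda>\<epsilon> x. 0) \<in> gfun_compact \<Omega>"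
  "gsupport \<Omega> (cls (\<lambda>\<epsilon> x. 0)) = {}"
proof -
  have "(\<lambda>\<epsilon> x. 0) \<in> nets"
    using moderate_zero by (simp add: zero_fun_def)
  then show "(\<lambda>\<epsilon> x. 0) \<in> compact_reps \<Omega> (cls (\<lambda>\<epsilon> x. 0))" "cls (\<lambda>\<epsilon> x. 0) \<in> gfun_compact \<Omega>"
    "gsupport \<Omega> (cls (\<lambda>\<epsilon> x. 0)) = {}"
    using compact_repsI[of "\<lambda>\<epsilon> x. 0" "{}"] gsupport_cls[of "\<lambda>\<epsilon> x. 0" "{}"] by auto
qed

section \<open>Linearity and continuity of the functional of a basic net\<close>

context
  fixes \<tau> assumes \<tau>: "basic_net \<Omega> \<tau>"
begin

lemma functional_of_in:
  assumes "U \<in> gfun_compact \<Omega>"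
  shows "functional_of \<Omega> \<tau> U \<in> gnumbers"
proof -
  have U: "U \<in> gfunctions \<Omega>" using assms by (simp add: gfun_compact_def)
  obtain u where u: "u \<in> compact_reps \<Omega> U" by (rule compact_rep_exists[OF assms])
  show ?thesis
    unfolding functional_of_eq[OF \<tau> U u] gnumbers_def by (rule num.cls_in[OF basic_net_moderate[OF \<tau> U u]])
qed

lemma functional_of_plus:
  assumes U: "U \<in> gfun_compact \<Omega>" and V: "V \<in> gfun_compact \<Omega>"
  shows "functional_of \<Omega> \<tau> (gfun_plus \<Omega> U V) = gnum_plus (functional_of \<Omega> \<tau> U) (functional_of \<Omega> \<tau> V)"
proof -
  have G: "U \<in> gfunctions \<Omega>" "V \<in> gfunctions \<Omega>" using U V by (auto simp: gfun_compact_def)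
  obtain u where u: "u \<in> compact_reps \<Omega> U" by (rule compact_rep_exists[OF U])
  obtain v where v: "v \<in> compact_reps \<Omega> V" by (rule compact_rep_exists[OF V])
  have mod: "(\<lambda>\<epsilon>. \<tau> \<epsilon> (u \<epsilon>)) \<in> moderate_numbers" "(\<lambda>\<epsilon>. \<tau> \<epsilon> (v \<epsilon>)) \<in> moderate_numbers"
    by (rule basic_net_moderate[OF \<tau> G(1) u], rule basic_net_moderate[OF \<tau> G(2) v])
  have PG: "gfun_plus \<Omega> U V \<in> gfunctions \<Omega>" using gfun_compact_plus(1)[OF u v G]
      by (simp add: gfun_compact_def)
  have m: "(\<lambda>\<epsilon>. \<tau> \<epsilon> (\<lambda>x. u \<epsilon> x + v \<epsilon> x)) \<in> moderate_numbers"
    by (rule basic_net_moderate[OF \<tau> PG gfun_compact_plus(2)[OF u v G]])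
  have "((\<lambda>\<epsilon>. \<tau> \<epsilon> (\<lambda>x. u \<epsilon> x + v \<epsilon> x)), (\<lambda>\<epsilon>. \<tau> \<epsilon> (u \<epsilon>) + \<tau> \<epsilon> (v \<epsilon>))) \<in> num.rel"
    unfolding num.rel_iff
  proof (intro conjI m num.moderate_add mod ballI allI)
    fix p :: "complex \<Rightarrow> real" and b assume p: "p \<in> {cmod}"
    show "has_order (\<lambda>\<epsilon>. p (\<tau> \<epsilon> (\<lambda>x. u \<epsilon> x + v \<epsilon> x) - (\<tau> \<epsilon> (u \<epsilon>) + \<tau> \<epsilon> (v \<epsilon>)))) b"
    proof (rule has_orderI[of 1 _ 0])
      fix \<epsilon> :: real assume "0 < \<epsilon>" "\<epsilon> \<le> 1"
      then have \<epsilon>: "\<epsilon> \<in> {0<..1}" by simp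
      have "u \<epsilon> \<in> test_functions \<Omega>" "v \<epsilon> \<in> test_functions \<Omega>"
        using compact_reps_test[OF G(1) u \<epsilon>] compact_reps_test[OF G(2) v \<epsilon>] .
      then have "\<tau> \<epsilon> (\<lambda>x. u \<epsilon> x + v \<epsilon> x) - (\<tau> \<epsilon> (u \<epsilon>) + \<tau> \<epsilon> (v \<epsilon>)) = 0"
        using basic_net_linear(1)[OF \<tau> \<epsilon>] by simp
      then show "\<bar>p (\<tau> \<epsilon> (\<lambda>x. u \<epsilon> x + v \<epsilon> x) - (\<tau> \<epsilon> (u \<epsilon>) + \<tau> \<epsilon> (v \<epsilon>)))\<bar> \<le> 0 * \<epsilon> powr b"
        using p by simp
    qed simp
  qed
  from num.cls_eq[OF this] show ?thesis
    unfolding functional_of_eq[OF \<tau> G(1) u] functional_of_eq[OF \<tau> G(2) v]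
      functional_of_eq[OF \<tau> PG gfun_compact_plus(2)[OF u v G]] gnum_plus_class[OF mod] .
qed

lemma functional_of_scale:
  assumes c: "c \<in> moderate_numbers" and U: "U \<in> gfun_compact \<Omega>"
  shows "functional_of \<Omega> \<tau> (gfun_scale \<Omega> (num_class c) U) = gnum_times (num_class c) (functional_of \<Omega> \<tau> U)"
proof -
  have G: "U \<in> gfunctions \<Omega>" using U by (auto simp: gfun_compact_def)
  obtain u where u: "u \<in> compact_reps \<Omega> U" by (rule compact_rep_exists[OF U])
  have mod: "(\<lambda>\<epsilon>. \<tau> \<epsilon> (u \<epsilon>)) \<in> moderate_numbers" by (rule basic_net_moderate[OF \<tau> G u])
  have PG: "gfun_scale \<Omega> (num_class c) U \<in> gfunctions \<Omega>" using gfun_compact_scale(1)[OF c u G]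
      by (simp add: gfun_compact_def)
  have "((\<lambda>\<epsilon>. \<tau> \<epsilon> (\<lambda>x. c \<epsilon> * u \<epsilon> x)), (\<lambda>\<epsilon>. c \<epsilon> * \<tau> \<epsilon> (u \<epsilon>))) \<in> num.rel"
    unfolding num.rel_iff
  proof (intro conjI basic_net_moderate[OF \<tau> PG gfun_compact_scale(2)[OF c u G]] ballI allI)
    show "(\<lambda>\<epsilon>. c \<epsilon> * \<tau> \<epsilon> (u \<epsilon>)) \<in> moderate_numbers"
      using rel_mult_numbers[OF num.rel_refl[OF c] num.rel_refl[OF mod]] by (simp add: num.rel_iff)
    fix p :: "complex \<Rightarrow> real" and b assume p: "p \<in> {cmod}"
    show "has_order (\<lambda>\<epsilon>. p (\<tau> \<epsilon> (\<lambda>x. c \<epsilon> * u \<epsilon> x) - c \<epsilon> * \<tau> \<epsilon> (u \<epsilon>))) b"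
    proof (rule has_orderI[of 1 _ 0])
      fix \<epsilon> :: real assume "0 < \<epsilon>" "\<epsilon> \<le> 1"
      then have \<epsilon>: "\<epsilon> \<in> {0<..1}" by simp
      have "u \<epsilon> \<in> test_functions \<Omega>"
        by (rule compact_reps_test[OF G u \<epsilon>])
      then show "\<bar>p (\<tau> \<epsilon> (\<lambda>x. c \<epsilon> * u \<epsilon> x) - c \<epsilon> * \<tau> \<epsilon> (u \<epsilon>))\<bar> \<le> 0 * \<epsilon> powr b"
        using p basic_net_linear(2)[OF \<tau> \<epsilon>] by simp
    qed simp
  qed
  from num.cls_eq[OF this] show ?thesis
    unfolding functional_of_eq[OF \<tau> G u]
      functional_of_eq[OF \<tau> PG gfun_compact_scale(2)[OF c u G]] gnum_times_class[OF c mod] .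
qed

lemma functional_of_less_iff:
  assumes U: "U \<in> gfun_compact \<Omega>" and u: "u \<in> compact_reps \<Omega> U" and r: "0 < r"
  shows "ultra_seminorm cmod (functional_of \<Omega> \<tau> U) < r \<longleftrightarrow> (\<exists>b. - ln r < b
      \<and> has_order (\<lambda>\<epsilon>. cmod (\<tau> \<epsilon> (u \<epsilon>))) b)"
proof -
  have G: "U \<in> gfunctions \<Omega>" using U by (auto simp: gfun_compact_def)
  show ?thesis
    using num.ultra_seminorm_less_iff[OF num.cls_in num.self_in_cls, OF basic_net_moderate[OF \<tau> G u]
        basic_net_moderate[OF \<tau> G u] _ r, of cmod]
    unfolding functional_of_eq[OF \<tau> G u] by simp
qed

text \<open>The preimage of a ball around 0. These sets turn out to be among the absolutely convex
  sets that define the inductive limit topology.\<close>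

definition "small r = {V \<in> gfun_compact \<Omega>. ultra_seminorm cmod (functional_of \<Omega> \<tau> V) < r}"

lemma absolutely_convex_small:
  assumes r: "0 < r"
  shows "absolutely_convex \<Omega> (small r)"
  unfolding absolutely_convex_def
proof (intro conjI ballI impI)
  fix C U assume C: "C \<in> gnumbers" "ultra_seminorm cmod C \<le> 1" and U: "U \<in> small r"
  obtain c where c: "c \<in> moderate_numbers" "C = num_class c" "c \<in> C"
    using C(1) unfolding gnumbers_def by (rule num.colombeauE)
  have Uc: "U \<in> gfun_compact \<Omega>" using U by (simp add: small_def)
  then have G: "U \<in> gfunctions \<Omega>" by (auto simp: gfun_compact_def)
  obtain u where u: "u \<in> compact_reps \<Omega> U" by (rule compact_rep_exists[OF Uc])
  obtain b where b: "- ln r < b" "has_order (\<lambda>\<epsilon>. cmod (\<tau> \<epsilon> (u \<epsilon>))) b"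
    using U functional_of_less_iff[OF Uc u r] by (auto simp: small_def)
  \<comment> \<open>The net \<open>c\<close> has every negative order but possibly not order 0. Half
    of the gap \<open>b + ln r\<close> is spent on it, and the product still has an order above
    \<open>- ln r\<close>.\<close>
  have "has_order (\<lambda>\<epsilon>. cmod (c \<epsilon>)) (- (b + ln r) / 2)"
    using b C c by (intro num.ultra_seminorm_le_1[of C]) (auto simp: gnumbers_def)
  from has_order_mult[OF this b(2)] have "has_order (\<lambda>\<epsilon>. cmod (\<tau> \<epsilon> (\<lambda>x. c \<epsilon> * u \<epsilon> x))) (- (b + ln r) / 2 +
      b)"
  proof (rule has_order_bound[where c = 1])
    fix \<epsilon> :: real assume \<epsilon>: "\<epsilon> \<in> {0<..1}"
    have "u \<epsilon> \<in> test_functions \<Omega>" by (rule compact_reps_test[OF G u \<epsilon>])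
    then show "\<bar>cmod (\<tau> \<epsilon> (\<lambda>x. c \<epsilon> * u \<epsilon> x))\<bar> \<le> 1 * \<bar>cmod (c \<epsilon>) * cmod (\<tau> \<epsilon> (u \<epsilon>))\<bar>"
      using basic_net_linear(2)[OF \<tau> \<epsilon>] by (simp add: norm_mult)
  qed
  moreover have "- ln r < - (b + ln r) / 2 + b" using b(1) by (simp add: field_simps)
  ultimately show "gfun_scale \<Omega> C U \<in> small r"
    using functional_of_less_iff[OF gfun_compact_scale[OF c(1) u G] r] gfun_compact_scale(1)[OF c(1) u G]
    unfolding small_def c(2) by blast
next
  fix U V assume UV: "U \<in> small r" "V \<in> small r"
  have c: "U \<in> gfun_compact \<Omega>" "V \<in> gfun_compact \<Omega>" using UV by (auto simp: small_def)
  then have G: "U \<in> gfunctions \<Omega>" "V \<in> gfunctions \<Omega>" by (auto simp: gfun_compact_def)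
  obtain u where u: "u \<in> compact_reps \<Omega> U" by (rule compact_rep_exists[OF c(1)])
  obtain v where v: "v \<in> compact_reps \<Omega> V" by (rule compact_rep_exists[OF c(2)])
  obtain a b where ab: "- ln r < a" "has_order (\<lambda>\<epsilon>. cmod (\<tau> \<epsilon> (u \<epsilon>))) a" "- ln r < b"
      "has_order (\<lambda>\<epsilon>. cmod (\<tau> \<epsilon> (v \<epsilon>))) b"
    using UV functional_of_less_iff[OF c(1) u r] functional_of_less_iff[OF c(2) v r]
        by (auto simp: small_def)
  \<comment> \<open>A sum has the smaller of the two orders. This is the ultrametric inequality, by
    which a ball is stable under addition.\<close>
  have "has_order (\<lambda>\<epsilon>. cmod (\<tau> \<epsilon> (u \<epsilon>)) + cmod (\<tau> \<epsilon> (v \<epsilon>))) (min a b)"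
    using ab by (intro has_order_add) (auto elim: has_order_mono)
  then have "has_order (\<lambda>\<epsilon>. cmod (\<tau> \<epsilon> (\<lambda>x. u \<epsilon> x + v \<epsilon> x))) (min a b)"
  proof (rule has_order_bound[where c = 1])
    fix \<epsilon> :: real assume \<epsilon>: "\<epsilon> \<in> {0<..1}"
    have "u \<epsilon> \<in> test_functions \<Omega>" "v \<epsilon> \<in> test_functions \<Omega>"
      using compact_reps_test[OF G(1) u \<epsilon>] compact_reps_test[OF G(2) v \<epsilon>] .
    then show "\<bar>cmod (\<tau> \<epsilon> (\<lambda>x. u \<epsilon> x + v \<epsilon> x))\<bar> \<le> 1 * \<bar>cmod (\<tau> \<epsilon> (u \<epsilon>)) + cmod (\<tau> \<epsilon> (v \<epsilon>))\<bar>"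
      using basic_net_linear(1)[OF \<tau> \<epsilon>] norm_triangle_ineq by simp
  qed
  moreover have "- ln r < min a b" using ab by simp
  ultimately show "gfun_plus \<Omega> U V \<in> small r"
    using functional_of_less_iff[OF gfun_compact_plus[OF u v G] r] gfun_compact_plus(1)[OF u v G]
    unfolding small_def by blast
qed

text \<open>The elements supported in \<open>K\<close> have representatives supported in one compact
  set \<open>L\<close>, so a single pair \<open>j\<close>, \<open>N\<close> controls the functional
  on all of them.\<close>

lemma small_neighbourhood:
  assumes r: "0 < r" and K: "compact K" "K \<subseteq> \<Omega>"
  shows "\<exists>W. openin (subtopology (colombeau_topology (smooth_on \<Omega>) (smooth_seminorms \<Omega>)) (gfun_supported \<Omega>
      K)) W \<and>
    cls (\<lambda>\<epsilon> x. 0) \<in> W \<and> W \<subseteq> small r"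
proof -
  let ?Z = "cls (\<lambda>\<epsilon> x. 0)"
  obtain \<kappa> L where L: "compact L" "L \<subseteq> \<Omega>" "\<kappa> \<in> test_functions L"
    "\<And>U u. U \<in> gfun_supported \<Omega> K \<Longrightarrow> u \<in> U \<Longrightarrow> (\<lambda>\<epsilon> x. \<kappa> x * u \<epsilon> x) \<in> compact_reps \<Omega> U"
    by (rule cutoff_compact_rep[OF K]) blast
  obtain j N :: nat where N: "\<And>w b. (\<And>\<epsilon>. \<epsilon> \<in> {0<..1} \<Longrightarrow> w \<epsilon> \<in> test_functions L) \<Longrightarrow>
      has_order (\<lambda>\<epsilon>. Ck_norm L j (w \<epsilon>)) b \<Longrightarrow> has_order (\<lambda>\<epsilon>. cmod (\<tau> \<epsilon> (w \<epsilon>))) (- real N + b)"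
    by (rule basic_net_order[OF \<tau> L(1,2)]) blast
  \<comment> \<open>A loss of \<open>\<epsilon> powr (- real N)\<close> lowers the valuation by at
    most \<open>N\<close>, that is, it multiplies the ultra-pseudo-seminorm by at most
    \<open>exp (real N)\<close>.\<close>
  define p r' where "p = Ck_norm L j" and "r' = r * exp (- real N)"
  have p: "p \<in> smooth_seminorms \<Omega>" unfolding p_def by (rule seminorm_in[OF L(1,2)])
  have r': "0 < r'" "- ln r' = - ln r + real N" using r by (auto simp: r'_def ln_mult)
  have Zm: "(\<lambda>\<epsilon> x. 0) \<in> nets"
    using moderate_zero by (simp add: zero_fun_def)
  have Z: "?Z \<in> colombeau (smooth_on \<Omega>) (smooth_seminorms \<Omega>)" by (rule cls_in[OF Zm])
  have minus: "lift2 (smooth_on \<Omega>) (smooth_seminorms \<Omega>) (-) B ?Z = B" if B: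
      "B \<in> colombeau (smooth_on \<Omega>) (smooth_seminorms \<Omega>)" for B
  proof -
    obtain u where u: "u \<in> nets" "B = cls u" by (rule colombeauE[OF B])
    show ?thesis unfolding u(2) lift2_diff[OF u(1) Zm] by (simp add: fun_diff_def)
  qed
  define W where "W = gfun_supported \<Omega> K \<inter> {B \<in> colombeau (smooth_on \<Omega>) (smooth_seminorms \<Omega>).
    ultra_seminorm p (lift2 (smooth_on \<Omega>) (smooth_seminorms \<Omega>) (-) B ?Z) < r'}"
  show ?thesis
  proof (intro exI conjI)
    show "openin (subtopology (colombeau_topology (smooth_on \<Omega>) (smooth_seminorms \<Omega>)) (gfun_supported \<Omega> K))
        W"
      unfolding W_def by (rule openin_subtopology_Int2[OF openin_ultra_ball[OF p Z r'(1)]])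
    have "has_order (\<lambda>\<epsilon>. p (\<lambda>x. 0)) (- ln r' + 1)"
      using seminorm_0[OF p] by (simp add: zero_fun_def)
    moreover have "- ln r' < - ln r' + 1" by simp
    ultimately have "ultra_seminorm p ?Z < r'"
      using ultra_seminorm_less_iff[OF Z self_in_cls[OF Zm] p r'(1)] by blast
    then show "?Z \<in> W"
      using zero_compact Z minus[OF Z] by (auto simp: W_def gfun_supported_def)
    show "W \<subseteq> small r"
    proof
      fix U assume "U \<in> W"
      then have U: "U \<in> gfun_supported \<Omega> K" "U \<in> colombeau (smooth_on \<Omega>) (smooth_seminorms \<Omega>)"
          "ultra_seminorm p U < r'"
        using minus by (auto simp: W_def)
      have Uc: "U \<in> gfun_compact \<Omega>" using U by (simp add: gfun_supported_def)
      obtain u where u: "u \<in> nets" "u \<in> U" by (rule colombeauE[OF U(2)])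
      define w where "w = (\<lambda>\<epsilon> x. \<kappa> x * u \<epsilon> x)"
      have w: "w \<in> compact_reps \<Omega> U" unfolding w_def by (rule L(4)[OF U(1) u(2)])
      then have wU: "w \<in> U" by (simp add: compact_reps_def)
      obtain b where b: "- ln r' < b" "has_order (\<lambda>\<epsilon>. p (w \<epsilon>)) b"
        using ultra_seminorm_less_iff[OF U(2) wU p r'(1)] U(3) by blast
      have "w \<epsilon> \<in> test_functions L" if \<epsilon>: "\<epsilon> \<in> {0<..1}" for \<epsilon>
      proof -
        have "w \<epsilon> \<in> smooth_on UNIV"
          using compact_reps_test[OF _ w \<epsilon>] U(2) test_functions_smooth by (auto simp: gfunctions_def)
        then show ?thesis
          using test_functions_vanish[OF L(3)] by (intro test_functionsI[OF _ L(1) order_refl]) (auto simp: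
              w_def)
      qed
      from N[OF this b(2)[unfolded p_def]] have "has_order (\<lambda>\<epsilon>. cmod (\<tau> \<epsilon> (w \<epsilon>))) (- real N + b)" .
      moreover have "- ln r < - real N + b" using b(1) r'(2) by simp
      ultimately show "U \<in> small r"
        using functional_of_less_iff[OF Uc w r] Uc unfolding small_def by blast
    qed
  qed
qed

lemma openin_translate_small:
  assumes "U \<in> gfun_compact \<Omega>" "0 < r"
  shows "openin (inductive_limit_topology \<Omega>) (gfun_plus \<Omega> U ` small r)"
proof -
  have "small r \<subseteq> gfun_compact \<Omega>" by (auto simp: small_def)
  moreover have "\<forall>K. compact K \<and> K \<subseteq> \<Omega> \<longrightarrow> (\<exists>W.
      openin (subtopology (colombeau_topology (smooth_on \<Omega>) (smooth_seminorms \<Omega>)) (gfun_supported \<Omega> K)) W \<and>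
      cls (\<lambda>\<epsilon> x. 0) \<in> W \<and> W \<subseteq> small r)"
    using small_neighbourhood[OF assms(2)] by blast
  ultimately show ?thesis
    unfolding inductive_limit_topology_def
    by (intro topology_generated_by_Basis CollectI exI[of _ U] exI[of _ "small r"] conjI refl assms(1)
        absolutely_convex_small[OF assms(2)])
qed

lemma gfun_plus_zero:
  assumes "U \<in> gfun_compact \<Omega>"
  shows "gfun_plus \<Omega> U (cls (\<lambda>\<epsilon> x. 0)) = U"
proof -
  obtain u where u: "u \<in> nets" "U = cls u"
    using assms colombeauE unfolding gfun_compact_def gfunctions_def by blast
  have "(\<lambda>\<epsilon> x. 0) \<in> nets"
    using moderate_zero by (simp add: zero_fun_def)
  from gfun_plus_class[OF u(1) this] show ?thesis by (simp add: u(2))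
qed

lemma topspace_inductive_limit: "topspace (inductive_limit_topology \<Omega>) \<subseteq> gfun_compact \<Omega>"
proof -
  have "gfun_plus \<Omega> U V \<in> gfun_compact \<Omega>" if "U \<in> gfun_compact \<Omega>" "V \<in> gfun_compact \<Omega>" for U V
    using compact_rep_exists[OF that(1)] compact_rep_exists[OF that(2)] gfun_compact_plus(1) that
    unfolding gfun_compact_def by (metis (no_types, lifting) mem_Collect_eq)
  then show ?thesis unfolding inductive_limit_topology_def topology_generated_by_topspace by blast
qed

lemma small_zero: "0 < r \<Longrightarrow> cls (\<lambda>\<epsilon> x. 0) \<in> small r"
  using small_neighbourhood[OF _ compact_empty empty_subsetI, of r] by blast

theorem functional_of_gfunctional: "functional_of \<Omega> \<tau> \<in> gfunctionals \<Omega>"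
  unfolding gfunctionals_def
proof (intro CollectI conjI ballI functional_of_plus)
  fix c U assume "c \<in> gnumbers" and U: "U \<in> gfun_compact \<Omega>"
  then obtain d where "d \<in> moderate_numbers" "c = num_class d" unfolding gnumbers_def
      by (blast elim: num.colombeauE)
  then show "functional_of \<Omega> \<tau> (gfun_scale \<Omega> c U) = gnum_times c (functional_of \<Omega> \<tau> U)"
    using functional_of_scale[OF _ U] by simp
next
  let ?T = "functional_of \<Omega> \<tau>"
  have zero: "ultra_seminorm cmod (num_class (\<lambda>\<epsilon>. 0)) < r" if "0 < r" for r
  proof -
    have "has_order (\<lambda>\<epsilon>. cmod 0) (- ln r + 1)" by simp
    then show ?thesis
      using num.ultra_seminorm_less_iff[OF num.cls_in[OF num.moderate_zero] num.self_in_cls[OF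
          num.moderate_zero] _ that, of cmod]
      by (auto intro!: exI[of _ "- ln r + 1"])
  qed
  show "continuous_map (inductive_limit_topology \<Omega>) (colombeau_topology UNIV {cmod}) ?T"
    unfolding colombeau_topology_def continuous_on_generated_topo_iff
  proof (intro conjI allI impI)
    fix O' assume "O' \<in> {{B \<in> colombeau UNIV {cmod}. ultra_seminorm p (lift2 UNIV {cmod} (-) B A) < r} |p A
        r.
        p \<in> {cmod} \<and> A \<in> colombeau UNIV {cmod} \<and> 0 < r}"
    then obtain A r where O': "O' = {B \<in> colombeau UNIV {cmod}. ultra_seminorm cmod (lift2 UNIV {cmod} (-) B
        A) < r}"
      and A: "A \<in> colombeau UNIV {cmod}" and r: "0 < r" by auto
    obtain a where a: "a \<in> moderate_numbers" "A = num_class a" by (rule num.colombeauE[OF A])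
    have char: "?T U \<in> O' \<longleftrightarrow> (\<exists>b. - ln r < b \<and> has_order (\<lambda>\<epsilon>. cmod (\<tau> \<epsilon> (u \<epsilon>) - a \<epsilon>)) b)"
      if U: "U \<in> gfun_compact \<Omega>" and u: "u \<in> compact_reps \<Omega> U" for U u
    proof -
      have G: "U \<in> gfunctions \<Omega>" using U by (simp add: gfun_compact_def)
      have m: "(\<lambda>\<epsilon>. \<tau> \<epsilon> (u \<epsilon>)) \<in> moderate_numbers" by (rule basic_net_moderate[OF \<tau> G u])
      have "?T U \<in> O' \<longleftrightarrow> ultra_seminorm cmod (num_class (\<lambda>\<epsilon>. \<tau> \<epsilon> (u \<epsilon>) - a \<epsilon>)) < r"
        using num.cls_in[OF m] unfolding O' functional_of_eq[OF \<tau> G u] a(2)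
            by (simp add: num.lift2_diff[OF m a(1)])
      also have "\<dots> \<longleftrightarrow> (\<exists>b. - ln r < b \<and> has_order (\<lambda>\<epsilon>. cmod (\<tau> \<epsilon> (u \<epsilon>) - a \<epsilon>)) b)"
        using num.moderate_diff[OF m a(1)]
        by (intro num.ultra_seminorm_less_iff num.cls_in num.self_in_cls r) auto
      finally show ?thesis .
    qed
    show "openin (inductive_limit_topology \<Omega>) (?T -` O' \<inter> topspace (inductive_limit_topology \<Omega>))"
    proof (subst openin_subopen, rule ballI)
      fix U assume U': "U \<in> ?T -` O' \<inter> topspace (inductive_limit_topology \<Omega>)"
      then have U: "U \<in> gfun_compact \<Omega>" using topspace_inductive_limit by blast
      then have G: "U \<in> gfunctions \<Omega>" by (simp add: gfun_compact_def)
      obtain u where u: "u \<in> compact_reps \<Omega> U" by (rule compact_rep_exists[OF U])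
      obtain b where b: "- ln r < b" "has_order (\<lambda>\<epsilon>. cmod (\<tau> \<epsilon> (u \<epsilon>) - a \<epsilon>)) b" using U' char[OF U u]
          by auto
      \<comment> \<open>The radius \<open>r\<close> of the target ball itself suffices for the
        translate, since by the ultrametric inequality every point of a ball is a centre of
        it.\<close>
      have op: "openin (inductive_limit_topology \<Omega>) (gfun_plus \<Omega> U ` small r)"
          by (rule openin_translate_small[OF U r])
      have "gfun_plus \<Omega> U V \<in> ?T -` O'" if V: "V \<in> small r" for V
      proof -
        have Vc: "V \<in> gfun_compact \<Omega>" using V by (simp add: small_def)
        then have GV: "V \<in> gfunctions \<Omega>" by (simp add: gfun_compact_def)
        obtain v where v: "v \<in> compact_reps \<Omega> V" by (rule compact_rep_exists[OF Vc])
        obtain d where d: "- ln r < d" "has_order (\<lambda>\<epsilon>. cmod (\<tau> \<epsilon> (v \<epsilon>))) d"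
          using V functional_of_less_iff[OF Vc v r] by (auto simp: small_def)
        have "has_order (\<lambda>\<epsilon>. cmod (\<tau> \<epsilon> (u \<epsilon>) - a \<epsilon>) + cmod (\<tau> \<epsilon> (v \<epsilon>))) (min b d)"
          using b d by (intro has_order_add) (auto elim: has_order_mono)
        then have "has_order (\<lambda>\<epsilon>. cmod (\<tau> \<epsilon> (\<lambda>x. u \<epsilon> x + v \<epsilon> x) - a \<epsilon>)) (min b d)"
        proof (rule has_order_bound[where c = 1])
          fix \<epsilon> :: real assume \<epsilon>: "\<epsilon> \<in> {0<..1}"
          have "u \<epsilon> \<in> test_functions \<Omega>" "v \<epsilon> \<in> test_functions \<Omega>"
            using compact_reps_test[OF G u \<epsilon>] compact_reps_test[OF GV v \<epsilon>] .
          then show "\<bar>cmod (\<tau> \<epsilon> (\<lambda>x. u \<epsilon> x + v \<epsilon> x) - a \<epsilon>)\<bar>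
              \<le> 1 * \<bar>cmod (\<tau> \<epsilon> (u \<epsilon>) - a \<epsilon>) + cmod (\<tau> \<epsilon> (v \<epsilon>))\<bar>"
            using basic_net_linear(1)[OF \<tau> \<epsilon>] norm_triangle_ineq[of "\<tau> \<epsilon> (u \<epsilon>) - a \<epsilon>" "\<tau> \<epsilon> (v \<epsilon>)"]
            by (simp add: algebra_simps)
        qed
        moreover have "- ln r < min b d" using b d by simp
        ultimately have "?T (gfun_plus \<Omega> U V) \<in> O'" using char[OF gfun_compact_plus[OF u v G GV]] by blast
        then show ?thesis by simp
      qed
      moreover have "U \<in> gfun_plus \<Omega> U ` small r"
        using small_zero[OF r] gfun_plus_zero[OF U] by (metis imageI)
      ultimately show "\<exists>T. openin (inductive_limit_topology \<Omega>) T \<and> U \<in> T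
          \<and> T \<subseteq> ?T -` O' \<inter> topspace (inductive_limit_topology \<Omega>)"
        using op openin_subset[OF op] by (intro exI[of _ "gfun_plus \<Omega> U ` small r"]) blast
    qed
  next
    \<comment> \<open>Every value lies in the ball of radius 1 around itself, so the subbasic sets
      cover the range.\<close>
    have "?T U \<in> {B \<in> colombeau UNIV {cmod}. ultra_seminorm cmod (lift2 UNIV {cmod} (-) B (?T U)) < 1}"
      if "U \<in> gfun_compact \<Omega>" for U
    proof -
      have TU: "?T U \<in> colombeau UNIV {cmod}" using functional_of_in[OF that] by (simp add: gnumbers_def)
      obtain c where c: "c \<in> moderate_numbers" "?T U = num_class c" by (rule num.colombeauE[OF TU])
      show ?thesis using TU zero[of 1] unfolding c(2) by (simp add: num.lift2_diff[OF c(1) c(1)])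
    qed
    moreover have "?T U \<in> colombeau UNIV {cmod}" if "U \<in> gfun_compact \<Omega>" for U
      using functional_of_in[OF that] by (simp add: gnumbers_def)
    ultimately show "?T ` topspace (inductive_limit_topology \<Omega>) \<subseteq> \<Union> {{B \<in> colombeau UNIV {cmod}.
        ultra_seminorm p (lift2 UNIV {cmod} (-) B A) < r} |p A r.
        p \<in> {cmod} \<and> A \<in> colombeau UNIV {cmod} \<and> 0 < r}"
      using topspace_inductive_limit zero_less_one by blast
  qed
qed

lemma generates_functional_of: "generates \<Omega> \<tau> (functional_of \<Omega> \<tau>)"
  unfolding generates_def functional_of_def using \<tau> by blast

lemma functional_of_basic: "functional_of \<Omega> \<tau> \<in> basic_functionals \<Omega>"
  unfolding basic_functionals_def using functional_of_gfunctional generates_functional_of by blast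

end

end

section \<open>Generalized symbols\<close>

lemma cutoff_domain_ball:
  assumes "0 < \<delta>"
  shows "cutoff_domain {x::'a::euclidean_space. norm x < \<delta>}"
proof
  have eq: "{x::'a. norm x < \<delta>} = ball 0 \<delta>" by auto
  show "open {x::'a. norm x < \<delta>}" unfolding eq by simp
  fix K :: "'a set" assume K: "compact K" "K \<subseteq> {x. norm x < \<delta>}"
  have "\<exists>r\<ge>0. r < \<delta> \<and> (\<forall>x\<in>K. norm x \<le> r)"
  proof (cases "K = {}")
    case True
    then show ?thesis using assms by auto
  next
    case False
    obtain x where "x \<in> K" "\<forall>y\<in>K. norm y \<le> norm x"
      using continuous_attains_sup[OF K(1) False continuous_on_norm_id] by blast
    then show ?thesis using K(2) by (intro exI[of _ "norm x"]) auto
  qed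
  then obtain r where r: "0 \<le> r" "r < \<delta>" "\<And>x. x \<in> K \<Longrightarrow> norm x \<le> r" by blast
  \<comment> \<open>Two radii strictly between \<delta> and the bound \<open>r\<close> for the norms
    on \<open>K\<close>. Since \<open>r\<close> may be 0, the cut-off starts from \<open>s\<close>,
    which is positive.\<close>
  define s R where "s = (r + \<delta>) / 2" and "R = (s + \<delta>) / 2"
  have s: "r < s" "0 < s" "s < R" "R < \<delta>" using r assms by (auto simp: s_def R_def field_simps)
  obtain \<kappa> :: "'a \<Rightarrow> complex" where \<kappa>: "\<kappa> \<in> smooth_on UNIV" "\<And>x. norm x \<le> s \<Longrightarrow> \<kappa> x = 1" "\<And>x. R \<le> norm x \<Longrightarrow> \<kappa> x
      = 0"
    by (rule cutoff_exists[OF s(2,3)]) blast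
  have "\<kappa> \<in> test_functions {x. norm x < \<delta>}"
    by (rule test_functionsI[OF \<kappa>(1) compact_cball[of 0 R]]) (use s \<kappa>(3) in auto)
  moreover have "K \<subseteq> ball 0 s" using r s by force
  ultimately show "\<exists>\<kappa>\<in>test_functions {x. norm x < \<delta>}. \<exists>V. open V \<and> K \<subseteq> V \<and> (\<forall>x\<in>V. \<kappa> x = 1)"
    using \<kappa>(2) by (intro bexI[of _ \<kappa>] exI[of _ "ball 0 s"]) auto
qed

lemma symbol_index_lists:
  assumes "\<alpha> \<in> lists Basis" "\<beta> \<in> lists (Basis :: 'a::euclidean_space set)"
  shows "map (\<lambda>b. (0, b)) \<alpha> @ map (\<lambda>b. (b, 0)) \<beta> \<in> lists (Basis :: ('a \<times> 'a) set)"
  using assms by (auto simp: in_lists_conv_set Basis_prod_def)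

lemma symbol_term_diff:
  assumes "a \<in> symbols m" "b \<in> symbols m" "\<alpha> \<in> lists Basis" "\<beta> \<in> lists Basis"
  shows "symbol_term m \<alpha> \<beta> (a - b) p \<le> symbol_term m \<alpha> \<beta> a p + symbol_term m \<alpha> \<beta> b p"
proof (cases p)
  case (Pair x \<xi>)
  let ?\<gamma> = "map (\<lambda>b. (0, b)) \<alpha> @ map (\<lambda>b. (b, 0)) \<beta>"
  have "partials ?\<gamma> (a - b) (x, \<xi>) = partials ?\<gamma> a (x, \<xi>) - partials ?\<gamma> b (x, \<xi>)"
    unfolding fun_diff_def
    by (rule partials_diff[OF open_UNIV symbol_smooth[OF assms(1)] symbol_smooth[OF assms(2)]
        symbol_index_lists[OF assms(3,4)] UNIV_I])
  then have "cmod (partials ?\<gamma> (a - b) (x, \<xi>)) \<le> cmod (partials ?\<gamma> a (x, \<xi>)) + cmod (partials ?\<gamma> b (x, \<xi>))"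
    by (simp add: norm_triangle_ineq4)
  from mult_left_mono[OF this, of "japanese \<xi> powr (- m + real (length \<alpha>))"]
  show ?thesis by (simp add: Pair symbol_term_def distrib_left)
qed

lemma symbol_term_bdd: "a \<in> symbols m \<Longrightarrow> \<alpha> \<in> lists Basis \<Longrightarrow> \<beta> \<in> lists Basis
    \<Longrightarrow> bdd_above (range (symbol_term m \<alpha> \<beta> a))"
  by (simp add: symbols_def)

lemma seminormed_space_symbols: "seminormed_space (symbols m :: ('a::euclidean_space \<times> 'a \<Rightarrow> complex) set)
    (symbol_seminorms m)"
proof
  have p0: "partials \<gamma> (0 :: 'a \<times> 'a \<Rightarrow> complex) p = 0" for \<gamma> p
    by (rule partials_vanish[OF open_UNIV]) auto
  then have s0: "symbol_term m \<alpha> \<beta> 0 = (\<lambda>_. 0)" for \<alpha> \<beta> :: "'a list"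
    by (auto simp: symbol_term_def fun_eq_iff)
  show "0 \<in> (symbols m :: ('a \<times> 'a \<Rightarrow> complex) set)"
    using smooth_on_const[of 0 UNIV] unfolding symbols_def by (simp add: s0 flip: zero_fun_def)
  show diff: "a - b \<in> symbols m" if ab: "a \<in> symbols m" "b \<in> symbols m" for a b :: "'a \<times> 'a \<Rightarrow> complex"
    unfolding symbols_def
  proof (intro CollectI conjI ballI)
    show "a - b \<in> smooth_on UNIV"
      using smooth_on_diff[OF open_UNIV symbol_smooth[OF ab(1)] symbol_smooth[OF ab(2)]]
          by (simp add: fun_diff_def)
    fix \<alpha> \<beta> :: "'a list" assume I: "\<alpha> \<in> lists Basis" "\<beta> \<in> lists Basis"
    obtain A B where "\<And>p. symbol_term m \<alpha> \<beta> a p \<le> A" "\<And>p. symbol_term m \<alpha> \<beta> b p \<le> B"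
      using symbol_term_bdd[OF ab(1) I] symbol_term_bdd[OF ab(2) I] unfolding bdd_above_def by auto
    then show "bdd_above (range (symbol_term m \<alpha> \<beta> (a - b)))"
      using symbol_term_diff[OF ab I] by (intro bdd_aboveI2[of _ _ "A + B"]) (meson add_mono order_trans)
  qed
  fix p :: "('a \<times> 'a \<Rightarrow> complex) \<Rightarrow> real" assume "p \<in> symbol_seminorms m"
  then obtain \<alpha> \<beta> where p: "p = (\<lambda>a. Sup (range (symbol_term m \<alpha> \<beta> a)))" and I: "\<alpha> \<in> lists Basis"
      "\<beta> \<in> lists Basis"
    unfolding symbol_seminorms_def by blast
  show "p 0 = 0" by (simp add: p s0)
  show "0 \<le> p a" if "a \<in> symbols m" for a unfolding p by (rule Sup_symbol_term_nonneg[OF that I])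
  show "p (a - b) \<le> p a + p b" if ab: "a \<in> symbols m" "b \<in> symbols m" for a b
    unfolding p
  proof (rule cSUP_least)
    fix q
    have "symbol_term m \<alpha> \<beta> (a - b) q \<le> symbol_term m \<alpha> \<beta> a q + symbol_term m \<alpha> \<beta> b q"
      by (rule symbol_term_diff[OF ab I])
    also have "\<dots> \<le> Sup (range (symbol_term m \<alpha> \<beta> a)) + Sup (range (symbol_term m \<alpha> \<beta> b))"
      by (intro add_mono cSUP_upper symbol_term_bdd ab I) auto
    finally show "symbol_term m \<alpha> \<beta> (a - b) q \<le> Sup (range (symbol_term m \<alpha> \<beta> a)) + Sup (range (symbol_term
        m \<alpha> \<beta> b))" .
  qed simp
qed

interpretation sym: seminormed_space "symbols m" "symbol_seminorms m"
  by (rule seminormed_space_symbols)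

lemma symbol_seminorm_in: "\<beta> \<in> lists Basis \<Longrightarrow> (\<lambda>a. Sup (range (symbol_term m [] \<beta> a))) \<in> symbol_seminorms m"
  unfolding symbol_seminorms_def by (intro CollectI exI[of _ "[]"] exI[of _ \<beta>]) auto

lemma symbol_norm_moderate:
  fixes a :: "real \<Rightarrow> 'a::euclidean_space \<times> 'a \<Rightarrow> complex"
  assumes "a \<in> moderate (symbols m) (symbol_seminorms m)"
  obtains N :: nat where "has_order (\<lambda>\<epsilon>. symbol_norm m k (a \<epsilon>)) (- real N)"
proof -
  let ?I = "{\<beta>. set \<beta> \<subseteq> (Basis :: 'a set) \<and> length \<beta> \<le> k}"
  have "\<forall>\<beta>\<in>?I. \<exists>N::nat. has_order (\<lambda>\<epsilon>. Sup (range (symbol_term m [] \<beta> (a \<epsilon>)))) (- real N)"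
  proof
    fix \<beta> assume "\<beta> \<in> ?I"
    then have "\<beta> \<in> lists Basis" by (auto simp: in_lists_conv_set)
    from sym.moderate_order[OF assms symbol_seminorm_in[OF this]]
    show "\<exists>N::nat. has_order (\<lambda>\<epsilon>. Sup (range (symbol_term m [] \<beta> (a \<epsilon>)))) (- real N)" .
  qed
  from bchoice[OF this] obtain N :: "'a list \<Rightarrow> nat"
    where N: "\<forall>\<beta>\<in>?I. has_order (\<lambda>\<epsilon>. Sup (range (symbol_term m [] \<beta> (a \<epsilon>)))) (- real (N \<beta>))" ..
  \<comment> \<open>The sum of the exponents is a common exponent for the finitely many seminorms,
    as it dominates each of them.\<close>
  have "has_order (\<lambda>\<epsilon>. symbol_norm m k (a \<epsilon>)) (- real (sum N ?I))"
    unfolding symbol_norm_def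
  proof (rule has_order_sum[OF finite_multi_indices])
    fix \<beta> assume \<beta>: "\<beta> \<in> ?I"
    have "N \<beta> \<le> sum N ?I" by (rule member_le_sum[OF \<beta> _ finite_multi_indices]) simp
    then show "has_order (\<lambda>\<epsilon>. Sup (range (symbol_term m [] \<beta> (a \<epsilon>)))) (- real (sum N ?I))"
      by (intro has_order_mono[OF bspec[OF N \<beta>]]) (simp del: of_nat_sum)
  qed
  then show thesis by (rule that)
qed

lemma symbol_norm_negligible:
  assumes "(a, b) \<in> sym.rel m"
  shows "has_order (\<lambda>\<epsilon>. symbol_norm m k (\<lambda>p. a \<epsilon> p - b \<epsilon> p)) c"
proof -
  have "has_order (\<lambda>\<epsilon>. Sup (range (symbol_term m [] \<beta> (a \<epsilon> - b \<epsilon>)))) c" if "set \<beta> \<subseteq> Basis" for \<beta>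
  proof -
    have "\<beta> \<in> lists Basis" using that by (auto simp: in_lists_conv_set)
    from bspec[OF conjunct2[OF conjunct2[OF assms[unfolded sym.rel_iff]]] symbol_seminorm_in[OF this]]
    show ?thesis by blast
  qed
  then show ?thesis
    unfolding symbol_norm_def fun_diff_def by (intro has_order_sum[OF finite_multi_indices]) auto
qed

section \<open>The solution in \<open>L\<^sup>2\<close>\<close>

lemma L2_norm_eq: "L2_norm \<Omega> f = sqrt (sq_norm lborel (\<lambda>x. indicator \<Omega> x *\<^sub>R f x))"
proof -
  have "indicator \<Omega> x *\<^sub>R (cmod (f x))\<^sup>2 = (cmod (indicator \<Omega> x *\<^sub>R f x))\<^sup>2" for x
    by (auto simp: indicator_def)
  then show ?thesis by (simp add: L2_norm_def sq_norm_def set_lebesgue_integral_def)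
qed

lemma L2_space_iff: "f \<in> L2_space \<Omega> \<longleftrightarrow> sq_integrable lborel (\<lambda>x. indicator \<Omega> x *\<^sub>R f x)"
proof -
  have "indicator \<Omega> x *\<^sub>R (cmod (f x))\<^sup>2 = (cmod (indicator \<Omega> x *\<^sub>R f x))\<^sup>2" for x
    by (auto simp: indicator_def)
  then show ?thesis
    by (simp add: L2_space_def sq_integrable_def set_borel_measurable_def set_integrable_def)
qed

lemma L2_norm_nonneg: "0 \<le> L2_norm \<Omega> f"
  by (simp add: L2_norm_eq sq_norm_nonneg)

text \<open>The Riesz representation yields a function on the whole space; cutting it off to
  \<Omega> does not increase its norm.\<close>

lemma sq_integrable_indicator:
  assumes "\<Omega> \<in> sets borel" "sq_integrable lborel t"
  shows "sq_integrable lborel (\<lambda>x. indicator \<Omega> x *\<^sub>R t x)"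
    and "sq_norm lborel (\<lambda>x. indicator \<Omega> x *\<^sub>R t x) \<le> sq_norm lborel t"
proof -
  have [measurable]: "t \<in> borel_measurable borel" "\<Omega> \<in> sets borel" using assms
      by (auto simp: sq_integrable_def)
  have t: "integrable lborel (\<lambda>x. (cmod (t x))\<^sup>2)" using assms by (simp add: sq_integrable_def)
  have le: "(cmod (indicator \<Omega> x *\<^sub>R t x))\<^sup>2 \<le> (cmod (t x))\<^sup>2" for x by (auto simp: indicator_def)
  have i: "integrable lborel (\<lambda>x. (cmod (indicator \<Omega> x *\<^sub>R t x))\<^sup>2)"
    by (rule integrable_norm_bound[OF t]) (use le in auto)
  then show "sq_integrable lborel (\<lambda>x. indicator \<Omega> x *\<^sub>R t x)"
    "sq_norm lborel (\<lambda>x. indicator \<Omega> x *\<^sub>R t x) \<le> sq_norm lborel t"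
    using integral_mono[OF i t le] unfolding sq_integrable_def sq_norm_def by auto
qed

lemma sq_integrable_bounded:
  fixes f :: "'a::euclidean_space \<Rightarrow> complex"
  assumes \<Omega>: "\<Omega> \<in> sets borel" "emeasure lborel \<Omega> < \<infinity>"
    and f: "f \<in> borel_measurable borel" "\<And>x. x \<in> \<Omega> \<Longrightarrow> cmod (f x) \<le> c" and c: "0 \<le> c"
  shows "sq_integrable lborel (\<lambda>x. indicator \<Omega> x *\<^sub>R f x)"
    and "sqrt (sq_norm lborel (\<lambda>x. indicator \<Omega> x *\<^sub>R f x)) \<le> sqrt (measure lborel \<Omega>) * c"
proof -
  have [measurable]: "f \<in> borel_measurable borel" "\<Omega> \<in> sets borel" by fact+
  have i: "integrable lborel (\<lambda>x. c\<^sup>2 * indicator \<Omega> x)"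
    using \<Omega> by (intro integrable_mult_right integrable_real_indicator) auto
  have le: "(cmod (indicator \<Omega> x *\<^sub>R f x))\<^sup>2 \<le> c\<^sup>2 * indicator \<Omega> x" for x
    using f(2)[of x] by (auto simp: indicator_def power_mono)
  have i': "integrable lborel (\<lambda>x. (cmod (indicator \<Omega> x *\<^sub>R f x))\<^sup>2)"
    by (rule integrable_norm_bound[OF i]) (use le in auto)
  then show "sq_integrable lborel (\<lambda>x. indicator \<Omega> x *\<^sub>R f x)" by (simp add: sq_integrable_def)
  have "sq_norm lborel (\<lambda>x. indicator \<Omega> x *\<^sub>R f x) \<le> (LINT x|lborel. c\<^sup>2 * indicator \<Omega> x)"
    unfolding sq_norm_def by (rule integral_mono[OF i' i le])
  also have "\<dots> = measure lborel \<Omega> * c\<^sup>2" using i by simp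
  finally show "sqrt (sq_norm lborel (\<lambda>x. indicator \<Omega> x *\<^sub>R f x)) \<le> sqrt (measure lborel \<Omega>) * c"
    using c by (metis real_sqrt_abs real_sqrt_le_iff real_sqrt_mult abs_of_nonneg)
qed

text \<open>Test functions are turned by the transpose into bounded functions that need not be
  supported in \<Omega>. Since \<Omega> has finite measure, these still pair with square integrable
  functions.\<close>

lemma
  fixes f :: "'a::euclidean_space \<Rightarrow> complex"
  assumes \<Omega>: "\<Omega> \<in> sets borel" "emeasure lborel \<Omega> < \<infinity>" and t: "t \<in> L2_space \<Omega>"
    and f: "f \<in> borel_measurable borel" "\<And>x. cmod (f x) \<le> c"
  shows integrable_fun_dist: "set_integrable lborel \<Omega> (\<lambda>x. t x * f x)"
    and fun_dist_bound: "cmod (fun_dist \<Omega> t f) \<le> L2_norm \<Omega> t * sqrt (measure lborel \<Omega>) * c"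
proof -
  have c: "0 \<le> c" using order_trans[OF norm_ge_zero f(2)] .
  note f' = sq_integrable_bounded[OF \<Omega> f(1) f(2) c]
  have t': "sq_integrable lborel (\<lambda>x. indicator \<Omega> x *\<^sub>R t x)" using t by (simp add: L2_space_iff)
  have eq: "(indicator \<Omega> x *\<^sub>R t x) * (indicator \<Omega> x *\<^sub>R f x) = indicator \<Omega> x *\<^sub>R (t x * f x)" for x
    by (auto simp: indicator_def)
  show "set_integrable lborel \<Omega> (\<lambda>x. t x * f x)"
    using sq_integrable_mult(1)[OF t' f'(1)] unfolding set_integrable_def eq .
  have "cmod (fun_dist \<Omega> t f) \<le> L2_norm \<Omega> t * sqrt (sq_norm lborel (\<lambda>x. indicator \<Omega> x *\<^sub>R f x))"
    using cauchy_schwarz_complex(1)[OF t' f'(1)] unfolding fun_dist_def set_lebesgue_integral_def eq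
        L2_norm_eq .
  also have "\<dots> \<le> L2_norm \<Omega> t * (sqrt (measure lborel \<Omega>) * c)"
    by (rule mult_left_mono[OF f'(2) L2_norm_nonneg])
  finally show "cmod (fun_dist \<Omega> t f) \<le> L2_norm \<Omega> t * sqrt (measure lborel \<Omega>) * c" by (simp add: mult.assoc)
qed

text \<open>The Riesz representation applied to \<open>b(x,D)\<close> cut off to \<Omega> and to
  \<phi> \<mapsto> \<open>f (cnj \<phi>)\<close>. Conjugation makes this functional antilinear, as
  the sesquilinear pairing demands, and does not change Sobolev norms.\<close>

lemma L2_solution:
  fixes b :: "'a::euclidean_space \<times> 'a \<Rightarrow> complex"
  assumes \<Omega>: "\<Omega> \<in> sets borel" "emeasure lborel \<Omega> < \<infinity>" and b: "b \<in> symbols m" and f: "f \<in> sobolev (- s)"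
    and est: "\<And>\<phi>. \<phi> \<in> test_functions \<Omega> \<Longrightarrow> sobolev_norm_fun s \<phi> \<le> c * L2_norm \<Omega> (psido b \<phi>)"
  shows "\<exists>t\<in>L2_space \<Omega>. L2_norm \<Omega> t \<le> \<bar>c\<bar> * sobolev_norm (- s) f \<and>
    (\<forall>\<phi>\<in>test_functions \<Omega>. fun_dist \<Omega> t (\<lambda>x. cnj (psido b \<phi> x)) = f (\<lambda>x. cnj (\<phi> x)))"
proof -
  \<comment> \<open>The density chosen here is literally the one inside \<open>sobolev_norm\<close>,
    so no comparison of different densities arises.\<close>
  define g where "g = (SOME g. fourier_density (- s) f g)"
  have g: "fourier_density (- s) f g"
  proof -
    have "\<exists>g. fourier_density (- s) f g" using f by (simp add: sobolev_def)
    then show ?thesis unfolding g_def by (rule someI_ex)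
  qed
  have norm: "sobolev_norm (- s) f = fourier_norm (- s) g" by (simp add: sobolev_norm_def g_def)
  have norm0: "0 \<le> fourier_norm (- s) g"
    unfolding fourier_norm_def by (intro real_sqrt_ge_zero mult_nonneg_nonneg integral_nonneg_AE) auto
  have lin: "linear_functional_on schwartz f" using f by (simp add: sobolev_def tempered_def)
  define B where "B \<phi> = (\<lambda>x. indicator \<Omega> x *\<^sub>R psido b \<phi> x)" for \<phi>
  have meas: "psido b \<phi> \<in> borel_measurable borel" if "\<phi> \<in> test_functions \<Omega>" for \<phi>
    by (rule borel_measurable_continuous_onI[OF continuous_psido[OF b that]])
  have "\<exists>t. sq_integrable lborel t \<and> sqrt (sq_norm lborel t) \<le> \<bar>c\<bar> * fourier_norm (- s) g \<and>
    (\<forall>\<phi>\<in>test_functions \<Omega>. (LINT x|lborel. t x * cnj (B \<phi> x)) = f (\<lambda>x. cnj (\<phi> x)))"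
  proof (rule riesz_representation_L2)
    have "(\<lambda>x. 0) \<in> test_functions \<Omega>" by (rule test_functionsI[OF smooth_on_const compact_empty]) auto
    then show "test_functions \<Omega> \<noteq> {}" by blast
    fix \<phi> assume \<phi>: "\<phi> \<in> test_functions \<Omega>"
    obtain K where K: "compact K" "\<phi> \<in> test_functions K" by (rule test_functionsE[OF \<phi>])
    then obtain C k where C: "0 \<le> C" "\<And>x. cmod (psido b \<phi> x) \<le> C * (symbol_norm m 0 b * Ck_norm K k \<phi>)"
      using psido_bound[OF K(1), of m] b by blast
    show "sq_integrable lborel (B \<phi>)"
      unfolding B_def
      by (rule sq_integrable_bounded(1)[OF \<Omega> meas[OF \<phi>] C(2)])
         (use C(1) symbol_norm_nonneg[OF b] test_Ck_norm_nonneg[OF \<phi> K(1)] in auto)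
    show "B (\<lambda>x. d * \<phi> x) = (\<lambda>x. d * B \<phi> x)" for d
      by (simp add: B_def psido_cmult)
    have \<phi>': "(\<lambda>x. cnj (\<phi> x)) \<in> test_functions \<Omega>" by (rule test_functions_cnj[OF \<phi>])
    show "f (\<lambda>x. cnj (d * \<phi> x)) = cnj d * f (\<lambda>x. cnj (\<phi> x))" for d
      using lin test_functions_schwartz[OF \<phi>'] unfolding linear_functional_on_def by simp
    have "cmod (f (\<lambda>x. cnj (\<phi> x))) \<le> fourier_norm (- s) g * sobolev_norm_fun s (\<lambda>x. cnj (\<phi> x))"
      by (rule sobolev_pairing[OF g \<phi>'])
    also have "\<dots> \<le> fourier_norm (- s) g * (\<bar>c\<bar> * L2_norm \<Omega> (psido b \<phi>))"
    proof (rule mult_left_mono[OF _ norm0])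
      \<comment> \<open>The sign of \<open>c\<close> is not known, but the constant in the Riesz
        representation has to be nonnegative.\<close>
      have "c * L2_norm \<Omega> (psido b \<phi>) \<le> \<bar>c\<bar> * L2_norm \<Omega> (psido b \<phi>)"
        by (intro mult_right_mono L2_norm_nonneg) auto
      then show "sobolev_norm_fun s (\<lambda>x. cnj (\<phi> x)) \<le> \<bar>c\<bar> * L2_norm \<Omega> (psido b \<phi>)"
        using est[OF \<phi>] unfolding sobolev_norm_fun_cnj by linarith
    qed
    finally show "cmod (f (\<lambda>x. cnj (\<phi> x))) \<le> \<bar>c\<bar> * fourier_norm (- s) g * sqrt (sq_norm lborel (B \<phi>))"
      by (simp add: L2_norm_eq B_def mult_ac)
  next
    fix \<phi> \<psi> assume \<phi>: "\<phi> \<in> test_functions \<Omega>" and \<psi>: "\<psi> \<in> test_functions \<Omega>"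
    show "B (\<lambda>x. \<phi> x + \<psi> x) = (\<lambda>x. B \<phi> x + B \<psi> x)"
      by (simp add: B_def psido_add[OF b \<phi> \<psi>] scaleR_add_right)
    show "f (\<lambda>x. cnj (\<phi> x + \<psi> x)) = f (\<lambda>x. cnj (\<phi> x)) + f (\<lambda>x. cnj (\<psi> x))"
      using lin test_functions_schwartz[OF test_functions_cnj[OF \<phi>]] test_functions_schwartz[OF
          test_functions_cnj[OF \<psi>]]
      unfolding linear_functional_on_def by simp
  qed (simp_all add: test_functions_add test_functions_cmult norm0)
  then obtain t where t: "sq_integrable lborel t" "sqrt (sq_norm lborel t) \<le> \<bar>c\<bar> * fourier_norm (- s) g"
    "\<And>\<phi>. \<phi> \<in> test_functions \<Omega> \<Longrightarrow> (LINT x|lborel. t x * cnj (B \<phi> x)) = f (\<lambda>x. cnj (\<phi> x))" by blast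
  show ?thesis
  proof (intro bexI[of _ t] conjI ballI)
    show "t \<in> L2_space \<Omega>" unfolding L2_space_iff by (rule sq_integrable_indicator(1)[OF \<Omega>(1) t(1)])
    have "L2_norm \<Omega> t \<le> sqrt (sq_norm lborel t)"
      unfolding L2_norm_eq using sq_integrable_indicator(2)[OF \<Omega>(1) t(1)] by simp
    then show "L2_norm \<Omega> t \<le> \<bar>c\<bar> * sobolev_norm (- s) f" using t(2) norm by simp
    fix \<phi> assume "\<phi> \<in> test_functions \<Omega>"
    from t(3)[OF this] show "fun_dist \<Omega> t (\<lambda>x. cnj (psido b \<phi> x)) = f (\<lambda>x. cnj (\<phi> x))"
      by (simp add: fun_dist_def set_lebesgue_integral_def B_def)
  qed
qed

section \<open>Nets of \<open>L\<^sup>2\<close> functions\<close>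

text \<open>One estimate with a factor \<open>g \<epsilon>\<close>, valid on all of
  \<open>{0<..1}\<close>, gives both requirements: at fixed \<epsilon> it is the continuity of the
  distribution, and the order of \<open>g\<close> gives the moderate bound for small
  \<epsilon>.\<close>

lemma basic_netI:
  assumes lin: "\<And>\<epsilon>. \<epsilon> \<in> {0<..1} \<Longrightarrow> linear_functional_on (test_functions \<Omega>) (\<tau> \<epsilon>)"
    and bound: "\<And>K. compact K \<Longrightarrow> K \<subseteq> \<Omega> \<Longrightarrow> \<exists>j (N::nat) g. has_order g (- real N) \<and>
      (\<forall>\<epsilon>\<in>{0<..1}. \<forall>f\<in>test_functions K. cmod (\<tau> \<epsilon> f) \<le> g \<epsilon> * Ck_norm K j f)"
  shows "basic_net \<Omega> \<tau>"
  unfolding basic_net_def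
proof (intro conjI ballI allI impI)
  show "\<tau> \<epsilon> \<in> distributions \<Omega>" if "\<epsilon> \<in> {0<..1}" for \<epsilon>
    unfolding distributions_def
  proof (intro CollectI conjI lin[OF that] allI impI)
    fix K assume "compact K \<and> K \<subseteq> \<Omega>"
    then obtain j N g where "\<forall>\<epsilon>\<in>{0<..1}. \<forall>f\<in>test_functions K. cmod (\<tau> \<epsilon> f) \<le> g \<epsilon> * Ck_norm K j f"
      using bound[of K] by blast
    from bspec[OF this that] show "\<exists>j c. \<forall>f\<in>test_functions K. cmod (\<tau> \<epsilon> f) \<le> c * Ck_norm K j f" by blast
  qed
  fix K assume K: "compact K \<and> K \<subseteq> \<Omega>"
  then obtain j and N :: nat and g where g: "has_order g (- real N)"
      "\<forall>\<epsilon>\<in>{0<..1}. \<forall>f\<in>test_functions K. cmod (\<tau> \<epsilon> f) \<le> g \<epsilon> * Ck_norm K j f"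
    using bound[of K] by blast
  obtain c \<eta> where c: "0 < c" "0 < \<eta>" "\<eta> \<le> 1" "\<And>\<epsilon>. 0 < \<epsilon> \<Longrightarrow> \<epsilon> \<le> \<eta> \<Longrightarrow> \<bar>g \<epsilon>\<bar> \<le> c * \<epsilon> powr (- real N)"
    by (rule has_orderD[OF g(1)]) blast
  have "cmod (\<tau> \<epsilon> f) \<le> c * \<epsilon> powr (- real N) * Ck_norm K j f" if "f \<in> test_functions K" "\<epsilon> \<in> {0<..\<eta>}"
      for f \<epsilon>
  proof -
    have "cmod (\<tau> \<epsilon> f) \<le> g \<epsilon> * Ck_norm K j f" using g(2) that c(3) by auto
    also have "\<dots> \<le> c * \<epsilon> powr (- real N) * Ck_norm K j f"
      using c(4)[of \<epsilon>] that K by (intro mult_right_mono test_Ck_norm_nonneg[OF that(1)]) auto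
    finally show ?thesis .
  qed
  then show "\<exists>j (N::nat). \<exists>c>0. \<exists>\<eta>\<in>{0<..1}. \<forall>f\<in>test_functions K. \<forall>\<epsilon>\<in>{0<..\<eta>}. cmod (\<tau> \<epsilon> f)
      \<le> c * \<epsilon> powr (- real N) * Ck_norm K j f"
    using c(1-3) by (intro exI[of _ j] exI[of _ N] exI[of _ c] conjI bexI[of _ \<eta>]) auto
qed

lemma basic_net_mono:
  assumes \<tau>: "basic_net \<Omega>' \<tau>" and sub: "\<Omega> \<subseteq> \<Omega>'"
  shows "basic_net \<Omega> \<tau>"
proof -
  have "\<tau> \<epsilon> \<in> distributions \<Omega>" if "\<tau> \<epsilon> \<in> distributions \<Omega>'" for \<epsilon>
  proof -
    have "linear_functional_on (test_functions \<Omega>) (\<tau> \<epsilon>)"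
      using that subsetD[OF test_functions_mono[OF sub]]
      unfolding distributions_def linear_functional_on_def by simp
    moreover have "\<exists>j c. \<forall>f\<in>test_functions K. cmod (\<tau> \<epsilon> f) \<le> c * Ck_norm K j f" if K: "compact K" "K \<subseteq> \<Omega>"
        for K
      using \<open>\<tau> \<epsilon> \<in> distributions \<Omega>'\<close> K(1) order_trans[OF K(2) sub] by (simp add: distributions_def)
    ultimately show ?thesis by (simp add: distributions_def)
  qed
  note dist = this
  show ?thesis
    unfolding basic_net_def
  proof (intro conjI ballI allI impI)
    show "\<tau> \<epsilon> \<in> distributions \<Omega>" if "\<epsilon> \<in> {0<..1}" for \<epsilon>
      using \<tau> that dist by (simp add: basic_net_def)
    fix K assume "compact K \<and> K \<subseteq> \<Omega>"
    then have "compact K \<and> K \<subseteq> \<Omega>'" using sub by blast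
    from mp[OF spec[OF conjunct2[OF \<tau>[unfolded basic_net_def]]] this]
    show "\<exists>(j::nat) (N::nat). \<exists>c>0. \<exists>\<eta>\<in>{0<..1}. \<forall>f\<in>test_functions K. \<forall>\<epsilon>\<in>{0<..\<eta>}.
        cmod (\<tau> \<epsilon> f) \<le> c * \<epsilon> powr (- real N) * Ck_norm K j f" .
  qed
qed

locale L2_net =
  fixes \<Omega> :: "'a::euclidean_space set" and t :: "real \<Rightarrow> 'a \<Rightarrow> complex"
  assumes domain: "\<Omega> \<in> sets borel" "emeasure lborel \<Omega> < \<infinity>"
    and moderate: "t \<in> moderate (L2_space \<Omega>) {L2_norm \<Omega>}"
begin

lemma L2: "\<epsilon> \<in> {0<..1} \<Longrightarrow> t \<epsilon> \<in> L2_space \<Omega>"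
  using moderate by (simp add: moderate_def)

lemma order: obtains N :: nat where "has_order (\<lambda>\<epsilon>. L2_norm \<Omega> (t \<epsilon>) * sqrt (measure lborel \<Omega>)) (- real N)"
proof -
  obtain N :: nat where N: "has_order (\<lambda>\<epsilon>. L2_norm \<Omega> (t \<epsilon>)) (- real N)"
    using moderate by (auto simp: moderate_def)
  show thesis
    by (rule that[OF has_order_bound[OF N, where c = "sqrt (measure lborel \<Omega>)"]]) (simp add: abs_mult)
qed

lemma fun_dist_add:
  assumes "\<epsilon> \<in> {0<..1}" "continuous_on UNIV f" "continuous_on UNIV g" "\<And>x. cmod (f x) \<le> c" "\<And>x. cmod (g x)
      \<le> d"
  shows "fun_dist \<Omega> (t \<epsilon>) (\<lambda>x. f x + g x) = fun_dist \<Omega> (t \<epsilon>) f + fun_dist \<Omega> (t \<epsilon>) g"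
proof -
  have "set_integrable lborel \<Omega> (\<lambda>x. t \<epsilon> x * f x)" "set_integrable lborel \<Omega> (\<lambda>x. t \<epsilon> x * g x)"
    by (rule integrable_fun_dist[OF domain L2[OF assms(1)] borel_measurable_continuous_onI[OF assms(2)]
        assms(4)],
        rule integrable_fun_dist[OF domain L2[OF assms(1)] borel_measurable_continuous_onI[OF assms(3)]
            assms(5)])
  then show ?thesis
    unfolding fun_dist_def set_lebesgue_integral_def set_integrable_def
        by (simp add: distrib_left scaleR_add_right)
qed

lemma fun_dist_cmult: "fun_dist \<Omega> (t \<epsilon>) (\<lambda>x. c * f x) = c * fun_dist \<Omega> (t \<epsilon>) f"
proof -
  have "indicator \<Omega> x *\<^sub>R (t \<epsilon> x * (c * f x)) = c * (indicator \<Omega> x *\<^sub>R (t \<epsilon> x * f x))" for x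
    by simp
  then show ?thesis unfolding fun_dist_def set_lebesgue_integral_def
      by (simp only: integral_mult_right_zero)
qed

lemma basic_net_fun_dist: "basic_net \<Omega> (\<lambda>\<epsilon>. fun_dist \<Omega> (t \<epsilon>))"
proof (rule basic_netI)
  fix \<epsilon> :: real assume \<epsilon>: "\<epsilon> \<in> {0<..1}"
  show "linear_functional_on (test_functions \<Omega>) (fun_dist \<Omega> (t \<epsilon>))"
    unfolding linear_functional_on_def
  proof (intro conjI ballI allI fun_dist_cmult)
    fix f g assume fg: "f \<in> test_functions \<Omega>" "g \<in> test_functions \<Omega>"
    obtain K where K: "compact K" "f \<in> test_functions K" by (rule test_functionsE[OF fg(1)])
    obtain L where L: "compact L" "g \<in> test_functions L" by (rule test_functionsE[OF fg(2)])
    show "fun_dist \<Omega> (t \<epsilon>) (\<lambda>x. f x + g x) = fun_dist \<Omega> (t \<epsilon>) f + fun_dist \<Omega> (t \<epsilon>) g"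
      by (rule fun_dist_add[OF \<epsilon> test_functions_continuous[OF fg(1)] test_functions_continuous[OF fg(2)]
            test_functions_bound[OF K(2,1)] test_functions_bound[OF L(2,1)]])
  qed
next
  fix K assume K: "compact K" "K \<subseteq> \<Omega>"
  obtain N :: nat where N: "has_order (\<lambda>\<epsilon>. L2_norm \<Omega> (t \<epsilon>) * sqrt (measure lborel \<Omega>)) (- real N)"
      by (rule order)
  have "cmod (fun_dist \<Omega> (t \<epsilon>) f) \<le> L2_norm \<Omega> (t \<epsilon>) * sqrt (measure lborel \<Omega>) * Ck_norm K 0 f"
    if "\<epsilon> \<in> {0<..1}" "f \<in> test_functions K" for \<epsilon> f
    by (rule fun_dist_bound[OF domain L2[OF that(1)] borel_measurable_continuous_onI[OF
        test_functions_continuous[OF that(2)]]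
          test_functions_bound[OF that(2) K(1)]])
  then show "\<exists>j (N::nat) g. has_order g (- real N) \<and>
      (\<forall>\<epsilon>\<in>{0<..1}. \<forall>f\<in>test_functions K. cmod (fun_dist \<Omega> (t \<epsilon>) f) \<le> g \<epsilon> * Ck_norm K j f)"
    using N by blast
qed

text \<open>Formulated for a single symbol and not for a net, as it is applied both to
  \<open>a \<epsilon>\<close> and to the difference of two representatives.\<close>

lemma fun_dist_transpose_bound:
  assumes K: "compact K"
  obtains k C where "0 \<le> C" "\<And>a \<epsilon> f. a \<in> symbols m \<Longrightarrow> \<epsilon> \<in> {0<..1} \<Longrightarrow> f \<in> test_functions K \<Longrightarrow>
    cmod (fun_dist \<Omega> (t \<epsilon>) (psido_transpose a f))
        \<le> L2_norm \<Omega> (t \<epsilon>) * sqrt (measure lborel \<Omega>) * (C * (symbol_norm m k a * Ck_norm K k f))"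
proof -
  obtain k C where C: "0 \<le> C" "\<And>a f y. a \<in> symbols m \<Longrightarrow> f \<in> test_functions K \<Longrightarrow>
      cmod (psido_transpose a f y) \<le> C * (symbol_norm m k a * Ck_norm K k f)"
    using psido_transpose_bound[OF K, of m] by blast
  show thesis
    by (rule that[OF C(1) fun_dist_bound[OF domain L2 borel_measurable_continuous_onI[OF
        continuous_psido_transpose] C(2)]])
qed

lemma basic_net_psido_dist:
  assumes a: "a \<in> moderate (symbols m) (symbol_seminorms m)"
  shows "basic_net \<Omega> (\<lambda>\<epsilon>. psido_dist (a \<epsilon>) (fun_dist \<Omega> (t \<epsilon>)))"
proof (rule basic_netI)
  fix \<epsilon> :: real assume \<epsilon>: "\<epsilon> \<in> {0<..1}"
  have aE: "a \<epsilon> \<in> symbols m" by (rule sym.moderate_in[OF a \<epsilon>])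
  show "linear_functional_on (test_functions \<Omega>) (psido_dist (a \<epsilon>) (fun_dist \<Omega> (t \<epsilon>)))"
    unfolding linear_functional_on_def psido_dist_def
  proof (intro conjI ballI allI)
    fix f g assume fg: "f \<in> test_functions \<Omega>" "g \<in> test_functions \<Omega>"
    obtain K where K: "compact K" "f \<in> test_functions K" by (rule test_functionsE[OF fg(1)])
    obtain L where L: "compact L" "g \<in> test_functions L" by (rule test_functionsE[OF fg(2)])
    obtain c where c: "\<And>y. cmod (psido_transpose (a \<epsilon>) f y) \<le> c"
      using psido_transpose_bound[OF K(1), of m] aE K(2) by blast
    obtain d where d: "\<And>y. cmod (psido_transpose (a \<epsilon>) g y) \<le> d"
      using psido_transpose_bound[OF L(1), of m] aE L(2) by blast
    have "psido_transpose (a \<epsilon>) (\<lambda>x. f x + g x) = (\<lambda>y. psido_transpose (a \<epsilon>) f y + psido_transpose (a \<epsilon>) g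
        y)"
      by (rule ext) (rule psido_transpose_add[OF aE fg])
    then show "fun_dist \<Omega> (t \<epsilon>) (psido_transpose (a \<epsilon>) (\<lambda>x. f x + g x)) =
        fun_dist \<Omega> (t \<epsilon>) (psido_transpose (a \<epsilon>) f) + fun_dist \<Omega> (t \<epsilon>) (psido_transpose (a \<epsilon>) g)"
      using fun_dist_add[OF \<epsilon> continuous_psido_transpose[OF aE fg(1)] continuous_psido_transpose[OF aE
          fg(2)] c d] by simp
  next
    fix c f
    have "psido_transpose (a \<epsilon>) (\<lambda>x. c * f x) = (\<lambda>y. c * psido_transpose (a \<epsilon>) f y)"
      by (rule ext) (rule psido_transpose_cmult)
    then show "fun_dist \<Omega> (t \<epsilon>) (psido_transpose (a \<epsilon>) (\<lambda>x. c * f x))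
        = c * fun_dist \<Omega> (t \<epsilon>) (psido_transpose (a \<epsilon>) f)"
      by (simp add: fun_dist_cmult)
  qed
next
  fix K assume K: "compact K" "K \<subseteq> \<Omega>"
  obtain k C where C: "0 \<le> C" "\<And>a \<epsilon> f. a \<in> symbols m \<Longrightarrow> \<epsilon> \<in> {0<..1} \<Longrightarrow> f \<in> test_functions K \<Longrightarrow>
    cmod (fun_dist \<Omega> (t \<epsilon>) (psido_transpose a f))
        \<le> L2_norm \<Omega> (t \<epsilon>) * sqrt (measure lborel \<Omega>) * (C * (symbol_norm m k a * Ck_norm K k f))"
    by (rule fun_dist_transpose_bound[OF K(1), of m]) blast
  obtain N :: nat where N: "has_order (\<lambda>\<epsilon>. L2_norm \<Omega> (t \<epsilon>) * sqrt (measure lborel \<Omega>)) (- real N)"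
      by (rule order)
  obtain M :: nat where M: "has_order (\<lambda>\<epsilon>. symbol_norm m k (a \<epsilon>)) (- real M)"
      by (rule symbol_norm_moderate[OF a])
  define g where "g \<epsilon> = C * (L2_norm \<Omega> (t \<epsilon>) * sqrt (measure lborel \<Omega>) * symbol_norm m k (a \<epsilon>))" for \<epsilon>
  have "has_order g (- real N + - real M)"
    by (rule has_order_bound[OF has_order_mult[OF N M], where c = C]) (simp add: g_def abs_mult C(1))
  then have "has_order g (- real (N + M))" by simp
  moreover have "cmod (psido_dist (a \<epsilon>) (fun_dist \<Omega> (t \<epsilon>)) f) \<le> g \<epsilon> * Ck_norm K k f" if "\<epsilon> \<in> {0<..1}"
      "f \<in> test_functions K" for \<epsilon> f
    using C(2)[OF sym.moderate_in[OF a that(1)] that] by (simp add: psido_dist_def g_def mult_ac)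
  ultimately show "\<exists>j (N::nat) g. has_order g (- real N) \<and>
      (\<forall>\<epsilon>\<in>{0<..1}. \<forall>f\<in>test_functions K. cmod (psido_dist (a \<epsilon>) (fun_dist \<Omega> (t \<epsilon>)) f) \<le> g \<epsilon> * Ck_norm K j f)"
    by blast
qed

text \<open>For the given representative \<open>a\<^sub>0\<close> the transpose is \<open>\<phi> \<mapsto> cnj (b' (cnj \<phi>))\<close>, so the defect of the
  equation splits into the negligible differences \<open>a - a\<^sub>0\<close> and \<open>b' - b\<close>.\<close>

lemma psido_dist_defect:
  assumes a: "(a, a0) \<in> sym.rel m" and b: "(b', b) \<in> sym.rel m"
    and adj: "\<And>\<epsilon>. \<epsilon> \<in> {0<..1} \<Longrightarrow> adjoint_symbol m (a0 \<epsilon>) (b' \<epsilon>)"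
    and sol: "\<And>\<epsilon> \<phi>. \<epsilon> \<in> {0<..1} \<Longrightarrow> \<phi> \<in> test_functions \<Omega> \<Longrightarrow>
        fun_dist \<Omega> (t \<epsilon>) (\<lambda>x. cnj (psido (b \<epsilon>) \<phi> x)) = f \<epsilon> (\<lambda>x. cnj (\<phi> x))"
    and K: "compact K" "K \<subseteq> \<Omega>" and u: "\<And>\<epsilon>. \<epsilon> \<in> {0<..1} \<Longrightarrow> u \<epsilon> \<in> test_functions K"
    and mod: "\<And>k. \<exists>N::nat. has_order (\<lambda>\<epsilon>. Ck_norm K k (u \<epsilon>)) (- real N)"
  shows "has_order (\<lambda>\<epsilon>. cmod (psido_dist (a \<epsilon>) (fun_dist \<Omega> (t \<epsilon>)) (u \<epsilon>) - f \<epsilon> (u \<epsilon>))) c"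
proof -
  obtain k C where C: "0 \<le> C" "\<And>a \<epsilon> f. a \<in> symbols m \<Longrightarrow> \<epsilon> \<in> {0<..1} \<Longrightarrow> f \<in> test_functions K \<Longrightarrow>
    cmod (fun_dist \<Omega> (t \<epsilon>) (psido_transpose a f))
        \<le> L2_norm \<Omega> (t \<epsilon>) * sqrt (measure lborel \<Omega>) * (C * (symbol_norm m k a * Ck_norm K k f))"
    by (rule fun_dist_transpose_bound[OF K(1), of m]) blast
  obtain l D where D: "0 \<le> D" "\<And>a f x. a \<in> symbols m \<Longrightarrow> f \<in> test_functions K \<Longrightarrow>
      cmod (psido a f x) \<le> D * (symbol_norm m 0 a * Ck_norm K l f)"
    using psido_bound[OF K(1), of m] by blast
  obtain N :: nat where N: "has_order (\<lambda>\<epsilon>. L2_norm \<Omega> (t \<epsilon>) * sqrt (measure lborel \<Omega>)) (- real N)"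
      by (rule order)
  obtain M M' :: nat where M: "has_order (\<lambda>\<epsilon>. Ck_norm K k (u \<epsilon>)) (- real M)" and M':
      "has_order (\<lambda>\<epsilon>. Ck_norm K l (u \<epsilon>)) (- real M')"
    using mod by blast
  define \<Lambda> where "\<Lambda> \<epsilon> = L2_norm \<Omega> (t \<epsilon>) * sqrt (measure lborel \<Omega>)" for \<epsilon>
  define x y where "x \<epsilon> = symbol_norm m k (\<lambda>p. a \<epsilon> p - a0 \<epsilon> p) * Ck_norm K k (u \<epsilon>)"
    and "y \<epsilon> = symbol_norm m 0 (\<lambda>p. b' \<epsilon> p - b \<epsilon> p) * Ck_norm K l (u \<epsilon>)" for \<epsilon>
  \<comment> \<open>The order aimed at is \<open>c + real N\<close>, which leaves \<open>c\<close>
    after multiplication by the norm of \<open>t \<epsilon>\<close>, of order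
    \<open>- real N\<close>. Negligibility of the symbol difference provides it against the growth
    of the test functions.\<close>
  have "has_order x (c + real N)"
    using has_order_mult[OF symbol_norm_negligible[OF a, of k "c + real N + real M"] M]
        by (simp add: x_def[abs_def])
  then have X: "has_order (\<lambda>\<epsilon>. C * x \<epsilon>) (c + real N)"
    by (rule has_order_bound[where c = C]) (simp add: abs_mult C(1))
  have "has_order y (c + real N)"
    using has_order_mult[OF symbol_norm_negligible[OF b, of 0 "c + real N + real M'"] M']
        by (simp add: y_def[abs_def])
  then have Y: "has_order (\<lambda>\<epsilon>. D * y \<epsilon>) (c + real N)"
    by (rule has_order_bound[where c = D]) (simp add: abs_mult D(1))
  have "has_order (\<lambda>\<epsilon>. \<Lambda> \<epsilon> * (C * x \<epsilon> + D * y \<epsilon>)) c"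
    using has_order_mult[OF N has_order_add[OF X Y]] by (simp add: \<Lambda>_def)
  then show ?thesis
  proof (rule has_order_bound[where c = 1])
    fix \<epsilon> :: real assume \<epsilon>: "\<epsilon> \<in> {0<..1}"
    have s: "a \<epsilon> \<in> symbols m" "a0 \<epsilon> \<in> symbols m" "b' \<epsilon> \<in> symbols m" "b \<epsilon> \<in> symbols m"
      using a b sym.moderate_in[OF _ \<epsilon>] unfolding sym.rel_iff by blast+
    have da: "(\<lambda>p. a \<epsilon> p - a0 \<epsilon> p) \<in> symbols m" and db: "(\<lambda>p. b' \<epsilon> p - b \<epsilon> p) \<in> symbols m"
      using sym.diff_in[OF s(1,2)] sym.diff_in[OF s(3,4)] by (simp_all add: fun_diff_def)
    have uK: "u \<epsilon> \<in> test_functions K" by (rule u[OF \<epsilon>])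
    define w where "w = (\<lambda>x. cnj (u \<epsilon> x))"
    have wK: "w \<in> test_functions K" unfolding w_def by (rule test_functions_cnj[OF uK])
    then have w\<Omega>: "w \<in> test_functions \<Omega>" using test_functions_mono[OF K(2)] by blast
    \<comment> \<open>\<open>F1\<close> and \<open>F2\<close> carry the two negligible symbol
      differences; \<open>F3\<close> is the function on which the equation for
      \<open>t \<epsilon>\<close> gives exactly \<open>f \<epsilon> (u \<epsilon>)\<close>.\<close>
    define F1 F2 F3 where "F1 = psido_transpose (\<lambda>p. a \<epsilon> p - a0 \<epsilon> p) (u \<epsilon>)"
      and "F2 = (\<lambda>x. cnj (psido (\<lambda>p. b' \<epsilon> p - b \<epsilon> p) w x))" and "F3 = (\<lambda>x. cnj (psido (b \<epsilon>) w x))"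
    have cont: "continuous_on UNIV F1" "continuous_on UNIV F2" "continuous_on UNIV F3"
      unfolding F1_def F2_def F3_def
      by (intro continuous_psido_transpose[OF da uK] continuous_on_cnj continuous_psido[OF db wK]
          continuous_psido[OF s(4) wK])+
    have b2: "cmod (F2 x) \<le> D * y \<epsilon>" for x
    proof -
      have "cmod (F2 x) \<le> D * (symbol_norm m 0 (\<lambda>p. b' \<epsilon> p - b \<epsilon> p) * Ck_norm K l w)"
        using D(2)[OF db wK] by (simp add: F2_def)
      also have "\<dots> \<le> D * y \<epsilon>"
        unfolding y_def w_def using Ck_norm_cnj[OF open_UNIV test_functions_smooth[OF uK] K(1), of l]
        by (intro mult_left_mono symbol_norm_nonneg[OF db] D(1)) auto
      finally show ?thesis .
    qed
    \<comment> \<open>The bounds \<open>c1\<close> and \<open>c3\<close> serve only to make the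
      pairing additive; their size is irrelevant.\<close>
    obtain c1 where b1: "\<And>x. cmod (F1 x) \<le> c1"
      unfolding F1_def using psido_transpose_bound[OF K(1), of m] da uK by blast
    obtain c3 where b3: "\<And>x. cmod (F3 x) \<le> c3"
      using D(2)[OF s(4) wK] by (auto simp: F3_def)
    have "psido_transpose (a \<epsilon>) (u \<epsilon>) x = F1 x + (F2 x + F3 x)" for x
    proof -
      have "psido_transpose (a0 \<epsilon>) (u \<epsilon>) x = cnj (psido (b' \<epsilon>) w x)"
        unfolding w_def by (rule psido_transpose_adjoint[OF adj[OF \<epsilon>] s(2) uK])
      then show ?thesis
        unfolding F1_def F2_def F3_def psido_transpose_diff_symbol[OF s(1,2) uK] psido_diff_symbol[OF s(3,4)
            wK] by simp
    qed
    then have "psido_transpose (a \<epsilon>) (u \<epsilon>) = (\<lambda>x. F1 x + (F2 x + F3 x))" by (rule ext)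
    then have "psido_dist (a \<epsilon>) (fun_dist \<Omega> (t \<epsilon>)) (u \<epsilon>) = fun_dist \<Omega> (t \<epsilon>) (\<lambda>x. F1 x + (F2 x + F3 x))"
      by (simp add: psido_dist_def)
    also have "\<dots> = fun_dist \<Omega> (t \<epsilon>) F1 + fun_dist \<Omega> (t \<epsilon>) (\<lambda>x. F2 x + F3 x)"
      by (rule fun_dist_add[OF \<epsilon> cont(1) continuous_on_add[OF cont(2,3)] b1 norm_triangle_mono[OF b2 b3]])
    also have "fun_dist \<Omega> (t \<epsilon>) (\<lambda>x. F2 x + F3 x) = fun_dist \<Omega> (t \<epsilon>) F2 + fun_dist \<Omega> (t \<epsilon>) F3"
      by (rule fun_dist_add[OF \<epsilon> cont(2,3) b2 b3])
    also have "fun_dist \<Omega> (t \<epsilon>) F3 = f \<epsilon> (u \<epsilon>)"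
      using sol[OF \<epsilon> w\<Omega>] by (simp add: F3_def w_def)
    finally have "cmod (psido_dist (a \<epsilon>) (fun_dist \<Omega> (t \<epsilon>)) (u \<epsilon>) - f \<epsilon> (u \<epsilon>))
        \<le> cmod (fun_dist \<Omega> (t \<epsilon>) F1) + cmod (fun_dist \<Omega> (t \<epsilon>) F2)"
      by (simp add: norm_triangle_ineq)
    also have "\<dots> \<le> \<Lambda> \<epsilon> * (C * x \<epsilon>) + \<Lambda> \<epsilon> * (D * y \<epsilon>)"
      unfolding \<Lambda>_def
      using C(2)[OF da \<epsilon> uK] fun_dist_bound[OF domain L2[OF \<epsilon>] borel_measurable_continuous_onI[OF cont(2)]
          b2]
      by (intro add_mono) (auto simp: F1_def x_def)
    finally show "\<bar>cmod (psido_dist (a \<epsilon>) (fun_dist \<Omega> (t \<epsilon>)) (u \<epsilon>) - f \<epsilon> (u \<epsilon>))\<bar>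
        \<le> 1 * \<bar>\<Lambda> \<epsilon> * (C * x \<epsilon> + D * y \<epsilon>)\<bar>"
      by (simp add: distrib_left)
  qed
qed

end

section \<open>Restriction of functionals\<close>

text \<open>All functions of the net live in one compact \<open>M \<subseteq> \<Omega>\<close>, so a
  seminorm over any compact subset of the whole space is at most the one over
  \<open>M\<close>.\<close>

lemma moderate_extend:
  assumes \<Omega>: "open \<Omega>" and u: "u \<in> moderate (smooth_on \<Omega>) (smooth_seminorms \<Omega>)"
    and M: "compact M" "M \<subseteq> \<Omega>" "\<And>\<epsilon>. \<epsilon> \<in> {0<..1} \<Longrightarrow> u \<epsilon> \<in> test_functions M"
  shows "u \<in> moderate (smooth_on UNIV) (smooth_seminorms UNIV)"
proof -
  interpret open_domain \<Omega> by standard (rule \<Omega>)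
  interpret U: open_domain "UNIV :: 'a set" by standard simp
  show ?thesis
  proof (rule U.moderateI)
    show "u \<epsilon> \<in> smooth_on UNIV" if "\<epsilon> \<in> {0<..1}" for \<epsilon> by (rule test_functions_smooth[OF M(3)[OF that]])
    fix p :: "('a \<Rightarrow> complex) \<Rightarrow> real" assume p: "p \<in> smooth_seminorms UNIV"
    then obtain L j where L: "p = Ck_norm L j" "compact L" by (auto simp: smooth_seminorms_def)
    obtain N :: nat where "has_order (\<lambda>\<epsilon>. Ck_norm M j (u \<epsilon>)) (- real N)"
      using moderate_order[OF u seminorm_in[OF M(1,2)]] by blast
    then have "has_order (\<lambda>\<epsilon>. p (u \<epsilon>)) (- real N)"
    proof (rule has_order_bound[where c = 1])
      fix \<epsilon> :: real assume "\<epsilon> \<in> {0<..1}"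
      then have uM: "u \<epsilon> \<in> test_functions M" by (rule M(3))
      have "p (u \<epsilon>) \<le> Ck_norm M j (u \<epsilon>)"
        unfolding L(1) by (rule Ck_norm_le[OF test_Ck_norm_nonneg[OF uM M(1)] test_partials_le[OF uM M(1)]])
      then show "\<bar>p (u \<epsilon>)\<bar> \<le> 1 * \<bar>Ck_norm M j (u \<epsilon>)\<bar>"
        using test_Ck_norm_nonneg[OF uM L(2), of j] by (simp add: L(1))
    qed
    then show "\<exists>b. has_order (\<lambda>\<epsilon>. p (u \<epsilon>)) b" ..
  qed
qed

lemma rel_extend:
  assumes \<Omega>: "open \<Omega>" and uv: "(u, v) \<in> colombeau_rel (smooth_on \<Omega>) (smooth_seminorms \<Omega>)"
    and M: "compact M" "M \<subseteq> \<Omega>" "\<And>\<epsilon>. \<epsilon> \<in> {0<..1} \<Longrightarrow> u \<epsilon> \<in> test_functions M" "\<And>\<epsilon>. \<epsilon> \<in> {0<..1}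
        \<Longrightarrow> v \<epsilon> \<in> test_functions M"
  shows "(u, v) \<in> colombeau_rel (smooth_on UNIV) (smooth_seminorms UNIV)"
proof -
  interpret open_domain \<Omega> by standard (rule \<Omega>)
  interpret U: open_domain "UNIV :: 'a set" by standard simp
  have m: "u \<in> moderate (smooth_on \<Omega>) (smooth_seminorms \<Omega>)"
      "v \<in> moderate (smooth_on \<Omega>) (smooth_seminorms \<Omega>)"
    using uv by (auto simp: rel_iff)
  show ?thesis
    unfolding U.rel_iff
  proof (intro conjI moderate_extend[OF \<Omega> m(1) M(1-3)] moderate_extend[OF \<Omega> m(2) M(1,2,4)] ballI allI)
    fix p :: "('a \<Rightarrow> complex) \<Rightarrow> real" and b assume p: "p \<in> smooth_seminorms UNIV"
    then obtain L j where L: "p = Ck_norm L j" "compact L" by (auto simp: smooth_seminorms_def)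
    have "has_order (\<lambda>\<epsilon>. Ck_norm M j (u \<epsilon> - v \<epsilon>)) b" using uv seminorm_in[OF M(1,2)] by (simp add: rel_iff)
    then show "has_order (\<lambda>\<epsilon>. p (u \<epsilon> - v \<epsilon>)) b"
    proof (rule has_order_bound[where c = 1])
      fix \<epsilon> :: real assume \<epsilon>: "\<epsilon> \<in> {0<..1}"
      have w: "u \<epsilon> - v \<epsilon> \<in> test_functions M"
        using test_functions_add[OF M(3)[OF \<epsilon>] test_functions_cmult[OF M(4)[OF \<epsilon>], of "-1"]]
            by (simp add: fun_diff_def)
      have "p (u \<epsilon> - v \<epsilon>) \<le> Ck_norm M j (u \<epsilon> - v \<epsilon>)"
        unfolding L(1) by (rule Ck_norm_le[OF test_Ck_norm_nonneg[OF w M(1)] test_partials_le[OF w M(1)]])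
      then show "\<bar>p (u \<epsilon> - v \<epsilon>)\<bar> \<le> 1 * \<bar>Ck_norm M j (u \<epsilon> - v \<epsilon>)\<bar>"
        using test_Ck_norm_nonneg[OF w L(2), of j] by (simp add: L(1))
    qed
  qed
qed

text \<open>Extension by 0 leads to the same class for every compactly supported representative, so
  \<open>F\<close> can be evaluated through \<open>f\<close> on the given \<open>u\<close>.\<close>

lemma restrict_functional_eq:
  assumes \<Omega>: "open \<Omega>" and F: "generates UNIV f F" and U: "U \<in> gfunctions \<Omega>" and u: "u \<in> compact_reps \<Omega> U"
  shows "restrict_functional \<Omega> F U = num_class (\<lambda>\<epsilon>. f \<epsilon> (u \<epsilon>))"
proof -
  interpret open_domain \<Omega> by standard (rule \<Omega>)
  interpret W: open_domain "UNIV :: 'a set" by standard simp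
  obtain K where K: "compact K" "K \<subseteq> \<Omega>" "\<And>\<epsilon>. \<epsilon> \<in> {0<..1} \<Longrightarrow> u \<epsilon> \<in> test_functions K"
    "u \<in> moderate (smooth_on \<Omega>) (smooth_seminorms \<Omega>)"
    by (rule compact_repsE[OF U u]) blast
  have "gfun_class UNIV v = gfun_class UNIV u" if v: "v \<in> compact_reps \<Omega> U" for v
  proof -
    obtain L where L: "compact L" "L \<subseteq> \<Omega>" "\<And>\<epsilon>. \<epsilon> \<in> {0<..1} \<Longrightarrow> v \<epsilon> \<in> test_functions L"
      by (rule compact_repsE[OF U v]) blast
    have "(v, u) \<in> rel"
      using member_rel[of U v u] U u v by (auto simp: gfunctions_def compact_reps_def)
    moreover have "u \<epsilon> \<in> test_functions (K \<union> L)" "v \<epsilon> \<in> test_functions (K \<union> L)" if "\<epsilon> \<in> {0<..1}" for \<epsilon>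
      using K(3)[OF that] L(3)[OF that] test_functions_mono[of K "K \<union> L"] test_functions_mono[of L "K \<union> L"]
          by auto
    ultimately have "(v, u) \<in> W.rel"
      using K(1,2) L(1,2) by (intro rel_extend[OF \<Omega>, of v u "K \<union> L"]) auto
    then show ?thesis by (rule W.cls_eq)
  qed
  then have ext: "gfun_extend \<Omega> U = gfun_class UNIV u"
    unfolding gfun_extend_def using u by blast
  have um: "u \<in> moderate (smooth_on UNIV) (smooth_seminorms UNIV)" by (rule moderate_extend[OF \<Omega> K(4,1-3)])
  have u0: "u \<epsilon> x = 0" if "\<epsilon> \<in> {0<..1}" "x \<notin> K" for \<epsilon> x
    by (rule test_functions_vanish[OF K(3)[OF that(1)] that(2)])
  have rep: "u \<in> compact_reps UNIV (gfun_class UNIV u)" "gfun_class UNIV u \<in> gfun_compact UNIV"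
    using W.compact_repsI[OF um K(1) subset_UNIV u0] by auto
  have "F (gfun_class UNIV u) = functional_of UNIV f (gfun_class UNIV u)"
    using F rep(2) by (simp add: generates_def functional_of_def)
  also have "\<dots> = num_class (\<lambda>\<epsilon>. f \<epsilon> (u \<epsilon>))"
    using F rep by (intro W.functional_of_eq) (auto simp: generates_def gfun_compact_def)
  finally show ?thesis by (simp add: restrict_functional_def ext)
qed

theorem theorem6p3:
  fixes m s \<delta> :: real
    and A :: "(real ^ 'n) gsymbol"
    and b :: "real \<Rightarrow> (real ^ 'n) \<times> (real ^ 'n) \<Rightarrow> complex"
    and l :: "real \<Rightarrow> real"
    and \<Omega> :: "(real ^ 'n) set"
  defines "\<Omega> \<equiv> {x. norm x < \<delta>}"
  assumes "A \<in> gsymbols m"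
    and "b \<in> gsymbol_adjoint m A"
    and "(\<lambda>\<epsilon>. complex_of_real (l \<epsilon>)) \<in> moderate_numbers"
    and "strictly_nonzero (\<lambda>\<epsilon>. complex_of_real (l \<epsilon>))"
    and "0 < \<delta>" and "0 \<le> s" and "s \<le> m"
    and "\<And>\<phi> \<epsilon>. \<phi> \<in> test_functions \<Omega> \<Longrightarrow> \<epsilon> \<in> {0<..1} \<Longrightarrow>
           sobolev_norm_fun s \<phi> \<le> l \<epsilon> * L2_norm \<Omega> (psido (b \<epsilon>) \<phi>)"
  shows "\<forall>F\<in>basic_functionals UNIV.
           (\<exists>f\<in>moderate (sobolev (- s)) {sobolev_norm (- s)}. generates UNIV f F) \<longrightarrow>
           (\<exists>T\<in>basic_functionals \<Omega>. \<exists>t\<in>moderate (L2_space \<Omega>) {L2_norm \<Omega>}.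
              generates \<Omega> (\<lambda>\<epsilon>. fun_dist \<Omega> (t \<epsilon>)) T \<and>
              (\<exists>S. psido_functional \<Omega> A t S \<and>
                   (\<forall>U\<in>gfun_compact \<Omega>. S U = restrict_functional \<Omega> F U)))"
proof (intro ballI impI)
  fix F :: "(real ^ 'n) gfun \<Rightarrow> gnum"
  assume "\<exists>f\<in>moderate (sobolev (- s)) {sobolev_norm (- s)}. generates UNIV f F"
  then obtain f where f: "f \<in> moderate (sobolev (- s)) {sobolev_norm (- s)}" "generates UNIV f F" by blast
  have \<Omega>: "\<Omega> = ball 0 \<delta>" unfolding \<Omega>_def by auto
  have dom: "open \<Omega>" "\<Omega> \<in> sets borel" "emeasure lborel \<Omega> < \<infinity>"
    unfolding \<Omega> using emeasure_bounded_finite[OF bounded_ball[of "0 :: real ^ 'n" \<delta>]] by auto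
  interpret cutoff_domain \<Omega> unfolding \<Omega>_def by (rule cutoff_domain_ball[OF assms(6)])
  \<comment> \<open>Membership of \<open>b\<close> in the adjoint class means that \<open>b\<close>
    is equivalent to the exact adjoint \<open>b'\<close> of some representative \<open>a0\<close>;
    \<open>b\<close> itself need not be the adjoint of any prescribed one.\<close>
  obtain a0 b' where a0: "a0 \<in> A" and adj: "\<forall>\<epsilon>\<in>{0<..1}. adjoint_symbol m (a0 \<epsilon>) (b' \<epsilon>)"
    and bb: "(b', b) \<in> sym.rel m"
    using assms(3) unfolding gsymbol_adjoint_def by (auto simp: sym.in_cls_iff)
  have bs: "b \<epsilon> \<in> symbols m" if "\<epsilon> \<in> {0<..1}" for \<epsilon>
    using bb sym.moderate_in that unfolding sym.rel_iff by blast
  have "\<exists>t\<in>L2_space \<Omega>. L2_norm \<Omega> t \<le> \<bar>l \<epsilon>\<bar> * sobolev_norm (- s) (f \<epsilon>) \<and>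
    (\<forall>\<phi>\<in>test_functions \<Omega>. fun_dist \<Omega> t (\<lambda>x. cnj (psido (b \<epsilon>) \<phi> x)) = f \<epsilon> (\<lambda>x. cnj (\<phi> x)))"
    if \<epsilon>: "\<epsilon> \<in> {0<..1}" for \<epsilon>
    using f(1) \<epsilon> by (intro L2_solution[OF dom(2,3) bs[OF \<epsilon>] _ assms(9)]) (auto simp: moderate_def)
  then obtain t where t: "\<And>\<epsilon>. \<epsilon> \<in> {0<..1} \<Longrightarrow> t \<epsilon> \<in> L2_space \<Omega>"
    "\<And>\<epsilon>. \<epsilon> \<in> {0<..1} \<Longrightarrow> L2_norm \<Omega> (t \<epsilon>) \<le> \<bar>l \<epsilon>\<bar> * sobolev_norm (- s) (f \<epsilon>)"
    "\<And>\<epsilon> \<phi>. \<epsilon> \<in> {0<..1} \<Longrightarrow> \<phi> \<in> test_functions \<Omega> \<Longrightarrow>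
      fun_dist \<Omega> (t \<epsilon>) (\<lambda>x. cnj (psido (b \<epsilon>) \<phi> x)) = f \<epsilon> (\<lambda>x. cnj (\<phi> x))"
    by metis
  have tm: "t \<in> moderate (L2_space \<Omega>) {L2_norm \<Omega>}"
  proof -
    obtain N M :: nat where "has_order (\<lambda>\<epsilon>. cmod (complex_of_real (l \<epsilon>))) (- real N)"
      "has_order (\<lambda>\<epsilon>. sobolev_norm (- s) (f \<epsilon>)) (- real M)"
      using assms(4) f(1) unfolding moderate_def by blast
    from has_order_mult[OF this] have "has_order (\<lambda>\<epsilon>. L2_norm \<Omega> (t \<epsilon>)) (- real N + - real M)"
    proof (rule has_order_bound[where c = 1])
      fix \<epsilon> :: real assume "\<epsilon> \<in> {0<..1}"
      from t(2)[OF this] show "\<bar>L2_norm \<Omega> (t \<epsilon>)\<bar> \<le> 1 * \<bar>cmod (complex_of_real (l \<epsilon>)) * sobolev_norm (- s) (f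
          \<epsilon>)\<bar>"
        using L2_norm_nonneg[of \<Omega> "t \<epsilon>"] by simp
    qed
    then have "has_order (\<lambda>\<epsilon>. L2_norm \<Omega> (t \<epsilon>)) (- real (N + M))" by simp
    then show ?thesis unfolding moderate_def using t(1) by blast
  qed
  interpret T: L2_net \<Omega> t by standard (use dom tm in auto)
  have f\<Omega>: "basic_net \<Omega> f" using f(2) basic_net_mono by (auto simp: generates_def)
  \<comment> \<open>\<open>S\<close> is built from \<open>f\<close> instead of \<open>a\<close> and
    \<open>t\<close>, which makes it independent of the representative of the symbol. Each net
    \<open>a(x,D)t\<close> is then shown to generate it.\<close>
  define S where "S = functional_of \<Omega> f"
  have "generates \<Omega> (\<lambda>\<epsilon>. psido_dist (a \<epsilon>) (fun_dist \<Omega> (t \<epsilon>))) S" if a: "a \<in> A" for a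
  proof -
    let ?\<tau> = "\<lambda>\<epsilon>. psido_dist (a \<epsilon>) (fun_dist \<Omega> (t \<epsilon>))"
    have aa: "(a, a0) \<in> sym.rel m"
      using assms(2) a a0 unfolding gsymbols_def by (rule sym.member_rel)
    then have \<tau>: "basic_net \<Omega> ?\<tau>" by (intro T.basic_net_psido_dist) (auto simp: sym.rel_iff)
    have "S U = functional_of \<Omega> ?\<tau> U" if Uc: "U \<in> gfun_compact \<Omega>" for U
    proof -
      have U: "U \<in> gfunctions \<Omega>" using Uc by (simp add: gfun_compact_def)
      obtain u where u: "u \<in> compact_reps \<Omega> U" by (rule compact_rep_exists[OF Uc])
      obtain K where K: "compact K" "K \<subseteq> \<Omega>" "\<And>\<epsilon>. \<epsilon> \<in> {0<..1} \<Longrightarrow> u \<epsilon> \<in> test_functions K"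
        "u \<in> moderate (smooth_on \<Omega>) (smooth_seminorms \<Omega>)"
        by (rule compact_repsE[OF U u]) blast
      have "((\<lambda>\<epsilon>. ?\<tau> \<epsilon> (u \<epsilon>)), (\<lambda>\<epsilon>. f \<epsilon> (u \<epsilon>))) \<in> num.rel"
        unfolding num.rel_iff
      proof (intro conjI basic_net_moderate[OF \<tau> U u] basic_net_moderate[OF f\<Omega> U u] ballI allI)
        fix p :: "complex \<Rightarrow> real" and c assume "p \<in> {cmod}"
        moreover have "has_order (\<lambda>\<epsilon>. cmod (?\<tau> \<epsilon> (u \<epsilon>) - f \<epsilon> (u \<epsilon>))) c"
          by (rule T.psido_dist_defect[OF aa bb bspec[OF adj] t(3) K(1-3) moderate_order[OF K(4)
              seminorm_in[OF K(1,2)]]])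
        ultimately show "has_order (\<lambda>\<epsilon>. p (?\<tau> \<epsilon> (u \<epsilon>) - f \<epsilon> (u \<epsilon>))) c" by simp
      qed
      from num.cls_eq[OF this] show ?thesis
        unfolding S_def functional_of_eq[OF f\<Omega> U u] functional_of_eq[OF \<tau> U u] ..
    qed
    then show ?thesis using \<tau> by (simp add: generates_def functional_of_def)
  qed
  then have "psido_functional \<Omega> A t S"
    unfolding psido_functional_def S_def using functional_of_gfunctional[OF f\<Omega>] by blast
  moreover have "S U = restrict_functional \<Omega> F U" if Uc: "U \<in> gfun_compact \<Omega>" for U
  proof -
    have U: "U \<in> gfunctions \<Omega>" using Uc by (simp add: gfun_compact_def)
    obtain u where u: "u \<in> compact_reps \<Omega> U" by (rule compact_rep_exists[OF Uc])
    show ?thesis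
      unfolding S_def functional_of_eq[OF f\<Omega> U u] restrict_functional_eq[OF dom(1) f(2) U u] ..
  qed
  ultimately show "\<exists>T\<in>basic_functionals \<Omega>. \<exists>t\<in>moderate (L2_space \<Omega>) {L2_norm \<Omega>}.
              generates \<Omega> (\<lambda>\<epsilon>. fun_dist \<Omega> (t \<epsilon>)) T \<and>
              (\<exists>S. psido_functional \<Omega> A t S \<and>
                   (\<forall>U\<in>gfun_compact \<Omega>. S U = restrict_functional \<Omega> F U))"
    using functional_of_basic[OF T.basic_net_fun_dist] generates_functional_of[OF T.basic_net_fun_dist] tm
        by blast
qed

end
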